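(* Let $N\ge3$, $\alpha\in(0,N)$, $p\in\big(\frac{N+\alpha}{N},\frac{N+\alpha}{N-2}\big)$, and let $u\in H^1(\mathbb{R}^N)$ be a positive ground state of the Choquard equation $-\Delta u+u=\Big(\int_{\mathbb{R}^N}\frac{|u(y)|^p}{|x-y|^{N-\alpha}}dy\Big)|u|^{p-2}u$ in $\mathbb{R}^N$. Then there exist $x^*\in\mathbb{R}^N$ and a nonnegative nonincreasing function $v$ on $[0,\infty)$ such that $u(x)=v(|x-x^*|)$ for all $x$ and $\lim_{r\to\infty}v(r)=0$.
   Context: The associated energy functional on $H^1(\mathbb{R}^N)$ is $I(u)=\frac12\int_{\mathbb{R}^N}(|\nabla u|^2+u^2)dx-\frac1{2p}\int_{\mathbb{R}^N}\int_{\mathbb{R}^N}\frac{|u(x)|^p|u(y)|^p}{|x-y|^{N-\alpha}}dxdy$. A ground state is a nonzero weak solution (critical point of $I$) minimizing $I$ among all nonzero weak solutions; positive means $u>0$ (ground states are continuous). *)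

theory Defs
  imports "HOL-Analysis.Analysis"
begin

fun iter_deriv :: "'a::euclidean_space list \<Rightarrow> ('a \<Rightarrow> real) \<Rightarrow> ('a \<Rightarrow> real)" where
  "iter_deriv [] f = f"
| "iter_deriv (v # vs) f = (\<lambda>x. frechet_derivative (iter_deriv vs f) (at x) v)"

definition smooth_fun :: "('a::euclidean_space \<Rightarrow> real) \<Rightarrow> bool" where
  "smooth_fun f \<longleftrightarrow> (\<forall>vs. set vs \<subseteq> Basis \<longrightarrow>
      continuous_on UNIV (iter_deriv vs f) \<and> (\<forall>x. iter_deriv vs f differentiable at x))"

definition test_fun :: "('a::euclidean_space \<Rightarrow> real) \<Rightarrow> bool" where
  "test_fun \<phi> \<longleftrightarrow> smooth_fun \<phi> \<and> compact (closure {x. \<phi> x \<noteq> 0})"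

definition weak_gradient :: "('a::euclidean_space \<Rightarrow> real) \<Rightarrow> ('a \<Rightarrow> 'a) \<Rightarrow> bool" where
  "weak_gradient u G \<longleftrightarrow> G \<in> borel_measurable lebesgue \<and>
     (\<forall>\<phi>. test_fun \<phi> \<longrightarrow> (\<forall>i\<in>Basis.
        (LINT x|lebesgue. u x * frechet_derivative \<phi> (at x) i) = - (LINT x|lebesgue. (G x \<bullet> i) * \<phi> x)))"

definition square_integrable :: "('a::euclidean_space \<Rightarrow> real) \<Rightarrow> bool" where
  "square_integrable f \<longleftrightarrow> f \<in> borel_measurable lebesgue \<and> integrable lebesgue (\<lambda>x. (f x)\<^sup>2)"

definition H1 :: "('a::euclidean_space \<Rightarrow> real) \<Rightarrow> bool" where
  "H1 u \<longleftrightarrow> square_integrable u \<and> (\<exists>G. weak_gradient u G \<and> square_integrable (\<lambda>x. norm (G x)))"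

text \<open>The (a.e. unique) weak gradient of an H^1 function.\<close>
definition wgrad :: "('a::euclidean_space \<Rightarrow> real) \<Rightarrow> ('a \<Rightarrow> 'a)" where
  "wgrad u = (SOME G. weak_gradient u G \<and> square_integrable (\<lambda>x. norm (G x)))"

definition choquard_energy :: "real \<Rightarrow> real \<Rightarrow> ('a::euclidean_space \<Rightarrow> real) \<Rightarrow> real" where
  "choquard_energy \<alpha> p u =
     (1/2) * (LINT x|lebesgue. (norm (wgrad u x))\<^sup>2 + (u x)\<^sup>2)
     - (1/(2*p)) * (LINT x|lebesgue. LINT y|lebesgue.
          \<bar>u x\<bar> powr p * \<bar>u y\<bar> powr p / norm (x - y) powr (real DIM('a) - \<alpha>))"

text \<open>Weak solution = critical point of I on H^1:
  for all phi in H^1, int (grad u . grad phi + u phi) = int int |u(y)|^p |u(x)|^(p-2) u(x) phi(x) / |x-y|^(N-alpha).\<close>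
definition choquard_weak_solution :: "real \<Rightarrow> real \<Rightarrow> ('a::euclidean_space \<Rightarrow> real) \<Rightarrow> bool" where
  "choquard_weak_solution \<alpha> p u \<longleftrightarrow> H1 u \<and>
     (\<forall>\<phi>. H1 \<phi> \<longrightarrow>
        (LINT x|lebesgue. wgrad u x \<bullet> wgrad \<phi> x + u x * \<phi> x) =
        (LINT x|lebesgue. LINT y|lebesgue.
           \<bar>u y\<bar> powr p * (\<bar>u x\<bar> powr (p - 1) * sgn (u x)) * \<phi> x
             / norm (x - y) powr (real DIM('a) - \<alpha>)))"

definition nonzero_H1 :: "('a::euclidean_space \<Rightarrow> real) \<Rightarrow> bool" where
  "nonzero_H1 u \<longleftrightarrow> \<not> (AE x in lebesgue. u x = 0)"

definition choquard_ground_state :: "real \<Rightarrow> real \<Rightarrow> ('a::euclidean_space \<Rightarrow> real) \<Rightarrow> bool" where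
  "choquard_ground_state \<alpha> p u \<longleftrightarrow> choquard_weak_solution \<alpha> p u \<and> nonzero_H1 u \<and>
     (\<forall>w::'a \<Rightarrow> real. choquard_weak_solution \<alpha> p w \<and> nonzero_H1 w \<longrightarrow>
        choquard_energy \<alpha> p u \<le> choquard_energy \<alpha> p w)"

end

(* Polarization with respect to a half space preserves the L^2 norm, does not increase the Dirichlet integral and does not
   decrease the Riesz energy D(u). Measuring the Dirichlet integral by the supremum of averaged difference quotients makes all of
   this a four point rearrangement inequality. By maximising over polarizations every nonnegative function can be replaced by a
   radially decreasing one, and Helly selection then yields a maximiser of D on the unit ball of H^1. Its suitable multiple w is
   a weak solution with ||w||^2 = D(w).

   For any weak solution I(u) = (1/2 - 1/(2p)) ||u||^2, so comparing a ground state u with w shows that u is optimal in the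
   inequality D(f) <= M ||f||^(2p). Hence no polarization increases D(u), and the equality case shows that for every hyperplane
   either u >= u o sigma or u <= u o sigma on the given side. For each direction a connectedness argument provides a hyperplane of
   symmetry; those of an orthonormal basis meet in x*, and square integrability fixes all remaining inequalities to point towards x*. *)
theory Submission
  imports Defs "HOL-Complex_Analysis.Great_Picard" "HOL-Probability.Helly_Selection"
begin

section \<open>Reflections and polarization\<close>

text \<open>The weak gradient of a polarized function has no convenient description, whereas an
  averaged difference quotient is a double integral against a kernel that decreases with the
  distance. Gradients therefore return mainly where the weak equation is tested, and
  \<open>kappa\<close> is the factor between the two Dirichlet integrals. The range of p enters
  through a single computation: on radially decreasing functions the two parts of the H^1 norm
  control the values by |x|^(-N/2) and |x|^(1 - N/2), and the minimum of these powers has finite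
  Riesz energy because (N - 2) p < N + \<alpha> < N p. It is the dominating function whenever values
  of D have to converge and not merely to be semicontinuous. The comparison rests on homogeneity: D
  has degree 2p and the squared norm degree 2, so the multiple w is fixed by M a^p = a with a =
  ||w||^2, and on weak solutions the energy is an increasing function of the squared norm.
  Strictness in the equality case comes from D alone, because the Riesz kernel is strictly
  decreasing; the Dirichlet integral only has to move in the right direction.\<close>

lemma nn_integral_lborel_affine:
  fixes f :: "'a::euclidean_space \<Rightarrow> ennreal"
  assumes [measurable]: "f \<in> borel_measurable borel" and c: "c \<noteq> 0"
  shows "(\<integral>\<^sup>+x. f x \<partial>lborel) = ennreal (\<bar>c\<bar> ^ DIM('a)) * (\<integral>\<^sup>+x. f (t + c *\<^sub>R x) \<partial>lborel)"
  by (subst lborel_affine[OF c, of t])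
     (simp add: nn_integral_density nn_integral_distr nn_integral_cmult)

lemma nn_integral_lborel_shift:
  fixes f :: "'a::euclidean_space \<Rightarrow> ennreal"
  assumes "f \<in> borel_measurable borel"
  shows "(\<integral>\<^sup>+x. f (t + x) \<partial>lborel) = (\<integral>\<^sup>+x. f x \<partial>lborel)"
    and "(\<integral>\<^sup>+x. f (x + t) \<partial>lborel) = (\<integral>\<^sup>+x. f x \<partial>lborel)"
    and "(\<integral>\<^sup>+x. f (x - t) \<partial>lborel) = (\<integral>\<^sup>+x. f x \<partial>lborel)"
    and "(\<integral>\<^sup>+x. f (t - x) \<partial>lborel) = (\<integral>\<^sup>+x. f x \<partial>lborel)"
    and "(\<integral>\<^sup>+x. f (- x) \<partial>lborel) = (\<integral>\<^sup>+x. f x \<partial>lborel)"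
  using nn_integral_lborel_affine[OF assms, of 1 t] nn_integral_lborel_affine[OF assms, of 1 "-t"]
    nn_integral_lborel_affine[OF assms, of "-1" t] nn_integral_lborel_affine[OF assms, of "-1" 0]
  by (simp_all add: add.commute)

text \<open>For a unit vector \<open>e\<close> this is the reflection in the hyperplane
  \<open>x \<bullet> e = t\<close>.\<close>

definition hrefl :: "'a::euclidean_space \<Rightarrow> real \<Rightarrow> 'a \<Rightarrow> 'a" where
  "hrefl e t x = x - (2 * (x \<bullet> e - t)) *\<^sub>R e"

lemma hrefl_measurable [measurable]: "hrefl e t \<in> borel_measurable borel"
  unfolding hrefl_def by measurable

lemma continuous_on_hrefl [continuous_intros]: "continuous_on S (hrefl e t)"
  unfolding hrefl_def by (intro continuous_intros)

lemma hrefl_inner: "norm e = 1 \<Longrightarrow> hrefl e t x \<bullet> e = 2 * t - x \<bullet> e"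
  by (simp add: hrefl_def inner_diff_left dot_square_norm)

lemma hrefl_hrefl [simp]: "norm e = 1 \<Longrightarrow> hrefl e t (hrefl e t x) = x"
  by (simp add: hrefl_inner hrefl_def[of e t "hrefl e t x"]) (simp add: hrefl_def algebra_simps flip: scaleR_add_left)

text \<open>The sign of the product tells whether \<open>x\<close> and \<open>y\<close> lie on the
  same side of the hyperplane. Every comparison of a decreasing kernel at a pair and at the pair
  with one reflected member goes back to this identity.\<close>

lemma norm_hrefl_diff_sq:
  assumes "norm e = 1"
  shows "(norm (x - hrefl e t y))\<^sup>2 = (norm (x - y))\<^sup>2 + 4 * (x \<bullet> e - t) * (y \<bullet> e - t)"
proof -
  have e: "e \<bullet> e = 1" using assms by (simp add: dot_square_norm)
  show ?thesis
    unfolding power2_norm_eq_inner hrefl_def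
    by (simp add: inner_diff_left inner_diff_right inner_commute e algebra_simps power2_eq_square)
qed

lemma norm_hrefl_hrefl:
  assumes "norm e = 1"
  shows "norm (hrefl e t x - hrefl e t y) = norm (x - y)"
proof -
  have "(norm (hrefl e t x - hrefl e t y))\<^sup>2 = (norm (hrefl e t x - y))\<^sup>2 + 4 * (hrefl e t x \<bullet> e - t) * (y \<bullet> e - t)"
    by (rule norm_hrefl_diff_sq[OF assms])
  also have "(norm (hrefl e t x - y))\<^sup>2 = (norm (y - x))\<^sup>2 + 4 * (y \<bullet> e - t) * (x \<bullet> e - t)"
    using norm_hrefl_diff_sq[OF assms, of y t x] by (simp add: norm_minus_commute)
  finally show ?thesis
    using assms by (simp add: hrefl_inner algebra_simps norm_minus_commute)
qed

lemma norm_hrefl_commute: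
  "norm e = 1 \<Longrightarrow> norm (x - hrefl e t y) = norm (hrefl e t x - y)"
  by (metis hrefl_hrefl norm_hrefl_hrefl)

text \<open>Invariance of Lebesgue measure under reflections, obtained from translations and Fubini.
  The integral is multiplied by the mass of the radial function \<open>K\<close>;
  \<open>Ksym\<close> moves the reflection from one variable of \<open>K\<close> to the other, and a
  translation by \<open>L y\<close> turns the argument of \<open>f\<close> into
  \<open>L x + y\<close>, whose integral over \<open>y\<close> no longer sees
  \<open>L\<close>.\<close>

lemma nn_integral_hrefl0:
  fixes f :: "'a::euclidean_space \<Rightarrow> ennreal"
  assumes [measurable]: "f \<in> borel_measurable borel" and e: "norm e = 1"
  shows "(\<integral>\<^sup>+x. f (hrefl e 0 x) \<partial>lborel) = (\<integral>\<^sup>+x. f x \<partial>lborel)"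
proof -
  define L where "L = hrefl e 0"
  define K :: "'a \<Rightarrow> ennreal" where "K x = indicator (ball 0 1) x" for x
  have [measurable]: "K \<in> borel_measurable borel" "L \<in> borel_measurable borel"
    unfolding K_def L_def by (auto intro!: hrefl_measurable borel_measurable_indicator)
  have Ladd: "L (x + L y) = L x + y" for x y
    using hrefl_hrefl[OF e, of 0 y] unfolding L_def hrefl_def
    by (simp add: inner_add_left algebra_simps)
  have Ksym: "K (y - L x) = K (L y - x)" for x y
    using norm_hrefl_commute[OF e, of y 0 x] unfolding K_def L_def by (simp add: indicator_def)
  have Km: "K (- x) = K x" for x unfolding K_def by (simp add: indicator_def)
  let ?I = "\<integral>\<^sup>+x. K x \<partial>lborel"
  have "(\<integral>\<^sup>+x. f (L x) \<partial>lborel) * ?I = (\<integral>\<^sup>+x. \<integral>\<^sup>+y. f (L x) * K (y - L x) \<partial>lborel \<partial>lborel)"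
    by (simp add: nn_integral_cmult nn_integral_multc nn_integral_lborel_shift)
  also have "\<dots> = (\<integral>\<^sup>+y. \<integral>\<^sup>+x. f (L x) * K (L y - x) \<partial>lborel \<partial>lborel)"
    unfolding Ksym by (rule lborel_pair.Fubini') measurable
  also have "\<dots> = (\<integral>\<^sup>+y. \<integral>\<^sup>+x. f (L (x + L y)) * K (L y - (x + L y)) \<partial>lborel \<partial>lborel)"
  proof (rule nn_integral_cong)
    fix y :: 'a
    show "(\<integral>\<^sup>+x. f (L x) * K (L y - x) \<partial>lborel)
      = (\<integral>\<^sup>+x. f (L (x + L y)) * K (L y - (x + L y)) \<partial>lborel)"
      by (rule nn_integral_lborel_shift(2)[where f="\<lambda>x. f (L x) * K (L y - x)", symmetric]) measurable
  qed
  also have "\<dots> = (\<integral>\<^sup>+y. \<integral>\<^sup>+x. f (L x + y) * K x \<partial>lborel \<partial>lborel)"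
    by (simp add: Ladd Km)
  also have "\<dots> = (\<integral>\<^sup>+x. \<integral>\<^sup>+y. f (L x + y) * K x \<partial>lborel \<partial>lborel)"
    by (rule lborel_pair.Fubini') measurable
  also have "\<dots> = (\<integral>\<^sup>+x. f x \<partial>lborel) * ?I"
    by (simp add: nn_integral_cmult nn_integral_multc nn_integral_lborel_shift)
  finally have *: "(\<integral>\<^sup>+x. f (L x) \<partial>lborel) * ?I = (\<integral>\<^sup>+x. f x \<partial>lborel) * ?I" .
  have I: "?I = emeasure lborel (ball (0::'a) 1)"
    unfolding K_def by simp
  have "?I \<noteq> 0"
    unfolding I by (metis Euclidean_Space.norm_Basis content_ball_pos emeasure_eq_measure2 emeasure_lborel_ball_finite
        ennreal_eq_0_iff infinity_ennreal_def less_irrefl measure_def enn2real_0 zero_less_one)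
  moreover have "?I \<noteq> \<infinity>"
    unfolding I using emeasure_lborel_ball_finite by (metis less_irrefl infinity_ennreal_def)
  ultimately show ?thesis using * unfolding L_def
    by (simp add: ennreal_mult_cancel_left mult.commute[of _ ?I])
qed

lemma nn_integral_hrefl:
  fixes f :: "'a::euclidean_space \<Rightarrow> ennreal"
  assumes [measurable]: "f \<in> borel_measurable borel" and e: "norm e = 1"
  shows "(\<integral>\<^sup>+x. f (hrefl e t x) \<partial>lborel) = (\<integral>\<^sup>+x. f x \<partial>lborel)"
proof -
  have "hrefl e t x = hrefl e 0 x + (2 * t) *\<^sub>R e" for x
    by (simp add: hrefl_def algebra_simps)
  then have "(\<integral>\<^sup>+x. f (hrefl e t x) \<partial>lborel) = (\<integral>\<^sup>+x. f (hrefl e 0 x + (2 * t) *\<^sub>R e) \<partial>lborel)"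
    by simp
  also have "\<dots> = (\<integral>\<^sup>+x. f (x + (2 * t) *\<^sub>R e) \<partial>lborel)"
    by (rule nn_integral_hrefl0[OF _ e]) measurable
  finally show ?thesis by (simp add: nn_integral_lborel_shift)
qed

text \<open>The half space \<open>t \<le> x \<bullet> e\<close> receives the larger of the two
  values. On its boundary the reflection fixes \<open>x\<close>, so both branches agree
  there.\<close>

definition polar :: "'a::euclidean_space \<Rightarrow> real \<Rightarrow> ('a \<Rightarrow> real) \<Rightarrow> 'a \<Rightarrow> real" where
  "polar e t f x = (if t \<le> x \<bullet> e then max (f x) (f (hrefl e t x)) else min (f x) (f (hrefl e t x)))"

lemma polar_measurable [measurable]:
  assumes [measurable]: "f \<in> borel_measurable borel"
  shows "polar e t f \<in> borel_measurable borel"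
  unfolding polar_def by measurable

section \<open>The rearrangement inequality for four points\<close>

lemma supermodular_four_sum:
  fixes \<Psi> :: "real \<Rightarrow> real \<Rightarrow> real"
  assumes sm: "\<And>a b c d. b \<le> a \<Longrightarrow> d \<le> c \<Longrightarrow> \<Psi> a d + \<Psi> b c \<le> \<Psi> a c + \<Psi> b d"
    and k: "k2 \<le> k1"
  shows "k1 * (\<Psi> a c + \<Psi> b d) + k2 * (\<Psi> a d + \<Psi> b c)
    \<le> k1 * (\<Psi> (max a b) (max c d) + \<Psi> (min a b) (min c d))
     + k2 * (\<Psi> (max a b) (min c d) + \<Psi> (min a b) (max c d))"
proof -
  \<comment> \<open>If the two pairs are ordered alike, sorting changes nothing or swaps both of
    them. Otherwise it moves the larger of the two sums of \<open>\<Psi>\<close> to the larger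
    weight \<open>k1\<close>, and this is the gain.\<close>
  have *: "k1 * B + k2 * A \<le> k1 * A + k2 * B" if "B \<le> A" for A B
  proof -
    have "0 \<le> (k1 - k2) * (A - B)" using that k by simp
    then show ?thesis by (simp add: algebra_simps)
  qed
  consider "b \<le> a" "d \<le> c" | "b \<le> a" "c \<le> d" | "a \<le> b" "d \<le> c" | "a \<le> b" "c \<le> d"
    by linarith
  then show ?thesis
  proof cases
    case 2
    then show ?thesis using *[OF sm[of b a c d]] by (simp add: max_def min_def algebra_simps)
  next
    case 3
    then show ?thesis using *[OF sm[of a b d c]] by (simp add: max_def min_def algebra_simps)
  qed (auto simp add: max_def min_def algebra_simps)
qed

text \<open>The sum over the orbit of a pair when each variable may be reflected separately.
  Integrating it costs a factor 4 and turns an inequality between double integrals into one between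
  integrands.\<close>

definition four_sum :: "('a \<Rightarrow> 'a) \<Rightarrow> ('a \<Rightarrow> 'a \<Rightarrow> 'b::plus) \<Rightarrow> 'a \<Rightarrow> 'a \<Rightarrow> 'b" where
  "four_sum \<sigma> F x y = F x y + F (\<sigma> x) (\<sigma> y) + (F x (\<sigma> y) + F (\<sigma> x) y)"

lemma nn_integral_four_sum:
  fixes F :: "'a::euclidean_space \<Rightarrow> 'a \<Rightarrow> ennreal"
  assumes F[measurable]: "case_prod F \<in> borel_measurable (borel \<Otimes>\<^sub>M borel)" and e: "norm e = 1"
  shows "(\<integral>\<^sup>+x. \<integral>\<^sup>+y. four_sum (hrefl e t) F x y \<partial>lborel \<partial>lborel) = 4 * (\<integral>\<^sup>+x. \<integral>\<^sup>+y. F x y \<partial>lborel \<partial>lborel)"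
proof -
  let ?s = "hrefl e t"
  have A: "(\<integral>\<^sup>+y. F x (?s y) \<partial>lborel) = (\<integral>\<^sup>+y. F x y \<partial>lborel)" for x
    by (rule nn_integral_hrefl[OF _ e]) measurable
  have B: "(\<integral>\<^sup>+x. \<integral>\<^sup>+y. F (?s x) y \<partial>lborel \<partial>lborel) = (\<integral>\<^sup>+x. \<integral>\<^sup>+y. F x y \<partial>lborel \<partial>lborel)"
    by (rule nn_integral_hrefl[OF _ e, where f="\<lambda>x. \<integral>\<^sup>+y. F x y \<partial>lborel"]) measurable
  have C: "(\<lambda>x. \<integral>\<^sup>+y. F x y \<partial>lborel) \<in> borel_measurable borel" by measurable
  have four_sum: "4 * I = I + (I + (I + I))" for I :: ennreal
  proof -
    have "(4::ennreal) = 1 + (1 + (1 + 1))" by simp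
    then show ?thesis by (simp only: distrib_right mult_1)
  qed
  show ?thesis
    unfolding four_sum_def four_sum using C by (simp add: nn_integral_add A B add_ac)
qed

text \<open>\<open>H\<close> records the gain, which is kept for the equality case. Pairs with
  \<open>x = y\<close> or \<open>x = hrefl e t y\<close> are excluded because the Riesz kernel has a
  junk value there; for fixed \<open>x\<close> each condition removes a single point.\<close>

lemma nn_integral_four_sum_mono:
  fixes F G H :: "'a::euclidean_space \<Rightarrow> 'a \<Rightarrow> ennreal"
  assumes [measurable]: "case_prod F \<in> borel_measurable (borel \<Otimes>\<^sub>M borel)"
      "case_prod G \<in> borel_measurable (borel \<Otimes>\<^sub>M borel)"
      "case_prod H \<in> borel_measurable (borel \<Otimes>\<^sub>M borel)"
    and e: "norm e = 1"
    and le: "\<And>x y. x \<noteq> y \<Longrightarrow> x \<noteq> hrefl e t y \<Longrightarrow>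
       four_sum (hrefl e t) F x y + H x y \<le> four_sum (hrefl e t) G x y"
  shows "4 * (\<integral>\<^sup>+x. \<integral>\<^sup>+y. F x y \<partial>lborel \<partial>lborel) + (\<integral>\<^sup>+x. \<integral>\<^sup>+y. H x y \<partial>lborel \<partial>lborel)
    \<le> 4 * (\<integral>\<^sup>+x. \<integral>\<^sup>+y. G x y \<partial>lborel \<partial>lborel)"
proof -
  have [measurable]: "case_prod (four_sum (hrefl e t) F) \<in> borel_measurable (borel \<Otimes>\<^sub>M borel)"
    unfolding four_sum_def by measurable
  have "4 * (\<integral>\<^sup>+x. \<integral>\<^sup>+y. F x y \<partial>lborel \<partial>lborel) + (\<integral>\<^sup>+x. \<integral>\<^sup>+y. H x y \<partial>lborel \<partial>lborel)
    = (\<integral>\<^sup>+x. \<integral>\<^sup>+y. four_sum (hrefl e t) F x y + H x y \<partial>lborel \<partial>lborel)"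
    by (simp add: nn_integral_add nn_integral_four_sum[OF _ e])
  also have "\<dots> \<le> (\<integral>\<^sup>+x. \<integral>\<^sup>+y. four_sum (hrefl e t) G x y \<partial>lborel \<partial>lborel)"
  proof (rule nn_integral_mono, rule nn_integral_mono_AE)
    fix x :: 'a
    have "AE y in lborel. y \<noteq> x" "AE y in lborel. y \<noteq> hrefl e t x"
      by (auto intro!: AE_lborel_singleton)
    then show "AE y in lborel. four_sum (hrefl e t) F x y + H x y \<le> four_sum (hrefl e t) G x y"
    proof eventually_elim
      case (elim y)
      then show ?case by (intro le) (metis e hrefl_hrefl)+
    qed
  qed
  also have "\<dots> = 4 * (\<integral>\<^sup>+x. \<integral>\<^sup>+y. G x y \<partial>lborel \<partial>lborel)"
    by (rule nn_integral_four_sum[OF _ e]) measurable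
  finally show ?thesis .
qed

section \<open>Smooth test functions\<close>

text \<open>The case \<open>n = 0\<close> is the classical smooth function that vanishes to infinite
  order at 0. The powers in the denominator are what its derivatives produce, so that the family is
  closed under differentiation up to linear combinations.\<close>

definition flat :: "nat \<Rightarrow> real \<Rightarrow> real" where
  "flat n t = (if 0 < t then exp (- (1 / t)) / t ^ n else 0)"

lemma power_div_fact_le_exp:
  fixes x :: real
  assumes "0 \<le> x"
  shows "x ^ m / fact m \<le> exp x"
proof -
  have "sum (\<lambda>k. x ^ k /\<^sub>R fact k) {m} \<le> (\<Sum>k. x ^ k /\<^sub>R fact k)"
    by (rule sum_le_suminf) (use assms summable_exp_generic[of x] in auto)
  then show ?thesis by (simp add: exp_def divide_inverse mult.commute)
qed

text \<open>A single term of the exponential series, of order \<open>n + m\<close> at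
  \<open>1 / t\<close>, absorbs the denominator and leaves \<open>m\<close> powers of
  \<open>t\<close>.\<close>

lemma abs_flat_le: "\<bar>flat n t\<bar> \<le> fact (n + m) * \<bar>t\<bar> ^ m"
proof (cases "0 < t")
  case True
  have "(1 / t) ^ (n + m) / fact (n + m) \<le> exp (1 / t)"
    using True by (intro power_div_fact_le_exp) simp
  then have "1 \<le> fact (n + m) * t ^ (n + m) * exp (1 / t)"
    using True by (simp add: field_simps)
  then have "exp (- (1 / t)) \<le> fact (n + m) * t ^ (n + m)"
    using True by (simp add: exp_minus field_simps)
  then show ?thesis
    using True by (simp add: flat_def pos_divide_le_eq power_add mult_ac)
qed (simp add: flat_def)

lemma flat_has_derivative:
  "(flat n has_real_derivative flat (n + 2) t - real n * flat (n + 1) t) (at t)"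
proof -
  consider "t < 0" | "t = 0" | "0 < t" by linarith
  then show ?thesis
  proof cases
    case 1
    have "((\<lambda>_. 0) has_real_derivative 0) (at t)" by simp
    moreover have "eventually (\<lambda>s. s < 0) (nhds t)"
      using 1 by (intro eventually_nhds_in_open[of "{..<0}", simplified]) auto
    then have "eventually (\<lambda>s. flat n s = 0) (nhds t)"
      by eventually_elim (simp add: flat_def)
    ultimately have "(flat n has_real_derivative 0) (at t)"
      by (subst DERIV_cong_ev[OF refl _ refl]) auto
    then show ?thesis using 1 by (simp add: flat_def)
  next
    case 2
    have "((\<lambda>h. (flat n (0 + h) - flat n 0) / h) \<longlongrightarrow> 0) (at 0)"
    proof (rule Lim_null_comparison[where g="\<lambda>h. fact (n + 2) * \<bar>h\<bar>"])
      have "norm ((flat n (0 + h) - flat n 0) / h) \<le> fact (n + 2) * \<bar>h\<bar>" if "h \<noteq> 0" for h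
      proof -
        \<comment> \<open>Quadratic vanishing: one factor survives the division by \<open>h\<close>,
          so the difference quotient at 0 tends to 0.\<close>
        have "\<bar>flat n h\<bar> \<le> (fact (n + 2) * \<bar>h\<bar>) * \<bar>h\<bar>"
          using abs_flat_le[of n h 2] by (simp only: power2_eq_square mult.assoc)
        then show ?thesis using that
          by (simp add: flat_def[of n 0] del: fact_Suc One_nat_def add_2_eq_Suc')
            (metis (no_types, opaque_lifting) pos_divide_le_eq zero_less_abs_iff)
      qed
      then show "\<forall>\<^sub>F h in at 0. norm ((flat n (0 + h) - flat n 0) / h) \<le> fact (n + 2) * \<bar>h\<bar>"
        by (auto simp: eventually_at_filter)
      show "((\<lambda>h::real. fact (n + 2) * \<bar>h\<bar>) \<longlongrightarrow> 0) (at 0)"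
        by (auto intro!: tendsto_eq_intros)
    qed
    then have "(flat n has_real_derivative 0) (at 0)" by (simp add: DERIV_def)
    then show ?thesis using 2 by (simp add: flat_def)
  next
    case 3
    have "((\<lambda>s. exp (- (1 / s)) / s ^ n) has_real_derivative
        flat (n + 2) t - real n * flat (n + 1) t) (at t)"
    proof -
      have "((\<lambda>s. exp (- (1 / s)) * inverse (s ^ n)) has_real_derivative
        exp (- (1 / t)) * (1 / t\<^sup>2) * inverse (t ^ n) + exp (- (1 / t)) * (- (real n * t ^ (n - 1)) * inverse ((t ^ n)\<^sup>2))) (at t)"
      proof -
        have 0: "((\<lambda>s::real. - (1 / s)) has_real_derivative 1 / t\<^sup>2) (at t)"
          using 3 by (auto intro!: derivative_eq_intros simp: power2_eq_square)
        have 1: "((\<lambda>s. exp (- (1 / s))) has_real_derivative exp (- (1 / t)) * (1 / t\<^sup>2)) (at t)"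
          by (rule DERIV_chain2[OF DERIV_exp 0])
        have 2: "((\<lambda>s. inverse (s ^ n)) has_real_derivative - (inverse (t ^ n) * (real n * t ^ (n - 1)) * inverse (t ^ n))) (at t)"
          by (rule DERIV_inverse') (use 3 in \<open>auto intro!: derivative_eq_intros\<close>)
        show ?thesis
          using DERIV_mult[OF 1 2] by (simp add: power2_eq_square algebra_simps)
      qed
      moreover have "exp (- (1 / t)) * (1 / t\<^sup>2) * inverse (t ^ n) = flat (n + 2) t"
        using 3 by (simp add: flat_def power_add divide_inverse) (simp only: power2_eq_square inverse_mult_distrib mult_ac)
      moreover have "exp (- (1 / t)) * (- (real n * t ^ (n - 1)) * inverse ((t ^ n)\<^sup>2)) = - real n * flat (n + 1) t"
        using 3 by (cases n) (simp_all add: flat_def field_simps power2_eq_square)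
      ultimately show ?thesis by (simp only: divide_inverse mult_minus_left diff_conv_add_uminus)
    qed
    moreover have "eventually (\<lambda>s. 0 < s) (nhds t)"
      using 3 by (intro eventually_nhds_in_open[of "{0<..}", simplified]) auto
    then have "eventually (\<lambda>s. flat n s = exp (- (1 / s)) / s ^ n) (nhds t)"
      by eventually_elim (simp add: flat_def)
    ultimately show ?thesis
      by (subst DERIV_cong_ev[OF refl _ refl]) auto
  qed
qed

text \<open>This class is closed under directional derivatives, so its members have derivatives of all orders.\<close>
inductive elem_smooth :: "('a::euclidean_space \<Rightarrow> real) \<Rightarrow> bool" where
  const: "elem_smooth (\<lambda>x. c)"
| inner: "elem_smooth (\<lambda>x. x \<bullet> v)"
| add: "elem_smooth f \<Longrightarrow> elem_smooth g \<Longrightarrow> elem_smooth (\<lambda>x. f x + g x)"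
| mult: "elem_smooth f \<Longrightarrow> elem_smooth g \<Longrightarrow> elem_smooth (\<lambda>x. f x * g x)"
| flat: "elem_smooth f \<Longrightarrow> elem_smooth (\<lambda>x. flat n (f x))"

lemma elem_smooth_deriv:
  "elem_smooth f \<Longrightarrow> \<exists>f'. (\<forall>x. (f has_derivative f' x) (at x)) \<and> (\<forall>v. elem_smooth (\<lambda>x. f' x v))"
proof (induction rule: elem_smooth.induct)
  case (const c)
  show ?case by (rule exI[of _ "\<lambda>x v. 0"]) (auto intro: elem_smooth.const)
next
  case (inner v)
  show ?case
    by (rule exI[of _ "\<lambda>x w. w \<bullet> v"]) (auto intro!: elem_smooth.const derivative_eq_intros)
next
  case (add f g)
  then obtain f' g' where
    "\<forall>x. (f has_derivative f' x) (at x)" "\<forall>v. elem_smooth (\<lambda>x. f' x v)"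
    "\<forall>x. (g has_derivative g' x) (at x)" "\<forall>v. elem_smooth (\<lambda>x. g' x v)" by blast
  then show ?case
    by (intro exI[of _ "\<lambda>x v. f' x v + g' x v"]) (auto intro!: elem_smooth.add derivative_eq_intros)
next
  case (mult f g)
  then obtain f' g' where
    "\<forall>x. (f has_derivative f' x) (at x)" "\<forall>v. elem_smooth (\<lambda>x. f' x v)"
    "\<forall>x. (g has_derivative g' x) (at x)" "\<forall>v. elem_smooth (\<lambda>x. g' x v)" by blast
  then show ?case using mult.hyps
    by (intro exI[of _ "\<lambda>x v. f x * g' x v + f' x v * g x"])
       (auto intro!: elem_smooth.add elem_smooth.mult has_derivative_mult)
next
  case (flat f n)
  then obtain f' where f': "\<forall>x. (f has_derivative f' x) (at x)" "\<forall>v. elem_smooth (\<lambda>x. f' x v)" by blast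
  let ?d = "\<lambda>x. flat (n + 2) (f x) + (- real n) * flat (n + 1) (f x)"
  have "((\<lambda>x. flat n (f x)) has_derivative (\<lambda>v. ?d x * f' x v)) (at x)" for x
    using has_derivative_compose[OF f'(1)[rule_format] flat_has_derivative[unfolded has_field_derivative_def], of n x]
    by simp
  moreover have "elem_smooth (\<lambda>x. ?d x * f' x v)" for v
    using f'(2) flat.hyps by (intro elem_smooth.intros) auto
  ultimately show ?case by (intro exI[of _ "\<lambda>x v. ?d x * f' x v"] conjI allI)
qed

lemma elem_smooth_iter_deriv: "elem_smooth f \<Longrightarrow> elem_smooth (iter_deriv vs f)"
proof (induction vs)
  case (Cons v vs)
  then obtain f' where f': "\<forall>x. (iter_deriv vs f has_derivative f' x) (at x)" "\<forall>v. elem_smooth (\<lambda>x. f' x v)"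
    using elem_smooth_deriv by blast
  then have "frechet_derivative (iter_deriv vs f) (at x) = f' x" for x
    using frechet_derivative_at by metis
  then show ?case using f' by simp
qed simp

lemma elem_smooth_differentiable: "elem_smooth f \<Longrightarrow> f differentiable at x"
  using elem_smooth_deriv differentiable_def by blast

lemma test_fun_elem_smooth:
  assumes "elem_smooth f" and "bounded {x. f x \<noteq> 0}"
  shows "test_fun f"
proof -
  have "iter_deriv vs f differentiable at x" for vs x
    using assms elem_smooth_iter_deriv elem_smooth_differentiable by blast
  moreover from this have "continuous_on UNIV (iter_deriv vs f)" for vs
    by (intro continuous_at_imp_continuous_on ballI differentiable_imp_continuous_within)
  ultimately show ?thesis
    using assms by (simp add: test_fun_def smooth_fun_def compact_closure)
qed

definition grad :: "('a::euclidean_space \<Rightarrow> real) \<Rightarrow> 'a \<Rightarrow> 'a" where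
  "grad f x = (\<Sum>i\<in>Basis. frechet_derivative f (at x) i *\<^sub>R i)"

lemma grad_inner_Basis: "i \<in> Basis \<Longrightarrow> grad f x \<bullet> i = frechet_derivative f (at x) i"
  unfolding grad_def by (simp add: inner_sum_left inner_Basis if_distrib cong: if_cong)

lemma grad_has_derivative:
  assumes "f differentiable at x"
  shows "(f has_derivative (\<lambda>h. grad f x \<bullet> h)) (at x)"
proof -
  have d: "(f has_derivative frechet_derivative f (at x)) (at x)"
    using assms frechet_derivative_works by blast
  then interpret bounded_linear "frechet_derivative f (at x)"
    by (rule has_derivative_bounded_linear)
  have "frechet_derivative f (at x) h = grad f x \<bullet> h" for h
  proof -
    have "frechet_derivative f (at x) h = frechet_derivative f (at x) (\<Sum>i\<in>Basis. (h \<bullet> i) *\<^sub>R i)"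
      by (simp add: euclidean_representation)
    also have "\<dots> = grad f x \<bullet> h"
      unfolding sum scale grad_def inner_sum_left by (simp add: inner_commute mult.commute)
    finally show ?thesis .
  qed
  then show ?thesis using d by (metis (no_types, lifting) ext)
qed

lemma test_fun_differentiable: "test_fun f \<Longrightarrow> f differentiable at x"
  unfolding test_fun_def smooth_fun_def by (metis empty_set empty_subsetI iter_deriv.simps(1))

lemma test_fun_continuous_grad: 
  assumes "test_fun f" shows "continuous_on UNIV (grad f)"
proof -
  have "continuous_on UNIV (iter_deriv [i] f)" if "i \<in> Basis" for i
    using assms that unfolding test_fun_def smooth_fun_def
    by (metis bot.extremum empty_set insert_subset list.simps(15))
  then show ?thesis
    unfolding grad_def by (intro continuous_intros) auto
qed

lemma test_fun_bounds:
  assumes "test_fun f"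
  obtains B R where "0 < B" "0 < R" "\<And>x. \<bar>f x\<bar> \<le> B" "\<And>x. norm (grad f x) \<le> B"
    "\<And>x. R < norm x \<Longrightarrow> f x = 0" "\<And>x. R < norm x \<Longrightarrow> grad f x = 0"
    "\<And>x y. \<bar>f x - f y\<bar> \<le> B * norm (x - y)"
proof -
  have d: "(f has_derivative (\<lambda>h. grad f x \<bullet> h)) (at x)" for x
    using assms by (intro grad_has_derivative test_fun_differentiable)
  have cf: "continuous_on UNIV f"
    using d by (intro continuous_at_imp_continuous_on ballI) (rule has_derivative_continuous)
  have cg: "continuous_on UNIV (grad f)" using assms by (rule test_fun_continuous_grad)
  obtain R0 where R0: "\<And>x. x \<in> closure {x. f x \<noteq> 0} \<Longrightarrow> norm x \<le> R0"
    using assms unfolding test_fun_def by (meson bounded_iff compact_imp_bounded)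
  define R where "R = max R0 1"
  have fz: "f x = 0" if "R < norm x" for x
  proof (rule ccontr)
    assume "f x \<noteq> 0"
    then have "x \<in> closure {x. f x \<noteq> 0}"
      by (intro subsetD[OF closure_subset]) simp
    from R0[OF this] show False using that unfolding R_def by simp
  qed
  have gz: "grad f x = 0" if "R < norm x" for x
  proof -
    have "eventually (\<lambda>y. R < norm y) (nhds x)"
      using that by (intro eventually_nhds_in_open[of "{y. R < norm y}", simplified]) (auto intro!: open_Collect_less continuous_intros)
    then have "eventually (\<lambda>y. f y = 0) (nhds x)" by eventually_elim (rule fz)
    then have "eventually (\<lambda>y. 0 = f y) (at x)"
      unfolding eventually_at_filter by eventually_elim simp
    then have "(f has_derivative (\<lambda>h. 0)) (at x)"
      by (rule has_derivative_transform_eventually[OF has_derivative_const]) (simp_all add: fz that)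
    then have "(\<lambda>h. grad f x \<bullet> h) = (\<lambda>h. 0)"
      by (rule has_derivative_unique[OF d])
    then have "grad f x \<bullet> grad f x = 0" by (rule fun_cong)
    then show ?thesis by simp
  qed
  have "bounded (f ` cball 0 R)" "bounded (grad f ` cball 0 R)"
    by (auto intro!: compact_imp_bounded compact_continuous_image continuous_on_subset[OF cf] continuous_on_subset[OF cg])
  then obtain B1 B2 where "\<forall>x\<in>cball 0 R. \<bar>f x\<bar> \<le> B1" "\<forall>x\<in>cball 0 R. norm (grad f x) \<le> B2"
    unfolding bounded_iff by auto
  then have B: "\<And>x. norm x \<le> R \<Longrightarrow> \<bar>f x\<bar> \<le> B1" "\<And>x. norm x \<le> R \<Longrightarrow> norm (grad f x) \<le> B2"
    by simp_all
  define B where "B = max 1 (max B1 B2)"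
  have gB: "norm (grad f x) \<le> B" for x
    using B(2)[of x] gz[of x] unfolding B_def by (cases "R < norm x") auto
  show thesis
  proof (rule that[of B R])
    show "\<bar>f x\<bar> \<le> B" for x
      using B(1)[of x] fz[of x] unfolding B_def by (cases "R < norm x") auto
    show "\<bar>f x - f y\<bar> \<le> B * norm (x - y)" for x y
    proof -
      have "norm (f x - f y) \<le> B * norm (x - y)"
      proof (rule differentiable_bound[of UNIV f "\<lambda>x h. grad f x \<bullet> h"])
        fix z :: 'a
        show "onorm (\<lambda>h. grad f z \<bullet> h) \<le> B"
        proof (rule onorm_le)
          fix h
          have "\<bar>grad f z \<bullet> h\<bar> \<le> norm (grad f z) * norm h" by (rule Cauchy_Schwarz_ineq2)
          also have "\<dots> \<le> B * norm h" by (intro mult_right_mono gB) simp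
          finally show "norm (grad f z \<bullet> h) \<le> B * norm h" by simp
        qed
      next
        fix z :: 'a
        show "(f has_derivative (\<lambda>h. grad f z \<bullet> h)) (at z within UNIV)" by (rule d)
      qed simp_all
      then show ?thesis by simp
    qed
    show "0 < B" "0 < R" by (simp_all add: B_def R_def)
  qed (use fz gz gB in blast)+
qed

section \<open>The fundamental lemma of the calculus of variations\<close>

lemma integrable_sq_bounded_set:
  fixes g :: "'a::euclidean_space \<Rightarrow> real"
  assumes [measurable]: "g \<in> borel_measurable borel" "S \<in> sets borel" and g: "integrable lborel (\<lambda>x. (g x)\<^sup>2)" and "bounded S"
  shows "integrable lborel (\<lambda>x. indicator S x * g x)"
proof -
  have "emeasure lborel S < \<infinity>" using \<open>bounded S\<close> emeasure_bounded_finite by blast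
  then have "integrable lborel (\<lambda>x. indicator S x * 1 + (g x)\<^sup>2)"
    using g by (intro Bochner_Integration.integrable_add) (auto simp: integrable_real_indicator)
  then show ?thesis
  proof (rule Bochner_Integration.integrable_bound)
    have "\<bar>g x\<bar> \<le> 1 + (g x)\<^sup>2" for x
      using zero_le_power2[of "\<bar>g x\<bar> - 1"] by (simp add: power2_diff)
    then show "AE x in lborel. norm (indicator S x * g x) \<le> norm (indicator S x * 1 + (g x)\<^sup>2)"
      by (simp add: indicator_def)
  qed auto
qed

text \<open>The positive and the negative part of \<open>g\<close>, taken as densities, give
  measures that agree on boxes. Boxes are stable under intersection and generate the Borel sets, so
  the measures agree, and densities are unique almost everywhere.\<close>

lemma AE_eq_0_box_integrals:
  fixes g :: "'a::euclidean_space \<Rightarrow> real"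
  assumes [measurable]: "g \<in> borel_measurable borel" 
    and int: "\<And>a b. integrable lborel (\<lambda>x. indicator (box a b) x * g x)"
    and zero: "\<And>a b. (LINT x|lborel. indicator (box a b) x * g x) = 0"
  shows "AE x in lborel. g x = 0"
proof -
  \<comment> \<open>\<open>ennreal\<close> truncates negative values to 0, so \<open>?M g\<close>
    has the positive part of \<open>g\<close> as density and \<open>?M (\<lambda>x. - g x)\<close>
    the negative part.\<close>
  let ?M = "\<lambda>h. density lborel (\<lambda>x. ennreal (h x))"
  have fin: "emeasure (?M h) (box a b) = ennreal (LINT x|lborel. indicator (box a b) x * max (h x) 0)"
    if "h = g \<or> h = (\<lambda>x. - g x)" for h a b
  proof -
    have [measurable]: "h \<in> borel_measurable borel" using that by auto
    have "integrable lborel (\<lambda>x. indicator (box a b) x * h x)"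
      using that int[of a b] Bochner_Integration.integrable_minus[OF int[of a b]] by auto
    then have "integrable lborel (\<lambda>x. max (indicator (box a b) x * h x) 0)" by simp
    moreover have "max (indicator (box a b) x * h x) 0 = indicator (box a b) x * max (h x) 0" for x
      by (simp add: indicator_def)
    ultimately have i: "integrable lborel (\<lambda>x. indicator (box a b) x * max (h x) 0)" by simp
    have "emeasure (?M h) (box a b) = (\<integral>\<^sup>+x. ennreal (indicator (box a b) x * max (h x) 0) \<partial>lborel)"
      by (subst emeasure_density) (auto intro!: nn_integral_cong simp: indicator_def max_def ennreal_neg)
    also have "\<dots> = ennreal (LINT x|lborel. indicator (box a b) x * max (h x) 0)"
      using i by (intro nn_integral_eq_integral) auto
    finally show ?thesis .
  qed
  have i: "integrable lborel (\<lambda>x. indicator (box a b) x * max (h x) 0)" if "h = g \<or> h = (\<lambda>x. - g x)" for h a b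
  proof -
    have "integrable lborel (\<lambda>x. indicator (box a b) x * h x)"
      using that int[of a b] Bochner_Integration.integrable_minus[OF int[of a b]] by auto
    then have "integrable lborel (\<lambda>x. max (indicator (box a b) x * h x) 0)" by simp
    moreover have "max (indicator (box a b) x * h x) 0 = indicator (box a b) x * max (h x) 0" for x
      by (simp add: indicator_def)
    ultimately show ?thesis by simp
  qed
  have eq: "emeasure (?M g) (box a b) = emeasure (?M (\<lambda>x. - g x)) (box a b)" for a b
  proof -
    have "0 = (LINT x|lborel. indicator (box a b) x * max (g x) 0 - indicator (box a b) x * max (- g x) 0)"
      by (subst zero[of a b, symmetric], rule Bochner_Integration.integral_cong) (auto simp: max_def indicator_def)
    also have "\<dots> = (LINT x|lborel. indicator (box a b) x * max (g x) 0) - (LINT x|lborel. indicator (box a b) x * max (- g x) 0)"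
      using i[of g] i[of "\<lambda>x. - g x"] by (intro Bochner_Integration.integral_diff) auto
    finally show ?thesis using fin[of g a b] fin[of "\<lambda>x. - g x" a b] by simp
  qed
  have "?M g = ?M (\<lambda>x. - g x)"
  proof (rule measure_eqI_generator_eq[where E="range (\<lambda>(a, b). box a b)" and \<Omega>=UNIV and A="\<lambda>n. box (- (real n *\<^sub>R One)) (real n *\<^sub>R One)"])
    show "Int_stable (range (\<lambda>(a, b). box a b::'a set))"
      by (auto simp: Int_stable_def box_Int_box)
    show "sets (?M g) = sigma_sets UNIV (range (\<lambda>(a, b). box a b))"
      "sets (?M (\<lambda>x. - g x)) = sigma_sets UNIV (range (\<lambda>(a, b). box a b))"
      by (simp_all add: borel_eq_box)
    show "(\<Union>n. box (- (real n *\<^sub>R One)) (real n *\<^sub>R One)) = (UNIV::'a set)"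
      unfolding UN_box_eq_UNIV by auto
    show "emeasure (?M g) (box (- (real n *\<^sub>R One)) (real n *\<^sub>R One)) \<noteq> \<infinity>" for n
      using fin[of g] by simp
  qed (use eq in auto)
  then have "AE x in lborel. ennreal (g x) = ennreal (- g x)"
    by (subst (asm) sigma_finite_measure.density_unique_iff[OF sigma_finite_lborel]) auto
  then show ?thesis
  proof eventually_elim
    case (elim x)
    then show ?case
      by (cases "0 \<le> g x") (auto simp: ennreal_neg ennreal_eq_0_iff elim: sym[THEN ennreal_eq_0_iff[THEN iffD1]])
  qed
qed

lemma flat_0_bounds: "0 \<le> flat 0 t" "flat 0 t \<le> 1"
  by (auto simp: flat_def)

lemma flat_0_limit: "(\<lambda>n. flat 0 (real n * s)) \<longlonglongrightarrow> (if 0 < s then 1 else 0)"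
proof (cases "0 < s")
  case True
  have "(\<lambda>n. exp (- (inverse s * (1 / real n)))) \<longlonglongrightarrow> exp (- (inverse s * 0))"
    by (intro tendsto_intros lim_1_over_n)
  moreover have "eventually (\<lambda>n. flat 0 (real n * s) = exp (- (inverse s * (1 / real n)))) sequentially"
    using eventually_gt_at_top[of 0]
    by eventually_elim (use True in \<open>auto simp: flat_def field_simps\<close>)
  ultimately show ?thesis using True by (simp add: filterlim_cong)
next
  case False
  then have "flat 0 (real n * s) = 0" for n
    by (simp add: flat_def zero_less_mult_iff)
  then show ?thesis using False by simp
qed

lemma elem_smooth_prod:
  "finite I \<Longrightarrow> (\<And>i. i \<in> I \<Longrightarrow> elem_smooth (f i)) \<Longrightarrow> elem_smooth (\<lambda>x. \<Prod>i\<in>I. f i x)"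
  by (induction I rule: finite_induct) (auto intro: elem_smooth.const elem_smooth.mult)

lemma AE_eq_0_test_fun:
  fixes g :: "'a::euclidean_space \<Rightarrow> real"
  assumes [measurable]: "g \<in> borel_measurable borel" 
    and sq: "integrable lborel (\<lambda>x. (g x)\<^sup>2)"
    and zero: "\<And>\<phi>. test_fun \<phi> \<Longrightarrow> (LINT x|lborel. g x * \<phi> x) = 0"
  shows "AE x in lborel. g x = 0"
proof (rule AE_eq_0_box_integrals)
  fix a b :: 'a
  show i: "integrable lborel (\<lambda>x. indicator (box a b) x * g x)"
    by (rule integrable_sq_bounded_set) (auto intro: sq bounded_box)
  \<comment> \<open>In each coordinate the two factors vanish outside the open interval and tend to
    1 inside it, so \<open>\<psi> n\<close> converges to the indicator of the open box from below;
    its support never leaves the box.\<close>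
  define \<psi> where "\<psi> n x = (\<Prod>i\<in>Basis. flat 0 (real n * (x \<bullet> i - a \<bullet> i)) * flat 0 (real n * (b \<bullet> i - x \<bullet> i)))" for n and x :: 'a
  have es: "elem_smooth (\<psi> n)" for n
  proof -
    have 1: "elem_smooth (\<lambda>x. real n * (x \<bullet> i + - (a \<bullet> i)))" for i :: 'a
      by (intro elem_smooth.intros)
    have 2: "elem_smooth (\<lambda>x. real n * (b \<bullet> i + (-1) * (x \<bullet> i)))" for i :: 'a
      by (intro elem_smooth.intros)
    show ?thesis
      unfolding \<psi>_def using elem_smooth.flat[OF 1, of 0] elem_smooth.flat[OF 2, of 0]
      by (intro elem_smooth_prod elem_smooth.mult) auto
  qed
  have supp: "\<psi> n x = 0" if "x \<notin> box a b" for n x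
  proof -
    obtain i :: 'a where i: "i \<in> Basis" "x \<bullet> i \<le> a \<bullet> i \<or> b \<bullet> i \<le> x \<bullet> i"
      using \<open>x \<notin> box a b\<close> unfolding mem_box by force
    then have "flat 0 (real n * (x \<bullet> i - a \<bullet> i)) * flat 0 (real n * (b \<bullet> i - x \<bullet> i)) = 0"
      by (auto simp: flat_def zero_less_mult_iff)
    then show ?thesis using i(1) unfolding \<psi>_def by (simp add: prod_zero_iff) blast
  qed
  have tf: "test_fun (\<psi> n)" for n
  proof (rule test_fun_elem_smooth[OF es])
    have "{x. \<psi> n x \<noteq> 0} \<subseteq> box a b" using supp by blast
    then show "bounded {x. \<psi> n x \<noteq> 0}" using bounded_box bounded_subset by blast
  qed
  have [measurable]: "\<psi> n \<in> borel_measurable borel" for n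
    using elem_smooth_differentiable[OF es] 
    by (intro borel_measurable_continuous_onI continuous_at_imp_continuous_on ballI differentiable_imp_continuous_within)
  have lim: "(\<lambda>n. \<psi> n x) \<longlonglongrightarrow> indicator (box a b) x" for x
  proof -
    have "(\<lambda>n. \<psi> n x) \<longlonglongrightarrow> (\<Prod>i\<in>Basis. (if 0 < x \<bullet> i - a \<bullet> i then 1 else 0) * (if 0 < b \<bullet> i - x \<bullet> i then 1 else 0))"
      unfolding \<psi>_def by (intro tendsto_intros flat_0_limit)
    moreover have "(\<Prod>i\<in>Basis. (if 0 < x \<bullet> i - a \<bullet> i then 1 else 0) * (if 0 < b \<bullet> i - x \<bullet> i then 1 else 0)) = (indicator (box a b) x :: real)"
    proof (cases "x \<in> box a b")
      case False
      then obtain i :: 'a where "i \<in> Basis" "x \<bullet> i \<le> a \<bullet> i \<or> b \<bullet> i \<le> x \<bullet> i"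
        unfolding mem_box by force
      then show ?thesis using False by (intro prod_zero[THEN trans]) (auto intro!: bexI[of _ i])
    qed (auto simp: mem_box intro!: prod.neutral)
    ultimately show ?thesis by simp
  qed
  have b: "\<bar>\<psi> n x\<bar> \<le> indicator (box a b) x" for n x
  proof (cases "x \<in> box a b")
    case True
    have "\<psi> n x \<le> 1"
      unfolding \<psi>_def by (intro prod_le_1) (auto simp: flat_0_bounds mult_le_one)
    moreover have "0 \<le> \<psi> n x" unfolding \<psi>_def by (intro prod_nonneg) (auto simp: flat_0_bounds)
    ultimately show ?thesis using True by simp
  qed (simp add: supp)
  have "(\<lambda>n. LINT x|lborel. g x * \<psi> n x) \<longlonglongrightarrow> (LINT x|lborel. indicator (box a b) x * g x)"
  proof (rule integral_dominated_convergence[where w="\<lambda>x. \<bar>indicator (box a b) x * g x\<bar>"])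
    show "integrable lborel (\<lambda>x. \<bar>indicator (box a b) x * g x\<bar>)" using i by simp
    show "AE x in lborel. (\<lambda>n. g x * \<psi> n x) \<longlonglongrightarrow> indicator (box a b) x * g x"
      by (subst mult.commute) (auto intro!: tendsto_mult lim)
    have "norm (g x * \<psi> n x) \<le> \<bar>indicator (box a b) x * g x\<bar>" for n x
      using mult_left_mono[OF b[of n x], of "\<bar>g x\<bar>"] by (simp add: abs_mult mult.commute)
    then show "AE x in lborel. norm (g x * \<psi> n x) \<le> \<bar>indicator (box a b) x * g x\<bar>" for n
      by simp
  qed auto
  then show "(LINT x|lborel. indicator (box a b) x * g x) = 0"
    using zero[OF tf] by (simp add: LIMSEQ_const_iff)
qed auto

section \<open>Square integrable functions and weak gradients\<close>

definition sq_norm :: "('a::euclidean_space \<Rightarrow> 'b::euclidean_space) \<Rightarrow> ennreal" where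
  "sq_norm f = (\<integral>\<^sup>+x. ennreal ((norm (f x))\<^sup>2) \<partial>lborel)"

text \<open>Borel rather than Lebesgue measurability, because it is preserved when \<open>f\<close>
  is composed with Borel maps such as \<open>(x, h) \<mapsto> x + h\<close>.\<close>

definition L2 :: "('a::euclidean_space \<Rightarrow> 'b::euclidean_space) \<Rightarrow> bool" where
  "L2 f \<longleftrightarrow> f \<in> borel_measurable borel \<and> sq_norm f < \<infinity>"

lemma L2_measurable [measurable_dest]: "L2 f \<Longrightarrow> f \<in> borel_measurable borel"
  by (simp add: L2_def)

text \<open>Cauchy-Schwarz in a form that asks for no integrability: if the product is not
  integrable, the integral on the left is 0 by convention, and the right-hand side may be
  infinite.\<close>

lemma integral_mult_sq_le:
  fixes a b :: "'a \<Rightarrow> real"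
  assumes [measurable]: "a \<in> borel_measurable M" "b \<in> borel_measurable M"
  shows "ennreal ((LINT x|M. a x * b x)\<^sup>2) \<le> (\<integral>\<^sup>+x. ennreal ((a x)\<^sup>2) \<partial>M) * (\<integral>\<^sup>+x. ennreal ((b x)\<^sup>2) \<partial>M)"
proof -
  have le: "ennreal \<bar>LINT x|M. a x * b x\<bar> \<le> (\<integral>\<^sup>+x. ennreal \<bar>a x\<bar> * ennreal \<bar>b x\<bar> \<partial>M)"
  proof (cases "integrable M (\<lambda>x. a x * b x)")
    case True
    have "ennreal (norm (LINT x|M. a x * b x)) \<le> (\<integral>\<^sup>+x. ennreal (norm (a x * b x)) \<partial>M)"
      by (rule integral_norm_bound_ennreal[OF True])
    then show ?thesis by (simp add: abs_mult ennreal_mult)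
  qed (simp add: not_integrable_integral_eq)
  have "ennreal ((LINT x|M. a x * b x)\<^sup>2) = (ennreal \<bar>LINT x|M. a x * b x\<bar>)\<^sup>2"
    by (simp add: ennreal_power)
  also have "\<dots> \<le> (\<integral>\<^sup>+x. ennreal \<bar>a x\<bar> * ennreal \<bar>b x\<bar> \<partial>M)\<^sup>2"
    by (intro power_mono le) simp
  also have "\<dots> \<le> (\<integral>\<^sup>+x. (ennreal \<bar>a x\<bar>)\<^sup>2 \<partial>M) * (\<integral>\<^sup>+x. (ennreal \<bar>b x\<bar>)\<^sup>2 \<partial>M)"
    by (rule Cauchy_Schwarz_nn_integral) auto
  finally show ?thesis by (simp add: ennreal_power)
qed

lemma integrable_mult_square_integrable:
  fixes a b :: "'a \<Rightarrow> real"
  assumes [measurable]: "a \<in> borel_measurable M" "b \<in> borel_measurable M"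
    and "(\<integral>\<^sup>+x. ennreal ((a x)\<^sup>2) \<partial>M) < \<infinity>" "(\<integral>\<^sup>+x. ennreal ((b x)\<^sup>2) \<partial>M) < \<infinity>"
  shows "integrable M (\<lambda>x. a x * b x)"
proof -
  have "integrable M (\<lambda>x. (a x)\<^sup>2)" "integrable M (\<lambda>x. (b x)\<^sup>2)"
    using assms by (auto intro!: integrableI_bounded)
  then have "integrable M (\<lambda>x. (a x)\<^sup>2 + (b x)\<^sup>2)" by simp
  then show ?thesis
  proof (rule Bochner_Integration.integrable_bound)
    have "norm (a x * b x) \<le> norm ((a x)\<^sup>2 + (b x)\<^sup>2)" for x
    proof -
      have "2 * (\<bar>a x\<bar> * \<bar>b x\<bar>) \<le> (a x)\<^sup>2 + (b x)\<^sup>2"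
        using sum_squares_bound[of "\<bar>a x\<bar>" "\<bar>b x\<bar>"] by (simp add: mult.assoc)
      moreover have "0 \<le> \<bar>a x\<bar> * \<bar>b x\<bar>" by simp
      ultimately have "\<bar>a x\<bar> * \<bar>b x\<bar> \<le> (a x)\<^sup>2 + (b x)\<^sup>2" by linarith
      then show ?thesis by (simp add: abs_mult)
    qed
    then show "AE x in M. norm (a x * b x) \<le> norm ((a x)\<^sup>2 + (b x)\<^sup>2)" by simp
  qed measurable
qed

lemma L2_integrable_mult:
  fixes f g :: "'a::euclidean_space \<Rightarrow> real"
  assumes "L2 f" "L2 g"
  shows "integrable lborel (\<lambda>x. f x * g x)"
  using assms by (intro integrable_mult_square_integrable) (auto simp: L2_def sq_norm_def)

lemma L2_integrable_sq: "L2 f \<Longrightarrow> integrable lborel (\<lambda>x. (norm (f x))\<^sup>2)"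
  by (intro integrableI_bounded) (auto simp: L2_def sq_norm_def)

lemma L2I_integrable:
  "f \<in> borel_measurable borel \<Longrightarrow> integrable lborel (\<lambda>x. (norm (f x))\<^sup>2) \<Longrightarrow> L2 f"
  by (simp add: L2_def sq_norm_def integrable_iff_bounded)

lemma sq_norm_eq: "L2 f \<Longrightarrow> sq_norm f = ennreal (LINT x|lborel. (norm (f x))\<^sup>2)"
  unfolding sq_norm_def by (intro nn_integral_eq_integral L2_integrable_sq) auto

lemma L2_bound:
  assumes "L2 g" and [measurable]: "f \<in> borel_measurable borel" and le: "\<And>x. norm (f x) \<le> norm (g x)"
  shows "L2 f"
proof -
  have "sq_norm f \<le> sq_norm g" unfolding sq_norm_def by (intro nn_integral_mono ennreal_leI power_mono le) simp
  then show ?thesis using assms unfolding L2_def by (meson le_less_trans)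
qed

lemma L2_cmult: 
  assumes "L2 f" shows "L2 (\<lambda>x. c *\<^sub>R f x)"
proof (rule L2I_integrable)
  show "integrable lborel (\<lambda>x. (norm (c *\<^sub>R f x))\<^sup>2)"
    using L2_integrable_sq[OF assms] by (simp add: power_mult_distrib)
qed (use assms in measurable)

lemma norm_add_sq_le:
  fixes a b :: "'b::euclidean_space"
  shows "(norm (a + b))\<^sup>2 \<le> 2 * (norm a)\<^sup>2 + 2 * (norm b)\<^sup>2"
proof -
  have "(norm (a + b))\<^sup>2 \<le> (norm a + norm b)\<^sup>2"
    by (intro power_mono norm_triangle_ineq) simp
  also have "\<dots> \<le> 2 * (norm a)\<^sup>2 + 2 * (norm b)\<^sup>2"
    using sum_squares_bound[of "norm a" "norm b"] by (simp add: power2_sum)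
  finally show ?thesis .
qed

lemma L2_add: 
  assumes "L2 f" "L2 g" shows "L2 (\<lambda>x. f x + g x)"
proof (rule L2I_integrable)
  have [measurable]: "f \<in> borel_measurable borel" "g \<in> borel_measurable borel"
    using assms by (auto simp: L2_def)
  show "(\<lambda>x. f x + g x) \<in> borel_measurable borel" by measurable
  have "integrable lborel (\<lambda>x. 2 * (norm (f x))\<^sup>2 + 2 * (norm (g x))\<^sup>2)"
    using assms by (intro Bochner_Integration.integrable_add integrable_mult_right L2_integrable_sq)
  then show "integrable lborel (\<lambda>x. (norm (f x + g x))\<^sup>2)"
    by (rule Bochner_Integration.integrable_bound) (auto simp: norm_add_sq_le)
qed

lemma L2_diff: 
  assumes "L2 f" "L2 g" shows "L2 (\<lambda>x. f x - g x)"
  using L2_add[OF assms(1) L2_cmult[OF assms(2), of "-1"]] by simp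

lemma L2_inner: 
  assumes "L2 f" shows "L2 (\<lambda>x. f x \<bullet> v)"
proof -
  have "L2 (\<lambda>x. norm v *\<^sub>R f x)" by (rule L2_cmult[OF assms])
  then show ?thesis
  proof (rule L2_bound)
    show "norm (f x \<bullet> v) \<le> norm (norm v *\<^sub>R f x)" for x
      using Cauchy_Schwarz_ineq2[of "f x" v] by (simp add: mult.commute)
  qed (use assms in measurable)
qed

lemma sq_norm_shift:
  fixes f :: "'a::euclidean_space \<Rightarrow> 'b::euclidean_space"
  assumes [measurable]: "f \<in> borel_measurable borel"
  shows "sq_norm (\<lambda>x. f (x + h)) = sq_norm f"
  unfolding sq_norm_def by (rule nn_integral_lborel_shift(2)[where f="\<lambda>x. ennreal ((norm (f x))\<^sup>2)"]) measurable

lemma L2_shift: 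
  assumes "L2 f" shows "L2 (\<lambda>x. f (x + h))"
  using assms sq_norm_shift[of f h] by (auto simp: L2_def)

lemma integral_lborel_shift:
  fixes f :: "'a::euclidean_space \<Rightarrow> real"
  assumes [measurable]: "f \<in> borel_measurable borel"
  shows "(LINT x|lborel. f (x + t)) = (LINT x|lborel. f x)"
proof -
  have "(LINT x|lborel. f x) = (LINT x|distr lborel borel ((+) t). f x)"
    by (simp add: lborel_distr_plus)
  also have "\<dots> = (LINT x|lborel. f (t + x))"
    by (subst integral_distr) auto
  finally show ?thesis by (simp add: add.commute)
qed

lemma L2_compact_support:
  fixes f :: "'a::euclidean_space \<Rightarrow> 'b::euclidean_space"
  assumes [measurable]: "f \<in> borel_measurable borel" and B: "\<And>x. norm (f x) \<le> B" and R: "\<And>x. R < norm x \<Longrightarrow> f x = 0"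
  shows "L2 f"
proof -
  have "L2 (\<lambda>x::'a. indicator (cball 0 R) x :: real)"
  proof (rule L2I_integrable)
    have "emeasure lborel (cball (0::'a) R) < \<infinity>" by (rule emeasure_bounded_finite) simp
    then have "integrable lborel (\<lambda>x::'a. indicator (cball 0 R) x :: real)"
      by (intro integrable_real_indicator) auto
    then show "integrable lborel (\<lambda>x::'a. (norm (indicator (cball 0 R) x :: real))\<^sup>2)"
      by (rule back_subst[of "integrable lborel"]) (auto simp: indicator_def)
  qed (auto intro!: borel_measurable_indicator)
  from L2_cmult[OF this, of B] show ?thesis
  proof (rule L2_bound)
    show "norm (f x) \<le> norm (B *\<^sub>R (indicator (cball 0 R) x :: real))" for x
      using B[of x] R[of x] by (cases "R < norm x") auto
  qed measurable
qed

lemma test_fun_measurable: 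
  assumes "test_fun f" shows "f \<in> borel_measurable borel" "grad f \<in> borel_measurable borel"
proof -
  have "continuous_on UNIV f"
    using assms by (intro continuous_at_imp_continuous_on ballI differentiable_imp_continuous_within test_fun_differentiable)
  then show "f \<in> borel_measurable borel" by (rule borel_measurable_continuous_onI)
  show "grad f \<in> borel_measurable borel"
    using assms by (intro borel_measurable_continuous_onI test_fun_continuous_grad)
qed

lemma test_fun_L2:
  assumes "test_fun f" shows "L2 f" "L2 (grad f)"
proof -
  from test_fun_bounds[OF assms] obtain B R where 
    "\<And>x. \<bar>f x\<bar> \<le> B" "\<And>x. norm (grad f x) \<le> B" "\<And>x. R < norm x \<Longrightarrow> f x = 0" "\<And>x. R < norm x \<Longrightarrow> grad f x = 0"
    by metis
  then show "L2 f" "L2 (grad f)"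
    using test_fun_measurable[OF assms] by (auto intro: L2_compact_support[where B=B and R=R])
qed

lemma test_fun_shift:
  assumes "test_fun f"
  shows "test_fun (\<lambda>x. f (x - c))" and "grad (\<lambda>x. f (x - c)) x = grad f (x - c)"
proof -
  have fd: "frechet_derivative (\<lambda>x. g (x - c)) (at x) = frechet_derivative g (at (x - c))"
    and df: "(\<lambda>x. g (x - c)) differentiable at x"
    if "\<And>x. g differentiable at x" for g :: "'a \<Rightarrow> real" and x
  proof -
    have "(g has_derivative frechet_derivative g (at (x - c))) (at (x - c))"
      using that frechet_derivative_works by blast
    then have "((\<lambda>x. g (x - c)) has_derivative (\<lambda>h. frechet_derivative g (at (x - c)) h)) (at x)"
      by (rule has_derivative_compose[rotated]) (auto intro!: derivative_eq_intros)
    then show "frechet_derivative (\<lambda>x. g (x - c)) (at x) = frechet_derivative g (at (x - c))"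
      "(\<lambda>x. g (x - c)) differentiable at x"
      by (auto simp: differentiable_def dest: frechet_derivative_at)
  qed
  have d: "iter_deriv vs f differentiable at x" and ct: "continuous_on UNIV (iter_deriv vs f)" if "set vs \<subseteq> Basis" for vs x
    using assms that unfolding test_fun_def smooth_fun_def by auto
  have it: "set vs \<subseteq> Basis \<Longrightarrow> iter_deriv vs (\<lambda>x. f (x - c)) = (\<lambda>x. iter_deriv vs f (x - c))" for vs
    by (induction vs) (auto simp: fd[OF d])
  have "smooth_fun (\<lambda>x. f (x - c))"
    unfolding smooth_fun_def
  proof (intro allI impI conjI)
    fix vs :: "'a list" assume vs: "set vs \<subseteq> Basis"
    show "continuous_on UNIV (iter_deriv vs (\<lambda>x. f (x - c)))"
      unfolding it[OF vs] by (intro continuous_on_compose2[OF ct[OF vs]] continuous_intros) auto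
    show "iter_deriv vs (\<lambda>x. f (x - c)) differentiable at x" for x
      unfolding it[OF vs] by (rule df[OF d[OF vs]])
  qed
  moreover have "bounded {x. f (x - c) \<noteq> 0}"
  proof -
    have "bounded {x. f x \<noteq> 0}"
      using assms unfolding test_fun_def by (meson bounded_closure_image bounded_subset closure_subset compact_imp_bounded)
    then have "bounded ((+) c ` {x. f x \<noteq> 0})" by (rule bounded_translation)
    moreover have "{x. f (x - c) \<noteq> 0} \<subseteq> (+) c ` {x. f x \<noteq> 0}"
      by (auto intro!: image_eqI[of _ _ "_ - c"])
    ultimately show ?thesis using bounded_subset by blast
  qed
  ultimately show "test_fun (\<lambda>x. f (x - c))" by (simp add: test_fun_def compact_closure)
  show "grad (\<lambda>x. f (x - c)) x = grad f (x - c)"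
    unfolding grad_def by (simp add: fd[OF d[of "[]", simplified]])
qed

text \<open>Weak gradients with Borel representatives and all integrals over \<open>lborel\<close>.\<close>
definition has_wgrad :: "('a::euclidean_space \<Rightarrow> real) \<Rightarrow> ('a \<Rightarrow> 'a) \<Rightarrow> bool" where
  "has_wgrad u G \<longleftrightarrow> L2 u \<and> L2 G \<and> (\<forall>\<phi>. test_fun \<phi> \<longrightarrow> (\<forall>v.
     (LINT x|lborel. u x * (grad \<phi> x \<bullet> v)) = - (LINT x|lborel. (G x \<bullet> v) * \<phi> x)))"

text \<open>Averaging over the segment from \<open>x\<close> to \<open>x + h\<close> is treated as
  an integral over the product of the unit interval with the space. For each fixed \<open>t\<close>
  the map is a translation, so nothing is lost.\<close>

lemma nn_integral_segment:
  fixes f :: "'a::euclidean_space \<Rightarrow> real"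
  assumes [measurable]: "f \<in> borel_measurable borel"
  shows "(\<integral>\<^sup>+p. ennreal ((case p of (t, x) \<Rightarrow> indicator {0..1::real} t * f (x + t *\<^sub>R h))\<^sup>2) \<partial>(lborel \<Otimes>\<^sub>M lborel))
    = (\<integral>\<^sup>+x. ennreal ((f x)\<^sup>2) \<partial>lborel)"
proof -
  have "(\<integral>\<^sup>+p. ennreal ((case p of (t, x) \<Rightarrow> indicator {0..1::real} t * f (x + t *\<^sub>R h))\<^sup>2) \<partial>(lborel \<Otimes>\<^sub>M lborel))
    = (\<integral>\<^sup>+t. \<integral>\<^sup>+x. ennreal ((indicator {0..1::real} t * f (x + t *\<^sub>R h))\<^sup>2) \<partial>lborel \<partial>lborel)"
    by (subst lborel.nn_integral_fst[symmetric]) auto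
  also have "\<dots> = (\<integral>\<^sup>+t. \<integral>\<^sup>+x. indicator {0..1::real} t * ennreal ((f (x + t *\<^sub>R h))\<^sup>2) \<partial>lborel \<partial>lborel)"
    by (intro nn_integral_cong) (simp add: indicator_def)
  also have "\<dots> = (\<integral>\<^sup>+t. indicator {0..1::real} t * (\<integral>\<^sup>+x. ennreal ((f x)\<^sup>2) \<partial>lborel) \<partial>lborel)"
  proof (rule nn_integral_cong)
    fix t :: real
    have "(\<integral>\<^sup>+x. ennreal ((f (x + t *\<^sub>R h))\<^sup>2) \<partial>lborel) = (\<integral>\<^sup>+x. ennreal ((f x)\<^sup>2) \<partial>lborel)"
      by (rule nn_integral_lborel_shift(2)[where f="\<lambda>x. ennreal ((f x)\<^sup>2)"]) measurable
    then show "(\<integral>\<^sup>+x. indicator {0..1::real} t * ennreal ((f (x + t *\<^sub>R h))\<^sup>2) \<partial>lborel) = indicator {0..1::real} t * (\<integral>\<^sup>+x. ennreal ((f x)\<^sup>2) \<partial>lborel)"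
      by (simp add: nn_integral_cmult)
  qed
  also have "\<dots> = (\<integral>\<^sup>+x. ennreal ((f x)\<^sup>2) \<partial>lborel)"
    by (simp add: nn_integral_multc)
  finally show ?thesis .
qed

lemma integrable_segment_mult:
  fixes f g :: "'a::euclidean_space \<Rightarrow> real"
  assumes "L2 f" "L2 g"
  shows "integrable (lborel \<Otimes>\<^sub>M lborel) (\<lambda>(t, x). indicator {0..1::real} t * (f (x + t *\<^sub>R h) * g (x + t *\<^sub>R k)))"
proof -
  have [measurable]: "f \<in> borel_measurable borel" "g \<in> borel_measurable borel"
    using assms by (auto simp: L2_def)
  have "integrable (lborel \<Otimes>\<^sub>M lborel) (\<lambda>p. (case p of (t, x) \<Rightarrow> indicator {0..1::real} t * f (x + t *\<^sub>R h)) *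
     (case p of (t, x) \<Rightarrow> indicator {0..1::real} t * g (x + t *\<^sub>R k)))"
    by (rule integrable_mult_square_integrable)
       (use assms in \<open>auto simp: nn_integral_segment L2_def sq_norm_def\<close>)
  then show ?thesis
    by (rule back_subst[of "integrable (lborel \<Otimes>\<^sub>M lborel)"]) (auto simp: indicator_def)
qed

text \<open>The increment equals almost everywhere the integral \<open>W\<close> of the directional
  derivative along the segment. Cauchy-Schwarz on the unit interval and translation invariance then
  bound \<open>W\<close>.\<close>

lemma has_wgrad_translation:
  fixes u :: "'a::euclidean_space \<Rightarrow> real"
  assumes "has_wgrad u G"
  shows "(\<integral>\<^sup>+x. ennreal ((u (x + h) - u x)\<^sup>2) \<partial>lborel) \<le> (\<integral>\<^sup>+x. ennreal ((G x \<bullet> h)\<^sup>2) \<partial>lborel)"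
proof -
  have uG: "L2 u" "L2 G" using assms by (auto simp: has_wgrad_def)
  then have [measurable]: "u \<in> borel_measurable borel" "G \<in> borel_measurable borel"
    by (auto simp: L2_def)
  let ?I = "indicator {0..1::real} :: real \<Rightarrow> real"
  define W where "W x = (LINT t|lborel. ?I t * (G (x + t *\<^sub>R h) \<bullet> h))" for x
  have [measurable]: "W \<in> borel_measurable borel"
    unfolding W_def by measurable
  have Wle: "(\<integral>\<^sup>+x. ennreal ((W x)\<^sup>2) \<partial>lborel) \<le> (\<integral>\<^sup>+x. ennreal ((G x \<bullet> h)\<^sup>2) \<partial>lborel)"
  proof -
    have "(\<integral>\<^sup>+x. ennreal ((W x)\<^sup>2) \<partial>lborel) \<le> (\<integral>\<^sup>+x. \<integral>\<^sup>+t. ennreal ((?I t * (G (x + t *\<^sub>R h) \<bullet> h))\<^sup>2) \<partial>lborel \<partial>lborel)"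
    proof (rule nn_integral_mono)
      fix x
      have "W x = (LINT t|lborel. ?I t * (?I t * (G (x + t *\<^sub>R h) \<bullet> h)))"
        unfolding W_def by (intro Bochner_Integration.integral_cong) (auto simp: indicator_def)
      then have "ennreal ((W x)\<^sup>2) \<le> (\<integral>\<^sup>+t. ennreal ((?I t)\<^sup>2) \<partial>lborel) * (\<integral>\<^sup>+t. ennreal ((?I t * (G (x + t *\<^sub>R h) \<bullet> h))\<^sup>2) \<partial>lborel)"
        by (simp only:) (rule integral_mult_sq_le, measurable)
      also have "(\<integral>\<^sup>+t. ennreal ((?I t)\<^sup>2) \<partial>lborel) = (\<integral>\<^sup>+t. indicator {0..1::real} t \<partial>lborel)"
        by (intro nn_integral_cong) (auto simp: indicator_def)
      finally show "ennreal ((W x)\<^sup>2) \<le> (\<integral>\<^sup>+t. ennreal ((?I t * (G (x + t *\<^sub>R h) \<bullet> h))\<^sup>2) \<partial>lborel)"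
        by simp
    qed
    also have "\<dots> = (\<integral>\<^sup>+t. \<integral>\<^sup>+x. ennreal ((?I t * (G (x + t *\<^sub>R h) \<bullet> h))\<^sup>2) \<partial>lborel \<partial>lborel)"
      by (rule lborel_pair.Fubini') measurable
    also have "\<dots> = (\<integral>\<^sup>+p. ennreal ((case p of (t, x) \<Rightarrow> ?I t * (G (x + t *\<^sub>R h) \<bullet> h))\<^sup>2) \<partial>(lborel \<Otimes>\<^sub>M lborel))"
      by (subst lborel.nn_integral_fst[symmetric]) auto
    also have "\<dots> = (\<integral>\<^sup>+x. ennreal ((G x \<bullet> h)\<^sup>2) \<partial>lborel)"
      by (rule nn_integral_segment[where f="\<lambda>x. G x \<bullet> h"]) measurable
    finally show ?thesis .
  qed
  have "L2 (\<lambda>x. G x \<bullet> h)" by (rule L2_inner[OF uG(2)])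
  then have "(\<integral>\<^sup>+x. ennreal ((G x \<bullet> h)\<^sup>2) \<partial>lborel) < \<infinity>" by (simp add: L2_def sq_norm_def)
  then have LW: "L2 W" using Wle by (auto simp: L2_def sq_norm_def)
  define w where "w x = u (x + h) - u x" for x
  have Lw: "L2 w" unfolding w_def by (intro L2_diff L2_shift uG)
  \<comment> \<open>Only the test functions are differentiable, so the identity is checked against
    them: the increment is shifted onto \<open>\<phi>\<close>, written by the fundamental theorem of
    calculus as an integral over the segment, and taken back after exchanging the integrals.\<close>
  have "AE x in lborel. w x - W x = 0"
  proof (rule AE_eq_0_test_fun)
    show "(\<lambda>x. w x - W x) \<in> borel_measurable borel" unfolding w_def by measurable
    show "integrable lborel (\<lambda>x. (w x - W x)\<^sup>2)"
      using L2_integrable_sq[OF L2_diff[OF Lw LW]] by simp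
    fix \<phi> :: "'a \<Rightarrow> real" assume \<phi>: "test_fun \<phi>"
    note [measurable] = test_fun_measurable[OF \<phi>]
    note L\<phi> = test_fun_L2[OF \<phi>]
    have "(LINT x|lborel. w x * \<phi> x) = (LINT x|lborel. u (x + h) * \<phi> x) - (LINT x|lborel. u x * \<phi> x)"
      unfolding w_def left_diff_distrib
      by (intro Bochner_Integration.integral_diff L2_integrable_mult L2_shift uG L\<phi>)
    also have "(LINT x|lborel. u (x + h) * \<phi> x) = (LINT x|lborel. u x * \<phi> (x - h))"
      using integral_lborel_shift[of "\<lambda>x. u x * \<phi> (x - h)" h] by simp
    also have "(LINT x|lborel. u x * \<phi> (x - h)) - (LINT x|lborel. u x * \<phi> x) = (LINT x|lborel. u x * \<phi> (x - h) - u x * \<phi> x)"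
      using L2_shift[OF L\<phi>(1), of "-h"] 
      by (intro Bochner_Integration.integral_diff[symmetric] L2_integrable_mult uG L\<phi>) simp
    also have "\<dots> = (LINT x|lborel. LINT t|lborel. - (?I t * (u x * (grad \<phi> (x - t *\<^sub>R h) \<bullet> h))))"
    proof (rule Bochner_Integration.integral_cong)
      fix x
      have "((\<lambda>t. \<phi> (x - t *\<^sub>R h)) has_real_derivative - (grad \<phi> (x - t *\<^sub>R h) \<bullet> h)) (at t)" for t
      proof -
        have "((\<lambda>t. \<phi> (x - t *\<^sub>R h)) has_derivative (\<lambda>s. grad \<phi> (x - t *\<^sub>R h) \<bullet> (- (s *\<^sub>R h)))) (at t)"
          by (rule has_derivative_compose[OF _ grad_has_derivative[OF test_fun_differentiable[OF \<phi>]]])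
             (auto intro!: derivative_eq_intros)
        moreover have "(\<lambda>s. grad \<phi> (x - t *\<^sub>R h) \<bullet> (- (s *\<^sub>R h))) = times (- (grad \<phi> (x - t *\<^sub>R h) \<bullet> h))"
          by (simp add: fun_eq_iff)
        ultimately show ?thesis unfolding has_field_derivative_def by simp
      qed
      moreover have "isCont (\<lambda>t. - (grad \<phi> (x - t *\<^sub>R h) \<bullet> h)) t" for t
      proof -
        have "continuous_on UNIV (\<lambda>t. - (grad \<phi> (x - t *\<^sub>R h) \<bullet> h))"
          by (intro continuous_intros continuous_on_compose2[OF test_fun_continuous_grad[OF \<phi>]]) auto
        then show ?thesis by (simp add: continuous_on_eq_continuous_at)
      qed
      ultimately have "(LINT t|lborel. - (grad \<phi> (x - t *\<^sub>R h) \<bullet> h) * ?I t) = \<phi> (x - 1 *\<^sub>R h) - \<phi> (x - 0 *\<^sub>R h)"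
        by (intro integral_FTC_Icc_real) auto
      then have "u x * \<phi> (x - h) - u x * \<phi> x = u x * (LINT t|lborel. - (grad \<phi> (x - t *\<^sub>R h) \<bullet> h) * ?I t)"
        by (simp add: right_diff_distrib)
      also have "\<dots> = (LINT t|lborel. - (?I t * (u x * (grad \<phi> (x - t *\<^sub>R h) \<bullet> h))))"
        by (subst integral_mult_right_zero[symmetric]) (simp add: mult_ac)
      finally show "u x * \<phi> (x - h) - u x * \<phi> x = (LINT t|lborel. - (?I t * (u x * (grad \<phi> (x - t *\<^sub>R h) \<bullet> h))))" .
    qed simp
    also have "\<dots> = - (LINT x|lborel. LINT t|lborel. ?I t * (u x * (grad \<phi> (x - t *\<^sub>R h) \<bullet> h)))"
      by simp
    also have "(LINT x|lborel. LINT t|lborel. ?I t * (u x * (grad \<phi> (x - t *\<^sub>R h) \<bullet> h)))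
      = (LINT t|lborel. LINT x|lborel. ?I t * (u x * (grad \<phi> (x - t *\<^sub>R h) \<bullet> h)))"
      using integrable_segment_mult[OF uG(1) L2_inner[OF L\<phi>(2)], of 0 "-h" h]
      by (intro lborel_pair.Fubini_integral) simp
    also have "- \<dots> = (LINT t|lborel. - (LINT x|lborel. ?I t * (u x * (grad \<phi> (x - t *\<^sub>R h) \<bullet> h))))"
      by simp
    \<comment> \<open>For each \<open>t\<close> the weak gradient is tested with the translate of
      \<open>\<phi>\<close> by \<open>t *\<^sub>R h\<close>.\<close>
    also have "\<dots> = (LINT t|lborel. LINT x|lborel. ?I t * ((G (x + t *\<^sub>R h) \<bullet> h) * \<phi> x))"
    proof (rule Bochner_Integration.integral_cong)
      fix t :: real
      have "(LINT x|lborel. u x * (grad \<phi> (x - t *\<^sub>R h) \<bullet> h)) = - (LINT x|lborel. (G x \<bullet> h) * \<phi> (x - t *\<^sub>R h))"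
        using assms test_fun_shift(1)[OF \<phi>, of "t *\<^sub>R h"] unfolding has_wgrad_def
        by (simp flip: test_fun_shift(2)[OF \<phi>])
      also have "(LINT x|lborel. (G x \<bullet> h) * \<phi> (x - t *\<^sub>R h)) = (LINT x|lborel. (G (x + t *\<^sub>R h) \<bullet> h) * \<phi> x)"
        using integral_lborel_shift[of "\<lambda>x. (G x \<bullet> h) * \<phi> (x - t *\<^sub>R h)" "t *\<^sub>R h"] by simp
      finally show "- (LINT x|lborel. ?I t * (u x * (grad \<phi> (x - t *\<^sub>R h) \<bullet> h)))
         = (LINT x|lborel. ?I t * ((G (x + t *\<^sub>R h) \<bullet> h) * \<phi> x))" by simp
    qed simp
    also have "\<dots> = (LINT x|lborel. LINT t|lborel. ?I t * ((G (x + t *\<^sub>R h) \<bullet> h) * \<phi> x))"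
      using integrable_segment_mult[OF L2_inner[OF uG(2)] L\<phi>(1), of h h 0]
      by (intro lborel_pair.Fubini_integral[symmetric]) simp
    also have "\<dots> = (LINT x|lborel. W x * \<phi> x)"
    proof (rule Bochner_Integration.integral_cong)
      fix x
      have "(LINT t|lborel. ?I t * ((G (x + t *\<^sub>R h) \<bullet> h) * \<phi> x)) = (LINT t|lborel. (?I t * (G (x + t *\<^sub>R h) \<bullet> h)) * \<phi> x)"
        by (simp add: mult.assoc)
      then show "(LINT t|lborel. ?I t * ((G (x + t *\<^sub>R h) \<bullet> h) * \<phi> x)) = W x * \<phi> x"
        unfolding W_def by simp
    qed simp
    finally have "(LINT x|lborel. w x * \<phi> x) = (LINT x|lborel. W x * \<phi> x)" .
    moreover have "(LINT x|lborel. w x * \<phi> x - W x * \<phi> x) = (LINT x|lborel. w x * \<phi> x) - (LINT x|lborel. W x * \<phi> x)"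
      by (intro Bochner_Integration.integral_diff L2_integrable_mult Lw LW L\<phi>)
    ultimately show "(LINT x|lborel. (w x - W x) * \<phi> x) = 0"
      by (simp add: left_diff_distrib)
  qed
  then have "(\<integral>\<^sup>+x. ennreal ((u (x + h) - u x)\<^sup>2) \<partial>lborel) = (\<integral>\<^sup>+x. ennreal ((W x)\<^sup>2) \<partial>lborel)"
    by (intro nn_integral_cong_AE) (auto simp: w_def)
  then show ?thesis using Wle by simp
qed

text \<open>The source of all strict inequalities between integrals: a strict inequality at one
  point, between continuous functions, holds on a nonempty open set, and such a set has positive
  measure.\<close>

lemma nn_integral_pos_open:
  fixes f :: "'a::euclidean_space \<Rightarrow> ennreal"
  assumes [measurable]: "f \<in> borel_measurable borel" and "open U" "U \<noteq> {}" and pos: "\<And>x. x \<in> U \<Longrightarrow> 0 < f x"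
  shows "0 < (\<integral>\<^sup>+x. f x \<partial>lborel)"
proof (rule ccontr)
  assume "\<not> ?thesis"
  then have "(\<integral>\<^sup>+x. f x \<partial>lborel) = 0" by simp
  then have "AE x in lborel. f x = 0" by (subst (asm) nn_integral_0_iff_AE) auto
  then have "AE x in lborel. x \<notin> U"
    by eventually_elim (metis pos less_irrefl)
  then have "U \<in> null_sets lborel" using \<open>open U\<close> by (subst AE_iff_null_sets) auto
  then have "U \<in> null_sets lebesgue" by (rule null_sets_completionI)
  then have "negligible U" by (simp add: negligible_iff_null_sets)
  then show False using open_not_negligible assms by blast
qed

lemma AE_lborel_shift:
  fixes P :: "'a::euclidean_space \<Rightarrow> bool"
  assumes "AE x in lborel. P x"
  shows "AE x in lborel. P (x + c)"
proof -
  have "AE x in distr lborel borel ((+) c). P x" by (subst lborel_distr_plus) (rule assms)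
  then have "AE x in lborel. P (c + x)" by (rule AE_distrD[rotated]) simp
  then show ?thesis by (simp add: add.commute)
qed

section \<open>A Dirichlet energy from difference quotients\<close>

definition bump :: "real \<Rightarrow> 'a::euclidean_space \<Rightarrow> real" where
  "bump \<epsilon> z = flat 0 (1 - (z \<bullet> z) / \<epsilon>\<^sup>2)"

lemma bump_nonneg [simp]: "0 \<le> bump \<epsilon> z"
  by (simp add: bump_def flat_def)

lemma bump_pos_iff: "0 < \<epsilon> \<Longrightarrow> 0 < bump \<epsilon> z \<longleftrightarrow> norm z < \<epsilon>"
proof -
  assume e: "0 < \<epsilon>"
  have "0 < 1 - (z \<bullet> z) / \<epsilon>\<^sup>2 \<longleftrightarrow> (norm z)\<^sup>2 < \<epsilon>\<^sup>2"
    using e by (simp add: power2_norm_eq_inner)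
  also have "\<dots> \<longleftrightarrow> norm z < \<epsilon>" 
    unfolding not_le[symmetric] using e by (subst power_mono_iff) auto
  finally show ?thesis by (simp add: bump_def flat_def)
qed

lemma bump_eq_0: "0 < \<epsilon> \<Longrightarrow> \<epsilon> \<le> norm z \<Longrightarrow> bump \<epsilon> z = 0"
  using bump_pos_iff[of \<epsilon> z] bump_nonneg[of \<epsilon> z] by linarith

lemma bump_scale: "0 < \<epsilon> \<Longrightarrow> bump \<epsilon> z = bump 1 (z /\<^sub>R \<epsilon>)"
  by (simp add: bump_def divide_inverse power2_eq_square mult_ac)

lemma flat_0_mono: "s \<le> t \<Longrightarrow> flat 0 s \<le> flat 0 t"
  by (auto simp: flat_def intro!: divide_left_mono)

lemma bump_antimono: "norm y \<le> norm x \<Longrightarrow> bump \<epsilon> x \<le> bump \<epsilon> y"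
  unfolding bump_def
  by (intro flat_0_mono diff_left_mono divide_right_mono) (auto simp: dot_square_norm power_mono)

lemma elem_smooth_sum:
  "finite I \<Longrightarrow> (\<And>i. i \<in> I \<Longrightarrow> elem_smooth (f i)) \<Longrightarrow> elem_smooth (\<lambda>x. \<Sum>i\<in>I. f i x)"
  by (induction I rule: finite_induct) (auto intro: elem_smooth.const elem_smooth.add)

lemma test_fun_bump:
  assumes "0 < \<epsilon>"
  shows "test_fun (\<lambda>z::'a::euclidean_space. c * bump \<epsilon> z)"
proof (rule test_fun_elem_smooth)
  have "elem_smooth (\<lambda>z::'a. 1 + (- 1 / \<epsilon>\<^sup>2) * (\<Sum>i\<in>Basis. (z \<bullet> i) * (z \<bullet> i)))"
    by (intro elem_smooth.add elem_smooth.mult elem_smooth.const elem_smooth_sum elem_smooth.inner) auto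
  then have "elem_smooth (\<lambda>z::'a. 1 - (z \<bullet> z) / \<epsilon>\<^sup>2)"
    by (rule back_subst[of elem_smooth]) (simp add: fun_eq_iff euclidean_inner[symmetric])
  then show "elem_smooth (\<lambda>z::'a. c * bump \<epsilon> z)"
    unfolding bump_def by (intro elem_smooth.intros)
  have "bump \<epsilon> z = 0" if "\<epsilon> \<le> norm z" for z :: 'a
    by (rule bump_eq_0[OF assms that])
  then have "{z::'a. c * bump \<epsilon> z \<noteq> 0} \<subseteq> ball 0 \<epsilon>"
    by (auto simp: not_le[symmetric])
  then show "bounded {z::'a. c * bump \<epsilon> z \<noteq> 0}" using bounded_ball bounded_subset by blast
qed

lemma bump_measurable [measurable]: "bump \<epsilon> \<in> borel_measurable borel"
  unfolding bump_def flat_def by measurable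

lemma bump_L2: "0 < \<epsilon> \<Longrightarrow> L2 (bump \<epsilon>)"
  using test_fun_L2(1)[OF test_fun_bump[of \<epsilon> 1]] by simp

text \<open>The divisor is the mass of \<open>bump 1\<close> for every \<open>\<epsilon>\<close>, so
  that \<open>ker \<epsilon>\<close> is a mere rescaling of \<open>ker 1\<close> without change of
  height. Its total mass is 1 only for \<open>\<epsilon> = 1\<close>.\<close>

definition ker :: "real \<Rightarrow> 'a::euclidean_space \<Rightarrow> real" where
  "ker \<epsilon> z = bump \<epsilon> z / (LINT h|lborel. bump 1 (h::'a))"

lemma bump_integral: 
  "integrable lborel (bump 1 :: 'a::euclidean_space \<Rightarrow> real)" "0 < (LINT h|lborel. bump 1 (h::'a))"
proof -
  show i: "integrable lborel (bump 1 :: 'a \<Rightarrow> real)"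
  proof -
    have "integrable lborel (\<lambda>x::'a. indicator (ball 0 1) x * bump 1 x)"
      using L2_integrable_sq[OF bump_L2[of 1]] by (intro integrable_sq_bounded_set) auto
    moreover have "indicator (ball 0 1) x * bump 1 x = bump 1 x" for x :: 'a
      using bump_eq_0[of 1 x] by (auto simp: indicator_def)
    ultimately show ?thesis by simp
  qed
  have "0 < (\<integral>\<^sup>+x. ennreal (bump 1 (x::'a)) \<partial>lborel)"
    by (rule nn_integral_pos_open[of _ "ball 0 1"]) (auto simp: bump_pos_iff)
  also have "\<dots> = ennreal (LINT h|lborel. bump 1 (h::'a))"
    by (intro nn_integral_eq_integral i) auto
  finally show "0 < (LINT h|lborel. bump 1 (h::'a))" by simp
qed

lemma ker_nonneg [simp]: "0 \<le> ker \<epsilon> z"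
  using bump_integral(2) by (simp add: ker_def less_imp_le)

lemma ker_measurable [measurable]: "ker \<epsilon> \<in> borel_measurable borel"
  unfolding ker_def by measurable

lemma ker_antimono: "norm (y::'a) \<le> norm (x::'a::euclidean_space) \<Longrightarrow> ker \<epsilon> x \<le> ker \<epsilon> y"
  unfolding ker_def using bump_integral(2)[where 'a='a]
  by (auto intro!: divide_right_mono bump_antimono simp: less_imp_le)

lemma ker_uminus [simp]: "ker \<epsilon> (- z) = ker \<epsilon> z"
  by (intro antisym ker_antimono) auto

lemma ker_pos_iff: "0 < \<epsilon> \<Longrightarrow> 0 < ker \<epsilon> (z::'a::euclidean_space) \<longleftrightarrow> norm z < \<epsilon>"
  using bump_integral(2)[where 'a='a] bump_pos_iff[of \<epsilon> z] by (simp add: ker_def zero_less_divide_iff)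

lemma ker_eq_0: "0 < \<epsilon> \<Longrightarrow> \<epsilon> \<le> norm z \<Longrightarrow> ker \<epsilon> z = 0"
  by (simp add: ker_def bump_eq_0)

lemma nn_integral_ker: "(\<integral>\<^sup>+z. ennreal (ker 1 (z::'a::euclidean_space)) \<partial>lborel) = 1"
proof -
  have "(LINT z|lborel. ker 1 (z::'a)) = 1"
    using bump_integral(2)[where 'a='a] by (simp add: ker_def)
  moreover have "integrable lborel (ker 1 :: 'a \<Rightarrow> real)"
    unfolding ker_def using bump_integral(1)[where 'a='a] by simp
  ultimately show ?thesis by (subst nn_integral_eq_integral) auto
qed

lemma test_fun_ker: "0 < \<epsilon> \<Longrightarrow> test_fun (\<lambda>z::'a::euclidean_space. c * ker \<epsilon> z)"
  using test_fun_bump[of \<epsilon> "c / (LINT h|lborel. bump 1 (h::'a))", where 'a='a] by (simp add: ker_def)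

lemma ker_L2: "0 < \<epsilon> \<Longrightarrow> L2 (ker \<epsilon>)"
  using test_fun_L2(1)[OF test_fun_ker[of \<epsilon> 1]] by simp

text \<open>Since \<open>ker 1\<close> is radial, the integral of \<open>ker 1 h * (g \<bullet> h)\<^sup>2\<close> over \<open>h\<close> is \<open>kappa * (norm g)\<^sup>2\<close>
  for every vector \<open>g\<close>; the choice of the basis vector does not matter.\<close>
definition kappa :: "'a::euclidean_space itself \<Rightarrow> real" where
  "kappa _ = (LINT h|lborel. ker 1 h * ((SOME b. b \<in> Basis) \<bullet> (h::'a))\<^sup>2)"

lemma ker_inner_finite: 
  fixes g :: "'a::euclidean_space"
  shows "(\<integral>\<^sup>+h. ennreal (ker 1 h * (g \<bullet> h)\<^sup>2) \<partial>lborel) \<le> ennreal ((norm g)\<^sup>2)"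
proof -
  have "ker 1 h * (g \<bullet> h)\<^sup>2 \<le> (norm g)\<^sup>2 * ker 1 h" for h
  proof (cases "norm h < 1")
    case True
    have "(g \<bullet> h)\<^sup>2 \<le> (norm g * norm h)\<^sup>2"
      using Cauchy_Schwarz_ineq2[of g h] by (intro power2_le_iff_abs_le[THEN iffD2]) auto
    also have "\<dots> \<le> (norm g * 1)\<^sup>2"
      using True by (intro power_mono mult_left_mono) auto
    finally show ?thesis by (simp add: mult.commute mult_left_mono)
  qed (simp add: ker_eq_0)
  then have "(\<integral>\<^sup>+h. ennreal (ker 1 h * (g \<bullet> h)\<^sup>2) \<partial>lborel) \<le> (\<integral>\<^sup>+h. ennreal ((norm g)\<^sup>2) * ennreal (ker 1 (h::'a)) \<partial>lborel)"
    by (intro nn_integral_mono) (simp flip: ennreal_mult)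
  also have "\<dots> = ennreal ((norm g)\<^sup>2)" by (simp add: nn_integral_cmult nn_integral_ker)
  finally show ?thesis .
qed

text \<open>By homogeneity \<open>g\<close> may be taken to be a unit vector, and a single
  reflection carries the chosen basis vector to it while preserving both \<open>ker 1\<close> and
  the measure.\<close>

lemma kappa_eq:
  fixes g :: "'a::euclidean_space"
  shows "(\<integral>\<^sup>+h. ennreal (ker 1 h * (g \<bullet> h)\<^sup>2) \<partial>lborel) = ennreal (kappa TYPE('a) * (norm g)\<^sup>2)"
proof (cases "g = 0")
  case False
  define b :: 'a where "b = (SOME b. b \<in> Basis)"
  have b: "norm b = 1" using some_in_eq[of "Basis::'a set"] nonempty_Basis unfolding b_def by auto
  define g1 where "g1 = g /\<^sub>R norm g"
  have g1: "norm g1 = 1" using False by (simp add: g1_def)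
  let ?F = "\<lambda>g. \<integral>\<^sup>+h. ennreal (ker 1 h * (g \<bullet> h)\<^sup>2) \<partial>lborel"
  have eq: "?F g1 = ?F b"
  proof (cases "g1 = b")
    case False
    \<comment> \<open>The unit normal of the hyperplane through the origin that exchanges the unit
      vectors \<open>g1\<close> and \<open>b\<close>.\<close>
    define e where "e = (g1 - b) /\<^sub>R norm (g1 - b)"
    have e: "norm e = 1" using False by (simp add: e_def)
    have n: "(norm (g1 - b))\<^sup>2 = 2 - 2 * (g1 \<bullet> b)"
      using g1 b by (simp add: power2_norm_eq_inner inner_diff_left inner_diff_right inner_commute norm_eq_1)
    have "(2 * (b \<bullet> e)) *\<^sub>R e = ((2 * (b \<bullet> (g1 - b))) / (norm (g1 - b))\<^sup>2) *\<^sub>R (g1 - b)"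
      by (simp add: e_def power2_eq_square divide_inverse)
    also have "2 * (b \<bullet> (g1 - b)) = - (norm (g1 - b))\<^sup>2"
      using b unfolding n by (simp add: inner_diff_right inner_commute norm_eq_1)
    finally have "hrefl e 0 b = g1"
      using False by (simp add: hrefl_def)
    then have i: "b \<bullet> hrefl e 0 h = g1 \<bullet> h" for h
      by (auto simp: hrefl_def inner_diff_left inner_diff_right inner_commute)
    have nh: "norm (hrefl e 0 h) = norm h" for h
      using norm_hrefl_hrefl[OF e, of 0 h 0] by (simp add: hrefl_def)
    then have "ker 1 (hrefl e 0 h) = ker 1 h" for h by (intro antisym ker_antimono) simp_all
    then have "?F g1 = (\<integral>\<^sup>+h. ennreal (ker 1 (hrefl e 0 h) * (b \<bullet> hrefl e 0 h)\<^sup>2) \<partial>lborel)"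
      by (simp add: i)
    also have "\<dots> = ?F b"
      by (rule nn_integral_hrefl[OF _ e, where f="\<lambda>h. ennreal (ker 1 h * (b \<bullet> h)\<^sup>2)"]) measurable
    finally show ?thesis .
  qed simp
  have "?F b < \<infinity>" using ker_inner_finite[of b] b by (auto simp: le_less_trans)
  then have fb: "?F b = ennreal (kappa TYPE('a))"
    unfolding kappa_def b_def[symmetric] by (intro nn_integral_eq_integral integrableI_bounded) auto
  have k0: "0 \<le> kappa TYPE('a)" unfolding kappa_def by (intro Bochner_Integration.integral_nonneg) simp
  have "?F g = (\<integral>\<^sup>+h. ennreal ((norm g)\<^sup>2) * ennreal (ker 1 h * (g1 \<bullet> h)\<^sup>2) \<partial>lborel)"
    using False by (intro nn_integral_cong) (simp add: g1_def power_mult_distrib flip: ennreal_mult, simp add: field_simps)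
  also have "\<dots> = ennreal ((norm g)\<^sup>2) * ?F g1" by (simp add: nn_integral_cmult)
  also have "\<dots> = ennreal (kappa TYPE('a) * (norm g)\<^sup>2)"
    unfolding eq fb using k0 by (simp add: mult.commute flip: ennreal_mult)
  finally show ?thesis .
qed simp

lemma kappa_pos: "0 < kappa TYPE('a::euclidean_space)"
proof -
  define b :: 'a where "b = (SOME b. b \<in> Basis)"
  have b: "b \<in> Basis" using some_in_eq[of "Basis::'a set"] nonempty_Basis unfolding b_def by auto
  have "0 < (\<integral>\<^sup>+h. ennreal (ker 1 h * (b \<bullet> h)\<^sup>2) \<partial>lborel)"
  proof (rule nn_integral_pos_open[of _ "ball 0 1 \<inter> {h. 0 < b \<bullet> h}"])
    show "open (ball 0 1 \<inter> {h. 0 < b \<bullet> h})" by (intro open_Int open_halfspace_gt) auto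
    have "(1/2) *\<^sub>R b \<in> ball 0 1 \<inter> {h. 0 < b \<bullet> h}" using b by (simp add: norm_Basis)
    then show "ball 0 1 \<inter> {h. 0 < b \<bullet> h} \<noteq> {}" by blast
  qed (auto simp: ker_pos_iff)
  then show ?thesis unfolding kappa_eq using b by simp
qed

text \<open>Since \<open>ker 1\<close> lives on the unit ball, \<open>s\<close> is the largest
  displacement that is seen. The weight is radial and decreasing, as the rearrangement inequality
  requires, and has mass 1.\<close>

definition dq_energy :: "real \<Rightarrow> ('a::euclidean_space \<Rightarrow> real) \<Rightarrow> ennreal" where
  "dq_energy s u = (\<integral>\<^sup>+h. \<integral>\<^sup>+x. ennreal (ker 1 h * ((u (x + s *\<^sub>R h) - u x) / s)\<^sup>2) \<partial>lborel \<partial>lborel)"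

text \<open>This equals \<open>kappa\<close> times the squared norm of the weak gradient. In contrast to the latter it is defined for every
  Borel function, it is lower semicontinuous, and it decreases under polarization because each \<open>dq_energy\<close>
  is a double integral against a radially decreasing kernel.\<close>
definition dirichlet :: "('a::euclidean_space \<Rightarrow> real) \<Rightarrow> ennreal" where
  "dirichlet u = (SUP s\<in>{0<..}. dq_energy s u)"

lemma dq_le_dirichlet: "0 < s \<Longrightarrow> dq_energy s u \<le> dirichlet u"
  unfolding dirichlet_def by (rule SUP_upper) simp

lemma dq_energy_le_sq_norm:
  fixes u :: "'a::euclidean_space \<Rightarrow> real"
  assumes w: "has_wgrad u G" and s: "0 < s"
  shows "dq_energy s u \<le> ennreal (kappa TYPE('a)) * sq_norm G"
proof -
  have [measurable]: "u \<in> borel_measurable borel" "G \<in> borel_measurable borel"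
    using w by (auto simp: has_wgrad_def L2_def)
  have "dq_energy s u \<le> (\<integral>\<^sup>+h. \<integral>\<^sup>+x. ennreal (ker 1 h * (G x \<bullet> h)\<^sup>2) \<partial>lborel \<partial>lborel)"
    unfolding dq_energy_def
  proof (rule nn_integral_mono)
    fix h :: 'a
    have "(\<integral>\<^sup>+x. ennreal (ker 1 h * ((u (x + s *\<^sub>R h) - u x) / s)\<^sup>2) \<partial>lborel)
      = ennreal (ker 1 h / s\<^sup>2) * (\<integral>\<^sup>+x. ennreal ((u (x + s *\<^sub>R h) - u x)\<^sup>2) \<partial>lborel)"
      by (subst nn_integral_cmult[symmetric]) (auto simp: power_divide simp flip: ennreal_mult)
    also have "\<dots> \<le> ennreal (ker 1 h / s\<^sup>2) * (\<integral>\<^sup>+x. ennreal ((G x \<bullet> (s *\<^sub>R h))\<^sup>2) \<partial>lborel)"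
      by (intro mult_left_mono has_wgrad_translation[OF w]) simp
    also have "\<dots> = (\<integral>\<^sup>+x. ennreal (ker 1 h * (G x \<bullet> h)\<^sup>2) \<partial>lborel)"
      using s by (subst nn_integral_cmult[symmetric]) (auto simp: power_mult_distrib simp flip: ennreal_mult)
    finally show "(\<integral>\<^sup>+x. ennreal (ker 1 h * ((u (x + s *\<^sub>R h) - u x) / s)\<^sup>2) \<partial>lborel)
      \<le> (\<integral>\<^sup>+x. ennreal (ker 1 h * (G x \<bullet> h)\<^sup>2) \<partial>lborel)" .
  qed
  also have "\<dots> = (\<integral>\<^sup>+x. \<integral>\<^sup>+h. ennreal (ker 1 h * (G x \<bullet> h)\<^sup>2) \<partial>lborel \<partial>lborel)"
    by (rule lborel_pair.Fubini') measurable
  also have "\<dots> = ennreal (kappa TYPE('a)) * sq_norm G"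
    unfolding kappa_eq sq_norm_def using kappa_pos[where 'a='a]
    by (subst nn_integral_cmult[symmetric]) (auto simp: ennreal_mult)
  finally show ?thesis .
qed

lemma dirichlet_le_sq_norm:
  fixes u :: "'a::euclidean_space \<Rightarrow> real"
  shows "has_wgrad u G \<Longrightarrow> dirichlet u \<le> ennreal (kappa TYPE('a)) * sq_norm G"
  unfolding dirichlet_def by (intro SUP_least dq_energy_le_sq_norm) auto

lemma young_sq: 
  fixes a b :: real
  assumes "0 < \<delta>"
  shows "(a + b)\<^sup>2 \<le> (1 + \<delta>) * a\<^sup>2 + (1 + 1 / \<delta>) * b\<^sup>2"
proof -
  have "0 \<le> (\<delta> * a - b)\<^sup>2 / \<delta>" using assms by simp
  also have "\<dots> = \<delta> * a\<^sup>2 - 2 * a * b + b\<^sup>2 / \<delta>"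
    using assms by (simp add: power2_eq_square field_simps)
  finally show ?thesis by (simp add: power2_sum algebra_simps)
qed

text \<open>The error \<open>d\<close> is a function of two points so that one statement serves for
  a perturbation, for the product with a cutoff function and for a sum. The parameter
  \<open>\<delta>\<close> of Young's inequality keeps the factor of the main term arbitrarily close
  to 1.\<close>

lemma dq_energy_split:
  fixes f g :: "'a::euclidean_space \<Rightarrow> real"
  assumes [measurable]: "f \<in> borel_measurable borel" "g \<in> borel_measurable borel" 
    and \<delta>: "0 < \<delta>" and s: "0 < s" 
    and bd: "\<And>x y. \<bar>f x - f y\<bar> \<le> \<bar>g x - g y\<bar> + \<bar>d x y\<bar>"
    and [measurable]: "case_prod d \<in> borel_measurable (borel \<Otimes>\<^sub>M borel)"
  shows "dq_energy s f \<le> ennreal (1 + \<delta>) * dq_energy s g + 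
     ennreal (1 + 1 / \<delta>) * (\<integral>\<^sup>+h. \<integral>\<^sup>+x. ennreal (ker 1 h * (d (x + s *\<^sub>R h) x / s)\<^sup>2) \<partial>lborel \<partial>lborel)"
proof -
  let ?a = "\<lambda>h x. ennreal (ker 1 h * ((g (x + s *\<^sub>R h) - g x) / s)\<^sup>2)"
  let ?b = "\<lambda>h x. ennreal (ker 1 h * (d (x + s *\<^sub>R h) x / s)\<^sup>2)"
  have "dq_energy s f \<le> (\<integral>\<^sup>+h. \<integral>\<^sup>+x. ennreal (1 + \<delta>) * ?a h x + ennreal (1 + 1 / \<delta>) * ?b h x \<partial>lborel \<partial>lborel)"
    unfolding dq_energy_def
  proof (intro nn_integral_mono)
    fix h x :: 'a
    define G where "G = \<bar>g (x + s *\<^sub>R h) - g x\<bar> / s"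
    define D where "D = \<bar>d (x + s *\<^sub>R h) x\<bar> / s"
    have "\<bar>(f (x + s *\<^sub>R h) - f x) / s\<bar> \<le> G + D"
      using bd[of "x + s *\<^sub>R h" x] s unfolding G_def D_def
      by (simp add: add_divide_distrib[symmetric] divide_right_mono)
    then have "((f (x + s *\<^sub>R h) - f x) / s)\<^sup>2 \<le> (G + D)\<^sup>2"
      unfolding abs_le_square_iff[symmetric] by (rule order_trans[OF _ abs_ge_self])
    also have "\<dots> \<le> (1 + \<delta>) * G\<^sup>2 + (1 + 1 / \<delta>) * D\<^sup>2" by (rule young_sq[OF \<delta>])
    finally have "ker 1 h * ((f (x + s *\<^sub>R h) - f x) / s)\<^sup>2 \<le> ker 1 h * ((1 + \<delta>) * G\<^sup>2 + (1 + 1 / \<delta>) * D\<^sup>2)"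
      by (intro mult_left_mono) auto
    also have "\<dots> = (1 + \<delta>) * (ker 1 h * ((g (x + s *\<^sub>R h) - g x) / s)\<^sup>2) + (1 + 1 / \<delta>) * (ker 1 h * (d (x + s *\<^sub>R h) x / s)\<^sup>2)"
      unfolding G_def D_def by (simp add: power_divide algebra_simps)
    finally show "ennreal (ker 1 h * ((f (x + s *\<^sub>R h) - f x) / s)\<^sup>2)
      \<le> ennreal (1 + \<delta>) * ?a h x + ennreal (1 + 1 / \<delta>) * ?b h x"
      using \<delta> by (simp flip: ennreal_mult ennreal_plus)
  qed
  also have "\<dots> = ennreal (1 + \<delta>) * dq_energy s g + ennreal (1 + 1 / \<delta>) * (\<integral>\<^sup>+h. \<integral>\<^sup>+x. ?b h x \<partial>lborel \<partial>lborel)"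
    unfolding dq_energy_def by (simp add: nn_integral_add nn_integral_cmult)
  finally show ?thesis .
qed

text \<open>At a fixed scale the energy is continuous with respect to the L2 norm, at the price of a
  constant that blows up as the scale tends to 0.\<close>

lemma dq_energy_perturb:
  fixes f g :: "'a::euclidean_space \<Rightarrow> real"
  assumes [measurable]: "f \<in> borel_measurable borel" "g \<in> borel_measurable borel" 
    and \<delta>: "0 < \<delta>" and s: "0 < s" 
  shows "dq_energy s f \<le> ennreal (1 + \<delta>) * dq_energy s g + 
     ennreal (1 + 1 / \<delta>) * (ennreal (4 / s\<^sup>2) * sq_norm (\<lambda>x. f x - g x))"
proof -
  define d where "d x = f x - g x" for x
  have [measurable]: "d \<in> borel_measurable borel" unfolding d_def by measurable
  have 1: "dq_energy s f \<le> ennreal (1 + \<delta>) * dq_energy s g + 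
     ennreal (1 + 1 / \<delta>) * (\<integral>\<^sup>+h. \<integral>\<^sup>+x. ennreal (ker 1 h * ((d (x + s *\<^sub>R h) - d x) / s)\<^sup>2) \<partial>lborel \<partial>lborel)"
    by (rule dq_energy_split[OF _ _ \<delta> s]) (auto simp: d_def)
  have "(\<integral>\<^sup>+h. \<integral>\<^sup>+x. ennreal (ker 1 h * ((d (x + s *\<^sub>R h) - d x) / s)\<^sup>2) \<partial>lborel \<partial>lborel) 
    \<le> (\<integral>\<^sup>+h. ennreal (ker 1 (h::'a)) * (ennreal (4 / s\<^sup>2) * sq_norm d) \<partial>lborel)"
  proof (rule nn_integral_mono)
    fix h :: 'a
    have "(\<integral>\<^sup>+x. ennreal (ker 1 h * ((d (x + s *\<^sub>R h) - d x) / s)\<^sup>2) \<partial>lborel)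
      \<le> (\<integral>\<^sup>+x. ennreal (ker 1 h * (2 / s\<^sup>2)) * (ennreal ((norm (d (x + s *\<^sub>R h)))\<^sup>2) + ennreal ((norm (d x))\<^sup>2)) \<partial>lborel)"
    proof (rule nn_integral_mono)
      fix x
      have "(d (x + s *\<^sub>R h) - d x)\<^sup>2 \<le> 2 * (d (x + s *\<^sub>R h))\<^sup>2 + 2 * (d x)\<^sup>2"
        using norm_add_sq_le[of "d (x + s *\<^sub>R h)" "- d x"] by simp
      then have "ker 1 h * ((d (x + s *\<^sub>R h) - d x) / s)\<^sup>2 \<le> ker 1 h * ((2 * (d (x + s *\<^sub>R h))\<^sup>2 + 2 * (d x)\<^sup>2) / s\<^sup>2)"
        unfolding power_divide by (intro mult_left_mono divide_right_mono) auto
      then show "ennreal (ker 1 h * ((d (x + s *\<^sub>R h) - d x) / s)\<^sup>2) 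
        \<le> ennreal (ker 1 h * (2 / s\<^sup>2)) * (ennreal ((norm (d (x + s *\<^sub>R h)))\<^sup>2) + ennreal ((norm (d x))\<^sup>2))"
        by (simp add: algebra_simps add_divide_distrib flip: ennreal_mult ennreal_plus)
    qed
    also have "\<dots> = ennreal (ker 1 h * (2 / s\<^sup>2)) * (sq_norm (\<lambda>x. d (x + s *\<^sub>R h)) + sq_norm d)"
      unfolding sq_norm_def by (subst nn_integral_cmult) (auto simp: nn_integral_add)
    also have "sq_norm (\<lambda>x. d (x + s *\<^sub>R h)) = sq_norm d" by (rule sq_norm_shift) measurable
    also have "sq_norm d + sq_norm d = ennreal 2 * sq_norm d" by (simp add: mult_2)
    also have "ennreal (ker 1 h * (2 / s\<^sup>2)) * (ennreal 2 * sq_norm d) = ennreal (ker 1 h) * (ennreal (4 / s\<^sup>2) * sq_norm d)"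
    proof -
      have "ennreal (ker 1 h * (2 / s\<^sup>2)) * ennreal 2 = ennreal (ker 1 h) * ennreal (4 / s\<^sup>2)"
        by (subst (1 2) ennreal_mult[symmetric]) auto
      then show ?thesis by (simp only: mult.assoc[symmetric])
    qed
    finally show "(\<integral>\<^sup>+x. ennreal (ker 1 h * ((d (x + s *\<^sub>R h) - d x) / s)\<^sup>2) \<partial>lborel)
       \<le> ennreal (ker 1 h) * (ennreal (4 / s\<^sup>2) * sq_norm d)" .
  qed
  also have "\<dots> = ennreal (4 / s\<^sup>2) * sq_norm d"
    by (simp add: nn_integral_multc nn_integral_ker)
  finally have 2: "(\<integral>\<^sup>+h. \<integral>\<^sup>+x. ennreal (ker 1 h * ((d (x + s *\<^sub>R h) - d x) / s)\<^sup>2) \<partial>lborel \<partial>lborel)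
    \<le> ennreal (4 / s\<^sup>2) * sq_norm d" .
  show ?thesis
    unfolding d_def[symmetric] by (rule order_trans[OF 1 add_left_mono[OF mult_left_mono[OF 2]]]) simp
qed

lemma dq_energy_Fatou:
  fixes f :: "'a::euclidean_space \<Rightarrow> real"
  assumes [measurable]: "f \<in> borel_measurable borel" "\<And>n. F n \<in> borel_measurable borel"
    and lim: "AE x in lborel. (\<lambda>n. F n x) \<longlonglongrightarrow> f x"
  shows "dq_energy s f \<le> liminf (\<lambda>n. dq_energy s (F n))"
proof -
  let ?E = "\<lambda>f h x. ennreal (ker 1 h * ((f (x + s *\<^sub>R h) - f x) / s)\<^sup>2)"
  have "dq_energy s f = (\<integral>\<^sup>+h. \<integral>\<^sup>+x. liminf (\<lambda>n. ?E (F n) h x) \<partial>lborel \<partial>lborel)"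
    unfolding dq_energy_def
  proof (rule nn_integral_cong, rule nn_integral_cong_AE)
    fix h :: 'a
    show "AE x in lborel. ?E f h x = liminf (\<lambda>n. ?E (F n) h x)"
      using lim AE_lborel_shift[OF lim, of "s *\<^sub>R h"]
    proof eventually_elim
      case (elim x)
      have "(\<lambda>n. ?E (F n) h x) \<longlonglongrightarrow> ?E f h x"
        by (cases "s = 0") (auto intro!: tendsto_intros tendsto_ennrealI elim)
      then show ?case by (rule lim_imp_Liminf[OF sequentially_bot, symmetric])
    qed
  qed
  also have "\<dots> \<le> (\<integral>\<^sup>+h. liminf (\<lambda>n. \<integral>\<^sup>+x. ?E (F n) h x \<partial>lborel) \<partial>lborel)"
    by (intro nn_integral_mono nn_integral_liminf) measurable
  also have "\<dots> \<le> liminf (\<lambda>n. \<integral>\<^sup>+h. \<integral>\<^sup>+x. ?E (F n) h x \<partial>lborel \<partial>lborel)"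
    by (intro nn_integral_liminf) measurable
  finally show ?thesis unfolding dq_energy_def .
qed

lemma integral_lborel_affine:
  fixes f :: "'a::euclidean_space \<Rightarrow> real"
  assumes [measurable]: "f \<in> borel_measurable borel" and c: "c \<noteq> 0"
  shows "(LINT x|lborel. f x) = \<bar>c\<bar> ^ DIM('a) * (LINT x|lborel. f (t + c *\<^sub>R x))"
  by (subst lborel_affine[OF c, of t]) (simp add: integral_density integral_distr)

section \<open>Polarization decreases the difference quotient energy\<close>

lemma polar_pair:
  assumes e: "norm e = 1"
  shows "t \<le> x \<bullet> e \<Longrightarrow> polar e t f x = max (f x) (f (hrefl e t x)) \<and> polar e t f (hrefl e t x) = min (f x) (f (hrefl e t x))"
    and "x \<bullet> e < t \<Longrightarrow> polar e t f x = min (f x) (f (hrefl e t x)) \<and> polar e t f (hrefl e t x) = max (f x) (f (hrefl e t x))"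
proof -
  assume le: "t \<le> x \<bullet> e"
  show "polar e t f x = max (f x) (f (hrefl e t x)) \<and> polar e t f (hrefl e t x) = min (f x) (f (hrefl e t x))"
  proof (cases "x \<bullet> e = t")
    case True
    then have "hrefl e t x = x" by (simp add: hrefl_def)
    then show ?thesis using True by (simp add: polar_def)
  next
    case False
    then show ?thesis using le e by (simp add: polar_def hrefl_inner min.commute)
  qed
next
  assume "x \<bullet> e < t"
  then show "polar e t f x = min (f x) (f (hrefl e t x)) \<and> polar e t f (hrefl e t x) = max (f x) (f (hrefl e t x))"
    using e by (simp add: polar_def hrefl_inner max.commute)
qed

lemma norm_hrefl_le:
  assumes e: "norm e = 1"
  shows "0 \<le> (x \<bullet> e - t) * (y \<bullet> e - t) \<Longrightarrow> norm (x - y) \<le> norm (x - hrefl e t y)"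
    and "(x \<bullet> e - t) * (y \<bullet> e - t) \<le> 0 \<Longrightarrow> norm (x - hrefl e t y) \<le> norm (x - y)"
proof -
  note * = norm_hrefl_diff_sq[OF e, where x=x and t=t and y=y, unfolded mult.assoc]
  show "norm (x - y) \<le> norm (x - hrefl e t y)" if "0 \<le> (x \<bullet> e - t) * (y \<bullet> e - t)"
    by (rule power2_le_imp_le) (use * that in simp_all)
  show "norm (x - hrefl e t y) \<le> norm (x - y)" if "(x \<bullet> e - t) * (y \<bullet> e - t) \<le> 0"
    by (rule power2_le_imp_le) (use * that in simp_all)
qed

text \<open>Two points on the same side are closer to each other than to the reflected partner, so
  the larger weight falls on the pair that polarization fills with both maxima. Points on opposite
  sides reduce to this case after exchanging \<open>y\<close> with its reflection. The weight is
  compared only at the given orbit, which leaves room for junk values elsewhere.\<close>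

lemma polar_four_sum:
  fixes k :: "'a::euclidean_space \<Rightarrow> 'a \<Rightarrow> real"
  assumes e: "norm e = 1"
    and sm: "\<And>a b c d. b \<le> a \<Longrightarrow> d \<le> c \<Longrightarrow> \<Psi> a d + \<Psi> b c \<le> \<Psi> a c + \<Psi> b d"
    and k1: "norm (x - y) \<le> norm (x - hrefl e t y) \<Longrightarrow> k x (hrefl e t y) \<le> k x y"
    and k2: "norm (x - hrefl e t y) \<le> norm (x - y) \<Longrightarrow> k x y \<le> k x (hrefl e t y)"
    and k3: "k (hrefl e t x) (hrefl e t y) = k x y" "k (hrefl e t x) y = k x (hrefl e t y)"
  shows "four_sum (hrefl e t) (\<lambda>x y. k x y * \<Psi> (u x) (u y)) x y
    \<le> four_sum (hrefl e t) (\<lambda>x y. k x y * \<Psi> (polar e t u x) (polar e t u y)) x y"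
proof -
  let ?s = "hrefl e t"
  note pp = polar_pair[OF e, where t=t and f=u]
  have L: "four_sum ?s (\<lambda>x y. k x y * \<Psi> (f x) (f y)) x y
    = k x y * (\<Psi> (f x) (f y) + \<Psi> (f (?s x)) (f (?s y))) + k x (?s y) * (\<Psi> (f x) (f (?s y)) + \<Psi> (f (?s x)) (f y))" for f
    unfolding four_sum_def k3 by (simp add: algebra_simps)
  consider "t \<le> x \<bullet> e" "t \<le> y \<bullet> e" | "x \<bullet> e < t" "y \<bullet> e < t" | "t \<le> x \<bullet> e" "y \<bullet> e < t" | "x \<bullet> e < t" "t \<le> y \<bullet> e"
    by linarith
  then show ?thesis
  proof cases
    case 1
    then have "k x (?s y) \<le> k x y" by (intro k1 norm_hrefl_le(1)[OF e]) simp
    from supermodular_four_sum[where \<Psi>=\<Psi> and a="u x" and c="u y" and b="u (?s x)" and d="u (?s y)", OF sm this]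
    show ?thesis unfolding L using pp(1)[OF 1(1)] pp(1)[OF 1(2)] by simp
  next
    case 2
    then have "k x (?s y) \<le> k x y" by (intro k1 norm_hrefl_le(1)[OF e]) (simp add: mult_nonpos_nonpos)
    from supermodular_four_sum[where \<Psi>=\<Psi> and a="u x" and c="u y" and b="u (?s x)" and d="u (?s y)", OF sm this]
    show ?thesis unfolding L using pp(2)[OF 2(1)] pp(2)[OF 2(2)] by (simp add: add.commute)
  next
    case 3
    then have "k x y \<le> k x (?s y)" by (intro k2 norm_hrefl_le(2)[OF e]) (simp add: mult_nonneg_nonpos)
    from supermodular_four_sum[where \<Psi>=\<Psi> and a="u x" and c="u (?s y)" and b="u (?s x)" and d="u y", OF sm this]
    show ?thesis unfolding L using pp(1)[OF 3(1)] pp(2)[OF 3(2)] by (simp add: add.commute max.commute min.commute)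
  next
    case 4
    then have "k x y \<le> k x (?s y)" by (intro k2 norm_hrefl_le(2)[OF e]) (simp add: mult_nonpos_nonneg)
    from supermodular_four_sum[where \<Psi>=\<Psi> and a="u x" and c="u (?s y)" and b="u (?s x)" and d="u y", OF sm this]
    show ?thesis unfolding L using pp(2)[OF 4(1)] pp(1)[OF 4(2)] by (simp add: add.commute max.commute min.commute)
  qed
qed

lemma four_sum_ennreal:
  "(\<And>x y. 0 \<le> F x y) \<Longrightarrow> four_sum \<sigma> (\<lambda>x y. ennreal (F x y)) x y = ennreal (four_sum \<sigma> F x y)"
  unfolding four_sum_def by (simp add: ennreal_plus)

text \<open>The substitution \<open>y = x + s *\<^sub>R h\<close> yields a double integral against a
  radially decreasing kernel in \<open>y - x\<close>, the form in which the four point inequality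
  applies.\<close>

lemma dq_energy_kernel:
  fixes u :: "'a::euclidean_space \<Rightarrow> real"
  assumes [measurable]: "u \<in> borel_measurable borel" and s: "0 < s"
  shows "dq_energy s u = (\<integral>\<^sup>+x. \<integral>\<^sup>+y. ennreal (ker 1 ((y - x) /\<^sub>R s) / (s\<^sup>2 * s ^ DIM('a)) * (u y - u x)\<^sup>2) \<partial>lborel \<partial>lborel)"
proof -
  let ?k = "\<lambda>x y. ker 1 ((y - x) /\<^sub>R s) / (s\<^sup>2 * s ^ DIM('a)) * (u y - u x)\<^sup>2"
  have "dq_energy s u = (\<integral>\<^sup>+x. \<integral>\<^sup>+h. ennreal (ker 1 h * ((u (x + s *\<^sub>R h) - u x) / s)\<^sup>2) \<partial>lborel \<partial>lborel)"
    unfolding dq_energy_def by (rule lborel_pair.Fubini') measurable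
  also have "\<dots> = (\<integral>\<^sup>+x. \<integral>\<^sup>+y. ennreal (?k x y) \<partial>lborel \<partial>lborel)"
  proof (rule nn_integral_cong)
    fix x :: 'a
    have "(\<integral>\<^sup>+y. ennreal (?k x y) \<partial>lborel) = ennreal (s ^ DIM('a)) * (\<integral>\<^sup>+h. ennreal (?k x (x + s *\<^sub>R h)) \<partial>lborel)"
      using nn_integral_lborel_affine[of "\<lambda>y. ennreal (?k x y)" s x] s by simp
    also have "\<dots> = (\<integral>\<^sup>+h. ennreal (s ^ DIM('a)) * ennreal (?k x (x + s *\<^sub>R h)) \<partial>lborel)"
      by (rule nn_integral_cmult[symmetric]) measurable
    also have "\<dots> = (\<integral>\<^sup>+h. ennreal (ker 1 h * ((u (x + s *\<^sub>R h) - u x) / s)\<^sup>2) \<partial>lborel)"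
      using s by (intro nn_integral_cong) (simp add: power_divide flip: ennreal_mult)
    finally show "(\<integral>\<^sup>+h. ennreal (ker 1 h * ((u (x + s *\<^sub>R h) - u x) / s)\<^sup>2) \<partial>lborel) = (\<integral>\<^sup>+y. ennreal (?k x y) \<partial>lborel)"
      by simp
  qed
  finally show ?thesis .
qed

lemma dq_energy_polar:
  fixes u :: "'a::euclidean_space \<Rightarrow> real"
  assumes [measurable]: "u \<in> borel_measurable borel" and s: "0 < s" and e: "norm e = 1"
  shows "dq_energy s (polar e t u) \<le> dq_energy s u"
proof -
  let ?k = "\<lambda>x y::'a. ker 1 ((y - x) /\<^sub>R s) / (s\<^sup>2 * s ^ DIM('a))"
  let ?F = "\<lambda>f x y. ?k x y * (f y - f x)\<^sup>2"
  have mono: "?k x y \<le> ?k x' y'" if "norm (x' - y') \<le> norm (x - y)" for x y x' y'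
    using that s by (intro divide_right_mono ker_antimono) (auto simp: norm_minus_commute intro!: divide_right_mono)
  have eq: "?k x y = ?k x' y'" if "norm (x' - y') = norm (x - y)" for x y x' y'
    using that by (intro antisym mono) auto
  have "four_sum (hrefl e t) (?F (polar e t u)) x y \<le> four_sum (hrefl e t) (?F u) x y" for x y
  proof -
    have "four_sum (hrefl e t) (\<lambda>x y. ?k x y * (- (u y - u x)\<^sup>2)) x y
      \<le> four_sum (hrefl e t) (\<lambda>x y. ?k x y * (- (polar e t u y - polar e t u x)\<^sup>2)) x y"
    \<comment> \<open>Minus the squared difference is supermodular: the defect is
      \<open>2 * (a - b) * (c - d)\<close>. The sign reverses the inequality, so the energy
      decreases where a product would increase.\<close>
    proof (rule polar_four_sum[OF e, where \<Psi>="\<lambda>a b. - (b - a)\<^sup>2"])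
      fix a b c d :: real assume "b \<le> a" "d \<le> c"
      then have "0 \<le> (a - b) * (c - d)" by simp
      then show "- (d - a)\<^sup>2 + - (c - b)\<^sup>2 \<le> - (c - a)\<^sup>2 + - (d - b)\<^sup>2"
        by (simp add: power2_eq_square algebra_simps)
    next
      show "?k (hrefl e t x) (hrefl e t y) = ?k x y"
        by (rule eq) (simp add: norm_hrefl_hrefl[OF e])
      show "?k (hrefl e t x) y = ?k x (hrefl e t y)"
        by (rule eq) (simp add: norm_hrefl_commute[OF e])
    qed (auto intro!: mono)
    then show ?thesis by (simp add: four_sum_def algebra_simps)
  qed
  then have "4 * (\<integral>\<^sup>+x. \<integral>\<^sup>+y. ennreal (?F (polar e t u) x y) \<partial>lborel \<partial>lborel) + (\<integral>\<^sup>+(x::'a). \<integral>\<^sup>+(y::'a). 0 \<partial>lborel \<partial>lborel)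
    \<le> 4 * (\<integral>\<^sup>+x. \<integral>\<^sup>+y. ennreal (?F u x y) \<partial>lborel \<partial>lborel)"
    using s by (intro nn_integral_four_sum_mono[OF _ _ _ e]) (auto simp: four_sum_ennreal intro!: ennreal_leI)
  then show ?thesis
    unfolding dq_energy_kernel[OF assms(1) s] dq_energy_kernel[OF polar_measurable[OF assms(1)] s]
    by (simp add: ennreal_mult_le_mult_iff)
qed

lemma dirichlet_polar:
  fixes u :: "'a::euclidean_space \<Rightarrow> real"
  assumes "u \<in> borel_measurable borel" "norm e = 1"
  shows "dirichlet (polar e t u) \<le> dirichlet u"
  unfolding dirichlet_def using assms by (intro SUP_mono) (auto intro: dq_energy_polar)

section \<open>Weak gradients from pointwise difference quotients\<close>

lemma directional_limit:
  assumes "(f has_derivative (\<lambda>h. g \<bullet> h)) (at x)"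
  shows "(\<lambda>n. real (Suc n) * (f (x + w /\<^sub>R real (Suc n)) - f x)) \<longlonglongrightarrow> g \<bullet> w"
proof -
  have "((\<lambda>t. f (x + t *\<^sub>R w)) has_derivative (\<lambda>t. g \<bullet> (t *\<^sub>R w))) (at 0)"
    using assms by (intro has_derivative_compose[of "\<lambda>t. x + t *\<^sub>R w" _ 0 UNIV f]) (auto intro!: derivative_eq_intros)
  moreover have "(\<lambda>t. g \<bullet> (t *\<^sub>R w)) = times (g \<bullet> w)" by (simp add: fun_eq_iff)
  ultimately have "((\<lambda>t. f (x + t *\<^sub>R w)) has_real_derivative (g \<bullet> w)) (at 0)"
    by (simp add: has_field_derivative_def)
  then have "((\<lambda>t. (f (x + t *\<^sub>R w) - f x) / t) \<longlongrightarrow> g \<bullet> w) (at 0)"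
    by (simp add: DERIV_def)
  moreover have "filterlim (\<lambda>n. inverse (real (Suc n))) (at 0) sequentially"
    by (rule filterlim_atI[OF LIMSEQ_inverse_real_of_nat]) auto
  ultimately have "(\<lambda>n. (f (x + inverse (real (Suc n)) *\<^sub>R w) - f x) / inverse (real (Suc n))) \<longlonglongrightarrow> g \<bullet> w"
    by (rule filterlim_compose)
  then show ?thesis by (simp add: divide_inverse mult.commute)
qed

lemma L2_indicator_cball: "L2 (indicator (cball 0 R) :: 'a::euclidean_space \<Rightarrow> real)"
  by (rule L2_compact_support[where B=1 and R=R]) (auto intro!: borel_measurable_indicator)

text \<open>Integration by parts holds exactly for difference quotients, and both sides pass to the
  limit: the Lipschitz bound of \<open>v\<close> dominates one side and that of the test function
  the other, each on a fixed ball.\<close>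

lemma has_wgradI_difference:
  fixes v :: "'a::euclidean_space \<Rightarrow> real"
  assumes Lv: "L2 v" and Lg: "L2 g"
    and lim: "\<And>x w. (\<lambda>n. real (Suc n) * (v (x + w /\<^sub>R real (Suc n)) - v x)) \<longlonglongrightarrow> g x \<bullet> w"
    and lip: "\<And>x y. \<bar>v x - v y\<bar> \<le> C * norm (x - y)"
  shows "has_wgrad v g"
  unfolding has_wgrad_def
proof (intro conjI allI impI Lv Lg)
  fix \<phi> :: "'a \<Rightarrow> real" and w :: 'a assume \<phi>: "test_fun \<phi>"
  have [measurable]: "v \<in> borel_measurable borel" "g \<in> borel_measurable borel" using Lv Lg by (auto simp: L2_def)
  note [measurable] = test_fun_measurable[OF \<phi>]
  note L\<phi> = test_fun_L2[OF \<phi>]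
  from test_fun_bounds[OF \<phi>] obtain B R where B: "0 < B" "0 < R" "\<And>x. \<bar>\<phi> x\<bar> \<le> B" "\<And>x. norm (grad \<phi> x) \<le> B"
    "\<And>x. R < norm x \<Longrightarrow> \<phi> x = 0" "\<And>x. R < norm x \<Longrightarrow> grad \<phi> x = 0"
    "\<And>x y. \<bar>\<phi> x - \<phi> y\<bar> \<le> B * norm (x - y)" by metis
  define c where "c n = w /\<^sub>R real (Suc n)" for n
  have nc: "real (Suc n) * norm (c n) = norm w" for n unfolding c_def by simp
  have nc1: "norm (c n) \<le> norm w" for n
  proof -
    have "1 * norm (c n) \<le> real (Suc n) * norm (c n)" by (rule mult_right_mono) auto
    then show ?thesis using nc[of n] by simp
  qed
  let ?A = "\<lambda>n. LINT x|lborel. real (Suc n) * (v (x + c n) - v x) * \<phi> x"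
  \<comment> \<open>Discrete integration by parts: a translation moves the increment from
    \<open>v\<close> to \<open>\<phi>\<close> with the opposite shift.\<close>
  have A: "?A n = (LINT x|lborel. v x * (real (Suc n) * (\<phi> (x - c n) - \<phi> x)))" for n
  proof -
    have "?A n = real (Suc n) * (LINT x|lborel. v (x + c n) * \<phi> x - v x * \<phi> x)"
      by (subst integral_mult_right_zero[symmetric]) (simp add: algebra_simps)
    also have "(LINT x|lborel. v (x + c n) * \<phi> x - v x * \<phi> x) = (LINT x|lborel. v (x + c n) * \<phi> x) - (LINT x|lborel. v x * \<phi> x)"
      by (intro Bochner_Integration.integral_diff L2_integrable_mult L2_shift Lv L\<phi>)
    also have "(LINT x|lborel. v (x + c n) * \<phi> x) = (LINT x|lborel. v x * \<phi> (x - c n))"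
      using integral_lborel_shift[of "\<lambda>x. v x * \<phi> (x - c n)" "c n"] by simp
    also have "\<dots> - (LINT x|lborel. v x * \<phi> x) = (LINT x|lborel. v x * \<phi> (x - c n) - v x * \<phi> x)"
      using L2_shift[OF L\<phi>(1), of "- c n"]
      by (intro Bochner_Integration.integral_diff[symmetric] L2_integrable_mult Lv L\<phi>) simp
    also have "real (Suc n) * \<dots> = (LINT x|lborel. v x * (real (Suc n) * (\<phi> (x - c n) - \<phi> x)))"
      by (subst integral_mult_right_zero[symmetric]) (simp add: algebra_simps)
    finally show ?thesis .
  qed
  have "?A \<longlonglongrightarrow> (LINT x|lborel. (g x \<bullet> w) * \<phi> x)"
  proof (rule integral_dominated_convergence[where w="\<lambda>x. C * norm w * \<bar>\<phi> x * indicator (cball 0 R) x\<bar>"])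
    show "integrable lborel (\<lambda>x. C * norm w * \<bar>\<phi> x * indicator (cball 0 R) x\<bar>)"
      by (intro integrable_mult_right integrable_abs L2_integrable_mult L\<phi> L2_indicator_cball)
    show "AE x in lborel. (\<lambda>n. real (Suc n) * (v (x + c n) - v x) * \<phi> x) \<longlonglongrightarrow> (g x \<bullet> w) * \<phi> x"
      unfolding c_def by (intro AE_I2 tendsto_mult lim tendsto_const)
    have "norm (real (Suc n) * (v (x + c n) - v x) * \<phi> x) \<le> C * norm w * \<bar>\<phi> x * indicator (cball 0 R) x\<bar>" for n x
    proof -
      have "real (Suc n) * \<bar>v (x + c n) - v x\<bar> \<le> real (Suc n) * (C * norm (c n))"
        using lip[of "x + c n" x] by (intro mult_left_mono) auto
      also have "\<dots> = C * norm w" using nc[of n] by (simp add: mult_ac)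
      finally have "real (Suc n) * \<bar>v (x + c n) - v x\<bar> * \<bar>\<phi> x\<bar> \<le> C * norm w * \<bar>\<phi> x\<bar>"
        by (rule mult_right_mono) simp
      moreover have "\<bar>\<phi> x * indicator (cball 0 R) x\<bar> = \<bar>\<phi> x\<bar>"
        using B(5)[of x] by (auto simp: indicator_def)
      ultimately show ?thesis by (simp only: abs_mult real_norm_def abs_of_nat)
    qed
    then show "AE x in lborel. norm (real (Suc n) * (v (x + c n) - v x) * \<phi> x) \<le> C * norm w * \<bar>\<phi> x * indicator (cball 0 R) x\<bar>" for n
      by (rule AE_I2)
  qed measurable
  moreover have "?A \<longlonglongrightarrow> (LINT x|lborel. v x * - (grad \<phi> x \<bullet> w))"
    unfolding A
  proof (rule integral_dominated_convergence[where w="\<lambda>x. B * norm w * \<bar>v x * indicator (cball 0 (R + norm w)) x\<bar>"])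
    show "integrable lborel (\<lambda>x. B * norm w * \<bar>v x * indicator (cball 0 (R + norm w)) x\<bar>)"
      by (intro integrable_mult_right integrable_abs L2_integrable_mult Lv L2_indicator_cball)
    show "AE x in lborel. (\<lambda>n. v x * (real (Suc n) * (\<phi> (x - c n) - \<phi> x))) \<longlonglongrightarrow> v x * - (grad \<phi> x \<bullet> w)"
    proof (intro AE_I2 tendsto_mult tendsto_const)
      fix x
      show "(\<lambda>n. real (Suc n) * (\<phi> (x - c n) - \<phi> x)) \<longlonglongrightarrow> - (grad \<phi> x \<bullet> w)"
        using directional_limit[OF grad_has_derivative[OF test_fun_differentiable[OF \<phi>]], of x "- w"]
        unfolding c_def by simp
    qed
    have "norm (v x * (real (Suc n) * (\<phi> (x - c n) - \<phi> x))) \<le> B * norm w * \<bar>v x * indicator (cball 0 (R + norm w)) x\<bar>" for n x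
    proof (cases "norm x \<le> R + norm w")
      case True
      have "real (Suc n) * \<bar>\<phi> (x - c n) - \<phi> x\<bar> \<le> real (Suc n) * (B * norm (c n))"
        using B(7)[of "x - c n" x] by (intro mult_left_mono) auto
      also have "\<dots> = B * norm w" using nc[of n] by (simp add: mult_ac)
      finally have "\<bar>v x\<bar> * (real (Suc n) * \<bar>\<phi> (x - c n) - \<phi> x\<bar>) \<le> \<bar>v x\<bar> * (B * norm w)"
        by (rule mult_left_mono) simp
      then show ?thesis using True by (simp add: abs_mult mult_ac)
    next
      case False
      then have "R < norm x" using norm_ge_zero[of w] by linarith
      moreover have "R < norm (x - c n)"
        using False nc1[of n] norm_triangle_ineq2[of x "c n"] by linarith
      ultimately show ?thesis using B(5) False by simp
    qed
    then show "AE x in lborel. norm (v x * (real (Suc n) * (\<phi> (x - c n) - \<phi> x))) \<le> B * norm w * \<bar>v x * indicator (cball 0 (R + norm w)) x\<bar>" for n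
      by (rule AE_I2)
  qed measurable
  ultimately have "(LINT x|lborel. (g x \<bullet> w) * \<phi> x) = (LINT x|lborel. v x * - (grad \<phi> x \<bullet> w))"
    by (rule LIMSEQ_unique)
  then show "(LINT x|lborel. v x * (grad \<phi> x \<bullet> w)) = - (LINT x|lborel. (g x \<bullet> w) * \<phi> x)"
    by simp
qed

lemma has_wgrad_test_fun: 
  assumes "test_fun \<psi>" shows "has_wgrad \<psi> (grad \<psi>)"
proof -
  from test_fun_bounds[OF assms] obtain B where "\<And>x y. \<bar>\<psi> x - \<psi> y\<bar> \<le> B * norm (x - y)" by metis
  then show ?thesis
    by (intro has_wgradI_difference test_fun_L2 assms directional_limit grad_has_derivative test_fun_differentiable)
qed

section \<open>Mollification\<close>

definition convolve :: "('a::euclidean_space \<Rightarrow> real) \<Rightarrow> ('a \<Rightarrow> real) \<Rightarrow> 'a \<Rightarrow> real" where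
  "convolve u \<psi> x = (LINT y|lborel. u y * \<psi> (x - y))"

lemma L2_reflect:
  fixes f :: "'a::euclidean_space \<Rightarrow> 'b::euclidean_space"
  assumes "L2 f" shows "L2 (\<lambda>y. f (x - y))"
proof -
  have [measurable]: "f \<in> borel_measurable borel" using assms by (simp add: L2_def)
  have "sq_norm (\<lambda>y. f (x - y)) = sq_norm f"
    unfolding sq_norm_def by (rule nn_integral_lborel_shift(4)[where f="\<lambda>y. ennreal ((norm (f y))\<^sup>2)"]) measurable
  then show ?thesis using assms by (simp add: L2_def)
qed

lemma convolve_diff:
  assumes "L2 u" "L2 \<psi>"
  shows "convolve u \<psi> x - convolve u \<psi> x' = (LINT y|lborel. u y * (\<psi> (x - y) - \<psi> (x' - y)))"
  unfolding convolve_def right_diff_distrib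
  by (intro Bochner_Integration.integral_diff[symmetric] L2_integrable_mult L2_reflect assms)

text \<open>Cauchy-Schwarz leaves the L2 norm of an increment of \<open>\<psi>\<close>, which the
  translation estimate bounds through its gradient. The Lipschitz constant is the product of the
  norms of \<open>u\<close> and of \<open>grad \<psi>\<close>.\<close>

lemma convolve_lipschitz:
  fixes u :: "'a::euclidean_space \<Rightarrow> real"
  assumes u: "L2 u" and \<psi>: "test_fun \<psi>"
  shows "\<exists>C\<ge>0. \<forall>x x'. \<bar>convolve u \<psi> x - convolve u \<psi> x'\<bar> \<le> C * norm (x - x')"
proof -
  have [measurable]: "u \<in> borel_measurable borel" using u by (simp add: L2_def)
  note [measurable] = test_fun_measurable[OF \<psi>]
  note L\<psi> = test_fun_L2[OF \<psi>]
  define a where "a = (LINT x|lborel. (norm (u x))\<^sup>2)"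
  define b where "b = (LINT x|lborel. (norm (grad \<psi> x))\<^sup>2)"
  have ab: "0 \<le> a" "0 \<le> b" "sq_norm u = ennreal a" "sq_norm (grad \<psi>) = ennreal b"
    unfolding a_def b_def using sq_norm_eq[OF u] sq_norm_eq[OF L\<psi>(2)] by auto
  have "\<bar>convolve u \<psi> x - convolve u \<psi> x'\<bar> \<le> sqrt (a * b) * norm (x - x')" for x x'
  proof -
    define h where "h = x - x'"
    have "ennreal ((convolve u \<psi> x - convolve u \<psi> x')\<^sup>2) \<le> (\<integral>\<^sup>+y. ennreal ((u y)\<^sup>2) \<partial>lborel) * (\<integral>\<^sup>+y. ennreal ((\<psi> (x - y) - \<psi> (x' - y))\<^sup>2) \<partial>lborel)"
      unfolding convolve_diff[OF u L\<psi>(1)] by (rule integral_mult_sq_le) measurable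
    also have "(\<integral>\<^sup>+y. ennreal ((\<psi> (x - y) - \<psi> (x' - y))\<^sup>2) \<partial>lborel) = (\<integral>\<^sup>+y. ennreal ((\<psi> (y + h) - \<psi> y)\<^sup>2) \<partial>lborel)"
      using nn_integral_lborel_shift(4)[of "\<lambda>y. ennreal ((\<psi> (y + h) - \<psi> y)\<^sup>2)" x'] by (simp add: h_def algebra_simps)
    also have "\<dots> \<le> (\<integral>\<^sup>+y. ennreal ((grad \<psi> y \<bullet> h)\<^sup>2) \<partial>lborel)"
      by (rule has_wgrad_translation[OF has_wgrad_test_fun[OF \<psi>]])
    also have "\<dots> \<le> (\<integral>\<^sup>+y. ennreal ((norm h)\<^sup>2) * ennreal ((norm (grad \<psi> y))\<^sup>2) \<partial>lborel)"
    proof (rule nn_integral_mono)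
      fix y
      have "(grad \<psi> y \<bullet> h)\<^sup>2 \<le> (norm (grad \<psi> y) * norm h)\<^sup>2"
        using Cauchy_Schwarz_ineq2[of "grad \<psi> y" h] by (intro abs_le_square_iff[THEN iffD1]) simp
      then show "ennreal ((grad \<psi> y \<bullet> h)\<^sup>2) \<le> ennreal ((norm h)\<^sup>2) * ennreal ((norm (grad \<psi> y))\<^sup>2)"
        by (simp add: power_mult_distrib mult.commute flip: ennreal_mult)
    qed
    also have "\<dots> = ennreal ((norm h)\<^sup>2) * sq_norm (grad \<psi>)" by (simp add: nn_integral_cmult sq_norm_def)
    also have "(\<integral>\<^sup>+y. ennreal ((u y)\<^sup>2) \<partial>lborel) = sq_norm u" by (simp add: sq_norm_def)
    finally have "ennreal ((convolve u \<psi> x - convolve u \<psi> x')\<^sup>2) \<le> ennreal a * (ennreal ((norm h)\<^sup>2) * ennreal b)"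
      unfolding ab by (simp add: mult_left_mono)
    then have "(convolve u \<psi> x - convolve u \<psi> x')\<^sup>2 \<le> a * ((norm h)\<^sup>2 * b)"
      using ab by (simp flip: ennreal_mult)
    then have "sqrt ((convolve u \<psi> x - convolve u \<psi> x')\<^sup>2) \<le> sqrt (a * b * (norm h)\<^sup>2)"
      by (intro real_sqrt_le_mono) (simp add: mult_ac)
    then show ?thesis by (simp add: real_sqrt_mult h_def)
  qed
  then show ?thesis using ab by (intro exI[of _ "sqrt (a * b)"]) simp
qed

definition grad_conv :: "('a::euclidean_space \<Rightarrow> real) \<Rightarrow> ('a \<Rightarrow> real) \<Rightarrow> 'a \<Rightarrow> 'a" where
  "grad_conv u \<psi> x = (LINT y|lborel. u y *\<^sub>R grad \<psi> (x - y))"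

text \<open>The difference quotient acts on \<open>\<psi>\<close> alone and is bounded by its
  Lipschitz constant. All shifted supports lie in one ball, on which \<open>u\<close> is
  integrable.\<close>

lemma convolve_difference_limit:
  fixes u :: "'a::euclidean_space \<Rightarrow> real"
  assumes u: "L2 u" and \<psi>: "test_fun \<psi>"
  shows "(\<lambda>n. real (Suc n) * (convolve u \<psi> (x + w /\<^sub>R real (Suc n)) - convolve u \<psi> x)) \<longlonglongrightarrow> grad_conv u \<psi> x \<bullet> w"
proof -
  have [measurable]: "u \<in> borel_measurable borel" using u by (simp add: L2_def)
  note [measurable] = test_fun_measurable[OF \<psi>]
  note L\<psi> = test_fun_L2[OF \<psi>]
  from test_fun_bounds[OF \<psi>] obtain B R where B: "0 < B" "0 < R" 
    "\<And>x. R < norm x \<Longrightarrow> \<psi> x = 0" "\<And>x. R < norm x \<Longrightarrow> grad \<psi> x = 0"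
    "\<And>x y. \<bar>\<psi> x - \<psi> y\<bar> \<le> B * norm (x - y)" by metis
  define c where "c n = w /\<^sub>R real (Suc n)" for n
  have nc: "real (Suc n) * norm (c n) = norm w" for n unfolding c_def by simp
  have nc1: "norm (c n) \<le> norm w" for n
  proof -
    have "1 * norm (c n) \<le> real (Suc n) * norm (c n)" by (rule mult_right_mono) auto
    then show ?thesis using nc[of n] by simp
  qed
  let ?I = "indicator (cball 0 (R + norm w)) :: 'a \<Rightarrow> real"
  have "(\<lambda>n. LINT y|lborel. u y * (real (Suc n) * (\<psi> (x - y + c n) - \<psi> (x - y)))) \<longlonglongrightarrow> (LINT y|lborel. u y * (grad \<psi> (x - y) \<bullet> w))"
  proof (rule integral_dominated_convergence[where w="\<lambda>y. B * norm w * \<bar>u y * ?I (x - y)\<bar>"])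
    show "integrable lborel (\<lambda>y. B * norm w * \<bar>u y * ?I (x - y)\<bar>)"
      by (intro integrable_mult_right integrable_abs L2_integrable_mult u L2_reflect[where f="?I"] L2_indicator_cball)
    show "AE y in lborel. (\<lambda>n. u y * (real (Suc n) * (\<psi> (x - y + c n) - \<psi> (x - y)))) \<longlonglongrightarrow> u y * (grad \<psi> (x - y) \<bullet> w)"
      unfolding c_def
      by (intro AE_I2 tendsto_mult tendsto_const directional_limit grad_has_derivative test_fun_differentiable \<psi>)
    have "norm (u y * (real (Suc n) * (\<psi> (x - y + c n) - \<psi> (x - y)))) \<le> B * norm w * \<bar>u y * ?I (x - y)\<bar>" for n y
    proof (cases "norm (x - y) \<le> R + norm w")
      case True
      have "real (Suc n) * \<bar>\<psi> (x - y + c n) - \<psi> (x - y)\<bar> \<le> real (Suc n) * (B * norm (c n))"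
        using B(5)[of "x - y + c n" "x - y"] by (intro mult_left_mono) auto
      also have "\<dots> = B * norm w" using nc[of n] by (simp add: mult_ac)
      finally have "\<bar>u y\<bar> * (real (Suc n) * \<bar>\<psi> (x - y + c n) - \<psi> (x - y)\<bar>) \<le> \<bar>u y\<bar> * (B * norm w)"
        by (rule mult_left_mono) simp
      then show ?thesis using True by (simp add: abs_mult mult_ac)
    next
      case False
      then have "R < norm (x - y)" using norm_ge_zero[of w] by linarith
      moreover have "R < norm (x - y + c n)"
        using False nc1[of n] norm_diff_ineq[of "x - y" "c n"] by linarith
      ultimately show ?thesis using B(3) False by simp
    qed
    then show "AE y in lborel. norm (u y * (real (Suc n) * (\<psi> (x - y + c n) - \<psi> (x - y)))) \<le> B * norm w * \<bar>u y * ?I (x - y)\<bar>" for n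
      by (rule AE_I2)
  qed measurable
  moreover have "(LINT y|lborel. u y * (real (Suc n) * (\<psi> (x - y + c n) - \<psi> (x - y)))) = real (Suc n) * (convolve u \<psi> (x + c n) - convolve u \<psi> x)" for n
    unfolding convolve_diff[OF u L\<psi>(1)] by (subst integral_mult_right_zero[symmetric]) (simp add: algebra_simps)
  moreover have "(LINT y|lborel. u y * (grad \<psi> (x - y) \<bullet> w)) = grad_conv u \<psi> x \<bullet> w"
  proof -
    have "integrable lborel (\<lambda>y. u y *\<^sub>R grad \<psi> (x - y))"
    proof (rule Bochner_Integration.integrable_bound)
      show "integrable lborel (\<lambda>y. \<bar>u y\<bar> * norm (grad \<psi> (x - y)))"
      proof (rule L2_integrable_mult)
        show "L2 (\<lambda>y. \<bar>u y\<bar>)" by (rule L2_bound[OF u]) auto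
        show "L2 (\<lambda>y. norm (grad \<psi> (x - y)))" by (rule L2_bound[OF L2_reflect[OF L\<psi>(2)]]) auto
      qed
    qed auto
    then have "grad_conv u \<psi> x \<bullet> w = (LINT y|lborel. (u y *\<^sub>R grad \<psi> (x - y)) \<bullet> w)"
      unfolding grad_conv_def by (rule integral_inner_left[symmetric])
    then show ?thesis by simp
  qed
  ultimately show ?thesis unfolding c_def by simp
qed

text \<open>Written as an average of translates with the fixed probability weight
  \<open>ker 1\<close>, so that convexity applies directly. The equivalent form as a convolution
  with \<open>ker \<epsilon>\<close>, divided by the power of \<open>\<epsilon>\<close> that
  restores mass 1, supplies the regularity.\<close>

definition mollify :: "real \<Rightarrow> ('a::euclidean_space \<Rightarrow> real) \<Rightarrow> 'a \<Rightarrow> real" where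
  "mollify \<epsilon> u x = (LINT z|lborel. ker 1 z * u (x - \<epsilon> *\<^sub>R z))"

lemma mollify_eq_convolve:
  fixes u :: "'a::euclidean_space \<Rightarrow> real"
  assumes [measurable]: "u \<in> borel_measurable borel" and \<epsilon>: "0 < \<epsilon>"
  shows "mollify \<epsilon> u = convolve u (\<lambda>z. 1 / \<epsilon> ^ DIM('a) * ker \<epsilon> z)"
proof
  fix x
  have k: "ker \<epsilon> (\<epsilon> *\<^sub>R z) = ker 1 z" for z :: 'a
    using \<epsilon> bump_scale[of \<epsilon> "\<epsilon> *\<^sub>R z"] by (simp add: ker_def)
  have "convolve u (\<lambda>z. 1 / \<epsilon> ^ DIM('a) * ker \<epsilon> z) x = (LINT y|lborel. u y * (1 / \<epsilon> ^ DIM('a) * ker \<epsilon> (x - y)))"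
    by (simp add: convolve_def)
  also have "\<dots> = \<epsilon> ^ DIM('a) * (LINT z|lborel. u (x - \<epsilon> *\<^sub>R z) * (1 / \<epsilon> ^ DIM('a) * ker 1 z))"
    using integral_lborel_affine[of "\<lambda>y. u y * (1 / \<epsilon> ^ DIM('a) * ker \<epsilon> (x - y))" "- \<epsilon>" x] \<epsilon> by (simp add: k)
  also have "\<dots> = mollify \<epsilon> u x"
    unfolding mollify_def using \<epsilon> by (subst integral_mult_right_zero[symmetric]) (simp add: mult_ac)
  finally show "mollify \<epsilon> u x = convolve u (\<lambda>z. 1 / \<epsilon> ^ DIM('a) * ker \<epsilon> z) x" by simp
qed

lemma L2_affine:
  fixes u :: "'a::euclidean_space \<Rightarrow> real"
  assumes "L2 u" and c: "c \<noteq> 0"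
  shows "L2 (\<lambda>z. u (x + c *\<^sub>R z))"
proof -
  have [measurable]: "u \<in> borel_measurable borel" using assms by (simp add: L2_def)
  have "sq_norm u = ennreal (\<bar>c\<bar> ^ DIM('a)) * sq_norm (\<lambda>z. u (x + c *\<^sub>R z))"
    unfolding sq_norm_def by (rule nn_integral_lborel_affine[OF _ c]) measurable
  then have "sq_norm (\<lambda>z. u (x + c *\<^sub>R z)) < \<infinity>"
    using assms c unfolding L2_def by (auto simp: ennreal_mult_less_top)
  then show ?thesis by (simp add: L2_def)
qed

lemma ker_mult_integrable:
  fixes u :: "'a::euclidean_space \<Rightarrow> real"
  assumes "L2 u" "0 < \<epsilon>"
  shows "integrable lborel (\<lambda>z. ker 1 z * u (x - \<epsilon> *\<^sub>R z))"
  using L2_integrable_mult[OF ker_L2[of 1] L2_affine[OF assms(1), of "- \<epsilon>" x]] assms by simp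

text \<open>Cauchy-Schwarz with the weight split evenly as
  \<open>sqrt (ker 1 z) * sqrt (ker 1 z)\<close>; one half integrates to 1.\<close>

lemma ker_jensen:
  fixes f :: "'a::euclidean_space \<Rightarrow> real"
  assumes [measurable]: "f \<in> borel_measurable borel"
  shows "ennreal ((LINT z|lborel. ker 1 z * f z)\<^sup>2) \<le> (\<integral>\<^sup>+z. ennreal (ker 1 z * (f z)\<^sup>2) \<partial>lborel)"
proof -
  have "ennreal ((LINT z|lborel. sqrt (ker 1 z) * (sqrt (ker 1 z) * f z))\<^sup>2)
    \<le> (\<integral>\<^sup>+z. ennreal ((sqrt (ker 1 (z::'a)))\<^sup>2) \<partial>lborel) * (\<integral>\<^sup>+z. ennreal ((sqrt (ker 1 z) * f z)\<^sup>2) \<partial>lborel)"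
    by (rule integral_mult_sq_le) measurable
  then show ?thesis
    by (simp add: nn_integral_ker power_mult_distrib flip: mult.assoc)
qed

lemma mollify_measurable [measurable]:
  assumes [measurable]: "u \<in> borel_measurable borel" 
  shows "mollify \<epsilon> u \<in> borel_measurable borel"
  unfolding mollify_def[abs_def] by measurable

text \<open>The error is an average of increments of length at most \<open>\<epsilon>\<close> with
  the very weight that defines \<open>dq_energy\<close>, so it is controlled at the scale
  \<open>\<epsilon>\<close> without any gradient.\<close>

lemma mollify_dist:
  fixes u :: "'a::euclidean_space \<Rightarrow> real"
  assumes u: "L2 u" and \<epsilon>: "0 < \<epsilon>"
  shows "sq_norm (\<lambda>x. mollify \<epsilon> u x - u x) \<le> ennreal (\<epsilon>\<^sup>2) * dq_energy \<epsilon> u"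
proof -
  have [measurable]: "u \<in> borel_measurable borel" using u by (simp add: L2_def)
  have i: "integrable lborel (ker 1 :: 'a \<Rightarrow> real)" 
    unfolding ker_def using bump_integral(1)[where 'a='a] by simp
  have 1: "(LINT z|lborel. ker 1 (z::'a)) = 1"
    using bump_integral(2)[where 'a='a] by (simp add: ker_def)
  have d: "mollify \<epsilon> u x - u x = (LINT z|lborel. ker 1 z * (u (x - \<epsilon> *\<^sub>R z) - u x))" for x
  proof -
    have "(LINT z|lborel. ker 1 z * u (x - \<epsilon> *\<^sub>R z) - ker 1 z * u x) = mollify \<epsilon> u x - (LINT z|lborel. ker 1 (z::'a) * u x)"
      unfolding mollify_def by (intro Bochner_Integration.integral_diff ker_mult_integrable u \<epsilon> integrable_mult_left i)
    then show ?thesis using 1 by (simp add: right_diff_distrib)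
  qed
  have "sq_norm (\<lambda>x. mollify \<epsilon> u x - u x) \<le> (\<integral>\<^sup>+x. \<integral>\<^sup>+z. ennreal (ker 1 z * (u (x - \<epsilon> *\<^sub>R z) - u x)\<^sup>2) \<partial>lborel \<partial>lborel)"
    unfolding sq_norm_def real_norm_def power2_abs d by (intro nn_integral_mono ker_jensen) measurable
  also have "\<dots> = (\<integral>\<^sup>+z. \<integral>\<^sup>+x. ennreal (ker 1 z * (u (x - \<epsilon> *\<^sub>R z) - u x)\<^sup>2) \<partial>lborel \<partial>lborel)"
    by (rule lborel_pair.Fubini') measurable
  also have "\<dots> = (\<integral>\<^sup>+z. \<integral>\<^sup>+x. ennreal (ker 1 (- z) * (u (x - \<epsilon> *\<^sub>R (- z)) - u x)\<^sup>2) \<partial>lborel \<partial>lborel)"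
    by (rule nn_integral_lborel_shift(5)[symmetric, where f="\<lambda>z. \<integral>\<^sup>+x. ennreal (ker 1 z * (u (x - \<epsilon> *\<^sub>R z) - u x)\<^sup>2) \<partial>lborel"]) measurable
  also have "\<dots> = (\<integral>\<^sup>+z. \<integral>\<^sup>+x. ennreal (\<epsilon>\<^sup>2) * ennreal (ker 1 z * ((u (x + \<epsilon> *\<^sub>R z) - u x) / \<epsilon>)\<^sup>2) \<partial>lborel \<partial>lborel)"
    using \<epsilon> by (intro nn_integral_cong) (simp add: power_divide flip: ennreal_mult)
  also have "\<dots> = ennreal (\<epsilon>\<^sup>2) * dq_energy \<epsilon> u"
    unfolding dq_energy_def by (simp add: nn_integral_cmult)
  finally show ?thesis .
qed

text \<open>Mollification is an average of translations, the energy is convex, and translations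
  preserve it.\<close>

lemma dq_energy_mollify:
  fixes u :: "'a::euclidean_space \<Rightarrow> real"
  assumes u: "L2 u" and \<epsilon>: "0 < \<epsilon>"
  shows "dq_energy s (mollify \<epsilon> u) \<le> dq_energy s u"
  unfolding dq_energy_def
proof (rule nn_integral_mono)
  fix h :: 'a
  have [measurable]: "u \<in> borel_measurable borel" using u by (simp add: L2_def)
  let ?d = "\<lambda>x. (u (x + s *\<^sub>R h) - u x) / s"
  have d: "(mollify \<epsilon> u (x + s *\<^sub>R h) - mollify \<epsilon> u x) / s = (LINT z|lborel. ker 1 z * ?d (x - \<epsilon> *\<^sub>R z))" for x
  proof -
    have "mollify \<epsilon> u (x + s *\<^sub>R h) - mollify \<epsilon> u x = (LINT z|lborel. ker 1 z * u (x + s *\<^sub>R h - \<epsilon> *\<^sub>R z) - ker 1 z * u (x - \<epsilon> *\<^sub>R z))"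
      unfolding mollify_def by (intro Bochner_Integration.integral_diff[symmetric] ker_mult_integrable u \<epsilon>)
    then have "(mollify \<epsilon> u (x + s *\<^sub>R h) - mollify \<epsilon> u x) / s = (LINT z|lborel. (ker 1 z * u (x + s *\<^sub>R h - \<epsilon> *\<^sub>R z) - ker 1 z * u (x - \<epsilon> *\<^sub>R z)) / s)"
      by simp
    then show ?thesis by (simp add: algebra_simps diff_divide_distrib)
  qed
  have "(\<integral>\<^sup>+x. ennreal (((mollify \<epsilon> u (x + s *\<^sub>R h) - mollify \<epsilon> u x) / s)\<^sup>2) \<partial>lborel)
    \<le> (\<integral>\<^sup>+x. \<integral>\<^sup>+z. ennreal (ker 1 z * (?d (x - \<epsilon> *\<^sub>R z))\<^sup>2) \<partial>lborel \<partial>lborel)"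
    unfolding d by (intro nn_integral_mono ker_jensen) measurable
  also have "\<dots> = (\<integral>\<^sup>+z. \<integral>\<^sup>+x. ennreal (ker 1 z) * ennreal ((?d (x - \<epsilon> *\<^sub>R z))\<^sup>2) \<partial>lborel \<partial>lborel)"
    by (subst lborel_pair.Fubini') (auto simp: ennreal_mult)
  also have "\<dots> = (\<integral>\<^sup>+z. ennreal (ker 1 (z::'a)) * (\<integral>\<^sup>+x. ennreal ((?d x)\<^sup>2) \<partial>lborel) \<partial>lborel)"
  proof (rule nn_integral_cong)
    fix z :: 'a
    have "(\<integral>\<^sup>+x. ennreal ((?d (x - \<epsilon> *\<^sub>R z))\<^sup>2) \<partial>lborel) = (\<integral>\<^sup>+x. ennreal ((?d x)\<^sup>2) \<partial>lborel)"
      by (rule nn_integral_lborel_shift(3)[where f="\<lambda>x. ennreal ((?d x)\<^sup>2)"]) measurable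
    then show "(\<integral>\<^sup>+x. ennreal (ker 1 z) * ennreal ((?d (x - \<epsilon> *\<^sub>R z))\<^sup>2) \<partial>lborel) = ennreal (ker 1 z) * (\<integral>\<^sup>+x. ennreal ((?d x)\<^sup>2) \<partial>lborel)"
      by (subst nn_integral_cmult) auto
  qed
  also have "\<dots> = (\<integral>\<^sup>+x. ennreal ((?d x)\<^sup>2) \<partial>lborel)"
    by (simp add: nn_integral_multc nn_integral_ker)
  finally have "ennreal (ker 1 h) * (\<integral>\<^sup>+x. ennreal (((mollify \<epsilon> u (x + s *\<^sub>R h) - mollify \<epsilon> u x) / s)\<^sup>2) \<partial>lborel)
    \<le> ennreal (ker 1 h) * (\<integral>\<^sup>+x. ennreal ((?d x)\<^sup>2) \<partial>lborel)"
    by (rule mult_left_mono) simp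
  then show "(\<integral>\<^sup>+x. ennreal (ker 1 h * ((mollify \<epsilon> u (x + s *\<^sub>R h) - mollify \<epsilon> u x) / s)\<^sup>2) \<partial>lborel) \<le>
     (\<integral>\<^sup>+x. ennreal (ker 1 h * ((u (x + s *\<^sub>R h) - u x) / s)\<^sup>2) \<partial>lborel)"
    by (subst (1 2) ennreal_mult) (auto simp: nn_integral_cmult)
qed

lemma mollify_L2:
  fixes u :: "'a::euclidean_space \<Rightarrow> real"
  assumes u: "L2 u" and \<epsilon>: "0 < \<epsilon>" and "dirichlet u < \<infinity>"
  shows "L2 (mollify \<epsilon> u)"
proof -
  have [measurable]: "u \<in> borel_measurable borel" using u by (simp add: L2_def)
  have "sq_norm (\<lambda>x. mollify \<epsilon> u x - u x) \<le> ennreal (\<epsilon>\<^sup>2) * dirichlet u"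
    by (rule order_trans[OF mollify_dist[OF u \<epsilon>]]) (intro mult_left_mono dq_le_dirichlet \<epsilon>, simp)
  also have "\<dots> < \<infinity>" using assms by (simp add: ennreal_mult_less_top)
  finally have "L2 (\<lambda>x. mollify \<epsilon> u x - u x)" by (simp add: L2_def)
  from L2_add[OF this u] show ?thesis by simp
qed

text \<open>The mollified function has genuine directional derivatives, so Fatou's lemma along
  scales tending to 0 compares its gradient with the limit of its energies, and those do not exceed
  the energies of \<open>u\<close>.\<close>

lemma mollify_gradient:
  fixes u :: "'a::euclidean_space \<Rightarrow> real"
  assumes u: "L2 u" and \<epsilon>: "0 < \<epsilon>" and fin: "dirichlet u < \<infinity>"
  shows "\<exists>g. has_wgrad (mollify \<epsilon> u) g \<and> ennreal (kappa TYPE('a)) * sq_norm g \<le> dirichlet u"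
proof -
  have [measurable]: "u \<in> borel_measurable borel" using u by (simp add: L2_def)
  define \<psi> where "\<psi> = (\<lambda>z::'a. 1 / \<epsilon> ^ DIM('a) * ker \<epsilon> z)"
  have \<psi>: "test_fun \<psi>" unfolding \<psi>_def by (rule test_fun_ker[OF \<epsilon>])
  note [measurable] = test_fun_measurable[OF \<psi>]
  define g where "g = grad_conv u \<psi>"
  have [measurable]: "g \<in> borel_measurable borel"
    unfolding g_def grad_conv_def[abs_def] by measurable
  have v: "mollify \<epsilon> u = convolve u \<psi>" unfolding \<psi>_def by (rule mollify_eq_convolve[OF _ \<epsilon>]) measurable
  have lim: "(\<lambda>n. real (Suc n) * (mollify \<epsilon> u (x + w /\<^sub>R real (Suc n)) - mollify \<epsilon> u x)) \<longlonglongrightarrow> g x \<bullet> w" for x w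
    unfolding v g_def by (rule convolve_difference_limit[OF u \<psi>])
  have "ennreal (kappa TYPE('a)) * sq_norm g = (\<integral>\<^sup>+x. \<integral>\<^sup>+h. ennreal (ker 1 h * (g x \<bullet> h)\<^sup>2) \<partial>lborel \<partial>lborel)"
    unfolding kappa_eq sq_norm_def using kappa_pos[where 'a='a]
    by (subst nn_integral_cmult[symmetric]) (auto simp: ennreal_mult)
  also have "\<dots> = (\<integral>\<^sup>+h. \<integral>\<^sup>+x. ennreal (ker 1 h * (g x \<bullet> h)\<^sup>2) \<partial>lborel \<partial>lborel)"
    by (rule lborel_pair.Fubini') measurable
  also have "\<dots> = (\<integral>\<^sup>+h. \<integral>\<^sup>+x. liminf (\<lambda>n. ennreal (ker 1 h * ((mollify \<epsilon> u (x + inverse (real (Suc n)) *\<^sub>R h) - mollify \<epsilon> u x) / inverse (real (Suc n)))\<^sup>2)) \<partial>lborel \<partial>lborel)"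
  proof (rule nn_integral_cong, rule nn_integral_cong)
    fix h x :: 'a
    have "(\<lambda>n. ennreal (ker 1 h * (real (Suc n) * (mollify \<epsilon> u (x + h /\<^sub>R real (Suc n)) - mollify \<epsilon> u x))\<^sup>2)) \<longlonglongrightarrow> ennreal (ker 1 h * (g x \<bullet> h)\<^sup>2)"
      by (intro tendsto_ennrealI tendsto_mult tendsto_const tendsto_power lim)
    moreover have "real (Suc n) * (mollify \<epsilon> u (x + h /\<^sub>R real (Suc n)) - mollify \<epsilon> u x) = (mollify \<epsilon> u (x + inverse (real (Suc n)) *\<^sub>R h) - mollify \<epsilon> u x) / inverse (real (Suc n))" for n
      by (simp add: divide_inverse mult.commute)
    ultimately have "(\<lambda>n. ennreal (ker 1 h * ((mollify \<epsilon> u (x + inverse (real (Suc n)) *\<^sub>R h) - mollify \<epsilon> u x) / inverse (real (Suc n)))\<^sup>2)) \<longlonglongrightarrow> ennreal (ker 1 h * (g x \<bullet> h)\<^sup>2)"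
      by simp
    then show "ennreal (ker 1 h * (g x \<bullet> h)\<^sup>2) = liminf (\<lambda>n. ennreal (ker 1 h * ((mollify \<epsilon> u (x + inverse (real (Suc n)) *\<^sub>R h) - mollify \<epsilon> u x) / inverse (real (Suc n)))\<^sup>2))"
      by (rule lim_imp_Liminf[OF sequentially_bot, symmetric])
  qed
  also have "\<dots> \<le> (\<integral>\<^sup>+h. liminf (\<lambda>n. \<integral>\<^sup>+x. ennreal (ker 1 h * ((mollify \<epsilon> u (x + inverse (real (Suc n)) *\<^sub>R h) - mollify \<epsilon> u x) / inverse (real (Suc n)))\<^sup>2) \<partial>lborel) \<partial>lborel)"
    by (rule nn_integral_mono, rule nn_integral_liminf) measurable
  also have "\<dots> \<le> liminf (\<lambda>n. dq_energy (inverse (real (Suc n))) (mollify \<epsilon> u))"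
    unfolding dq_energy_def by (rule nn_integral_liminf) measurable
  also have "\<dots> \<le> dirichlet u"
  proof (rule Liminf_le)
    show "sequentially \<noteq> bot" by simp
    show "\<forall>\<^sub>F n in sequentially. dq_energy (inverse (real (Suc n))) (mollify \<epsilon> u) \<le> dirichlet u"
      by (intro always_eventually allI order_trans[OF dq_energy_mollify[OF u \<epsilon>]] dq_le_dirichlet) simp
  qed
  finally have le: "ennreal (kappa TYPE('a)) * sq_norm g \<le> dirichlet u" .
  then have "ennreal (kappa TYPE('a)) * sq_norm g < \<infinity>" using fin by (rule le_less_trans)
  then have "sq_norm g < \<infinity>" using kappa_pos[where 'a='a] by (auto simp: ennreal_mult_less_top)
  then have "L2 g" by (simp add: L2_def)
  moreover obtain C where "\<And>x x'. \<bar>convolve u \<psi> x - convolve u \<psi> x'\<bar> \<le> C * norm (x - x')"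
    using convolve_lipschitz[OF u \<psi>] by blast
  ultimately have "has_wgrad (mollify \<epsilon> u) g"
    by (intro has_wgradI_difference[where C=C] mollify_L2 u \<epsilon> fin lim) (simp_all add: v)
  then show ?thesis using le by blast
qed

lemma has_wgrad_lincomb:
  assumes "has_wgrad u G" "has_wgrad v H"
  shows "has_wgrad (\<lambda>x. a * u x + b * v x) (\<lambda>x. a *\<^sub>R G x + b *\<^sub>R H x)"
  unfolding has_wgrad_def
proof (intro conjI allI impI)
  have L: "L2 u" "L2 G" "L2 v" "L2 H" using assms by (auto simp: has_wgrad_def)
  show "L2 (\<lambda>x. a * u x + b * v x)"
    using L2_add[OF L2_cmult[OF L(1), of a] L2_cmult[OF L(3), of b]] by simp
  show "L2 (\<lambda>x. a *\<^sub>R G x + b *\<^sub>R H x)"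
    by (intro L2_add L2_cmult L)
  fix \<phi> :: "'a \<Rightarrow> real" and w :: 'a assume \<phi>: "test_fun \<phi>"
  note L\<phi> = test_fun_L2[OF \<phi>]
  have i: "integrable lborel (\<lambda>x. u x * (grad \<phi> x \<bullet> w))" "integrable lborel (\<lambda>x. v x * (grad \<phi> x \<bullet> w))"
    "integrable lborel (\<lambda>x. (G x \<bullet> w) * \<phi> x)" "integrable lborel (\<lambda>x. (H x \<bullet> w) * \<phi> x)"
    by (intro L2_integrable_mult L2_inner L L\<phi>)+
  have "(LINT x|lborel. (a * u x + b * v x) * (grad \<phi> x \<bullet> w)) = (LINT x|lborel. a * (u x * (grad \<phi> x \<bullet> w)) + b * (v x * (grad \<phi> x \<bullet> w)))"
    by (intro Bochner_Integration.integral_cong) (auto simp: algebra_simps)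
  also have "\<dots> = a * (LINT x|lborel. u x * (grad \<phi> x \<bullet> w)) + b * (LINT x|lborel. v x * (grad \<phi> x \<bullet> w))"
    using i by simp
  also have "\<dots> = - (a * (LINT x|lborel. (G x \<bullet> w) * \<phi> x) + b * (LINT x|lborel. (H x \<bullet> w) * \<phi> x))"
    using assms \<phi> unfolding has_wgrad_def by simp
  also have "a * (LINT x|lborel. (G x \<bullet> w) * \<phi> x) + b * (LINT x|lborel. (H x \<bullet> w) * \<phi> x)
     = (LINT x|lborel. a * ((G x \<bullet> w) * \<phi> x) + b * ((H x \<bullet> w) * \<phi> x))"
    using i by simp
  also have "\<dots> = (LINT x|lborel. ((a *\<^sub>R G x + b *\<^sub>R H x) \<bullet> w) * \<phi> x)"
    by (intro Bochner_Integration.integral_cong) (auto simp: inner_add_left algebra_simps)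
  finally show "(LINT x|lborel. (a * u x + b * v x) * (grad \<phi> x \<bullet> w)) = - (LINT x|lborel. ((a *\<^sub>R G x + b *\<^sub>R H x) \<bullet> w) * \<phi> x)" .
qed

section \<open>Completeness of L2 and the gradient of a function of finite Dirichlet energy\<close>

lemma AE_tendsto_0_if_summable:
  fixes d :: "nat \<Rightarrow> 'a \<Rightarrow> real"
  assumes [measurable]: "\<And>n. d n \<in> borel_measurable M" 
    and le: "\<And>n. (\<integral>\<^sup>+x. ennreal ((d n x)\<^sup>2) \<partial>M) \<le> ennreal (C * (1/4) ^ n)" and C: "0 \<le> C"
  shows "AE x in M. summable (\<lambda>n. \<bar>d n x\<bar>)"
proof -
  \<comment> \<open>The weight \<open>2 ^ n\<close> still leaves a convergent geometric series of
    integrals and makes it possible to pass from squares to first powers below.\<close>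
  have "(\<integral>\<^sup>+x. (\<Sum>n. ennreal (2 ^ n * (d n x)\<^sup>2)) \<partial>M) = (\<Sum>n. \<integral>\<^sup>+x. ennreal (2 ^ n * (d n x)\<^sup>2) \<partial>M)"
    by (rule nn_integral_suminf) measurable
  also have "\<dots> \<le> (\<Sum>n. ennreal (C * (1/2) ^ n))"
  proof (intro suminf_le)
    fix n
    have "(\<integral>\<^sup>+x. ennreal (2 ^ n * (d n x)\<^sup>2) \<partial>M) = ennreal (2 ^ n) * (\<integral>\<^sup>+x. ennreal ((d n x)\<^sup>2) \<partial>M)"
      by (subst nn_integral_cmult[symmetric]) (auto simp: ennreal_mult)
    also have "\<dots> \<le> ennreal (2 ^ n) * ennreal (C * (1/4) ^ n)"
      by (intro mult_left_mono le) simp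
    also have "\<dots> = ennreal (C * (1/2) ^ n)"
    proof -
      have "(2::real) ^ n * (1/4) ^ n = (1/2) ^ n" by (simp flip: power_mult_distrib)
      then have "2 ^ n * (C * (1/4) ^ n) = C * (1/2) ^ n" by (simp add: mult.left_commute)
      then show ?thesis by (simp add: C flip: ennreal_mult)
    qed
    finally show "(\<integral>\<^sup>+x. ennreal (2 ^ n * (d n x)\<^sup>2) \<partial>M) \<le> ennreal (C * (1/2) ^ n)" .
  qed auto
  also have "\<dots> = ennreal (\<Sum>n. C * (1/2) ^ n)"
    using C by (intro suminf_ennreal2) (auto intro!: summable_mult summable_geometric)
  also have "\<dots> < \<infinity>" by simp
  finally have "AE x in M. (\<Sum>n. ennreal (2 ^ n * (d n x)\<^sup>2)) \<noteq> \<infinity>"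
    by (intro nn_integral_noteq_infinite) auto
  then show ?thesis
  proof eventually_elim
    case (elim x)
    then have "summable (\<lambda>n. 2 ^ n * (d n x)\<^sup>2)"
      by (intro summable_suminf_not_top) (auto simp: top_ennreal_def)
    moreover have "summable (\<lambda>n. (1/2::real) ^ n)" by (rule summable_geometric) simp
    ultimately have "summable (\<lambda>n. 2 ^ n * (d n x)\<^sup>2 + (1/2::real) ^ n)" by (rule summable_add)
    then show ?case
    proof (rule summable_comparison_test_ev[rotated])
      \<comment> \<open>The inequality between the arithmetic and the geometric mean of
        \<open>2 ^ n * (d n x)\<^sup>2\<close> and \<open>(1/2) ^ n\<close>.\<close>
      have "\<bar>d n x\<bar> \<le> 2 ^ n * (d n x)\<^sup>2 + (1/2::real) ^ n" for n
      proof -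
        define a where "a = (2::real) ^ n"
        have a: "0 < a" by (simp add: a_def)
        have "0 \<le> (a * \<bar>d n x\<bar> - 1)\<^sup>2 / a" using a by simp
        also have "\<dots> = a * (d n x)\<^sup>2 - 2 * \<bar>d n x\<bar> + 1 / a"
          using a by (simp add: power2_eq_square field_simps)
        finally have "2 * \<bar>d n x\<bar> \<le> a * (d n x)\<^sup>2 + 1 / a" by simp
        then show ?thesis unfolding a_def by (simp add: power_one_over)
      qed
      then show "\<forall>\<^sub>F n in sequentially. norm \<bar>d n x\<bar> \<le> 2 ^ n * (d n x)\<^sup>2 + (1/2::real) ^ n"
        by simp
    qed
  qed
qed

lemma tendsto_0_if_ennreal_le:
  fixes f :: "nat \<Rightarrow> ennreal"
  assumes "\<And>\<epsilon>::real. 0 < \<epsilon> \<Longrightarrow> \<forall>\<^sub>F n in sequentially. f n \<le> ennreal \<epsilon>"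
  shows "f \<longlonglongrightarrow> 0"
proof (rule order_tendstoI)
  fix a :: ennreal assume "0 < a"
  then obtain b where b: "0 < b" "b < a" using dense by blast
  then obtain \<epsilon> where e: "b = ennreal \<epsilon>" "0 < \<epsilon>" by (cases b) auto
  show "\<forall>\<^sub>F n in sequentially. f n < a"
    using assms[OF e(2)] by eventually_elim (use b e in \<open>auto intro: le_less_trans\<close>)
qed simp

text \<open>The Riesz-Fischer argument. The subsequence that converges almost everywhere is part of
  the result because Fatou's lemma is applied along it when the norm of the limit is
  estimated.\<close>

lemma L2_complete:
  fixes g :: "nat \<Rightarrow> 'a::euclidean_space \<Rightarrow> 'b::euclidean_space"
  assumes L: "\<And>n. L2 (g n)"
    and Cauchy: "\<And>\<epsilon>::real. 0 < \<epsilon> \<Longrightarrow> \<exists>N. \<forall>m\<ge>N. \<forall>n\<ge>N. sq_norm (\<lambda>x. g m x - g n x) \<le> ennreal \<epsilon>"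
  shows "\<exists>G r. strict_mono (r::nat \<Rightarrow> nat) \<and> G \<in> borel_measurable borel \<and> (AE x in lborel. (\<lambda>n. g (r n) x) \<longlonglongrightarrow> G x)
     \<and> (\<lambda>n. sq_norm (\<lambda>x. g n x - G x)) \<longlonglongrightarrow> 0"
proof -
  have [measurable]: "g n \<in> borel_measurable borel" for n using L[of n] by (simp add: L2_def)
  have "\<forall>i. \<exists>N. \<forall>m\<ge>N. \<forall>n\<ge>N. sq_norm (\<lambda>x. g m x - g n x) \<le> ennreal ((1/4) ^ i)"
    using Cauchy by simp
  then obtain N where N: "\<And>i m n. N i \<le> m \<Longrightarrow> N i \<le> n \<Longrightarrow> sq_norm (\<lambda>x. g m x - g n x) \<le> ennreal ((1/4) ^ i)"
    by metis
  \<comment> \<open>Increasing indices with \<open>N i \<le> r i\<close>, so that consecutive terms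
    differ by at most \<open>(1/4) ^ i\<close> in squared norm.\<close>
  define r where "r = rec_nat (N 0) (\<lambda>i k. max (Suc k) (N (Suc i)))"
  have rN: "N i \<le> r i" for i by (cases i) (auto simp: r_def)
  have rS: "r i < r (Suc i)" for i by (simp add: r_def)
  then have r: "strict_mono r" by (rule strict_mono_Suc_iff[THEN iffD2, rule_format])
  have "AE x in lborel. summable (\<lambda>i. \<bar>norm (g (r (Suc i)) x - g (r i) x)\<bar>)"
  proof (rule AE_tendsto_0_if_summable[where C=1])
    show "(\<integral>\<^sup>+x. ennreal ((norm (g (r (Suc i)) x - g (r i) x))\<^sup>2) \<partial>lborel) \<le> ennreal (1 * (1/4) ^ i)" for i
      using N[of i "r (Suc i)" "r i"] rN[of i] rS[of i] by (simp add: sq_norm_def)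
    show "(\<lambda>x. norm (g (r (Suc i)) x - g (r i) x)) \<in> borel_measurable lborel" for i by measurable
  qed simp
  then have ae: "AE x in lborel. convergent (\<lambda>i. g (r i) x)"
  proof eventually_elim
    case (elim x)
    then have "summable (\<lambda>i. g (r (Suc i)) x - g (r i) x)"
      unfolding abs_norm_cancel by (rule summable_norm_cancel)
    then have "convergent (\<lambda>n. \<Sum>i<n. g (r (Suc i)) x - g (r i) x)"
      by (simp only: summable_iff_convergent)
    then have "convergent (\<lambda>n. g (r n) x - g (r 0) x)"
      by (simp only: sum_lessThan_telescope[of "\<lambda>i. g (r i) x"])
    from convergent_add[OF this convergent_const[of "g (r 0) x"]] show ?case by simp
  qed
  define G where "G x = lim (\<lambda>i. g (r i) x)" for x
  have [measurable]: "G \<in> borel_measurable borel"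
    unfolding G_def by (rule borel_measurable_lim_metric) measurable
  have convolve: "AE x in lborel. (\<lambda>n. g (r n) x) \<longlonglongrightarrow> G x"
    using ae
  proof eventually_elim
    case (elim x)
    then show ?case unfolding G_def by (simp only: convergent_LIMSEQ_iff)
  qed
  have "(\<lambda>n. sq_norm (\<lambda>x. g n x - G x)) \<longlonglongrightarrow> 0"
  proof (rule tendsto_0_if_ennreal_le)
    fix \<epsilon> :: real assume "0 < \<epsilon>"
    then obtain K where K: "\<And>m n. K \<le> m \<Longrightarrow> K \<le> n \<Longrightarrow> sq_norm (\<lambda>x. g m x - g n x) \<le> ennreal \<epsilon>" using Cauchy by metis
    have "sq_norm (\<lambda>x. g n x - G x) \<le> ennreal \<epsilon>" if n: "K \<le> n" for n
    proof -
      have "sq_norm (\<lambda>x. g n x - G x) = (\<integral>\<^sup>+x. liminf (\<lambda>i. ennreal ((norm (g n x - g (r i) x))\<^sup>2)) \<partial>lborel)"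
        unfolding sq_norm_def
      proof (rule nn_integral_cong_AE)
        show "AE x in lborel. ennreal ((norm (g n x - G x))\<^sup>2) = liminf (\<lambda>i. ennreal ((norm (g n x - g (r i) x))\<^sup>2))"
          using convolve
        proof eventually_elim
          case (elim x)
          have "(\<lambda>i. ennreal ((norm (g n x - g (r i) x))\<^sup>2)) \<longlonglongrightarrow> ennreal ((norm (g n x - G x))\<^sup>2)"
            by (intro tendsto_ennrealI tendsto_power tendsto_norm tendsto_diff tendsto_const elim)
          then show ?case by (rule lim_imp_Liminf[OF sequentially_bot, symmetric])
        qed
      qed
      also have "\<dots> \<le> liminf (\<lambda>i. sq_norm (\<lambda>x. g n x - g (r i) x))"
        unfolding sq_norm_def by (rule nn_integral_liminf) measurable
      also have "\<dots> \<le> ennreal \<epsilon>"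
      proof (rule Liminf_le)
        show "\<forall>\<^sub>F i in sequentially. sq_norm (\<lambda>x. g n x - g (r i) x) \<le> ennreal \<epsilon>"
          using eventually_ge_at_top[of K]
        proof eventually_elim
          case (elim i)
          then show ?case using seq_suble[OF r, of i] n by (intro K) auto
        qed
      qed simp
      finally show ?thesis .
    qed
    then show "\<forall>\<^sub>F n in sequentially. sq_norm (\<lambda>x. g n x - G x) \<le> ennreal \<epsilon>"
      by (auto simp: eventually_sequentially)
  qed
  then show ?thesis using r convolve \<open>G \<in> borel_measurable borel\<close> by blast
qed

lemma sq_norm_parallelogram:
  fixes g h :: "'a::euclidean_space \<Rightarrow> 'b::euclidean_space"
  assumes [measurable]: "g \<in> borel_measurable borel" "h \<in> borel_measurable borel"
  shows "sq_norm (\<lambda>x. g x - h x) + sq_norm (\<lambda>x. g x + h x) = 2 * sq_norm g + 2 * sq_norm h"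
proof -
  have pw: "(norm (a - b))\<^sup>2 + (norm (a + b))\<^sup>2 = 2 * (norm a)\<^sup>2 + 2 * (norm b)\<^sup>2" for a b :: 'b
    by (simp add: power2_norm_eq_inner inner_diff_left inner_diff_right inner_add_left inner_add_right inner_commute)
  have "sq_norm (\<lambda>x. g x - h x) + sq_norm (\<lambda>x. g x + h x) = (\<integral>\<^sup>+x. ennreal ((norm (g x - h x))\<^sup>2) + ennreal ((norm (g x + h x))\<^sup>2) \<partial>lborel)"
    unfolding sq_norm_def by (rule nn_integral_add[symmetric]) measurable
  also have "\<dots> = (\<integral>\<^sup>+x. 2 * ennreal ((norm (g x))\<^sup>2) + 2 * ennreal ((norm (h x))\<^sup>2) \<partial>lborel)"
  proof (rule nn_integral_cong)
    fix x
    have "ennreal ((norm (g x - h x))\<^sup>2) + ennreal ((norm (g x + h x))\<^sup>2) = ennreal (2 * (norm (g x))\<^sup>2 + 2 * (norm (h x))\<^sup>2)"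
      by (subst ennreal_plus[symmetric]) (simp_all add: pw)
    then show "ennreal ((norm (g x - h x))\<^sup>2) + ennreal ((norm (g x + h x))\<^sup>2) = 2 * ennreal ((norm (g x))\<^sup>2) + 2 * ennreal ((norm (h x))\<^sup>2)"
      by (simp add: ennreal_mult)
  qed
  also have "\<dots> = 2 * sq_norm g + 2 * sq_norm h"
    unfolding sq_norm_def by (simp add: nn_integral_add nn_integral_cmult)
  finally show ?thesis .
qed

lemma sq_norm_cmult:
  fixes g :: "'a::euclidean_space \<Rightarrow> 'b::euclidean_space"
  assumes [measurable]: "g \<in> borel_measurable borel"
  shows "sq_norm (\<lambda>x. c *\<^sub>R g x) = ennreal (c\<^sup>2) * sq_norm g"
  unfolding sq_norm_def by (simp add: power_mult_distrib ennreal_mult nn_integral_cmult)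

lemma sq_norm_add_le:
  fixes g h :: "'a::euclidean_space \<Rightarrow> 'b::euclidean_space"
  assumes [measurable]: "g \<in> borel_measurable borel" "h \<in> borel_measurable borel"
  shows "sq_norm (\<lambda>x. g x + h x) \<le> 2 * sq_norm g + 2 * sq_norm h"
  using sq_norm_parallelogram[OF assms] by (metis add.commute le_iff_add)

lemma inner_converges:
  fixes f :: "nat \<Rightarrow> 'a::euclidean_space \<Rightarrow> real"
  assumes L: "\<And>n. L2 (f n)" "L2 F" and \<phi>: "L2 \<phi>" and lim: "(\<lambda>n. sq_norm (\<lambda>x. f n x - F x)) \<longlonglongrightarrow> 0"
  shows "(\<lambda>n. LINT x|lborel. f n x * \<phi> x) \<longlonglongrightarrow> (LINT x|lborel. F x * \<phi> x)"
proof -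
  have [measurable]: "f n \<in> borel_measurable borel" "F \<in> borel_measurable borel" "\<phi> \<in> borel_measurable borel" for n
    using L(1)[of n] L(2) \<phi> by (auto simp: L2_def)
  have "(\<lambda>n. sq_norm \<phi> * sq_norm (\<lambda>x. f n x - F x)) \<longlonglongrightarrow> sq_norm \<phi> * 0"
    using \<phi> by (intro ennreal_tendsto_cmult lim) (auto simp: L2_def)
  then have *: "(\<lambda>n. sq_norm (\<lambda>x. f n x - F x) * sq_norm \<phi>) \<longlonglongrightarrow> 0" by (simp add: mult.commute)
  have "(\<lambda>n. ennreal (((LINT x|lborel. f n x * \<phi> x) - (LINT x|lborel. F x * \<phi> x))\<^sup>2)) \<longlonglongrightarrow> ennreal 0"
    unfolding ennreal_0
  proof (rule tendsto_sandwich[OF _ _ tendsto_const *])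
    show "\<forall>\<^sub>F n in sequentially. ennreal (((LINT x|lborel. f n x * \<phi> x) - (LINT x|lborel. F x * \<phi> x))\<^sup>2) \<le> sq_norm (\<lambda>x. f n x - F x) * sq_norm \<phi>"
    proof (intro always_eventually allI)
      fix n
      have "(LINT x|lborel. f n x * \<phi> x) - (LINT x|lborel. F x * \<phi> x) = (LINT x|lborel. (f n x - F x) * \<phi> x)"
        unfolding left_diff_distrib by (intro Bochner_Integration.integral_diff[symmetric] L2_integrable_mult L \<phi>)
      then show "ennreal (((LINT x|lborel. f n x * \<phi> x) - (LINT x|lborel. F x * \<phi> x))\<^sup>2) \<le> sq_norm (\<lambda>x. f n x - F x) * sq_norm \<phi>"
        using integral_mult_sq_le[of "\<lambda>x. f n x - F x" lborel \<phi>] by (simp add: sq_norm_def)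
    qed
  qed simp
  then have "(\<lambda>n. ((LINT x|lborel. f n x * \<phi> x) - (LINT x|lborel. F x * \<phi> x))\<^sup>2) \<longlonglongrightarrow> 0"
    by (subst (asm) tendsto_ennreal_iff) auto
  then have "(\<lambda>n. sqrt (((LINT x|lborel. f n x * \<phi> x) - (LINT x|lborel. F x * \<phi> x))\<^sup>2)) \<longlonglongrightarrow> sqrt 0"
    by (rule tendsto_real_sqrt)
  then have "(\<lambda>n. (LINT x|lborel. f n x * \<phi> x) - (LINT x|lborel. F x * \<phi> x)) \<longlonglongrightarrow> 0"
    by (simp add: tendsto_rabs_zero_iff)
  then show ?thesis by (simp add: LIM_zero_iff)
qed

lemma has_wgrad_limit:
  fixes v :: "nat \<Rightarrow> 'a::euclidean_space \<Rightarrow> real"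
  assumes w: "\<And>n. has_wgrad (v n) (g n)" and u: "L2 u" and G: "L2 G"
    and vlim: "(\<lambda>n. sq_norm (\<lambda>x. v n x - u x)) \<longlonglongrightarrow> 0" and glim: "(\<lambda>n. sq_norm (\<lambda>x. g n x - G x)) \<longlonglongrightarrow> 0"
  shows "has_wgrad u G"
  unfolding has_wgrad_def
proof (intro conjI allI impI u G)
  fix \<phi> :: "'a \<Rightarrow> real" and w :: 'a assume \<phi>: "test_fun \<phi>"
  note L\<phi> = test_fun_L2[OF \<phi>]
  have L: "L2 (v n)" "L2 (g n)" for n using w[of n] by (auto simp: has_wgrad_def)
  have [measurable]: "v n \<in> borel_measurable borel" "g n \<in> borel_measurable borel" "u \<in> borel_measurable borel" "G \<in> borel_measurable borel" for n
    using L[of n] u G by (auto simp: L2_def)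
  have 1: "(\<lambda>n. LINT x|lborel. v n x * (grad \<phi> x \<bullet> w)) \<longlonglongrightarrow> (LINT x|lborel. u x * (grad \<phi> x \<bullet> w))"
    by (intro inner_converges L u L2_inner L\<phi> vlim)
  have "(\<lambda>n. sq_norm (\<lambda>x. g n x \<bullet> w - G x \<bullet> w)) \<longlonglongrightarrow> 0"
  proof (rule tendsto_sandwich[OF _ _ tendsto_const])
    have "(\<lambda>n. ennreal ((norm w)\<^sup>2) * sq_norm (\<lambda>x. g n x - G x)) \<longlonglongrightarrow> ennreal ((norm w)\<^sup>2) * 0"
      by (intro ennreal_tendsto_cmult glim) simp
    then show "(\<lambda>n. ennreal ((norm w)\<^sup>2) * sq_norm (\<lambda>x. g n x - G x)) \<longlonglongrightarrow> 0" by simp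
    show "\<forall>\<^sub>F n in sequentially. sq_norm (\<lambda>x. g n x \<bullet> w - G x \<bullet> w) \<le> ennreal ((norm w)\<^sup>2) * sq_norm (\<lambda>x. g n x - G x)"
    proof (intro always_eventually allI)
      fix n
      have "sq_norm (\<lambda>x. g n x \<bullet> w - G x \<bullet> w) \<le> sq_norm (\<lambda>x. norm w *\<^sub>R (g n x - G x))"
        unfolding sq_norm_def
      proof (intro nn_integral_mono ennreal_leI power_mono)
        fix x
        show "norm (g n x \<bullet> w - G x \<bullet> w) \<le> norm (norm w *\<^sub>R (g n x - G x))"
          using Cauchy_Schwarz_ineq2[of "g n x - G x" w] by (simp add: inner_diff_left mult.commute)
      qed simp
      also have "\<dots> = ennreal ((norm w)\<^sup>2) * sq_norm (\<lambda>x. g n x - G x)" by (rule sq_norm_cmult) measurable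
      finally show "sq_norm (\<lambda>x. g n x \<bullet> w - G x \<bullet> w) \<le> ennreal ((norm w)\<^sup>2) * sq_norm (\<lambda>x. g n x - G x)" .
    qed
  qed simp
  then have 2: "(\<lambda>n. LINT x|lborel. (g n x \<bullet> w) * \<phi> x) \<longlonglongrightarrow> (LINT x|lborel. (G x \<bullet> w) * \<phi> x)"
    by (intro inner_converges L2_inner L G L\<phi>)
  have "(LINT x|lborel. v n x * (grad \<phi> x \<bullet> w)) = - (LINT x|lborel. (g n x \<bullet> w) * \<phi> x)" for n
    using w[of n] \<phi> unfolding has_wgrad_def by blast
  then have "(\<lambda>n. LINT x|lborel. v n x * (grad \<phi> x \<bullet> w)) \<longlonglongrightarrow> - (LINT x|lborel. (G x \<bullet> w) * \<phi> x)"
    using tendsto_minus[OF 2] by simp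
  then show "(LINT x|lborel. u x * (grad \<phi> x \<bullet> w)) = - (LINT x|lborel. (G x \<bullet> w) * \<phi> x)"
    using 1 LIMSEQ_unique by blast
qed

lemma ennreal_combine:
  assumes "0 \<le> p" "0 \<le> q" "0 \<le> r" "0 \<le> x" "0 \<le> y" "0 \<le> z"
  shows "ennreal p * (ennreal q * ennreal r) + ennreal x * (ennreal y * ennreal z) = ennreal (p * (q * r) + x * (y * z))"
  using assms by (simp add: ennreal_mult ennreal_plus)

text \<open>Uniform convexity produces the gradient as a strong limit. The gradients of
  mollifications all have energy at most \<open>a = dirichlet u\<close>. The midpoint of two of them
  belongs to a function close to \<open>u\<close> in L2, and at a scale that nearly realises the
  supremum \<open>a\<close> its energy cannot be much smaller than \<open>a\<close>; by the
  parallelogram law the two gradients are then close to each other.\<close>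

lemma dirichlet_gradient:
  fixes u :: "'a::euclidean_space \<Rightarrow> real"
  assumes u: "L2 u" and fin: "dirichlet u < \<infinity>"
  shows "\<exists>G. has_wgrad u G \<and> ennreal (kappa TYPE('a)) * sq_norm G \<le> dirichlet u"
proof -
  have [measurable]: "u \<in> borel_measurable borel" using u by (simp add: L2_def)
  define \<epsilon> where "\<epsilon> n = inverse (real (Suc n))" for n
  have \<epsilon>0: "0 < \<epsilon> n" for n by (simp add: \<epsilon>_def)
  define v where "v n = mollify (\<epsilon> n) u" for n
  have "\<forall>n. \<exists>g. has_wgrad (v n) g \<and> ennreal (kappa TYPE('a)) * sq_norm g \<le> dirichlet u"
    unfolding v_def using mollify_gradient[OF u \<epsilon>0 fin] by blast
  then obtain g where g: "\<And>n. has_wgrad (v n) (g n)" and gle: "\<And>n. ennreal (kappa TYPE('a)) * sq_norm (g n) \<le> dirichlet u"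
    by metis
  have L: "L2 (v n)" "L2 (g n)" for n using g[of n] by (auto simp: has_wgrad_def)
  have [measurable]: "v n \<in> borel_measurable borel" "g n \<in> borel_measurable borel" for n
    using L[of n] by (auto simp: L2_def)
  obtain a where a: "dirichlet u = ennreal a" "0 \<le> a" using fin by (cases "dirichlet u") auto
  have dist: "sq_norm (\<lambda>x. v n x - u x) \<le> ennreal ((\<epsilon> n)\<^sup>2 * a)" for n
  proof -
    have "sq_norm (\<lambda>x. v n x - u x) \<le> ennreal ((\<epsilon> n)\<^sup>2) * dirichlet u"
      unfolding v_def by (rule order_trans[OF mollify_dist[OF u \<epsilon>0]]) (intro mult_left_mono dq_le_dirichlet \<epsilon>0, simp)
    then show ?thesis using a by (simp flip: ennreal_mult)
  qed
  have \<epsilon>lim: "\<epsilon> \<longlonglongrightarrow> 0" unfolding \<epsilon>_def by (rule LIMSEQ_inverse_real_of_nat)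
  have vlim: "(\<lambda>n. sq_norm (\<lambda>x. v n x - u x)) \<longlonglongrightarrow> 0"
  proof (rule tendsto_sandwich[OF _ _ tendsto_const])
    have "(\<lambda>n. (\<epsilon> n)\<^sup>2 * a) \<longlonglongrightarrow> 0\<^sup>2 * a" by (intro tendsto_intros \<epsilon>lim)
    then show "(\<lambda>n. ennreal ((\<epsilon> n)\<^sup>2 * a)) \<longlonglongrightarrow> 0" using tendsto_ennrealI by fastforce
  qed (use dist in auto)
  define k where "k = kappa TYPE('a)"
  have k: "0 < k" unfolding k_def by (rule kappa_pos)
  have Cauchy: "\<exists>N. \<forall>m\<ge>N. \<forall>n\<ge>N. sq_norm (\<lambda>x. g m x - g n x) \<le> ennreal \<delta>" if \<delta>: "0 < \<delta>" for \<delta> :: real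
  proof -
    \<comment> \<open>The midpoint loses at most three times \<open>\<eta>\<close>, and the
      parallelogram law multiplies this loss by 4.\<close>
    define \<eta> where "\<eta> = k * \<delta> / 12"
    have \<eta>: "0 < \<eta>" using \<delta> k by (simp add: \<eta>_def)
    have "\<exists>s>0. ennreal (a - \<eta>) \<le> dq_energy s u"
    \<comment> \<open>A scale strictly above \<open>a - \<eta>\<close> can be extracted from the
      supremum only if \<open>a\<close> is positive; for \<open>a = 0\<close> the truncated bound is
      0 and every scale will do.\<close>
    proof (cases "a = 0")
      case True
      then have "ennreal (a - \<eta>) \<le> dq_energy 1 u" using \<eta> by (simp add: ennreal_neg)
      then show ?thesis by (intro exI[of _ 1]) simp
    next
      case False
      then have "ennreal (a - \<eta>) < dirichlet u"
        unfolding a(1) using a(2) \<eta> by (intro ennreal_lessI) auto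
      then show ?thesis unfolding dirichlet_def less_SUP_iff by (auto intro: less_imp_le)
    qed
    then obtain s where s: "0 < s" and su: "ennreal (a - \<eta>) \<le> dq_energy s u" by blast
    \<comment> \<open>The denominator \<open>a + 1\<close> keeps the quotient meaningful for
      \<open>a = 0\<close> and still gives \<open>\<theta> * a \<le> \<eta>\<close>.\<close>
    define \<theta> where "\<theta> = \<eta> / (a + 1)"
    have \<theta>: "0 < \<theta>" "\<theta> * a \<le> \<eta>" using \<eta> a by (auto simp: \<theta>_def field_simps)
    have "(\<lambda>n. (1 + 1 / \<theta>) * (4 / s\<^sup>2 * ((\<epsilon> n)\<^sup>2 * a))) \<longlonglongrightarrow> (1 + 1 / \<theta>) * (4 / s\<^sup>2 * (0\<^sup>2 * a))"
      by (intro tendsto_intros \<epsilon>lim)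
    then have "\<forall>\<^sub>F n in sequentially. (1 + 1 / \<theta>) * (4 / s\<^sup>2 * ((\<epsilon> n)\<^sup>2 * a)) < \<eta>"
      by (rule order_tendstoD) (simp add: \<eta>)
    then obtain N where N: "\<And>n. N \<le> n \<Longrightarrow> (1 + 1 / \<theta>) * (4 / s\<^sup>2 * ((\<epsilon> n)\<^sup>2 * a)) < \<eta>"
      unfolding eventually_sequentially by blast
    have "sq_norm (\<lambda>x. g m x - g n x) \<le> ennreal \<delta>" if mn: "N \<le> m" "N \<le> n" for m n
    proof -
      \<comment> \<open>The midpoint of two mollifications, with gradient the midpoint
        \<open>h\<close> of their gradients.\<close>
      define w where "w x = (1/2) * v m x + (1/2) * v n x" for x
      define h where "h x = (1/2) *\<^sub>R g m x + (1/2) *\<^sub>R g n x" for x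
      have wh: "has_wgrad w h" unfolding w_def h_def by (intro has_wgrad_lincomb g)
      then have Lw: "L2 w" "L2 h" by (auto simp: has_wgrad_def)
      then have [measurable]: "w \<in> borel_measurable borel" "h \<in> borel_measurable borel" by (auto simp: L2_def)
      have mle: "sq_norm (\<lambda>x. v j x - u x) \<le> ennreal ((\<epsilon> N)\<^sup>2 * a)" if "N \<le> j" for j
      proof -
        have "\<epsilon> j \<le> \<epsilon> N" using that by (simp add: \<epsilon>_def)
        then have "(\<epsilon> j)\<^sup>2 * a \<le> (\<epsilon> N)\<^sup>2 * a" using a \<epsilon>0[of j] by (intro mult_right_mono power_mono) auto
        then show ?thesis using dist[of j] by (meson ennreal_leI order_trans)
      qed
      have "sq_norm (\<lambda>x. u x - w x) \<le> 2 * sq_norm (\<lambda>x. (- 1/2) *\<^sub>R (v m x - u x)) + 2 * sq_norm (\<lambda>x. (- 1/2) *\<^sub>R (v n x - u x))"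
      proof -
        have "(\<lambda>x. u x - w x) = (\<lambda>x. (- 1/2) *\<^sub>R (v m x - u x) + (- 1/2) *\<^sub>R (v n x - u x))"
          by (auto simp: w_def field_simps)
        then show ?thesis using sq_norm_add_le[of "\<lambda>x. (- 1/2) *\<^sub>R (v m x - u x)" "\<lambda>x. (- 1/2) *\<^sub>R (v n x - u x)"] by simp
      qed
      also have "\<dots> = ennreal (1/2) * sq_norm (\<lambda>x. v m x - u x) + ennreal (1/2) * sq_norm (\<lambda>x. v n x - u x)"
      proof -
        have q: "2 * (ennreal (1/4) * X) = ennreal (1/2) * X" for X
        proof -
          have "2 * ennreal (1/4) = ennreal (1/2)"
            by (subst ennreal_numeral[symmetric], subst ennreal_mult[symmetric]) simp_all
          then show ?thesis by (simp only: mult.assoc[symmetric])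
        qed
        have c: "sq_norm (\<lambda>x. (- 1/2) *\<^sub>R (v j x - u x)) = ennreal (1/4) * sq_norm (\<lambda>x. v j x - u x)" for j
        proof -
          have "sq_norm (\<lambda>x. (- 1/2) *\<^sub>R (v j x - u x)) = ennreal ((- 1/2)\<^sup>2) * sq_norm (\<lambda>x. v j x - u x)"
            by (rule sq_norm_cmult) measurable
          moreover have "(- 1/2)\<^sup>2 = (1/4 :: real)" by (simp add: power2_eq_square)
          ultimately show ?thesis by (simp only:)
        qed
        show ?thesis unfolding c q ..
      qed
      also have "\<dots> \<le> ennreal (1/2) * ennreal ((\<epsilon> N)\<^sup>2 * a) + ennreal (1/2) * ennreal ((\<epsilon> N)\<^sup>2 * a)"
        by (intro add_mono mult_left_mono mle mn) auto
      also have "\<dots> = ennreal ((\<epsilon> N)\<^sup>2 * a)"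
      proof -
        define c where "c = (\<epsilon> N)\<^sup>2 * a"
        have c: "0 \<le> c" using a by (simp add: c_def)
        have "ennreal (1/2) * ennreal c = ennreal (1/2 * c)"
          by (rule ennreal_mult[symmetric]) (use c in auto)
        moreover have "ennreal (1/2 * c) + ennreal (1/2 * c) = ennreal (1/2 * c + 1/2 * c)"
          by (rule ennreal_plus[symmetric]) (use c in auto)
        moreover have "1/2 * c + 1/2 * c = c" by simp
        ultimately show ?thesis unfolding c_def[symmetric] by (simp only:)
      qed
      finally have dw: "sq_norm (\<lambda>x. u x - w x) \<le> ennreal ((\<epsilon> N)\<^sup>2 * a)" .
      have dqfin: "dq_energy s w \<le> ennreal k * sq_norm h" unfolding k_def by (rule dq_energy_le_sq_norm[OF wh s])
      define A where "A = (\<lambda>f::'a \<Rightarrow> 'a. LINT x|lborel. (norm (f x))\<^sup>2)"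
      have A: "sq_norm f = ennreal (A f)" "0 \<le> A f" if "L2 f" for f :: "'a \<Rightarrow> 'a"
        using sq_norm_eq[OF that] by (auto simp: A_def)
      have gj: "k * A (g j) \<le> a" for j
        using gle[of j] A[OF L(2)[of j]] a k unfolding k_def[symmetric] by (simp flip: ennreal_mult)
      have dm: "L2 (\<lambda>x. g m x - g n x)" by (intro L2_diff L)
      have par: "A (\<lambda>x. g m x - g n x) + 4 * A h = 2 * A (g m) + 2 * A (g n)"
      proof -
        have "sq_norm (\<lambda>x. g m x - g n x) + sq_norm (\<lambda>x. g m x + g n x) = 2 * sq_norm (g m) + 2 * sq_norm (g n)"
          by (rule sq_norm_parallelogram) measurable
        moreover have "sq_norm (\<lambda>x. g m x + g n x) = ennreal 4 * sq_norm h"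
        proof -
          have "(\<lambda>x. g m x + g n x) = (\<lambda>x. 2 *\<^sub>R h x)" by (simp add: h_def scaleR_add_right)
          then show ?thesis by (simp add: sq_norm_cmult)
        qed
        ultimately have "ennreal (A (\<lambda>x. g m x - g n x) + 4 * A h) = ennreal (2 * A (g m) + 2 * A (g n))"
          using A[OF dm] A[OF Lw(2)] A[OF L(2)[of m]] A[OF L(2)[of n]] by (simp add: ennreal_mult ennreal_plus)
        then show ?thesis
          using A[OF dm] A[OF Lw(2)] A[OF L(2)[of m]] A[OF L(2)[of n]] by (subst (asm) ennreal_inj) auto
      qed
      have "ennreal (a - \<eta>) \<le> ennreal (1 + \<theta>) * dq_energy s w + ennreal (1 + 1 / \<theta>) * (ennreal (4 / s\<^sup>2) * sq_norm (\<lambda>x. u x - w x))"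
        by (rule order_trans[OF su dq_energy_perturb]) (use \<theta> s in auto)
      also have "\<dots> \<le> ennreal (1 + \<theta>) * (ennreal k * ennreal (A h)) + ennreal (1 + 1 / \<theta>) * (ennreal (4 / s\<^sup>2) * ennreal ((\<epsilon> N)\<^sup>2 * a))"
        using dqfin dw unfolding A(1)[OF Lw(2)] by (intro add_mono mult_left_mono) auto
      also have "\<dots> = ennreal ((1 + \<theta>) * (k * A h) + (1 + 1 / \<theta>) * (4 / s\<^sup>2 * ((\<epsilon> N)\<^sup>2 * a)))"
        by (rule ennreal_combine) (use \<theta> k a A(2)[OF Lw(2)] in auto)
      finally have "a - \<eta> \<le> (1 + \<theta>) * (k * A h) + (1 + 1 / \<theta>) * (4 / s\<^sup>2 * ((\<epsilon> N)\<^sup>2 * a))"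
        using \<theta> k a A(2)[OF Lw(2)] by (subst (asm) ennreal_le_iff) auto
      also have "\<dots> \<le> (1 + \<theta>) * (k * A h) + \<eta>" using N[of N] by simp
      finally have 1: "a - 2 * \<eta> \<le> k * A h + \<theta> * (k * A h)" by (simp add: algebra_simps)
      have pk: "k * A (\<lambda>x. g m x - g n x) + 4 * (k * A h) = 2 * (k * A (g m)) + 2 * (k * A (g n))"
        using arg_cong[OF par, of "\<lambda>z. k * z"] by (simp add: algebra_simps)
      have "4 * (k * A h) \<le> 2 * (k * A (g m)) + 2 * (k * A (g n))"
        using pk k A(2)[OF dm] by (smt (verit) mult_nonneg_nonneg)
      then have "k * A h \<le> a" using gj[of m] gj[of n] by linarith
      then have "\<theta> * (k * A h) \<le> \<eta>" using \<theta> by (meson less_imp_le mult_left_mono order_trans)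
      then have "k * A (\<lambda>x. g m x - g n x) \<le> 12 * \<eta>" using 1 pk gj[of m] gj[of n] by linarith
      then have "A (\<lambda>x. g m x - g n x) \<le> \<delta>" using k by (simp add: \<eta>_def)
      then show ?thesis using A(1)[OF dm] by (simp add: ennreal_leI)
    qed
    then show ?thesis by blast
  qed
  from L2_complete[OF L(2) Cauchy] obtain G r where r: "strict_mono (r :: nat \<Rightarrow> nat)" and [measurable]: "G \<in> borel_measurable borel"
    and ae: "AE x in lborel. (\<lambda>n. g (r n) x) \<longlonglongrightarrow> G x" and glim: "(\<lambda>n. sq_norm (\<lambda>x. g n x - G x)) \<longlonglongrightarrow> 0"
    by blast
  have "ennreal k * sq_norm G = (\<integral>\<^sup>+x. liminf (\<lambda>n. ennreal (k * (norm (g (r n) x))\<^sup>2)) \<partial>lborel)"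
    unfolding sq_norm_def
  proof (subst nn_integral_cmult[symmetric])
    show "(\<integral>\<^sup>+x. ennreal k * ennreal ((norm (G x))\<^sup>2) \<partial>lborel) = (\<integral>\<^sup>+x. liminf (\<lambda>n. ennreal (k * (norm (g (r n) x))\<^sup>2)) \<partial>lborel)"
    proof (rule nn_integral_cong_AE)
      show "AE x in lborel. ennreal k * ennreal ((norm (G x))\<^sup>2) = liminf (\<lambda>n. ennreal (k * (norm (g (r n) x))\<^sup>2))"
        using ae
      proof eventually_elim
        case (elim x)
        have "(\<lambda>n. ennreal (k * (norm (g (r n) x))\<^sup>2)) \<longlonglongrightarrow> ennreal (k * (norm (G x))\<^sup>2)"
          by (intro tendsto_ennrealI tendsto_mult tendsto_const tendsto_power tendsto_norm elim)
        from lim_imp_Liminf[OF sequentially_bot this] show ?case using k by (simp add: ennreal_mult)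
      qed
    qed
  qed measurable
  also have "\<dots> \<le> liminf (\<lambda>n. \<integral>\<^sup>+x. ennreal (k * (norm (g (r n) x))\<^sup>2) \<partial>lborel)"
    by (rule nn_integral_liminf) measurable
  also have "\<dots> \<le> dirichlet u"
  proof (rule Liminf_le)
    have "(\<integral>\<^sup>+x. ennreal (k * (norm (g (r n) x))\<^sup>2) \<partial>lborel) = ennreal k * sq_norm (g (r n))" for n
      unfolding sq_norm_def using k by (subst nn_integral_cmult[symmetric]) (auto simp: ennreal_mult)
    then show "\<forall>\<^sub>F n in sequentially. (\<integral>\<^sup>+x. ennreal (k * (norm (g (r n) x))\<^sup>2) \<partial>lborel) \<le> dirichlet u"
      using gle unfolding k_def by simp
  qed simp
  finally have le: "ennreal k * sq_norm G \<le> dirichlet u" .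
  then have "ennreal k * sq_norm G < \<infinity>" using fin by (rule le_less_trans)
  then have "L2 G" using k by (auto simp: L2_def ennreal_mult_less_top)
  from has_wgrad_limit[OF g u this vlim glim] le show ?thesis unfolding k_def by blast
qed

section \<open>Riesz potentials of powers\<close>

text \<open>One scheme for both dyadic decompositions, with balls shrinking to the origin or growing
  to infinity: \<open>f\<close> is dominated by the sum of the constants \<open>c k\<close> on the
  balls of radius \<open>r k\<close>, whose integrals form a geometric series.\<close>

lemma nn_integral_geometric_cover:
  fixes f :: "'a::euclidean_space \<Rightarrow> real" and c :: "nat \<Rightarrow> real"
  assumes [measurable]: "f \<in> borel_measurable borel" 
    and cover: "\<And>z. f z \<noteq> 0 \<Longrightarrow> \<exists>k. norm z \<le> r k \<and> f z \<le> c k"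
    and r: "\<And>k. 0 \<le> r k" and c: "\<And>k. 0 \<le> c k" and le: "\<And>k. c k * r k ^ DIM('a) \<le> C * q ^ k"
    and q: "0 \<le> q" "q < 1" and C: "0 \<le> C"
  shows "(\<integral>\<^sup>+z. ennreal (f z) \<partial>lborel) < \<infinity>"
proof -
  define \<omega> where "\<omega> = unit_ball_vol (real DIM('a))"
  have \<omega>: "0 \<le> \<omega>" by (simp add: \<omega>_def)
  have "(\<integral>\<^sup>+z. ennreal (f z) \<partial>lborel) \<le> (\<integral>\<^sup>+z. (\<Sum>k. ennreal (c k) * indicator (cball 0 (r k)) (z::'a)) \<partial>lborel)"
  proof (rule nn_integral_mono)
    fix z :: 'a
    show "ennreal (f z) \<le> (\<Sum>k. ennreal (c k) * indicator (cball 0 (r k)) z)"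
    proof (cases "f z = 0")
      case False
      then obtain k where k: "norm z \<le> r k" "f z \<le> c k" using cover by blast
      have "ennreal (f z) \<le> (\<Sum>j\<in>{k}. ennreal (c j) * indicator (cball 0 (r j)) z)"
        using k by (simp add: ennreal_leI)
      also have "\<dots> \<le> (\<Sum>k. ennreal (c k) * indicator (cball 0 (r k)) z)"
        by (rule sum_le_suminf) auto
      finally show ?thesis .
    qed simp
  qed
  also have "\<dots> = (\<Sum>k. \<integral>\<^sup>+z. ennreal (c k) * indicator (cball 0 (r k)) (z::'a) \<partial>lborel)"
    by (rule nn_integral_suminf) (auto intro!: borel_measurable_indicator borel_measurable_times_ennreal)
  also have "\<dots> \<le> (\<Sum>k. ennreal (\<omega> * C * q ^ k))"
  proof (rule suminf_le)
    fix k
    have "(\<integral>\<^sup>+z. ennreal (c k) * indicator (cball 0 (r k)) (z::'a) \<partial>lborel) = ennreal (c k) * emeasure lborel (cball (0::'a) (r k))"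
      by (subst nn_integral_cmult) (auto intro!: borel_measurable_indicator)
    also have "\<dots> = ennreal (c k) * ennreal (\<omega> * r k ^ DIM('a))"
      using r by (simp add: emeasure_cball \<omega>_def)
    also have "\<dots> = ennreal (c k * (\<omega> * r k ^ DIM('a)))"
      by (rule ennreal_mult[symmetric]) (use c r \<omega> in auto)
    also have "\<dots> \<le> ennreal (\<omega> * C * q ^ k)"
      using mult_left_mono[OF le[of k] \<omega>] by (intro ennreal_leI) (simp add: mult_ac)
    finally show "(\<integral>\<^sup>+z. ennreal (c k) * indicator (cball 0 (r k)) (z::'a) \<partial>lborel) \<le> ennreal (\<omega> * C * q ^ k)" .
  qed auto
  also have "\<dots> = ennreal (\<Sum>k. \<omega> * C * q ^ k)"
    using \<omega> C q by (intro suminf_ennreal2) (auto intro!: summable_mult summable_geometric)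
  also have "\<dots> < \<infinity>" by simp
  finally show ?thesis .
qed

lemma dyadic_upper:
  fixes x :: real
  assumes "1 \<le> x"
  shows "\<exists>k::nat. 2 ^ k \<le> x \<and> x < 2 ^ Suc k"
proof -
  have "\<exists>n::nat. x < 2 ^ n" using real_arch_pow[of 2 x] by auto
  define n where "n = (LEAST n. x < 2 ^ n)"
  have n: "x < 2 ^ n" unfolding n_def by (rule LeastI_ex) fact
  then obtain k where k: "n = Suc k" using assms by (cases n) auto
  have "\<not> x < 2 ^ k" using not_less_Least[of k "\<lambda>n. x < 2 ^ n"] k n_def by simp
  then show ?thesis using n k by (intro exI[of _ k]) auto
qed

lemma power_powr_commute: "0 < x \<Longrightarrow> (x ^ n) powr q = (x powr q) ^ n" for x q :: real
  by (induction n) (auto simp: powr_mult)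

lemma power_integral_inner:
  assumes q: "0 \<le> q" "q < real DIM('a::euclidean_space)"
  shows "(\<integral>\<^sup>+z. ennreal (if norm (z::'a) \<le> 1 then norm z powr (- q) else 0) \<partial>lborel) < \<infinity>"
\<comment> \<open>The exponent \<open>Suc k\<close> belongs to the inner radius of the ring between
  \<open>(1/2) ^ Suc k\<close> and \<open>(1/2) ^ k\<close>, where the power is largest.\<close>
proof (rule nn_integral_geometric_cover[where r="\<lambda>k. (1/2) ^ k" and c="\<lambda>k. (2 powr q) ^ Suc k" and C="2 powr q" and q="2 powr (q - real DIM('a))"])
  show "(\<lambda>z::'a. if norm z \<le> 1 then norm z powr (- q) else 0) \<in> borel_measurable borel" by measurable
  fix z :: 'a assume nz: "(if norm z \<le> 1 then norm z powr (- q) else 0) \<noteq> 0"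
  then have z: "z \<noteq> 0" "norm z \<le> 1" by (auto split: if_splits)
  then obtain k where k: "2 ^ k \<le> 1 / norm z" "1 / norm z < 2 ^ Suc k"
    using dyadic_upper[of "1 / norm z"] by auto
  have "norm z \<le> (1/2) ^ k" using k(1) z by (simp add: field_simps power_one_over)
  moreover have "norm z powr (- q) = (1 / norm z) powr q"
    using z by (simp add: powr_minus_divide powr_divide)
  moreover have "(1 / norm z) powr q \<le> (2 ^ Suc k) powr q"
    using k(2) z q by (intro powr_mono2) auto
  moreover have "(2 ^ Suc k) powr q = (2 powr q) ^ Suc k"
    by (rule power_powr_commute) simp
  ultimately show "\<exists>k. norm z \<le> (1/2) ^ k \<and> (if norm z \<le> 1 then norm z powr (- q) else 0) \<le> (2 powr q) ^ Suc k"
    using z by (intro exI[of _ k]) simp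
next
  show "2 powr (q - real DIM('a)) < 1"
    using q by (simp add: powr_less_one)
  fix k
  have "(2 powr q) ^ Suc k * ((1/2) ^ k) ^ DIM('a) = 2 powr q * ((2 powr q) * (1/2) ^ DIM('a)) ^ k"
  proof -
    have "((1/2::real) ^ k) ^ DIM('a) = ((1/2) ^ DIM('a)) ^ k"
      by (simp only: power_mult[symmetric] mult.commute)
    then show ?thesis by (simp only: power_mult_distrib power_Suc mult_ac)
  qed
  also have "(2 powr q) * (1/2) ^ DIM('a) = 2 powr (q - real DIM('a))"
    by (simp add: powr_diff powr_realpow power_one_over)
  finally show "(2 powr q) ^ Suc k * ((1/2) ^ k) ^ DIM('a) \<le> 2 powr q * (2 powr (q - real DIM('a))) ^ k" by simp
qed auto

text \<open>The inner radius is 1/2 because the integral is needed on the region that keeps distance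
  1/2 from both singularities in \<open>riesz_potential_power\<close>.\<close>

lemma power_integral_outer:
  assumes q: "real DIM('a::euclidean_space) < q"
  shows "(\<integral>\<^sup>+z. ennreal (if 1 / 2 \<le> norm (z::'a) then norm z powr (- q) else 0) \<partial>lborel) < \<infinity>"
proof (rule nn_integral_geometric_cover[where r="\<lambda>k. 2 ^ k" and c="\<lambda>k. 2 powr q * (2 powr (- q)) ^ k" and C="2 powr q" and q="2 powr (real DIM('a) - q)"])
  show "(\<lambda>z::'a. if 1 / 2 \<le> norm z then norm z powr (- q) else 0) \<in> borel_measurable borel" by measurable
  fix z :: 'a assume nz: "(if 1 / 2 \<le> norm z then norm z powr (- q) else 0) \<noteq> 0"
  then have z: "1 / 2 \<le> norm z" by (auto split: if_splits)
  then obtain k where k: "2 ^ k \<le> 2 * norm z" "2 * norm z < 2 ^ Suc k"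
    using dyadic_upper[of "2 * norm z"] by auto
  have q0: "0 \<le> q" using q by (meson less_imp_le of_nat_0_le_iff order_trans)
  have "norm z \<le> 2 ^ k" using k(2) by simp
  moreover have "norm z powr (- q) = 2 powr q * (2 * norm z) powr (- q)"
    using z by (simp add: powr_mult powr_minus)
  moreover have "(2 * norm z) powr (- q) \<le> (2 ^ k) powr (- q)"
    using k(1) z q0 by (intro powr_mono2') auto
  moreover have "(2 ^ k) powr (- q) = (2 powr (- q)) ^ k"
    by (rule power_powr_commute) simp
  ultimately show "\<exists>k. norm z \<le> 2 ^ k \<and> (if 1 / 2 \<le> norm z then norm z powr (- q) else 0) \<le> 2 powr q * (2 powr (- q)) ^ k"
    using z by (intro exI[of _ k]) simp
next
  show "2 powr (real DIM('a) - q) < 1"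
    using q by (simp add: powr_less_one)
  fix k
  have "2 powr q * (2 powr (- q)) ^ k * (2 ^ k) ^ DIM('a) = 2 powr q * (2 powr (- q) * 2 ^ DIM('a)) ^ k"
  proof -
    have "((2::real) ^ k) ^ DIM('a) = (2 ^ DIM('a)) ^ k"
      by (simp only: power_mult[symmetric] mult.commute)
    then show ?thesis by (simp only: power_mult_distrib mult_ac)
  qed
  also have "2 powr (- q) * 2 ^ DIM('a) = 2 powr (real DIM('a) - q)"
    by (simp add: powr_diff powr_realpow powr_minus_divide)
  finally show "2 powr q * (2 powr (- q)) ^ k * (2 ^ k) ^ DIM('a) \<le> 2 powr q * (2 powr (real DIM('a) - q)) ^ k" by simp
qed auto

text \<open>Scaling reduces the claim to unit vectors, where the integral has a bound independent of
  the direction. The conditions \<open>t < N\<close> and \<open>s < N\<close> make the singularities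
  at 0 and at \<open>x\<close> integrable, and \<open>N < t + s\<close> gives decay at
  infinity.\<close>

lemma riesz_potential_power:
  assumes ts: "0 < t" "0 < s" "t < real DIM('a::euclidean_space)" "s < real DIM('a)" "real DIM('a) < t + s"
  shows "\<exists>C\<ge>0. \<forall>x::'a. x \<noteq> 0 \<longrightarrow> (\<integral>\<^sup>+y. ennreal (norm y powr (- t) * norm (x - y) powr (- s)) \<partial>lborel)
     \<le> ennreal (C * norm x powr (real DIM('a) - t - s))"
proof -
  let ?I = "\<lambda>q z::'a. if norm z \<le> 1 then norm z powr (- q) else 0"
  let ?O = "\<lambda>q z::'a. if 1 / 2 \<le> norm z then norm z powr (- q) else 0"
  have fin: "(\<integral>\<^sup>+z. ennreal (?I t z) \<partial>lborel) < \<infinity>" "(\<integral>\<^sup>+z. ennreal (?I s z) \<partial>lborel) < \<infinity>" "(\<integral>\<^sup>+z. ennreal (?O (t + s) z) \<partial>lborel) < \<infinity>"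
    using ts power_integral_inner[of t, where 'a='a] power_integral_inner[of s, where 'a='a]
      power_integral_outer[of "t + s", where 'a='a] by linarith+
  \<comment> \<open>One summand for each region: near 0, near the unit vector, and away from both.
    The factors bound the power that is not singular in that region.\<close>
  define B where "B = ennreal (2 powr s) * (\<integral>\<^sup>+z. ennreal (?I t z) \<partial>lborel) + ennreal (2 powr t) * (\<integral>\<^sup>+z. ennreal (?I s z) \<partial>lborel)
     + ennreal (3 powr s) * (\<integral>\<^sup>+z. ennreal (?O (t + s) z) \<partial>lborel)"
  have "B < \<infinity>" using fin by (simp add: B_def ennreal_mult_less_top)
  then obtain C where C: "B = ennreal C" "0 \<le> C" by (cases B) auto
  have unit: "(\<integral>\<^sup>+z. ennreal (norm z powr (- t) * norm (e - z) powr (- s)) \<partial>lborel) \<le> ennreal C" if e: "norm e = 1" for e :: 'a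
  proof -
    have "(\<integral>\<^sup>+z. ennreal (norm z powr (- t) * norm (e - z) powr (- s)) \<partial>lborel)
      \<le> (\<integral>\<^sup>+z. ennreal (2 powr s) * ennreal (?I t z) + ennreal (2 powr t) * ennreal (?I s (e - z)) + ennreal (3 powr s) * ennreal (?O (t + s) z) \<partial>lborel)"
    proof (rule nn_integral_mono)
      fix z :: 'a
      have pos: "0 \<le> 2 powr s * ?I t z" "0 \<le> 2 powr t * ?I s (e - z)" "0 \<le> 3 powr s * ?O (t + s) z" by auto
      have "norm z powr (- t) * norm (e - z) powr (- s) \<le> 2 powr s * ?I t z + 2 powr t * ?I s (e - z) + 3 powr s * ?O (t + s) z"
      proof -
        consider "norm z < 1/2" | "norm (e - z) < 1/2" | "1/2 \<le> norm z" "1/2 \<le> norm (e - z)" by linarith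
        then show ?thesis
        proof cases
          case 1
          then have "1/2 \<le> norm (e - z)" using norm_triangle_ineq2[of e z] e by linarith
          then have "norm (e - z) powr (- s) \<le> (1/2) powr (- s)" using ts by (intro powr_mono2') auto
          also have "\<dots> = 2 powr s" by (simp add: powr_minus_divide powr_divide)
          finally have "norm z powr (- t) * norm (e - z) powr (- s) \<le> norm z powr (- t) * 2 powr s" by (intro mult_left_mono) auto
          also have "\<dots> = 2 powr s * ?I t z" using 1 by (simp add: mult.commute)
          finally show ?thesis using pos by linarith
        next
          case 2
          then have "1/2 \<le> norm z" using norm_triangle_sub[of e z] e by linarith
          then have "norm z powr (- t) \<le> (1/2) powr (- t)" using ts by (intro powr_mono2') auto
          also have "\<dots> = 2 powr t" by (simp add: powr_minus_divide powr_divide)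
          finally have "norm z powr (- t) * norm (e - z) powr (- s) \<le> 2 powr t * norm (e - z) powr (- s)" by (intro mult_right_mono) auto
          also have "\<dots> = 2 powr t * ?I s (e - z)" using 2 by simp
          finally show ?thesis using pos by linarith
        next
          case 3
          \<comment> \<open>The norm of \<open>z\<close> is at most \<open>1 + norm (e - z)\<close>,
            and 1 is at most \<open>2 * norm (e - z)\<close> in this region.\<close>
          have "norm z \<le> 3 * norm (e - z)" using norm_triangle_sub[of z e] e 3 by (simp add: norm_minus_commute)
          then have "norm (e - z) powr (- s) \<le> (norm z / 3) powr (- s)" using ts 3 by (intro powr_mono2') auto
          also have "\<dots> = 3 powr s * norm z powr (- s)" using 3 by (simp add: powr_minus_divide powr_divide)
          finally have "norm z powr (- t) * norm (e - z) powr (- s) \<le> norm z powr (- t) * (3 powr s * norm z powr (- s))" by (intro mult_left_mono) auto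
          also have "\<dots> = 3 powr s * ?O (t + s) z" using 3 by (simp add: powr_add[symmetric])
          finally show ?thesis using pos by linarith
        qed
      qed
      then have "ennreal (norm z powr (- t) * norm (e - z) powr (- s)) \<le> ennreal (2 powr s * ?I t z + 2 powr t * ?I s (e - z) + 3 powr s * ?O (t + s) z)"
        by (rule ennreal_leI)
      also have "\<dots> = ennreal (2 powr s * ?I t z) + ennreal (2 powr t * ?I s (e - z)) + ennreal (3 powr s * ?O (t + s) z)"
        using pos by (simp add: ennreal_plus del: mult_eq_0_iff)
      also have "\<dots> = ennreal (2 powr s) * ennreal (?I t z) + ennreal (2 powr t) * ennreal (?I s (e - z)) + ennreal (3 powr s) * ennreal (?O (t + s) z)"
        by (simp add: ennreal_mult)
      finally show "ennreal (norm z powr (- t) * norm (e - z) powr (- s)) \<le> ennreal (2 powr s) * ennreal (?I t z) + ennreal (2 powr t) * ennreal (?I s (e - z)) + ennreal (3 powr s) * ennreal (?O (t + s) z)" .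
    qed
    also have "\<dots> = ennreal (2 powr s) * (\<integral>\<^sup>+z. ennreal (?I t z) \<partial>lborel) + ennreal (2 powr t) * (\<integral>\<^sup>+z. ennreal (?I s (e - z)) \<partial>lborel)
     + ennreal (3 powr s) * (\<integral>\<^sup>+z. ennreal (?O (t + s) z) \<partial>lborel)"
      by (simp add: nn_integral_add nn_integral_cmult)
    also have "(\<integral>\<^sup>+z. ennreal (?I s (e - z)) \<partial>lborel) = (\<integral>\<^sup>+z. ennreal (?I s z) \<partial>lborel)"
      by (rule nn_integral_lborel_shift(4)[where f="\<lambda>z. ennreal (?I s z)"]) measurable
    finally show ?thesis unfolding C(1)[symmetric] B_def .
  qed
  have "(\<integral>\<^sup>+y. ennreal (norm y powr (- t) * norm (x - y) powr (- s)) \<partial>lborel) \<le> ennreal (C * norm x powr (real DIM('a) - t - s))" if x: "x \<noteq> 0" for x :: 'a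
  proof -
    define r where "r = norm x"
    have r: "0 < r" using x by (simp add: r_def)
    have "(\<integral>\<^sup>+y. ennreal (norm y powr (- t) * norm (x - y) powr (- s)) \<partial>lborel)
      = ennreal (r ^ DIM('a)) * (\<integral>\<^sup>+z. ennreal (norm (r *\<^sub>R z) powr (- t) * norm (x - r *\<^sub>R z) powr (- s)) \<partial>lborel)"
      using nn_integral_lborel_affine[of "\<lambda>y. ennreal (norm y powr (- t) * norm (x - y) powr (- s))" r 0] r by simp
    also have "(\<integral>\<^sup>+z. ennreal (norm (r *\<^sub>R z) powr (- t) * norm (x - r *\<^sub>R z) powr (- s)) \<partial>lborel)
      = (\<integral>\<^sup>+z. ennreal (r powr (- t - s)) * ennreal (norm z powr (- t) * norm (x /\<^sub>R r - z) powr (- s)) \<partial>lborel)"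
    proof (rule nn_integral_cong)
      fix z
      have "x - r *\<^sub>R z = r *\<^sub>R (x /\<^sub>R r - z)" using r by (simp add: scaleR_diff_right)
      then have "norm (x - r *\<^sub>R z) = r * norm (x /\<^sub>R r - z)" using r by (metis norm_scaleR abs_of_pos)
      then have "norm (r *\<^sub>R z) powr (- t) * norm (x - r *\<^sub>R z) powr (- s) = r powr (- t - s) * (norm z powr (- t) * norm (x /\<^sub>R r - z) powr (- s))"
        using r by (simp add: powr_mult powr_diff powr_minus divide_inverse mult_ac)
      then show "ennreal (norm (r *\<^sub>R z) powr (- t) * norm (x - r *\<^sub>R z) powr (- s)) = ennreal (r powr (- t - s)) * ennreal (norm z powr (- t) * norm (x /\<^sub>R r - z) powr (- s))"
        by (simp add: ennreal_mult)
    qed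
    also have "\<dots> = ennreal (r powr (- t - s)) * (\<integral>\<^sup>+z. ennreal (norm z powr (- t) * norm (x /\<^sub>R r - z) powr (- s)) \<partial>lborel)"
      by (rule nn_integral_cmult) measurable
    also have "ennreal (r ^ DIM('a)) * \<dots> \<le> ennreal (r ^ DIM('a)) * (ennreal (r powr (- t - s)) * ennreal C)"
      using x by (intro mult_left_mono unit) (auto simp: r_def)
    also have "\<dots> = ennreal (r ^ DIM('a) * (r powr (- t - s) * C))"
      using r C by (simp add: ennreal_mult)
    also have "r ^ DIM('a) * (r powr (- t - s) * C) = C * r powr (real DIM('a) - t - s)"
      using r by (simp add: powr_realpow[symmetric] powr_add[symmetric] powr_diff divide_inverse powr_minus mult_ac)
    finally show ?thesis unfolding r_def .
  qed
  then show ?thesis using C by blast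
qed

lemma ennreal_le_plusI: "a \<le> b + c \<Longrightarrow> 0 \<le> b \<Longrightarrow> 0 \<le> c \<Longrightarrow> ennreal a \<le> ennreal b + ennreal c"
  using ennreal_leI[of a "b + c"] by simp

text \<open>A Schur test with a power weight: the product is split by the inequality of arithmetic
  and geometric means so that one variable can be integrated with
  \<open>riesz_potential_power\<close>. What remains is the integral of
  \<open>(\<phi> x)\<^sup>2 * norm x powr \<alpha>\<close>, which converges at 0 and at infinity by
  the two conditions on \<open>a\<close> and \<open>b\<close>.\<close>

lemma riesz_power_finite:
  fixes a b \<alpha> :: real and \<phi> :: "'a::euclidean_space \<Rightarrow> real"
  assumes \<alpha>: "0 < \<alpha>" "\<alpha> < real DIM('a)" and ab: "2 * a < real DIM('a) + \<alpha>" "real DIM('a) + \<alpha> < 2 * b"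
    and [measurable]: "\<phi> \<in> borel_measurable borel" and \<phi>0: "\<And>x. 0 \<le> \<phi> x"
    and \<phi>a: "\<And>x. x \<noteq> 0 \<Longrightarrow> norm x \<le> 1 \<Longrightarrow> \<phi> x \<le> norm x powr (- a)"
    and \<phi>b: "\<And>x. 1 \<le> norm x \<Longrightarrow> \<phi> x \<le> norm x powr (- b)"
  shows "(\<integral>\<^sup>+x. \<integral>\<^sup>+y. ennreal (\<phi> x * \<phi> y / norm (x - y) powr (real DIM('a) - \<alpha>)) \<partial>lborel \<partial>lborel) < \<infinity>"
proof -
  define N where "N = real DIM('a)"
  \<comment> \<open>Any exponent strictly between \<open>\<alpha>\<close> and \<open>N\<close> would
    serve as weight; this is the midpoint.\<close>
  define t where "t = (N + \<alpha>) / 2"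
  have t: "\<alpha> < t" "t < N" "0 < t" using \<alpha> by (auto simp: t_def N_def)
  define s where "s = N - \<alpha>"
  have s: "0 < s" "s < N" "N < t + s" using \<alpha> t by (auto simp: s_def N_def)
  obtain C where C: "0 \<le> C" "\<And>x::'a. x \<noteq> 0 \<Longrightarrow> (\<integral>\<^sup>+y. ennreal (norm y powr (- t) * norm (x - y) powr (- s)) \<partial>lborel)
     \<le> ennreal (C * norm x powr (N - t - s))"
    using riesz_potential_power[of t s, where 'a='a] t s unfolding N_def by blast
  let ?W = "\<lambda>x y::'a. (\<phi> x)\<^sup>2 * (norm x powr t * norm y powr (- t)) * norm (x - y) powr (- s)"
  let ?J = "\<integral>\<^sup>+x. \<integral>\<^sup>+y. ennreal (?W x y) \<partial>lborel \<partial>lborel"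
  have ne: "AE x in lborel. x \<noteq> (0::'a)" by (rule AE_lborel_singleton)
  have "(\<integral>\<^sup>+x. \<integral>\<^sup>+y. ennreal (\<phi> x * \<phi> y / norm (x - y) powr s) \<partial>lborel \<partial>lborel) \<le> (\<integral>\<^sup>+x. \<integral>\<^sup>+y. ennreal (?W x y) + ennreal (?W y x) \<partial>lborel \<partial>lborel)"
  proof (rule nn_integral_mono_AE, use ne in eventually_elim)
    case (elim x)
    show ?case
    proof (rule nn_integral_mono_AE, use ne in eventually_elim)
      case (elim y)
      \<comment> \<open>The weight of the Schur test, applied to the two factors as \<open>c\<close>
        and \<open>1 / c\<close>; its square is the quotient of the two powers in
        \<open>?W\<close>.\<close>
      define c where "c = norm x powr (t/2) * norm y powr (- (t/2))"
      have c: "0 < c" using \<open>x \<noteq> 0\<close> \<open>y \<noteq> 0\<close> by (simp add: c_def)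
      have sq: "(norm z powr (r / 2))\<^sup>2 = norm z powr r" for z :: 'a and r
        by (simp add: power2_eq_square powr_add[symmetric])
      have c2: "c\<^sup>2 = norm x powr t * norm y powr (- t)"
        unfolding c_def power_mult_distrib sq using sq[of y "- t"] by simp
      have c3: "(1 / c)\<^sup>2 = norm y powr t * norm x powr (- t)"
        unfolding power_divide c2 by (simp add: powr_minus_divide)
      have "2 * (\<phi> x * \<phi> y) = 2 * (\<phi> x * c) * (\<phi> y * (1 / c))" using c by simp
      also have "\<dots> \<le> (\<phi> x * c)\<^sup>2 + (\<phi> y * (1 / c))\<^sup>2" by (rule sum_squares_bound)
      finally have "\<phi> x * \<phi> y \<le> (\<phi> x)\<^sup>2 * c\<^sup>2 + (\<phi> y)\<^sup>2 * (1 / c)\<^sup>2"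
        using mult_nonneg_nonneg[OF \<phi>0[of x] \<phi>0[of y]] unfolding power_mult_distrib by linarith
      then have "\<phi> x * \<phi> y * norm (x - y) powr (- s) \<le> ((\<phi> x)\<^sup>2 * c\<^sup>2 + (\<phi> y)\<^sup>2 * (1 / c)\<^sup>2) * norm (x - y) powr (- s)"
        by (rule mult_right_mono) simp
      then have "\<phi> x * \<phi> y / norm (x - y) powr s \<le> ?W x y + ?W y x"
        unfolding c2 c3 by (simp add: powr_minus divide_inverse algebra_simps norm_minus_commute)
      then show "ennreal (\<phi> x * \<phi> y / norm (x - y) powr s) \<le> ennreal (?W x y) + ennreal (?W y x)"
        by (rule ennreal_le_plusI) simp_all
    qed
  qed
  also have "\<dots> = ?J + (\<integral>\<^sup>+x. \<integral>\<^sup>+y. ennreal (?W y x) \<partial>lborel \<partial>lborel)"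
    by (simp add: nn_integral_add)
  also have "(\<integral>\<^sup>+x. \<integral>\<^sup>+y. ennreal (?W y x) \<partial>lborel \<partial>lborel) = ?J"
    by (rule lborel_pair.Fubini') measurable
  also have "?J + ?J < \<infinity>"
  proof -
    \<comment> \<open>The bound at the origin is stated for nonnegative exponents. Raising the
      exponent to 0 only enlarges the power inside the unit ball.\<close>
    define q where "q = max 0 (2 * a - \<alpha>)"
    define q' where "q' = 2 * b - \<alpha>"
    let ?I = "\<lambda>z::'a. if norm z \<le> 1 then norm z powr (- q) else 0"
    let ?O = "\<lambda>z::'a. if 1 / 2 \<le> norm z then norm z powr (- q') else 0"
    have fin: "(\<integral>\<^sup>+z. ennreal (?I z) \<partial>lborel) < \<infinity>" "(\<integral>\<^sup>+z. ennreal (?O z) \<partial>lborel) < \<infinity>"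
      using ab power_integral_inner[of q, where 'a='a] power_integral_outer[of q', where 'a='a] \<alpha>
      by (simp_all add: q_def q'_def)
    have "?J \<le> (\<integral>\<^sup>+x. ennreal C * (ennreal (?I x) + ennreal (?O x)) \<partial>lborel)"
    proof (rule nn_integral_mono_AE, use ne in eventually_elim)
      case (elim x)
      have nx: "0 < norm x" using elim by simp
      have "(\<integral>\<^sup>+y. ennreal (?W x y) \<partial>lborel) = (\<integral>\<^sup>+y. ennreal ((\<phi> x)\<^sup>2 * norm x powr t) * ennreal (norm y powr (- t) * norm (x - y) powr (- s)) \<partial>lborel)"
        by (intro nn_integral_cong) (simp add: mult_ac flip: ennreal_mult)
      also have "\<dots> = ennreal ((\<phi> x)\<^sup>2 * norm x powr t) * (\<integral>\<^sup>+y. ennreal (norm y powr (- t) * norm (x - y) powr (- s)) \<partial>lborel)"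
        by (rule nn_integral_cmult) measurable
      also have "\<dots> \<le> ennreal ((\<phi> x)\<^sup>2 * norm x powr t) * ennreal (C * norm x powr (N - t - s))"
        by (intro mult_left_mono C elim) simp
      also have "\<dots> = ennreal (((\<phi> x)\<^sup>2 * norm x powr t) * (C * norm x powr (N - t - s)))"
        by (rule ennreal_mult[symmetric]) (use C in auto)
      also have "((\<phi> x)\<^sup>2 * norm x powr t) * (C * norm x powr (N - t - s)) = C * ((\<phi> x)\<^sup>2 * norm x powr \<alpha>)"
      proof -
        have "norm x powr t * norm x powr (N - t - s) = norm x powr \<alpha>"
          unfolding powr_add[symmetric] by (simp add: s_def)
        then show ?thesis by (simp add: mult_ac)
      qed
      also have "ennreal (C * ((\<phi> x)\<^sup>2 * norm x powr \<alpha>)) \<le> ennreal (C * (?I x + ?O x))"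
      proof (intro ennreal_leI mult_left_mono C)
        show "(\<phi> x)\<^sup>2 * norm x powr \<alpha> \<le> ?I x + ?O x"
        proof (cases "norm x \<le> 1")
          case True
          have "(\<phi> x)\<^sup>2 \<le> (norm x powr (- a))\<^sup>2"
            by (intro power_mono \<phi>a \<phi>0) (use elim True in auto)
          then have "(\<phi> x)\<^sup>2 * norm x powr \<alpha> \<le> (norm x powr (- a))\<^sup>2 * norm x powr \<alpha>" by (rule mult_right_mono) simp
          also have "\<dots> = norm x powr (- (2 * a - \<alpha>))" unfolding power2_eq_square powr_add[symmetric] by simp
          also have "\<dots> \<le> norm x powr (- q)" using True nx by (intro powr_mono') (auto simp: q_def)
          finally show ?thesis using True by (auto intro: order_trans)
        next
          case False
          have "(\<phi> x)\<^sup>2 \<le> (norm x powr (- b))\<^sup>2"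
            by (intro power_mono \<phi>b \<phi>0) (use False in auto)
          then have "(\<phi> x)\<^sup>2 * norm x powr \<alpha> \<le> (norm x powr (- b))\<^sup>2 * norm x powr \<alpha>" by (rule mult_right_mono) simp
          also have "\<dots> = norm x powr (- q')" unfolding power2_eq_square powr_add[symmetric] by (simp add: q'_def)
          finally show ?thesis using False by simp
        qed
      qed
      also have "\<dots> = ennreal C * (ennreal (?I x) + ennreal (?O x))"
        using C by (simp add: ennreal_mult ennreal_plus)
      finally show "(\<integral>\<^sup>+y. ennreal (?W x y) \<partial>lborel) \<le> ennreal C * (ennreal (?I x) + ennreal (?O x))" .
    qed
    also have "\<dots> = ennreal C * ((\<integral>\<^sup>+z. ennreal (?I z) \<partial>lborel) + (\<integral>\<^sup>+z. ennreal (?O z) \<partial>lborel))"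
      by (simp add: nn_integral_cmult nn_integral_add)
    also have "\<dots> < \<infinity>" using fin by (simp add: ennreal_mult_less_top)
    finally show ?thesis by simp
  qed
  finally show ?thesis unfolding s_def N_def .
qed

section \<open>Radially decreasing functions\<close>

text \<open>Points of equal norm satisfy both inequalities, so radial symmetry is included.\<close>

definition radial_decr :: "('a::euclidean_space \<Rightarrow> real) \<Rightarrow> bool" where
  "radial_decr g \<longleftrightarrow> (\<forall>x y. norm x \<le> norm y \<longrightarrow> g y \<le> g x)"

lemma radial_decrD: "radial_decr g \<Longrightarrow> norm x \<le> norm y \<Longrightarrow> g y \<le> g x"
  by (simp add: radial_decr_def)

text \<open>The part of the weight in \<open>dq_energy\<close> that belongs to long displacements.
  Such displacements carry a ball around the origin entirely outside a larger one, which forces a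
  radially decreasing function to drop.\<close>

definition ring_mass :: "'a::euclidean_space itself \<Rightarrow> real" where
  "ring_mass _ = enn2real (\<integral>\<^sup>+h. ennreal (ker 1 (h::'a)) * indicator {h. 1/2 < norm h} h \<partial>lborel)"

lemma ring_mass_props:
  "(\<integral>\<^sup>+h. ennreal (ker 1 (h::'a::euclidean_space)) * indicator {h. 1/2 < norm h} h \<partial>lborel) = ennreal (ring_mass TYPE('a))"
  "0 < ring_mass TYPE('a)"
proof -
  let ?M = "\<integral>\<^sup>+h. ennreal (ker 1 (h::'a)) * indicator {h. 1/2 < norm h} h \<partial>lborel"
  have op: "open {h::'a. 1/2 < norm h}" by (intro open_Collect_less continuous_intros)
  then have [measurable]: "{h::'a. 1/2 < norm h} \<in> sets borel" by simp
  have "?M \<le> (\<integral>\<^sup>+h. ennreal (ker 1 (h::'a)) \<partial>lborel)"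
    by (intro nn_integral_mono) (simp add: indicator_def)
  then have fin: "?M < \<infinity>" unfolding nn_integral_ker by (simp add: le_less_trans)
  then show eq: "?M = ennreal (ring_mass TYPE('a))" by (simp add: ring_mass_def)
  obtain b :: 'a where b: "b \<in> Basis" using nonempty_Basis by blast
  have "0 < ?M"
  proof (rule nn_integral_pos_open[of _ "{h. 1/2 < norm h} \<inter> ball 0 1"])
    show "open ({h::'a. 1/2 < norm h} \<inter> ball 0 1)" using op by (intro open_Int) auto
    have "(3/4) *\<^sub>R b \<in> {h. 1/2 < norm h} \<inter> ball 0 1" using b by simp
    then show "{h::'a. 1/2 < norm h} \<inter> ball 0 1 \<noteq> {}" by blast
  qed (auto simp: ker_pos_iff indicator_def)
  then show "0 < ring_mass TYPE('a)" unfolding eq by simp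
qed

lemma nn_integral_cball_const:
  fixes c :: real
  assumes "0 \<le> c" "0 \<le> r"
  shows "(\<integral>\<^sup>+x. ennreal c * indicator (cball (0::'a::euclidean_space) r) x \<partial>lborel) = ennreal (c * (unit_ball_vol (real DIM('a)) * r ^ DIM('a)))"
proof -
  have "(\<integral>\<^sup>+x. ennreal c * indicator (cball (0::'a) r) x \<partial>lborel) = ennreal c * emeasure lborel (cball (0::'a) r)"
    by (subst nn_integral_cmult) (auto intro!: borel_measurable_indicator)
  also have "\<dots> = ennreal (c * (unit_ball_vol (real DIM('a)) * r ^ DIM('a)))"
    using assms by (simp add: emeasure_cball ennreal_mult)
  finally show ?thesis .
qed

text \<open>On the ball of radius \<open>norm x\<close> the function is at least
  \<open>g x\<close>.\<close>

lemma radial_decr_L2_bound: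
  fixes g :: "'a::euclidean_space \<Rightarrow> real"
  assumes g: "radial_decr g" "\<And>x. 0 \<le> g x" and [measurable]: "g \<in> borel_measurable borel" and A: "sq_norm g \<le> ennreal A" "0 \<le> A"
  shows "(g x)\<^sup>2 * (unit_ball_vol (real DIM('a)) * norm x ^ DIM('a)) \<le> A"
proof -
  have "ennreal ((g x)\<^sup>2 * (unit_ball_vol (real DIM('a)) * norm x ^ DIM('a))) = (\<integral>\<^sup>+y. ennreal ((g x)\<^sup>2) * indicator (cball (0::'a) (norm x)) y \<partial>lborel)"
    by (rule nn_integral_cball_const[symmetric]) auto
  also have "\<dots> \<le> sq_norm g"
    unfolding sq_norm_def
  proof (rule nn_integral_mono)
    fix y
    show "ennreal ((g x)\<^sup>2) * indicator (cball 0 (norm x)) y \<le> ennreal ((norm (g y))\<^sup>2)"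
      using radial_decrD[OF g(1), of y x] g(2)[of x] by (auto simp: indicator_def intro!: ennreal_leI power_mono)
  qed
  finally show ?thesis using A by (meson ennreal_le_iff order_trans)
qed

text \<open>A displacement that carries the ball of radius \<open>norm x\<close> beyond radius
  \<open>2 * norm x\<close> changes \<open>g\<close> by at least
  \<open>g x - g (2 *\<^sub>R x)\<close> at every point of the ball. The energy at one suitable
  scale sees all these displacements.\<close>

lemma radial_decr_step_bound:
  fixes g :: "'a::euclidean_space \<Rightarrow> real"
  assumes g: "radial_decr g" and [measurable]: "g \<in> borel_measurable borel" and E: "dirichlet g \<le> ennreal E" "0 \<le> E" and x: "x \<noteq> 0"
  shows "(g x - g (2 *\<^sub>R x))\<^sup>2 * (ring_mass TYPE('a) * unit_ball_vol (real DIM('a)) * norm x ^ DIM('a)) \<le> 64 * (norm x)\<^sup>2 * E"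
proof -
  define r where "r = norm x"
  \<comment> \<open>With \<open>1/2 < norm h\<close> the displacement is longer than
    \<open>4 * r\<close>, hence it ends outside radius \<open>3 * r\<close>; the factor 64 in the
    claim is the square of 8.\<close>
  define s where "s = 8 * r"
  have r: "0 < r" "0 < s" using x by (auto simp: r_def s_def)
  define c where "c = ((g x - g (2 *\<^sub>R x)) / s)\<^sup>2"
  have [measurable]: "{h::'a. 1/2 < norm h} \<in> sets borel"
    by (intro borel_open open_Collect_less continuous_intros)
  have "ennreal (ring_mass TYPE('a)) * ennreal (c * (unit_ball_vol (real DIM('a)) * r ^ DIM('a)))
    = (\<integral>\<^sup>+h. ennreal (ker 1 (h::'a)) * indicator {h. 1/2 < norm h} h * ennreal (c * (unit_ball_vol (real DIM('a)) * r ^ DIM('a))) \<partial>lborel)"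
    unfolding ring_mass_props(1)[symmetric] by (rule nn_integral_multc[symmetric]) measurable
  also have "\<dots> \<le> dq_energy s g"
    unfolding dq_energy_def
  proof (rule nn_integral_mono)
    fix h :: 'a
    show "ennreal (ker 1 h) * indicator {h. 1/2 < norm h} h * ennreal (c * (unit_ball_vol (real DIM('a)) * r ^ DIM('a)))
      \<le> (\<integral>\<^sup>+x. ennreal (ker 1 h * ((g (x + s *\<^sub>R h) - g x) / s)\<^sup>2) \<partial>lborel)"
    proof (cases "1/2 < norm h")
      case True
      have "ennreal (ker 1 h) * ennreal (c * (unit_ball_vol (real DIM('a)) * r ^ DIM('a))) = ennreal (ker 1 h * c * (unit_ball_vol (real DIM('a)) * r ^ DIM('a)))"
        using r by (subst ennreal_mult[symmetric]) (auto simp: c_def mult.assoc)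
      also have "\<dots> = (\<integral>\<^sup>+y. ennreal (ker 1 h * c) * indicator (cball (0::'a) r) y \<partial>lborel)"
        using r by (intro nn_integral_cball_const[symmetric]) (auto simp: c_def)
      also have "\<dots> \<le> (\<integral>\<^sup>+x. ennreal (ker 1 h * ((g (x + s *\<^sub>R h) - g x) / s)\<^sup>2) \<partial>lborel)"
      proof (rule nn_integral_mono)
        fix y :: 'a
        show "ennreal (ker 1 h * c) * indicator (cball 0 r) y \<le> ennreal (ker 1 h * ((g (y + s *\<^sub>R h) - g y) / s)\<^sup>2)"
        proof (cases "norm y \<le> r")
          case yr: True
          have "4 * r \<le> norm (s *\<^sub>R h)" using True r by (simp add: s_def)
          moreover have "norm (s *\<^sub>R h) - norm y \<le> norm (y + s *\<^sub>R h)"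
            using norm_diff_ineq[of "s *\<^sub>R h" y] by (simp add: add.commute)
          moreover have "norm (2 *\<^sub>R x) = 2 * r" by (simp add: r_def)
          ultimately have "norm (2 *\<^sub>R x) \<le> norm (y + s *\<^sub>R h)" using yr r by linarith
          then have "g (y + s *\<^sub>R h) \<le> g (2 *\<^sub>R x)" by (rule radial_decrD[OF g])
          moreover have "g x \<le> g y" using yr by (intro radial_decrD[OF g]) (simp add: r_def)
          moreover have "g (2 *\<^sub>R x) \<le> g x" by (intro radial_decrD[OF g]) simp
          ultimately have "\<bar>(g x - g (2 *\<^sub>R x)) / s\<bar> \<le> \<bar>(g (y + s *\<^sub>R h) - g y) / s\<bar>"
            unfolding abs_divide using r by (intro divide_right_mono) auto
          then have "c \<le> ((g (y + s *\<^sub>R h) - g y) / s)\<^sup>2" unfolding c_def by (simp only: abs_le_square_iff)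
          then show ?thesis using yr by (simp add: ennreal_leI mult_left_mono)
        qed simp
      qed
      finally show ?thesis using True by simp
    qed simp
  qed
  also have "\<dots> \<le> ennreal E" by (rule order_trans[OF dq_le_dirichlet[OF r(2)] E(1)])
  finally have "ennreal (ring_mass TYPE('a) * (c * (unit_ball_vol (real DIM('a)) * r ^ DIM('a)))) \<le> ennreal E"
    using r ring_mass_props(2)[where 'a='a] by (subst ennreal_mult) (auto simp: c_def)
  then have "ring_mass TYPE('a) * (c * (unit_ball_vol (real DIM('a)) * r ^ DIM('a))) \<le> E"
    using E by simp
  then have "s\<^sup>2 * (ring_mass TYPE('a) * (c * (unit_ball_vol (real DIM('a)) * r ^ DIM('a)))) \<le> s\<^sup>2 * E"
    by (rule mult_left_mono) simp
  moreover have "s\<^sup>2 * c = (g x - g (2 *\<^sub>R x))\<^sup>2" using r by (simp add: c_def power_divide)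
  moreover have "s\<^sup>2 = 64 * (norm x)\<^sup>2" by (simp add: s_def r_def power_mult_distrib)
  moreover have "s\<^sup>2 * (ring_mass TYPE('a) * (c * (unit_ball_vol (real DIM('a)) * r ^ DIM('a)))) = (s\<^sup>2 * c) * (ring_mass TYPE('a) * unit_ball_vol (real DIM('a)) * r ^ DIM('a))"
    by (simp only: mult_ac)
  ultimately show ?thesis unfolding r_def by (simp only:)
qed

text \<open>The polynomial decay of radially decreasing functions replaces compact Sobolev embeddings.\<close>
lemma radial_bound:
  assumes dim: "DIM('a::euclidean_space) \<ge> 3" and A: "0 \<le> A" "0 \<le> E"
  shows "\<exists>C>0. \<forall>g :: 'a \<Rightarrow> real. radial_decr g \<longrightarrow> (\<forall>x. 0 \<le> g x) \<longrightarrow> g \<in> borel_measurable borel \<longrightarrow> sq_norm g \<le> ennreal A \<longrightarrow> dirichlet g \<le> ennreal E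
     \<longrightarrow> (\<forall>x. x \<noteq> 0 \<longrightarrow> g x \<le> C * norm x powr (- (real DIM('a) / 2)) \<and> g x \<le> C * norm x powr (1 - real DIM('a) / 2))"
proof -
  define N where "N = real DIM('a)"
  define \<omega> where "\<omega> = unit_ball_vol N"
  define m where "m = ring_mass TYPE('a)"
  have \<omega>: "0 < \<omega>" "0 < m" unfolding \<omega>_def N_def m_def using ring_mass_props(2) by auto
  define \<beta> where "\<beta> = N / 2 - 1"
  have \<beta>: "0 < \<beta>" using dim by (simp add: \<beta>_def N_def)
  define C1 where "C1 = sqrt (A / \<omega>)"
  define K where "K = sqrt (64 * E / (m * \<omega>))"
  define q where "q = 2 powr (- \<beta>)"
  have q: "0 < q" "q < 1" using \<beta> by (auto simp: q_def powr_less_one)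
  define C2 where "C2 = K / (1 - q)"
  have C12: "0 \<le> C1" "0 \<le> K" "0 \<le> C2" using A \<omega> q by (auto simp: C1_def K_def C2_def)
  have powN: "norm x ^ DIM('a) = (norm x powr (N / 2))\<^sup>2" if "x \<noteq> 0" for x :: 'a
    using that by (simp add: N_def power2_eq_square powr_add[symmetric] powr_realpow)
  have "g x \<le> C1 * norm x powr (- (N / 2)) \<and> g x \<le> C2 * norm x powr (1 - N / 2)"
    if g: "radial_decr g" "\<And>x. 0 \<le> g x" and [measurable]: "g \<in> borel_measurable borel" and Q: "sq_norm g \<le> ennreal A" "dirichlet g \<le> ennreal E" and x: "x \<noteq> 0"
    for g :: "'a \<Rightarrow> real" and x
  proof -
    have 1: "g x \<le> C1 * norm x powr (- (N / 2))" if x: "x \<noteq> 0" for x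
    proof -
      have "(g x)\<^sup>2 * (\<omega> * norm x ^ DIM('a)) \<le> A"
        using radial_decr_L2_bound[OF g _ Q(1) A(1), of x] unfolding \<omega>_def N_def by simp
      then have "(g x * norm x powr (N / 2))\<^sup>2 \<le> A / \<omega>"
        using \<omega> unfolding powN[OF x] power_mult_distrib by (simp add: field_simps)
      then have "g x * norm x powr (N / 2) \<le> C1" unfolding C1_def by (rule real_le_rsqrt)
      then show ?thesis using x by (simp add: powr_minus divide_inverse[symmetric] pos_le_divide_eq)
    qed
    have step: "g x - g (2 *\<^sub>R x) \<le> K * norm x powr (- \<beta>)" if x: "x \<noteq> 0" for x
    proof -
      have "(g x - g (2 *\<^sub>R x))\<^sup>2 * (m * \<omega> * norm x ^ DIM('a)) \<le> 64 * (norm x)\<^sup>2 * E"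
        using radial_decr_step_bound[OF g(1) _ Q(2) A(2) x] unfolding \<omega>_def N_def m_def by simp
      then have "(g x - g (2 *\<^sub>R x))\<^sup>2 * ((norm x powr (N / 2))\<^sup>2 / (norm x)\<^sup>2) \<le> 64 * E / (m * \<omega>)"
        using \<omega> x unfolding powN[OF x] by (simp add: field_simps)
      moreover have "norm x powr (N / 2) / norm x = norm x powr \<beta>"
        using x by (simp add: \<beta>_def powr_diff)
      ultimately have "((g x - g (2 *\<^sub>R x)) * norm x powr \<beta>)\<^sup>2 \<le> 64 * E / (m * \<omega>)"
        by (simp add: power_mult_distrib flip: power_divide)
      then have "(g x - g (2 *\<^sub>R x)) * norm x powr \<beta> \<le> K" unfolding K_def by (rule real_le_rsqrt)
      then show ?thesis using x by (simp add: powr_minus divide_inverse[symmetric] pos_le_divide_eq)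
    qed
    \<comment> \<open>The step bound is summed along the points \<open>2 ^ j\<close> times
      \<open>x\<close>. Its terms decrease with ratio \<open>q\<close>, which is below 1 because the
      dimension exceeds 2.\<close>
    have ind: "g x \<le> g ((2 ^ n) *\<^sub>R x) + K * norm x powr (- \<beta>) * (\<Sum>j<n. q ^ j)" for n
    proof (induction n)
      case (Suc n)
      have "g ((2 ^ n) *\<^sub>R x) \<le> g (2 *\<^sub>R (2 ^ n) *\<^sub>R x) + K * norm ((2 ^ n) *\<^sub>R x) powr (- \<beta>)"
        using step[of "(2 ^ n) *\<^sub>R x"] x by simp
      moreover have "norm ((2 ^ n) *\<^sub>R x) powr (- \<beta>) = q ^ n * norm x powr (- \<beta>)"
        unfolding q_def by (simp add: powr_mult power_powr_commute)
      ultimately show ?case using Suc by (simp add: algebra_simps)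
    qed simp
    have geo: "(\<Sum>j<n. q ^ j) \<le> 1 / (1 - q)" for n
      using q by (simp add: sum_gp_strict divide_right_mono)
    have le: "g x \<le> g ((2 ^ n) *\<^sub>R x) + C2 * norm x powr (- \<beta>)" for n
    proof -
      have "K * norm x powr (- \<beta>) * (\<Sum>j<n. q ^ j) \<le> K * norm x powr (- \<beta>) * (1 / (1 - q))"
        by (intro mult_left_mono geo) (use C12 in auto)
      also have "\<dots> = C2 * norm x powr (- \<beta>)" by (simp add: C2_def)
      finally show ?thesis using ind[of n] by linarith
    qed
    have L: "(\<lambda>n. C1 * norm x powr (- (N / 2)) * (2 powr (- (N / 2))) ^ n) \<longlonglongrightarrow> C1 * norm x powr (- (N / 2)) * 0"
      by (intro tendsto_mult tendsto_const LIMSEQ_realpow_zero) (use dim in \<open>auto simp: N_def powr_less_one\<close>)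
    have U: "g ((2 ^ n) *\<^sub>R x) \<le> C1 * norm x powr (- (N / 2)) * (2 powr (- (N / 2))) ^ n" for n
      using 1[of "(2 ^ n) *\<^sub>R x"] x by (simp add: powr_mult power_powr_commute mult_ac)
    \<comment> \<open>The decay from the L2 norm removes the last term of the telescoping
      sum.\<close>
    have "(\<lambda>n. g ((2 ^ n) *\<^sub>R x)) \<longlonglongrightarrow> 0"
    proof (rule tendsto_sandwich[OF always_eventually always_eventually tendsto_const L[unfolded mult_zero_right]]; rule allI)
      show "0 \<le> g ((2 ^ n) *\<^sub>R x)" for n by (rule g(2))
      show "g ((2 ^ n) *\<^sub>R x) \<le> C1 * norm x powr (- (N / 2)) * (2 powr (- (N / 2))) ^ n" for n by (rule U)
    qed
    then have "(\<lambda>n. g ((2 ^ n) *\<^sub>R x) + C2 * norm x powr (- \<beta>)) \<longlonglongrightarrow> 0 + C2 * norm x powr (- \<beta>)"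
      by (intro tendsto_intros)
    then have "g x \<le> 0 + C2 * norm x powr (- \<beta>)" by (rule LIMSEQ_le_const) (use le in blast)
    then show ?thesis using 1[OF x] by (simp add: \<beta>_def)
  qed
  note bound = this
  define C where "C = C1 + C2 + 1"
  have "g x \<le> C * norm x powr (- (N / 2)) \<and> g x \<le> C * norm x powr (1 - N / 2)"
    if "radial_decr g" "\<And>x. 0 \<le> g x" "g \<in> borel_measurable borel" "sq_norm g \<le> ennreal A" "dirichlet g \<le> ennreal E" "x \<noteq> 0" for g :: "'a \<Rightarrow> real" and x
  proof -
    have "C1 * norm x powr (- (N / 2)) \<le> C * norm x powr (- (N / 2))" "C2 * norm x powr (1 - N / 2) \<le> C * norm x powr (1 - N / 2)"
      using C12 by (auto simp: C_def intro!: mult_right_mono)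
    then show ?thesis using bound[OF that] by linarith
  qed
  then show ?thesis using C12 unfolding N_def by (intro exI[of _ C]) (auto simp: C_def)
qed

section \<open>The Riesz energy\<close>

text \<open>On the null set where \<open>x = y\<close> the quotient has the junk value 0.\<close>
definition riesz :: "real \<Rightarrow> real \<Rightarrow> ('a::euclidean_space \<Rightarrow> real) \<Rightarrow> ennreal" where
  "riesz \<alpha> p f = (\<integral>\<^sup>+x. \<integral>\<^sup>+y. ennreal (\<bar>f x\<bar> powr p * \<bar>f y\<bar> powr p / norm (x - y) powr (real DIM('a) - \<alpha>)) \<partial>lborel \<partial>lborel)"

lemma riesz_mono:
  assumes "0 \<le> p" "\<And>x. \<bar>f x\<bar> \<le> \<bar>g x\<bar>"
  shows "riesz \<alpha> p f \<le> riesz \<alpha> p g"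
  unfolding riesz_def
  by (intro nn_integral_mono ennreal_leI divide_right_mono mult_mono powr_mono2) (use assms in auto)

lemma riesz_cmult:
  fixes f :: "'a::euclidean_space \<Rightarrow> real"
  assumes [measurable]: "f \<in> borel_measurable borel" and c: "0 < c"
  shows "riesz \<alpha> p (\<lambda>x. c * f x) = ennreal (c powr (2 * p)) * riesz \<alpha> p f"
proof -
  have "c powr (2 * p) = c powr p * c powr p" by (simp add: powr_add[symmetric])
  then have "riesz \<alpha> p (\<lambda>x. c * f x) = (\<integral>\<^sup>+x. \<integral>\<^sup>+y. ennreal (c powr (2 * p)) * ennreal (\<bar>f x\<bar> powr p * \<bar>f y\<bar> powr p / norm (x - y) powr (real DIM('a) - \<alpha>)) \<partial>lborel \<partial>lborel)"
    unfolding riesz_def using c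
    by (intro nn_integral_cong) (simp add: abs_mult powr_mult mult_ac flip: ennreal_mult)
  also have "\<dots> = ennreal (c powr (2 * p)) * riesz \<alpha> p f"
    unfolding riesz_def by (simp add: nn_integral_cmult)
  finally show ?thesis .
qed

lemma riesz_Fatou:
  fixes f :: "'a::euclidean_space \<Rightarrow> real"
  assumes [measurable]: "f \<in> borel_measurable borel" "\<And>n. F n \<in> borel_measurable borel"
    and lim: "AE x in lborel. (\<lambda>n. F n x) \<longlonglongrightarrow> f x" and p: "0 < p"
  shows "riesz \<alpha> p f \<le> liminf (\<lambda>n. riesz \<alpha> p (F n))"
proof -
  let ?E = "\<lambda>f x y. ennreal (\<bar>f x\<bar> powr p * \<bar>f y\<bar> powr p / norm (x - y) powr (real DIM('a) - \<alpha>))"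
  have "riesz \<alpha> p f = (\<integral>\<^sup>+x. \<integral>\<^sup>+y. liminf (\<lambda>n. ?E (F n) x y) \<partial>lborel \<partial>lborel)"
    unfolding riesz_def
  proof (rule nn_integral_cong_AE, use lim in eventually_elim)
    case (elim x)
    note x = elim
    show ?case
    proof (rule nn_integral_cong_AE, use lim in eventually_elim)
      case (elim y)
      have "(\<lambda>n. ?E (F n) x y) \<longlonglongrightarrow> ?E f x y"
      proof (rule tendsto_ennrealI)
        have "(\<lambda>n. \<bar>F n x\<bar> powr p) \<longlonglongrightarrow> \<bar>f x\<bar> powr p" "(\<lambda>n. \<bar>F n y\<bar> powr p) \<longlonglongrightarrow> \<bar>f y\<bar> powr p"
          using p x elim by (auto intro!: tendsto_powr' tendsto_rabs)
        then show "(\<lambda>n. \<bar>F n x\<bar> powr p * \<bar>F n y\<bar> powr p / norm (x - y) powr (real DIM('a) - \<alpha>)) \<longlonglongrightarrow> \<bar>f x\<bar> powr p * \<bar>f y\<bar> powr p / norm (x - y) powr (real DIM('a) - \<alpha>)"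
          unfolding divide_inverse by (intro tendsto_mult tendsto_const)
      qed
      then show ?case by (rule lim_imp_Liminf[OF sequentially_bot, symmetric])
    qed
  qed
  also have "\<dots> \<le> (\<integral>\<^sup>+x. liminf (\<lambda>n. \<integral>\<^sup>+y. ?E (F n) x y \<partial>lborel) \<partial>lborel)"
    by (rule nn_integral_mono, rule nn_integral_liminf) measurable
  also have "\<dots> \<le> liminf (\<lambda>n. \<integral>\<^sup>+x. \<integral>\<^sup>+y. ?E (F n) x y \<partial>lborel \<partial>lborel)"
    by (rule nn_integral_liminf) measurable
  finally show ?thesis unfolding riesz_def .
qed

text \<open>Dominated convergence in the inner and then in the outer integral. The bound excludes
  the origin because the dominating function in use is a multiple of \<open>envelope\<close>, whose
  value at 0 is the junk value 0.\<close>

lemma riesz_dominated: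
  fixes f G :: "'a::euclidean_space \<Rightarrow> real"
  assumes [measurable]: "f \<in> borel_measurable borel" "\<And>n. F n \<in> borel_measurable borel" "G \<in> borel_measurable borel"
    and lim: "AE x in lborel. (\<lambda>n. F n x) \<longlonglongrightarrow> f x" and p: "0 < p"
    and bd: "\<And>n x. x \<noteq> 0 \<Longrightarrow> \<bar>F n x\<bar> \<le> G x" and fin: "riesz \<alpha> p G < \<infinity>"
  shows "(\<lambda>n. riesz \<alpha> p (F n)) \<longlonglongrightarrow> riesz \<alpha> p f"
proof -
  let ?E = "\<lambda>f x y. ennreal (\<bar>f x\<bar> powr p * \<bar>f y\<bar> powr p / norm (x - y) powr (real DIM('a) - \<alpha>))"
  have ne: "AE x in lborel. x \<noteq> (0::'a)" by (rule AE_lborel_singleton)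
  have bE: "?E (F n) x y \<le> ?E G x y" if "x \<noteq> 0" "y \<noteq> 0" for n x y
    using bd[OF that(1), of n] bd[OF that(2), of n] p
    by (intro ennreal_leI divide_right_mono mult_mono powr_mono2) auto
  have finx: "AE x in lborel. (\<integral>\<^sup>+y. ?E G x y \<partial>lborel) < \<infinity>"
  proof -
    have "AE x in lborel. (\<integral>\<^sup>+y. ?E G x y \<partial>lborel) \<noteq> \<infinity>"
      by (rule nn_integral_noteq_infinite) (use fin in \<open>auto simp: riesz_def\<close>)
    then show ?thesis by eventually_elim (simp add: less_top)
  qed
  show ?thesis
    unfolding riesz_def
  proof (rule nn_integral_dominated_convergence[where w="\<lambda>x. \<integral>\<^sup>+y. ?E G x y \<partial>lborel"])
    show "AE x in lborel. (\<integral>\<^sup>+y. ?E (F n) x y \<partial>lborel) \<le> (\<integral>\<^sup>+y. ?E G x y \<partial>lborel)" for n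
      using ne
    proof eventually_elim
      case (elim x)
      show ?case by (rule nn_integral_mono_AE, use ne in eventually_elim) (rule bE[OF elim])
    qed
    show "(\<integral>\<^sup>+x. \<integral>\<^sup>+y. ?E G x y \<partial>lborel \<partial>lborel) < \<infinity>" using fin by (simp add: riesz_def)
    show "AE x in lborel. (\<lambda>n. \<integral>\<^sup>+y. ?E (F n) x y \<partial>lborel) \<longlonglongrightarrow> (\<integral>\<^sup>+y. ?E f x y \<partial>lborel)"
      using ne finx lim
    proof eventually_elim
      case x: (elim x)
      show ?case
      proof (rule nn_integral_dominated_convergence[where w="\<lambda>y. ?E G x y"])
        show "AE y in lborel. ?E (F n) x y \<le> ?E G x y" for n
          using ne by eventually_elim (rule bE[OF x(1)])
        show "(\<integral>\<^sup>+y. ?E G x y \<partial>lborel) < \<infinity>" by (rule x)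
        show "AE y in lborel. (\<lambda>n. ?E (F n) x y) \<longlonglongrightarrow> ?E f x y"
          using lim
        proof eventually_elim
          case (elim y)
          show ?case
          proof (rule tendsto_ennrealI)
            have "(\<lambda>n. \<bar>F n x\<bar> powr p) \<longlonglongrightarrow> \<bar>f x\<bar> powr p" "(\<lambda>n. \<bar>F n y\<bar> powr p) \<longlonglongrightarrow> \<bar>f y\<bar> powr p"
              using p x elim by (auto intro!: tendsto_powr' tendsto_rabs)
            then show "(\<lambda>n. \<bar>F n x\<bar> powr p * \<bar>F n y\<bar> powr p / norm (x - y) powr (real DIM('a) - \<alpha>)) \<longlonglongrightarrow> \<bar>f x\<bar> powr p * \<bar>f y\<bar> powr p / norm (x - y) powr (real DIM('a) - \<alpha>)"
              unfolding divide_inverse by (intro tendsto_mult tendsto_const)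
          qed
        qed
      qed measurable
    qed
  qed measurable
qed

section \<open>Polarization increases the Riesz energy\<close>

lemma riesz_polar_four_sum:
  fixes f :: "'a::euclidean_space \<Rightarrow> real"
  assumes e: "norm e = 1" and \<alpha>: "\<alpha> < real DIM('a)" and f: "\<And>x. 0 \<le> f x" and p: "0 \<le> p"
    and xy: "x \<noteq> y" "x \<noteq> hrefl e t y"
  shows "four_sum (hrefl e t) (\<lambda>x y. 1 / norm (x - y) powr (real DIM('a) - \<alpha>) * (f x powr p * f y powr p)) x y
    \<le> four_sum (hrefl e t) (\<lambda>x y. 1 / norm (x - y) powr (real DIM('a) - \<alpha>) * (polar e t f x powr p * polar e t f y powr p)) x y"
proof -
  \<comment> \<open>An increasing function commutes with maxima and minima, so the power can be
    taken before polarizing; the product of two values is then supermodular.\<close>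
  have P: "polar e t f x powr p = polar e t (\<lambda>x. f x powr p) x" for x
  proof -
    have "max a b powr p = max (a powr p) (b powr p)" "min a b powr p = min (a powr p) (b powr p)" if "0 \<le> a" "0 \<le> b" for a b :: real
      using powr_mono2[OF p, of a b] powr_mono2[OF p, of b a] that by (auto simp: max_def min_def)
    then show ?thesis using f by (simp add: polar_def)
  qed
  show ?thesis
    unfolding P
  proof (rule polar_four_sum[OF e, where u="\<lambda>x. f x powr p" and \<Psi>="times"])
    fix a b c d :: real assume "b \<le> a" "d \<le> c"
    then have "0 \<le> (a - b) * (c - d)" by simp
    then show "a * d + b * c \<le> a * c + b * d" by (simp add: algebra_simps)
  next
    assume le: "norm (x - y) \<le> norm (x - hrefl e t y)"
    show "1 / norm (x - hrefl e t y) powr (real DIM('a) - \<alpha>) \<le> 1 / norm (x - y) powr (real DIM('a) - \<alpha>)"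
      using le xy \<alpha> by (intro divide_left_mono powr_mono2 mult_pos_pos) auto
  next
    assume le: "norm (x - hrefl e t y) \<le> norm (x - y)"
    show "1 / norm (x - y) powr (real DIM('a) - \<alpha>) \<le> 1 / norm (x - hrefl e t y) powr (real DIM('a) - \<alpha>)"
      using le xy \<alpha> by (intro divide_left_mono powr_mono2 mult_pos_pos) auto
  qed (simp_all add: norm_hrefl_commute[OF e, symmetric] hrefl_hrefl[OF e])
qed

lemma polar_nonneg: "(\<And>x. 0 \<le> f x) \<Longrightarrow> 0 \<le> polar e t f x"
  by (auto simp: polar_def le_max_iff_disj)

lemma riesz_nonneg_eq:
  fixes f :: "'a::euclidean_space \<Rightarrow> real"
  assumes "\<And>x. 0 \<le> f x"
  shows "riesz \<alpha> p f = (\<integral>\<^sup>+x. \<integral>\<^sup>+y. ennreal (1 / norm (x - y) powr (real DIM('a) - \<alpha>) * (f x powr p * f y powr p)) \<partial>lborel \<partial>lborel)"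
  unfolding riesz_def using assms by simp

lemma riesz_polar:
  fixes f :: "'a::euclidean_space \<Rightarrow> real"
  assumes e: "norm e = 1" and \<alpha>: "\<alpha> < real DIM('a)" and f: "\<And>x. 0 \<le> f x" and p: "0 \<le> p"
    and [measurable]: "f \<in> borel_measurable borel"
  shows "riesz \<alpha> p f \<le> riesz \<alpha> p (polar e t f)"
proof -
  let ?F = "\<lambda>f x y::'a. 1 / norm (x - y) powr (real DIM('a) - \<alpha>) * (f x powr p * f y powr p)"
  have "4 * (\<integral>\<^sup>+x. \<integral>\<^sup>+y. ennreal (?F f x y) \<partial>lborel \<partial>lborel) + (\<integral>\<^sup>+(x::'a). \<integral>\<^sup>+(y::'a). 0 \<partial>lborel \<partial>lborel)
    \<le> 4 * (\<integral>\<^sup>+x. \<integral>\<^sup>+y. ennreal (?F (polar e t f) x y) \<partial>lborel \<partial>lborel)"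
  proof (rule nn_integral_four_sum_mono[OF _ _ _ e])
    fix x y :: 'a assume "x \<noteq> y" "x \<noteq> hrefl e t y"
    then show "four_sum (hrefl e t) (\<lambda>x y. ennreal (?F f x y)) x y + 0 \<le> four_sum (hrefl e t) (\<lambda>x y. ennreal (?F (polar e t f) x y)) x y"
      using riesz_polar_four_sum[OF e \<alpha> f p] by (subst (1 2) four_sum_ennreal) (auto intro!: ennreal_leI)
  qed measurable
  then show ?thesis
    unfolding riesz_nonneg_eq[OF f] riesz_nonneg_eq[OF polar_nonneg[OF f]]
    by (simp add: ennreal_mult_le_mult_iff)
qed

text \<open>If \<open>f\<close> crossed its reflection strictly, the rearrangement inequality for the four points obtained from
  \<open>x0\<close> and \<open>y0\<close> would be strict on an open set.\<close>
lemma riesz_polar_rigid: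
  fixes f :: "'a::euclidean_space \<Rightarrow> real"
  assumes e: "norm e = 1" and \<alpha>: "\<alpha> < real DIM('a)" and f: "\<And>x. 0 \<le> f x" and p: "0 < p"
    and cont: "continuous_on UNIV f"
    and eq: "riesz \<alpha> p (polar e t f) \<le> riesz \<alpha> p f" and fin: "riesz \<alpha> p f < \<infinity>"
    and x0: "t < x0 \<bullet> e" and y0: "t < y0 \<bullet> e"
  shows "\<not> (f (hrefl e t x0) < f x0 \<and> f y0 < f (hrefl e t y0))"
proof
  assume neg: "f (hrefl e t x0) < f x0 \<and> f y0 < f (hrefl e t y0)"
  have [measurable]: "f \<in> borel_measurable borel" using cont by (rule borel_measurable_continuous_onI)
  let ?s = "hrefl e t"
  let ?k = "\<lambda>x y::'a. 1 / norm (x - y) powr (real DIM('a) - \<alpha>)"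
  let ?F = "\<lambda>f x y. ?k x y * (f x powr p * f y powr p)"
  \<comment> \<open>The gain of the four point sum under polarization. Its integral is squeezed to 0
    by \<open>eq\<close> and then shown to be positive.\<close>
  define H where "H x y = four_sum ?s (?F (polar e t f)) x y - four_sum ?s (?F f) x y" for x y
  have [measurable]: "case_prod H \<in> borel_measurable (borel \<Otimes>\<^sub>M borel)"
    unfolding H_def four_sum_def by measurable
  have nn: "0 \<le> ?F g x y" if "\<And>x. 0 \<le> g x" for g x y using that by simp
  have four_nn: "0 \<le> four_sum ?s (?F g) x y" if "\<And>x. 0 \<le> g x" for g x y
    unfolding four_sum_def using nn[OF that] by (intro add_nonneg_nonneg) auto
  have "4 * (\<integral>\<^sup>+x. \<integral>\<^sup>+y. ennreal (?F f x y) \<partial>lborel \<partial>lborel) + (\<integral>\<^sup>+x. \<integral>\<^sup>+y. ennreal (H x y) \<partial>lborel \<partial>lborel)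
    \<le> 4 * (\<integral>\<^sup>+x. \<integral>\<^sup>+y. ennreal (?F (polar e t f) x y) \<partial>lborel \<partial>lborel)"
  proof (rule nn_integral_four_sum_mono[OF _ _ _ e])
    fix x y :: 'a assume xy: "x \<noteq> y" "x \<noteq> hrefl e t y"
    have H0: "0 \<le> H x y" using riesz_polar_four_sum[OF e \<alpha> f _ xy] p by (simp add: H_def)
    have "ennreal (four_sum ?s (?F f) x y) + ennreal (H x y) = ennreal (four_sum ?s (?F f) x y + H x y)"
      by (rule ennreal_plus[symmetric]) (use four_nn[OF f] H0 in auto)
    also have "four_sum ?s (?F f) x y + H x y = four_sum ?s (?F (polar e t f)) x y" by (simp add: H_def)
    finally show "four_sum (hrefl e t) (\<lambda>x y. ennreal (?F f x y)) x y + ennreal (H x y) \<le> four_sum (hrefl e t) (\<lambda>x y. ennreal (?F (polar e t f) x y)) x y"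
      using f by (subst (1 2) four_sum_ennreal) (auto intro: polar_nonneg)
  qed measurable
  then have "4 * riesz \<alpha> p f + (\<integral>\<^sup>+x. \<integral>\<^sup>+y. ennreal (H x y) \<partial>lborel \<partial>lborel) \<le> 4 * riesz \<alpha> p (polar e t f)"
    unfolding riesz_nonneg_eq[OF f] riesz_nonneg_eq[OF polar_nonneg[OF f]] .
  also have "\<dots> \<le> 4 * riesz \<alpha> p f" by (intro mult_left_mono eq) simp
  finally have le: "4 * riesz \<alpha> p f + (\<integral>\<^sup>+x. \<integral>\<^sup>+y. ennreal (H x y) \<partial>lborel \<partial>lborel) \<le> 4 * riesz \<alpha> p f + 0" by simp
  have "4 * riesz \<alpha> p f \<noteq> \<infinity>" using fin by (simp add: ennreal_mult_eq_top_iff)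
  \<comment> \<open>Finiteness of the Riesz energy is what allows the common term to be
    cancelled.\<close>
  with le have zero: "(\<integral>\<^sup>+x. \<integral>\<^sup>+y. ennreal (H x y) \<partial>lborel \<partial>lborel) \<le> 0"
    by (subst (asm) ennreal_add_left_cancel_le) auto
  define U where "U = {x. t < x \<bullet> e} \<inter> {x. f (?s x) < f x}"
  define V where "V = {x. t < x \<bullet> e} \<inter> {x. f x < f (?s x)}"
  have cs: "continuous_on UNIV (\<lambda>x. f (?s x))"
    by (rule continuous_on_compose2[OF cont continuous_on_hrefl]) auto
  have UV: "open U" "open V" "x0 \<in> U" "y0 \<in> V"
    unfolding U_def V_def using x0 y0 neg
    by (auto intro!: open_Int open_Collect_less continuous_intros cont cs)
  have Hpos: "0 < H x y" if xy: "x \<in> U" "y \<in> V" for x y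
  proof -
    have ne: "x \<noteq> y" using xy by (auto simp: U_def V_def)
    have h: "t < x \<bullet> e" "t < y \<bullet> e" "f (?s x) < f x" "f y < f (?s y)" using xy by (auto simp: U_def V_def)
    define a b c d where "a = f x powr p" and "b = f (?s x) powr p" and "c = f y powr p" and "d = f (?s y) powr p"
    have ab: "b < a" "c < d" unfolding a_def b_def c_def d_def using h f p by (auto intro!: powr_less_mono2)
    have px: "polar e t f x = f x" "polar e t f (?s x) = f (?s x)" "polar e t f y = f (?s y)" "polar e t f (?s y) = f y"
      using polar_pair(1)[OF e, where t=t and f=f, of x] polar_pair(1)[OF e, where t=t and f=f, of y] h by auto
    have k: "?k (?s x) (?s y) = ?k x y" "?k (?s x) y = ?k x (?s y)"
      by (simp_all add: norm_hrefl_commute[OF e, symmetric] hrefl_hrefl[OF e])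
    define k1 k2 where "k1 = ?k x y" and "k2 = ?k x (?s y)"
    \<comment> \<open>Polarization leaves the pair over \<open>x\<close> alone and swaps the pair
      over \<open>y\<close>. The gain factors, and strict decrease of the kernel makes the first
      factor positive.\<close>
    have "H x y = (k1 - k2) * ((a - b) * (d - c))"
      unfolding H_def four_sum_def px k a_def[symmetric] b_def[symmetric] c_def[symmetric] d_def[symmetric] hrefl_hrefl[OF e] k1_def[symmetric] k2_def[symmetric]
      by (simp add: algebra_simps)
    moreover have "norm (x - y) < norm (x - ?s y)"
    proof (rule power2_less_imp_less)
      have "0 < (x \<bullet> e - t) * (y \<bullet> e - t)" using h by simp
      then show "(norm (x - y))\<^sup>2 < (norm (x - ?s y))\<^sup>2"
        unfolding norm_hrefl_diff_sq[OF e] mult.assoc by linarith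
    qed simp
    then have "?k x (?s y) < ?k x y"
      using ne \<alpha> by (intro divide_strict_left_mono powr_less_mono2 mult_pos_pos) auto
    ultimately show ?thesis using ab by (simp add: k1_def k2_def)
  qed
  have "0 < (\<integral>\<^sup>+x. \<integral>\<^sup>+y. ennreal (H x y) \<partial>lborel \<partial>lborel)"
  proof (rule nn_integral_pos_open[of _ U])
    fix x assume x: "x \<in> U"
    show "0 < (\<integral>\<^sup>+y. ennreal (H x y) \<partial>lborel)"
      by (rule nn_integral_pos_open[of _ V]) (use UV Hpos x in auto)
  qed (use UV in auto)
  then show False using zero by simp
qed

section \<open>Symmetrization\<close>

text \<open>The pointwise minimum of the two bounds in \<open>radial_bound\<close>: the power
  \<open>1 - N/2\<close> is the smaller one inside the unit ball, the power \<open>-N/2\<close>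
  outside. At the origin both powers have the junk value 0.\<close>

definition envelope :: "'a::euclidean_space \<Rightarrow> real" where
  "envelope x = min (norm x powr (- (real DIM('a) / 2))) (norm x powr (1 - real DIM('a) / 2))"

lemma envelope_measurable [measurable]: "envelope \<in> borel_measurable borel"
  unfolding envelope_def by measurable

lemma envelope_nonneg [simp]: "0 \<le> envelope x"
  by (simp add: envelope_def)

text \<open>After raising to the power \<open>p\<close> the exponents at 0 and at infinity are
  \<open>(N/2 - 1) * p\<close> and \<open>N/2 * p\<close>. The two conditions of
  \<open>riesz_power_finite\<close> then become exactly the two bounds on \<open>p\<close>.\<close>

lemma riesz_envelope_finite:
  fixes \<alpha> p C :: real
  assumes dim: "DIM('a::euclidean_space) \<ge> 3" and \<alpha>: "0 < \<alpha>" "\<alpha> < real DIM('a)"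
    and p: "(real DIM('a) + \<alpha>) / real DIM('a) < p" "p < (real DIM('a) + \<alpha>) / (real DIM('a) - 2)"
    and C: "0 < C"
  shows "riesz \<alpha> p (\<lambda>x::'a. C * envelope x) < \<infinity>"
proof -
  define N where "N = real DIM('a)"
  have N: "3 \<le> N" using dim by (simp add: N_def)
  have p1: "N + \<alpha> < N * p" "(N - 2) * p < N + \<alpha>" 
    using p N unfolding N_def[symmetric] by (simp_all add: field_simps)
  have "0 < N * p" using p1(1) N \<alpha> by linarith
  then have p0: "0 < p" using N by (simp add: zero_less_mult_iff)
  have "(\<integral>\<^sup>+x. \<integral>\<^sup>+y. ennreal (envelope (x::'a) powr p * envelope y powr p / norm (x - y) powr (real DIM('a) - \<alpha>)) \<partial>lborel \<partial>lborel) < \<infinity>"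
  proof (rule riesz_power_finite[where a="(N / 2 - 1) * p" and b="N / 2 * p"])
    show "2 * ((N / 2 - 1) * p) < real DIM('a) + \<alpha>" "real DIM('a) + \<alpha> < 2 * (N / 2 * p)"
      using p1 by (simp_all add: N_def[symmetric] algebra_simps)
    fix x :: 'a
    have "envelope x powr p \<le> (norm x powr (1 - N / 2)) powr p"
      using p0 unfolding envelope_def N_def by (intro powr_mono2) auto
    then show "envelope x powr p \<le> norm x powr (- ((N / 2 - 1) * p))"
      by (simp add: powr_powr algebra_simps)
    have "envelope x powr p \<le> (norm x powr (- (N / 2))) powr p"
      using p0 unfolding envelope_def N_def by (intro powr_mono2) auto
    then show "envelope x powr p \<le> norm x powr (- (N / 2 * p))"
      by (simp add: powr_powr)
  qed (use \<alpha> in auto)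
  then have "riesz \<alpha> p (envelope :: 'a \<Rightarrow> real) < \<infinity>" by (simp add: riesz_def)
  then show ?thesis by (subst riesz_cmult) (use C in \<open>auto simp: ennreal_mult_less_top\<close>)
qed

lemma sq_norm_mollify_le:
  fixes u :: "'a::euclidean_space \<Rightarrow> real"
  assumes u: "L2 u"
  shows "sq_norm (mollify \<epsilon> u) \<le> sq_norm u"
proof -
  have [measurable]: "u \<in> borel_measurable borel" using u by (simp add: L2_def)
  have "sq_norm (mollify \<epsilon> u) \<le> (\<integral>\<^sup>+x. \<integral>\<^sup>+z. ennreal (ker 1 z * (u (x - \<epsilon> *\<^sub>R z))\<^sup>2) \<partial>lborel \<partial>lborel)"
    unfolding sq_norm_def real_norm_def power2_abs mollify_def by (intro nn_integral_mono ker_jensen) measurable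
  also have "\<dots> = (\<integral>\<^sup>+z. \<integral>\<^sup>+x. ennreal (ker 1 z) * ennreal ((u (x - \<epsilon> *\<^sub>R z))\<^sup>2) \<partial>lborel \<partial>lborel)"
    by (subst lborel_pair.Fubini') (auto simp: ennreal_mult)
  also have "\<dots> = (\<integral>\<^sup>+z. ennreal (ker 1 (z::'a)) * sq_norm u \<partial>lborel)"
  proof (rule nn_integral_cong)
    fix z :: 'a
    have "(\<integral>\<^sup>+x. ennreal ((u (x - \<epsilon> *\<^sub>R z))\<^sup>2) \<partial>lborel) = sq_norm u"
      using nn_integral_lborel_shift(3)[where f="\<lambda>x. ennreal ((u x)\<^sup>2)" and t="\<epsilon> *\<^sub>R z"] by (simp add: sq_norm_def)
    then show "(\<integral>\<^sup>+x. ennreal (ker 1 z) * ennreal ((u (x - \<epsilon> *\<^sub>R z))\<^sup>2) \<partial>lborel) = ennreal (ker 1 z) * sq_norm u"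
      by (subst nn_integral_cmult) auto
  qed
  also have "\<dots> = sq_norm u" by (simp add: nn_integral_multc nn_integral_ker)
  finally show ?thesis .
qed

definition cutoff :: "real \<Rightarrow> 'a::euclidean_space \<Rightarrow> real" where
  "cutoff k x = max 0 (min 1 (2 - norm x / k))"

lemma cutoff_bounds: "0 \<le> cutoff k x" "cutoff k x \<le> 1"
  by (auto simp: cutoff_def)

lemma cutoff_lipschitz: 
  assumes "0 < k" shows "\<bar>cutoff k x - cutoff k y\<bar> \<le> norm (x - y) / k"
proof -
  have "\<bar>norm x / k - norm y / k\<bar> \<le> norm (x - y) / k"
    using assms norm_triangle_ineq3[of x y] by (simp add: diff_divide_distrib[symmetric] divide_right_mono)
  then show ?thesis unfolding cutoff_def by linarith
qed

lemma cutoff_measurable [measurable]: "cutoff k \<in> borel_measurable borel"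
  unfolding cutoff_def by measurable

text \<open>The product rule at the level of differences. The increment of the cutoff function over
  a displacement \<open>s *\<^sub>R h\<close> is at most \<open>s * norm h / k\<close>, so the scale
  cancels and the error is bounded uniformly in \<open>s\<close>.\<close>

lemma dirichlet_cutoff:
  fixes f :: "'a::euclidean_space \<Rightarrow> real"
  assumes f: "L2 f" and k: "0 < k" and \<delta>: "0 < \<delta>"
  shows "dirichlet (\<lambda>x. cutoff k x * \<bar>f x\<bar>) \<le> ennreal (1 + \<delta>) * dirichlet f + ennreal (1 + 1 / \<delta>) * (ennreal (1 / k\<^sup>2) * sq_norm f)"
  unfolding dirichlet_def[of "\<lambda>x. cutoff k x * \<bar>f x\<bar>"]
proof (rule SUP_least)
  fix s :: real assume "s \<in> {0<..}"
  then have s: "0 < s" by simp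
  have [measurable]: "f \<in> borel_measurable borel" using f by (simp add: L2_def)
  let ?d = "\<lambda>x y::'a. norm (x - y) / k * f y"
  have 1: "dq_energy s (\<lambda>x. cutoff k x * \<bar>f x\<bar>) \<le> ennreal (1 + \<delta>) * dq_energy s f + 
     ennreal (1 + 1 / \<delta>) * (\<integral>\<^sup>+h. \<integral>\<^sup>+x. ennreal (ker 1 h * (?d (x + s *\<^sub>R h) x / s)\<^sup>2) \<partial>lborel \<partial>lborel)"
  proof (rule dq_energy_split[OF _ _ \<delta> s])
    fix x y
    have "cutoff k x * \<bar>f x\<bar> - cutoff k y * \<bar>f y\<bar> = cutoff k x * (\<bar>f x\<bar> - \<bar>f y\<bar>) + (cutoff k x - cutoff k y) * \<bar>f y\<bar>"
      by (simp add: algebra_simps)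
    also have "\<bar>\<dots>\<bar> \<le> cutoff k x * \<bar>\<bar>f x\<bar> - \<bar>f y\<bar>\<bar> + \<bar>cutoff k x - cutoff k y\<bar> * \<bar>f y\<bar>"
      using cutoff_bounds(1)[of k x] by (intro order_trans[OF abs_triangle_ineq]) (simp add: abs_mult)
    also have "\<dots> \<le> 1 * \<bar>f x - f y\<bar> + norm (x - y) / k * \<bar>f y\<bar>"
      by (intro add_mono mult_mono cutoff_bounds cutoff_lipschitz k) (use k in \<open>auto simp: abs_triangle_ineq3\<close>)
    finally show "\<bar>cutoff k x * \<bar>f x\<bar> - cutoff k y * \<bar>f y\<bar>\<bar> \<le> \<bar>f x - f y\<bar> + \<bar>?d x y\<bar>"
      using k by (simp add: abs_mult)
  qed measurable
  have 2: "(\<integral>\<^sup>+h. \<integral>\<^sup>+x. ennreal (ker 1 h * (?d (x + s *\<^sub>R h) x / s)\<^sup>2) \<partial>lborel \<partial>lborel) \<le> ennreal (1 / k\<^sup>2) * sq_norm f"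
  proof -
    have "(\<integral>\<^sup>+h. \<integral>\<^sup>+x. ennreal (ker 1 h * (?d (x + s *\<^sub>R h) x / s)\<^sup>2) \<partial>lborel \<partial>lborel) \<le> (\<integral>\<^sup>+h. ennreal (ker 1 (h::'a)) * (ennreal (1 / k\<^sup>2) * sq_norm f) \<partial>lborel)"
    proof (rule nn_integral_mono)
      fix h :: 'a
      have "(\<integral>\<^sup>+x. ennreal (ker 1 h * (?d (x + s *\<^sub>R h) x / s)\<^sup>2) \<partial>lborel) \<le> (\<integral>\<^sup>+x. ennreal (ker 1 h * (1 / k\<^sup>2)) * ennreal ((norm (f x))\<^sup>2) \<partial>lborel)"
      proof (rule nn_integral_mono)
        fix x
        have "ker 1 h * (?d (x + s *\<^sub>R h) x / s)\<^sup>2 = ker 1 h * (norm h)\<^sup>2 * (1 / k\<^sup>2 * (f x)\<^sup>2)"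
          using s by (simp add: power_mult_distrib power_divide)
        also have "\<dots> \<le> ker 1 h * (1 / k\<^sup>2 * (f x)\<^sup>2)"
        proof (rule mult_right_mono)
          show "ker 1 h * (norm h)\<^sup>2 \<le> ker 1 h"
          proof (cases "norm h < 1")
            case True
            then have "(norm h)\<^sup>2 \<le> 1" by (simp add: power_le_one)
            then show ?thesis by (simp add: mult_left_le)
          qed (simp add: ker_eq_0)
        qed simp
        finally show "ennreal (ker 1 h * (?d (x + s *\<^sub>R h) x / s)\<^sup>2) \<le> ennreal (ker 1 h * (1 / k\<^sup>2)) * ennreal ((norm (f x))\<^sup>2)"
          by (simp add: ennreal_leI flip: ennreal_mult)
      qed
      also have "\<dots> = ennreal (ker 1 h * (1 / k\<^sup>2)) * sq_norm f"
        unfolding sq_norm_def by (rule nn_integral_cmult) measurable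
      also have "\<dots> = ennreal (ker 1 h) * (ennreal (1 / k\<^sup>2) * sq_norm f)"
        by (subst ennreal_mult) (auto simp: mult.assoc)
      finally show "(\<integral>\<^sup>+x. ennreal (ker 1 h * (?d (x + s *\<^sub>R h) x / s)\<^sup>2) \<partial>lborel) \<le> ennreal (ker 1 h) * (ennreal (1 / k\<^sup>2) * sq_norm f)" .
    qed
    also have "\<dots> = ennreal (1 / k\<^sup>2) * sq_norm f" by (simp add: nn_integral_multc nn_integral_ker)
    finally show ?thesis .
  qed
  show "dq_energy s (\<lambda>x. cutoff k x * \<bar>f x\<bar>) \<le> ennreal (1 + \<delta>) * dirichlet f + ennreal (1 + 1 / \<delta>) * (ennreal (1 / k\<^sup>2) * sq_norm f)"
    by (rule order_trans[OF 1]) (intro add_mono mult_left_mono dq_le_dirichlet s 2; simp)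
qed

lemma dirichlet_mollify:
  fixes u :: "'a::euclidean_space \<Rightarrow> real"
  assumes "L2 u" "0 < \<epsilon>"
  shows "dirichlet (mollify \<epsilon> u) \<le> dirichlet u"
  unfolding dirichlet_def by (intro SUP_mono) (use dq_energy_mollify[OF assms] in auto)

lemma ennreal_combine2:
  assumes "0 \<le> p" "0 \<le> q" "0 \<le> r" "0 \<le> s"
  shows "ennreal p * ennreal q + ennreal r * ennreal s = ennreal (p * q + r * s)"
  using assms by (simp add: ennreal_mult ennreal_plus)

text \<open>Cutting off and then mollifying gives nonnegative Lipschitz functions of bounded
  support. The absolute value may be introduced because the Riesz energy depends only on it, and it
  does not increase difference quotients.\<close>

lemma lipschitz_approximation:
  fixes f :: "'a::euclidean_space \<Rightarrow> real"
  assumes f: "L2 f" and fin: "dirichlet f < \<infinity>"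
  shows "\<exists>F. (\<forall>k. (\<exists>L\<ge>0. \<forall>x y. \<bar>F k x - F k y\<bar> \<le> L * norm (x - y)) \<and> (\<exists>R>0. \<forall>x. R < norm x \<longrightarrow> F k x = 0) \<and> (\<forall>x. 0 \<le> F k x)
      \<and> sq_norm (F k) \<le> sq_norm f \<and> dirichlet (F k) \<le> ennreal (1 + 1 / real (Suc k)) * dirichlet f + ennreal (2 / real (Suc k)) * sq_norm f)
     \<and> (AE x in lborel. (\<lambda>k. F k x) \<longlonglongrightarrow> \<bar>f x\<bar>)"
proof -
  have [measurable]: "f \<in> borel_measurable borel" using f by (simp add: L2_def)
  define c where "c k x = cutoff (real (Suc k)) x * \<bar>f x\<bar>" for k x
  have cle: "\<bar>c k x\<bar> \<le> \<bar>f x\<bar>" for k x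
    using cutoff_bounds[of "real (Suc k)" x] by (simp add: c_def abs_mult mult_left_le_one_le)
  have [measurable]: "c k \<in> borel_measurable borel" for k unfolding c_def by measurable
  have Lc: "L2 (c k)" for k by (rule L2_bound[OF f]) (auto simp: cle)
  have sqc: "sq_norm (c k) \<le> sq_norm f" for k
    unfolding sq_norm_def by (intro nn_integral_mono ennreal_leI power_mono) (auto simp: cle)
  \<comment> \<open>Cutoff radius \<open>Suc k\<close> and Young parameter
    \<open>1 / real (Suc k)\<close> are coupled so that the excess over the Dirichlet energy of
    \<open>f\<close> disappears in the limit.\<close>
  have dc: "dirichlet (c k) \<le> ennreal (1 + 1 / real (Suc k)) * dirichlet f + ennreal (2 / real (Suc k)) * sq_norm f" for k
  proof -
    have "dirichlet (c k) \<le> ennreal (1 + 1 / real (Suc k)) * dirichlet f + ennreal (1 + 1 / (1 / real (Suc k))) * (ennreal (1 / (real (Suc k))\<^sup>2) * sq_norm f)"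
      unfolding c_def by (rule dirichlet_cutoff[OF f]) auto
    also have "ennreal (1 + 1 / (1 / real (Suc k))) * (ennreal (1 / (real (Suc k))\<^sup>2) * sq_norm f) \<le> ennreal (2 / real (Suc k)) * sq_norm f"
    proof -
      define m where "m = real (Suc k)"
      have m: "1 \<le> m" by (simp add: m_def)
      have "(1 + 1 / (1 / m)) * (1 / m\<^sup>2) = (1 + m) / m\<^sup>2" by simp
      also have "\<dots> \<le> (2 * m) / m\<^sup>2" using m by (intro divide_right_mono) auto
      also have "\<dots> = 2 / m" using m by (simp add: power2_eq_square)
      finally have "(1 + 1 / (1 / real (Suc k))) * (1 / (real (Suc k))\<^sup>2) \<le> 2 / real (Suc k)"
        unfolding m_def .
      then have "ennreal (1 + 1 / (1 / real (Suc k))) * ennreal (1 / (real (Suc k))\<^sup>2) \<le> ennreal (2 / real (Suc k))"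
        by (subst ennreal_mult[symmetric]) (auto intro!: ennreal_leI)
      then show ?thesis unfolding mult.assoc[symmetric] by (rule mult_right_mono) simp
    qed
    finally show ?thesis by (simp add: add_left_mono)
  qed
  \<comment> \<open>Geometric radii make the mollification errors summable, so that the whole
    sequence converges almost everywhere.\<close>
  define \<epsilon> where "\<epsilon> k = (1/2::real) ^ k" for k
  have \<epsilon>: "0 < \<epsilon> k" "\<epsilon> k \<le> 1" for k by (auto simp: \<epsilon>_def power_le_one)
  define F where "F k = mollify (\<epsilon> k) (c k)" for k
  have Lip: "\<exists>L\<ge>0. \<forall>x y. \<bar>F k x - F k y\<bar> \<le> L * norm (x - y)" for k
    unfolding F_def mollify_eq_convolve[OF \<open>c k \<in> borel_measurable borel\<close> \<epsilon>(1)]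
    by (rule convolve_lipschitz[OF Lc test_fun_ker[OF \<epsilon>(1)]])
  have supp: "F k x = 0" if x: "2 * real (Suc k) + 1 < norm x" for k x
  proof -
    have z: "ker 1 z * c k (x - \<epsilon> k *\<^sub>R z) = 0" for z :: 'a
    proof (cases "norm z < 1")
      case True
      have "norm (\<epsilon> k *\<^sub>R z) \<le> 1" using True \<epsilon>[of k] by (simp add: mult_le_one)
      then have "2 * real (Suc k) \<le> norm (x - \<epsilon> k *\<^sub>R z)" using x norm_triangle_ineq2[of x "\<epsilon> k *\<^sub>R z"] by linarith
      then have "cutoff (real (Suc k)) (x - \<epsilon> k *\<^sub>R z) = 0"
        unfolding cutoff_def by (simp add: pos_le_divide_eq)
      then show ?thesis by (simp add: c_def)
    qed (simp add: ker_eq_0)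
    show ?thesis unfolding F_def mollify_def z by simp
  qed
  have nn: "0 \<le> F k x" for k x
    unfolding F_def mollify_def c_def using cutoff_bounds(1)
    by (intro Bochner_Integration.integral_nonneg mult_nonneg_nonneg) auto
  obtain a where a: "dirichlet f = ennreal a" "0 \<le> a" using fin by (cases "dirichlet f") auto
  obtain b where b: "sq_norm f = ennreal b" "0 \<le> b" using f by (cases "sq_norm f") (auto simp: L2_def)
  have dc2: "dirichlet (c k) \<le> ennreal (2 * a + 2 * b)" for k
  proof -
    have "(1 + 1 / real (Suc k)) * a \<le> 2 * a" "2 / real (Suc k) * b \<le> 2 * b"
      using a b by (auto intro!: mult_right_mono simp: field_simps)
    then have "(1 + 1 / real (Suc k)) * a + 2 / real (Suc k) * b \<le> 2 * a + 2 * b" by linarith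
    moreover have "ennreal (1 + 1 / real (Suc k)) * dirichlet f + ennreal (2 / real (Suc k)) * sq_norm f = ennreal ((1 + 1 / real (Suc k)) * a + 2 / real (Suc k) * b)"
      unfolding a b by (rule ennreal_combine2) (use a b in auto)
    ultimately show ?thesis using dc[of k] ennreal_leI order_trans by metis
  qed
  have "AE x in lborel. summable (\<lambda>k. \<bar>F k x - c k x\<bar>)"
  proof (rule AE_tendsto_0_if_summable[where C="2 * a + 2 * b"])
    show "(\<lambda>x. F k x - c k x) \<in> borel_measurable lborel" for k unfolding F_def by measurable
    fix k
    have "(\<integral>\<^sup>+x. ennreal ((F k x - c k x)\<^sup>2) \<partial>lborel) = sq_norm (\<lambda>x. F k x - c k x)" by (simp add: sq_norm_def)
    also have "\<dots> \<le> ennreal ((\<epsilon> k)\<^sup>2) * dq_energy (\<epsilon> k) (c k)" unfolding F_def by (rule mollify_dist[OF Lc \<epsilon>(1)])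
    also have "\<dots> \<le> ennreal ((\<epsilon> k)\<^sup>2) * ennreal (2 * a + 2 * b)"
      by (intro mult_left_mono order_trans[OF dq_le_dirichlet[OF \<epsilon>(1)] dc2]) simp
    also have "\<dots> = ennreal ((2 * a + 2 * b) * (1/4) ^ k)"
    proof -
      have "(\<epsilon> k)\<^sup>2 = (1/4) ^ k" by (simp add: \<epsilon>_def power2_eq_square power_mult_distrib[symmetric])
      then show ?thesis using a b by (subst ennreal_mult[symmetric]) (auto simp: mult.commute)
    qed
    finally show "(\<integral>\<^sup>+x. ennreal ((F k x - c k x)\<^sup>2) \<partial>lborel) \<le> ennreal ((2 * a + 2 * b) * (1/4) ^ k)" .
  qed (use a b in simp)
  then have lim: "AE x in lborel. (\<lambda>k. F k x) \<longlonglongrightarrow> \<bar>f x\<bar>"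
  proof eventually_elim
    case (elim x)
    have "(\<lambda>k. \<bar>F k x - c k x\<bar>) \<longlonglongrightarrow> 0" by (rule summable_LIMSEQ_zero[OF elim])
    then have 1: "(\<lambda>k. F k x - c k x) \<longlonglongrightarrow> 0" by (rule tendsto_rabs_zero_cancel)
    have "\<forall>\<^sub>F k in sequentially. c k x = \<bar>f x\<bar>"
      using eventually_ge_at_top[of "nat \<lceil>norm x\<rceil>"]
    proof eventually_elim
      case (elim k)
      then have "norm x \<le> real (Suc k)" by linarith
      then have "norm x / real (Suc k) \<le> 1" by simp
      then have "cutoff (real (Suc k)) x = 1" unfolding cutoff_def by linarith
      then show ?case by (simp add: c_def)
    qed
    then have 2: "(\<lambda>k. c k x) \<longlonglongrightarrow> \<bar>f x\<bar>" by (rule tendsto_eventually)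
    from tendsto_add[OF 1 2] show ?case by simp
  qed
  show ?thesis
  proof (intro exI[of _ F] conjI allI lim Lip nn)
    show "\<exists>R>0. \<forall>x. R < norm x \<longrightarrow> F k x = 0" for k
      using supp[of k] by (intro exI[of _ "2 * real (Suc k) + 1"]) auto
    show "sq_norm (F k) \<le> sq_norm f" for k
      unfolding F_def by (rule order_trans[OF sq_norm_mollify_le[OF Lc] sqc])
    show "dirichlet (F k) \<le> ennreal (1 + 1 / real (Suc k)) * dirichlet f + ennreal (2 / real (Suc k)) * sq_norm f" for k
      unfolding F_def by (rule order_trans[OF dirichlet_mollify[OF Lc \<epsilon>(1)] dc])
  qed
qed

lemma lborel_distr_hrefl:
  assumes "norm e = 1"
  shows "distr lborel borel (hrefl e t) = lborel"
proof (rule measure_eqI)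
  fix A assume "A \<in> sets (distr lborel borel (hrefl e t))"
  then have [measurable]: "A \<in> sets borel" by simp
  have "emeasure (distr lborel borel (hrefl e t)) A = (\<integral>\<^sup>+x. indicator A x \<partial>distr lborel borel (hrefl e t))"
    by simp
  also have "\<dots> = (\<integral>\<^sup>+x. indicator A (hrefl e t x) \<partial>lborel)"
    by (rule nn_integral_distr) (use hrefl_measurable in auto)
  also have "\<dots> = (\<integral>\<^sup>+x. indicator A x \<partial>lborel)"
    by (rule nn_integral_hrefl[OF _ assms]) measurable
  finally show "emeasure (distr lborel borel (hrefl e t)) A = emeasure lborel A" by simp
qed simp

lemma integral_hrefl:
  fixes f :: "'a::euclidean_space \<Rightarrow> real"
  assumes "norm e = 1" and [measurable]: "f \<in> borel_measurable borel"
  shows "(LINT x|lborel. f (hrefl e t x)) = (LINT x|lborel. f x)"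
proof -
  have "(LINT x|lborel. f x) = (LINT x|distr lborel borel (hrefl e t). f x)"
    by (simp add: lborel_distr_hrefl[OF assms(1)])
  also have "\<dots> = (LINT x|lborel. f (hrefl e t x))"
    by (rule integral_distr) (use hrefl_measurable in auto)
  finally show ?thesis by simp
qed

lemma integrable_hrefl:
  fixes f :: "'a::euclidean_space \<Rightarrow> real"
  assumes e: "norm e = 1" and f: "integrable lborel f"
  shows "integrable lborel (\<lambda>x. f (hrefl e t x))"
proof -
  have "hrefl e t \<in> measurable lborel borel" using hrefl_measurable by auto
  moreover have "integrable (distr lborel borel (hrefl e t)) f" using f by (simp add: lborel_distr_hrefl[OF e])
  ultimately show ?thesis by (metis integrable_distr)
qed

text \<open>Sorting two values preserves closeness. If \<open>x\<close> and \<open>y\<close> lie on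
  opposite sides, reflecting one of them brings it no farther from the other, so the values may be
  compared crosswise.\<close>

lemma polar_lipschitz:
  fixes f :: "'a::euclidean_space \<Rightarrow> real"
  assumes e: "norm e = 1" and L: "\<And>x y. \<bar>f x - f y\<bar> \<le> L * norm (x - y)" "0 \<le> L"
  shows "\<bar>polar e t f x - polar e t f y\<bar> \<le> L * norm (x - y)"
proof -
  define D where "D = L * norm (x - y)"
  have 1: "\<bar>f x - f y\<bar> \<le> D" "\<bar>f (hrefl e t x) - f (hrefl e t y)\<bar> \<le> D"
    using L(1)[of x y] L(1)[of "hrefl e t x" "hrefl e t y"] by (auto simp: D_def norm_hrefl_hrefl[OF e])
  show ?thesis
  proof (cases "(t \<le> x \<bullet> e) = (t \<le> y \<bullet> e)")
    case True
    then show ?thesis using 1 unfolding D_def[symmetric] polar_def by (auto simp: max_def min_def)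
  next
    case False
    then have "(x \<bullet> e - t) * (y \<bullet> e - t) \<le> 0"
      by (auto simp: mult_le_0_iff)
    then have "L * norm (x - hrefl e t y) \<le> D"
      unfolding D_def by (intro mult_left_mono L norm_hrefl_le(2)[OF e])
    then have 2: "\<bar>f x - f (hrefl e t y)\<bar> \<le> D" "\<bar>f (hrefl e t x) - f y\<bar> \<le> D"
      using L(1)[of x "hrefl e t y"] L(1)[of "hrefl e t x" y] norm_hrefl_commute[OF e, of x t y] by auto
    show ?thesis using False 1 2 unfolding D_def[symmetric] polar_def by (auto simp: max_def min_def)
  qed
qed

lemma continuous_on_lipschitz:
  fixes f :: "'a::euclidean_space \<Rightarrow> real"
  assumes "\<And>x y. \<bar>f x - f y\<bar> \<le> L * norm (x - y)"
  shows "continuous_on UNIV f"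
proof (rule continuous_on_subset[OF lipschitz_on_continuous_on])
  show "(max 0 L)-lipschitz_on UNIV f"
  proof (rule lipschitz_onI)
    fix x y
    have "\<bar>f x - f y\<bar> \<le> L * norm (x - y)" by (rule assms)
    also have "\<dots> \<le> max 0 L * norm (x - y)" by (intro mult_right_mono) auto
    finally show "dist (f x) (f y) \<le> max 0 L * dist x y" by (simp add: dist_norm)
  qed simp
qed simp

text \<open>Over each pair of mirror points polarization only permutes the two values.\<close>

lemma sq_norm_polar:
  fixes f :: "'a::euclidean_space \<Rightarrow> real"
  assumes e: "norm e = 1" and [measurable]: "f \<in> borel_measurable borel"
  shows "sq_norm (polar e t f) = sq_norm f"
proof -
  have *: "2 * sq_norm g = (\<integral>\<^sup>+x. ennreal ((norm (g x))\<^sup>2) + ennreal ((norm (g (hrefl e t x)))\<^sup>2) \<partial>lborel)"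
    if [measurable]: "g \<in> borel_measurable borel" for g :: "'a \<Rightarrow> real"
  proof -
    have "(\<integral>\<^sup>+x. ennreal ((norm (g (hrefl e t x)))\<^sup>2) \<partial>lborel) = sq_norm g"
      unfolding sq_norm_def by (rule nn_integral_hrefl[OF _ e, where f="\<lambda>x. ennreal ((norm (g x))\<^sup>2)"]) measurable
    then show ?thesis by (subst nn_integral_add) (auto simp: sq_norm_def mult_2)
  qed
  have "2 * sq_norm (polar e t f) = 2 * sq_norm f"
    unfolding *[OF assms(2)] *[OF polar_measurable[OF assms(2)]]
  proof (rule nn_integral_cong)
    fix x
    have "polar e t f x = f x \<and> polar e t f (hrefl e t x) = f (hrefl e t x) \<or> polar e t f x = f (hrefl e t x) \<and> polar e t f (hrefl e t x) = f x"
      using polar_pair[OF e, where t=t and f=f and x=x] by (cases "t \<le> x \<bullet> e") (auto simp: max_def min_def)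
    then show "ennreal ((norm (polar e t f x))\<^sup>2) + ennreal ((norm (polar e t f (hrefl e t x)))\<^sup>2) = ennreal ((norm (f x))\<^sup>2) + ennreal ((norm (f (hrefl e t x)))\<^sup>2)"
      by (auto simp: add.commute)
  qed
  then show ?thesis by (simp add: ennreal_mult_cancel_left)
qed

text \<open>If \<open>x\<close> is strictly closer to the origin than \<open>y\<close>, the
  hyperplane halfway between them has the origin and \<open>x\<close> on the same side, and its
  reflection takes \<open>x\<close> to \<open>y\<close>. Equality of the norms is reached by
  continuity.\<close>

lemma radial_decr_if_polarized:
  fixes g :: "'a::euclidean_space \<Rightarrow> real"
  assumes cont: "continuous_on UNIV g"
    and pol: "\<And>e t x. norm e = 1 \<Longrightarrow> t < 0 \<Longrightarrow> t < x \<bullet> e \<Longrightarrow> g (hrefl e t x) \<le> g x"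
  shows "radial_decr g"
proof -
  have strict: "g y \<le> g x" if xy: "norm x < norm y" for x y
  proof -
    define e where "e = (x - y) /\<^sub>R norm (x - y)"
    \<comment> \<open>The position of the perpendicular bisector of \<open>x\<close> and
      \<open>y\<close> along \<open>e\<close>; it is negative because
      \<open>norm x < norm y\<close>.\<close>
    define t where "t = ((norm x)\<^sup>2 - (norm y)\<^sup>2) / (2 * norm (x - y))"
    have ne: "x \<noteq> y" using xy by auto
    then have e: "norm e = 1" by (simp add: e_def)
    have n2: "(norm (x - y))\<^sup>2 = (norm x)\<^sup>2 - 2 * (x \<bullet> y) + (norm y)\<^sup>2"
      by (simp add: power2_norm_eq_inner inner_diff_left inner_diff_right inner_commute)
    have "(norm x)\<^sup>2 < (norm y)\<^sup>2" using xy by (simp add: power_strict_mono)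
    then have t0: "t < 0" using ne by (simp add: t_def divide_less_0_iff)
    have xe: "x \<bullet> e = ((norm x)\<^sup>2 - x \<bullet> y) / norm (x - y)"
      by (simp add: e_def inner_diff_right power2_norm_eq_inner divide_inverse mult.commute)
    have xt: "x \<bullet> e - t = norm (x - y) / 2"
    proof -
      have "x \<bullet> e - t = (2 * ((norm x)\<^sup>2 - x \<bullet> y) - ((norm x)\<^sup>2 - (norm y)\<^sup>2)) / (2 * norm (x - y))"
        unfolding xe t_def using ne by (simp add: field_simps)
      also have "2 * ((norm x)\<^sup>2 - x \<bullet> y) - ((norm x)\<^sup>2 - (norm y)\<^sup>2) = (norm (x - y))\<^sup>2" by (simp add: n2)
      finally show ?thesis using ne by (simp add: power2_eq_square)
    qed
    then have "hrefl e t x = x - norm (x - y) *\<^sub>R e" unfolding hrefl_def by simp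
    then have "hrefl e t x = y" using ne by (simp add: e_def)
    moreover have "t < x \<bullet> e" using xt ne by (metis diff_gt_0_iff_gt half_gt_zero zero_less_norm_iff right_minus_eq)
    ultimately show ?thesis using pol[OF e t0] by metis
  qed
  show ?thesis
    unfolding radial_decr_def
  proof (intro allI impI)
    fix x y :: 'a assume le: "norm x \<le> norm y"
    show "g y \<le> g x"
    proof (cases "norm y = 0")
      case False
      \<comment> \<open>Points on the segment from 0 to \<open>x\<close> that are strictly shorter
        than \<open>y\<close> and converge to \<open>x\<close>.\<close>
      define a where "a n = (1 - inverse (real (Suc n))) *\<^sub>R x" for n
      have "(\<lambda>n. (1 - inverse (real (Suc n))) *\<^sub>R x) \<longlonglongrightarrow> (1 - 0) *\<^sub>R x"
        by (intro tendsto_intros LIMSEQ_inverse_real_of_nat)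
      then have "a \<longlonglongrightarrow> x" by (simp add: a_def[abs_def])
      moreover have "isCont g x" using cont by (simp add: continuous_on_eq_continuous_at)
      ultimately have lim: "(\<lambda>n. g (a n)) \<longlonglongrightarrow> g x" by (rule isCont_tendsto_compose[rotated])
      have "g y \<le> g (a n)" for n
      proof (rule strict)
        have i: "0 < inverse (real (Suc n))" "inverse (real (Suc n)) \<le> 1" by (auto simp: field_simps)
        then have "norm (a n) = (1 - inverse (real (Suc n))) * norm x" unfolding a_def by simp
        also have "\<dots> \<le> (1 - inverse (real (Suc n))) * norm y" using i le by (intro mult_left_mono) auto
        also have "\<dots> < 1 * norm y" using i False by (intro mult_strict_right_mono) auto
        finally show "norm (a n) < norm y" by simp
      qed
      then show ?thesis by (intro LIMSEQ_le_const[OF lim]) auto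
    qed (use le in simp)
  qed
qed

lemma riesz_mono_off_origin:
  fixes f :: "'a::euclidean_space \<Rightarrow> real"
  assumes "0 \<le> p" and le: "\<And>x. x \<noteq> 0 \<Longrightarrow> \<bar>f x\<bar> \<le> \<bar>g x\<bar>"
  shows "riesz \<alpha> p f \<le> riesz \<alpha> p g"
proof -
  have ne: "AE x in lborel. x \<noteq> (0::'a)" by (rule AE_lborel_singleton)
  show ?thesis
    unfolding riesz_def
  proof (rule nn_integral_mono_AE, use ne in eventually_elim)
    case x: (elim x)
    show ?case
    proof (rule nn_integral_mono_AE, use ne in eventually_elim)
      case (elim y)
      show ?case
        using le[OF x] le[OF elim] assms(1) by (intro ennreal_leI divide_right_mono mult_mono powr_mono2) auto
    qed
  qed
qed

text \<open>Places a bounded function supported in a ball of radius \<open>R\<close> below a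
  multiple of \<open>envelope\<close>, so that \<open>riesz_dominated\<close> covers it as
  well.\<close>

lemma bounded_le_envelope:
  assumes "DIM('a::euclidean_space) \<ge> 3" "1 \<le> R" "x \<noteq> 0" "norm (x::'a) \<le> R"
  shows "1 \<le> R powr (real DIM('a) / 2) * envelope x"
proof -
  define N where "N = real DIM('a)"
  have N: "3 \<le> N" using assms by (simp add: N_def)
  have "R powr (- (N / 2)) \<le> norm x powr (- (N / 2))"
    using assms N by (intro powr_mono2') auto
  moreover have "R powr (- (N / 2)) \<le> R powr (1 - N / 2)"
    using assms by (intro powr_mono) auto
  moreover have "R powr (1 - N / 2) \<le> norm x powr (1 - N / 2)"
    using assms N by (intro powr_mono2') auto
  ultimately have "R powr (- (N / 2)) \<le> envelope x" unfolding envelope_def N_def by simp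
  then have "R powr (N / 2) * R powr (- (N / 2)) \<le> R powr (N / 2) * envelope x" by (intro mult_left_mono) auto
  moreover have "R powr (N / 2) * R powr (- (N / 2)) = 1" using assms by (simp flip: powr_add)
  ultimately show ?thesis by (simp add: N_def)
qed

text \<open>All constraints pass to uniform limits and to polarizations at half spaces containing the origin. By Arzela--Ascoli the
  integral of \<open>g\<close> against a strictly radially decreasing weight attains its maximum on this class, and each such
  polarization that changed a maximiser would increase the integral.\<close>
definition sym_class :: "real \<Rightarrow> real \<Rightarrow> real \<Rightarrow> real \<Rightarrow> ('a::euclidean_space \<Rightarrow> real) \<Rightarrow> ('a \<Rightarrow> real) set" where
  "sym_class \<alpha> p L R f = {g. (\<forall>x y. \<bar>g x - g y\<bar> \<le> L * norm (x - y)) \<and> (\<forall>x. 0 \<le> g x) \<and> (\<forall>x. R < norm x \<longrightarrow> g x = 0)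
     \<and> sq_norm g \<le> sq_norm f \<and> (\<forall>s>0. dq_energy s g \<le> dq_energy s f) \<and> riesz \<alpha> p f \<le> riesz \<alpha> p g}"

text \<open>The support is the only constraint that depends on the position of the half space. For
  \<open>t < 0\<close> the side that receives the maxima contains the origin, so a point of that
  side outside the ball has its mirror image even farther out.\<close>

lemma polar_sym_class:
  fixes f :: "'a::euclidean_space \<Rightarrow> real"
  assumes g: "g \<in> sym_class \<alpha> p L R f" and e: "norm e = 1" and t: "t < 0" and L: "0 \<le> L" and \<alpha>: "\<alpha> < real DIM('a)" and p: "0 \<le> p"
  shows "polar e t g \<in> sym_class \<alpha> p L R f"
proof -
  have g': "\<And>x y. \<bar>g x - g y\<bar> \<le> L * norm (x - y)" "\<And>x. 0 \<le> g x" "\<And>x. R < norm x \<Longrightarrow> g x = 0"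
     "sq_norm g \<le> sq_norm f" "\<And>s. 0 < s \<Longrightarrow> dq_energy s g \<le> dq_energy s f" "riesz \<alpha> p f \<le> riesz \<alpha> p g"
    using g unfolding sym_class_def by auto
  have [measurable]: "g \<in> borel_measurable borel"
    by (rule borel_measurable_continuous_onI[OF continuous_on_lipschitz[OF g'(1)]])
  have "polar e t g x = 0" if x: "R < norm x" for x
  proof (cases "t \<le> x \<bullet> e")
    case True
    have "norm (0 - x) \<le> norm (0 - hrefl e t x)"
    proof (rule norm_hrefl_le(1)[OF e])
      show "0 \<le> (0 \<bullet> e - t) * (x \<bullet> e - t)" by (intro mult_nonneg_nonneg) (use t True in auto)
    qed
    then have "R < norm (hrefl e t x)" using x by simp
    then show ?thesis using True g'(3) x by (simp add: polar_def)
  next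
    case False
    then show ?thesis using g'(2)[of "hrefl e t x"] g'(3)[OF x] by (simp add: polar_def)
  qed
  moreover have "dq_energy s (polar e t g) \<le> dq_energy s f" if "0 < s" for s
    using dq_energy_polar[OF _ that e, where u=g and t=t] g'(5)[OF that] by (auto intro: order_trans)
  moreover have "riesz \<alpha> p f \<le> riesz \<alpha> p (polar e t g)"
    using riesz_polar[OF e \<alpha> g'(2) p, where t=t] g'(6) by (auto intro: order_trans)
  ultimately show ?thesis
    unfolding sym_class_def using polar_lipschitz[OF e g'(1) L] polar_nonneg[OF g'(2)] sq_norm_polar[OF e, where f=g and t=t] g'(4) by auto
qed

lemma symmetrization:
  fixes f :: "'a::euclidean_space \<Rightarrow> real"
  assumes dim: "DIM('a) \<ge> 3" and \<alpha>: "0 < \<alpha>" "\<alpha> < real DIM('a)"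
    and p: "(real DIM('a) + \<alpha>) / real DIM('a) < p" "p < (real DIM('a) + \<alpha>) / (real DIM('a) - 2)"
    and L: "\<And>x y. \<bar>f x - f y\<bar> \<le> L * norm (x - y)" "0 \<le> L" and f0: "\<And>x. 0 \<le> f x" and supp: "\<And>x. R < norm x \<Longrightarrow> f x = 0" and "0 < R"
  shows "\<exists>g::'a \<Rightarrow> real. radial_decr g \<and> (\<forall>x. 0 \<le> g x) \<and> continuous_on UNIV g \<and> sq_norm g \<le> sq_norm f \<and> dirichlet g \<le> dirichlet f \<and> riesz \<alpha> p f \<le> riesz \<alpha> p g"
proof -
  define \<A> where "\<A> = sym_class \<alpha> p L R f"
  have p0: "0 < p" using p(1) \<alpha> by (smt (verit) divide_nonneg_nonneg of_nat_0_le_iff)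
  \<comment> \<open>Each member of the class vanishes at distance \<open>R + 1\<close> from the
    origin, which is at most \<open>2 * R + 1\<close> away from any point of the ball; the Lipschitz
    bound then limits its values.\<close>
  define B where "B = L * (2 * R + 1) + 1"
  have B: "0 < B" using L \<open>0 < R\<close> by (simp add: B_def add_nonneg_pos)
  obtain b :: 'a where b: "b \<in> Basis" using nonempty_Basis by blast
  have fA: "f \<in> \<A>" using L f0 supp by (auto simp: \<A>_def sym_class_def)
  have gA: "\<And>x y. \<bar>g x - g y\<bar> \<le> L * norm (x - y)" "\<And>x. 0 \<le> g x" "\<And>x. R < norm x \<Longrightarrow> g x = 0"
     "sq_norm g \<le> sq_norm f" "\<And>s. 0 < s \<Longrightarrow> dq_energy s g \<le> dq_energy s f" "riesz \<alpha> p f \<le> riesz \<alpha> p g"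
     if "g \<in> \<A>" for g
    using that unfolding \<A>_def sym_class_def by auto
  have gB: "g x \<le> B * indicator (cball 0 R) x" if "g \<in> \<A>" for g x
  proof (cases "norm x \<le> R")
    case True
    have "g ((R + 1) *\<^sub>R b) = 0" using b \<open>0 < R\<close> by (intro gA(3)[OF that]) simp
    then have "g x \<le> L * norm (x - (R + 1) *\<^sub>R b)" using gA(1)[OF that, of x "(R + 1) *\<^sub>R b"] by simp
    also have "\<dots> \<le> L * (2 * R + 1)"
    proof (rule mult_left_mono)
      have "norm (x - (R + 1) *\<^sub>R b) \<le> norm x + norm ((R + 1) *\<^sub>R b)" by (rule norm_triangle_ineq4)
      then show "norm (x - (R + 1) *\<^sub>R b) \<le> 2 * R + 1" using True b \<open>0 < R\<close> by simp
    qed (rule L)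
    finally show ?thesis using True by (simp add: B_def)
  qed (use gA(3)[OF that] in simp)
  have gm: "g \<in> borel_measurable borel" if "g \<in> \<A>" for g
    by (rule borel_measurable_continuous_onI[OF continuous_on_lipschitz[OF gA(1)[OF that]]])
  \<comment> \<open>A bounded weight that decreases strictly with the norm; every polarization
    toward the origin that changes the function moves mass to larger weights.\<close>
  define w where "w x = 1 / (1 + norm x)" for x :: 'a
  have w: "0 < w x" "w x \<le> 1" for x by (auto simp: w_def add_pos_nonneg)
  have [measurable]: "w \<in> borel_measurable borel" unfolding w_def by measurable
  define J where "J g = (LINT x|lborel. g x * w x)" for g
  have ind: "integrable lborel (\<lambda>x::'a. B * indicator (cball 0 R) x)"
    using emeasure_bounded_finite[of "cball (0::'a) R"] by (intro integrable_mult_right integrable_real_indicator) auto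
  have gw: "\<bar>g x * w x\<bar> \<le> B * indicator (cball 0 R) x" if "g \<in> \<A>" for g x
  proof -
    have "g x * w x \<le> g x" using w[of x] gA(2)[OF that, of x] by (simp add: mult_left_le)
    then show ?thesis using gB[OF that, of x] w[of x] gA(2)[OF that, of x] by (simp add: abs_mult)
  qed
  have Ji: "integrable lborel (\<lambda>x. g x * w x)" if "g \<in> \<A>" for g
    using gm[OF that] by (intro Bochner_Integration.integrable_bound[OF ind]) (use gw[OF that] B in \<open>auto simp: abs_mult\<close>)
  have bdd: "bdd_above (J ` \<A>)"
  proof (rule bdd_aboveI2)
    fix g assume g: "g \<in> \<A>"
    show "J g \<le> (LINT x|lborel. B * indicator (cball 0 R) (x::'a))"
      unfolding J_def by (rule integral_mono[OF Ji[OF g] ind]) (use gw[OF g] in \<open>meson abs_le_D1\<close>)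
  qed
  define S where "S = Sup (J ` \<A>)"
  have JS: "J g \<le> S" if "g \<in> \<A>" for g unfolding S_def using that bdd by (auto intro: cSup_upper)
  have "\<exists>g. g \<in> \<A> \<and> S - inverse (real (Suc n)) < J g" for n
  proof -
    have "S - inverse (real (Suc n)) < Sup (J ` \<A>)" by (simp add: S_def)
    then show ?thesis using fA bdd by (subst (asm) less_cSup_iff) auto
  qed
  then obtain h where h: "\<And>n. h n \<in> \<A>" "\<And>n. S - inverse (real (Suc n)) < J (h n)" by metis
  obtain g0 and k :: "nat \<Rightarrow> nat" where k: "strict_mono k" and
    unif: "\<And>e. 0 < e \<Longrightarrow> \<exists>N. \<forall>n x. n \<ge> N \<and> x \<in> cball 0 (R + 1) \<longrightarrow> norm (h (k n) x - g0 x) < e"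
  proof (rule Arzela_Ascoli[of "cball 0 (R + 1)" h B])
    show "norm (h n x) \<le> B" for n x using gB[OF h(1), of n x] gA(2)[OF h(1), of n x] B by (cases "norm x \<le> R") auto
    show "\<exists>d>0. \<forall>n y. y \<in> cball 0 (R + 1) \<and> norm (x - y) < d \<longrightarrow> norm (h n x - h n y) < e" if "0 < e" for x e
    proof (intro exI[of _ "e / (L + 1)"] conjI allI impI)
      show "0 < e / (L + 1)" using that L by simp
      fix n y assume y: "y \<in> cball 0 (R + 1) \<and> norm (x - y) < e / (L + 1)"
      have "norm (h n x - h n y) \<le> L * norm (x - y)" using gA(1)[OF h(1)] by simp
      also have "\<dots> \<le> (L + 1) * norm (x - y)" by (intro mult_right_mono) auto
      also have "\<dots> < e" using y L by (simp add: pos_less_divide_eq mult.commute)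
      finally show "norm (h n x - h n y) < e" .
    qed
  qed (use that in auto)
  \<comment> \<open>The uniform limit is known only on the compact ball. Outside of it all members
    of the class vanish, and so does \<open>g\<close>.\<close>
  define g where "g x = (if norm x \<le> R + 1 then g0 x else 0)" for x
  have lim: "(\<lambda>n. h (k n) x) \<longlonglongrightarrow> g x" for x
  proof (cases "norm x \<le> R + 1")
    case True
    show ?thesis
    proof (rule LIMSEQ_I)
      fix r :: real assume "0 < r"
      from unif[OF this] show "\<exists>no. \<forall>n\<ge>no. norm (h (k n) x - g x) < r" using True by (auto simp: g_def)
    qed
  next
    case False
    then show ?thesis using gA(3)[OF h(1)] by (simp add: g_def)
  qed
  have gnn: "0 \<le> g x" for x by (rule LIMSEQ_le_const[OF lim]) (use gA(2)[OF h(1)] in auto)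
  have gLip: "\<bar>g x - g y\<bar> \<le> L * norm (x - y)" for x y
    by (rule LIMSEQ_le_const2[OF tendsto_rabs[OF tendsto_diff[OF lim lim]]]) (use gA(1)[OF h(1)] in auto)
  have gsupp: "g x = 0" if "R < norm x" for x
    using lim[of x] gA(3)[OF h(1) that] by (simp add: LIMSEQ_const_iff)
  have cont: "continuous_on UNIV g" by (rule continuous_on_lipschitz[OF gLip])
  have [measurable]: "g \<in> borel_measurable borel" using cont by (rule borel_measurable_continuous_onI)
  have [measurable]: "h n \<in> borel_measurable borel" for n by (rule gm[OF h(1)])
  have gsq: "sq_norm g \<le> sq_norm f"
  proof -
    have "sq_norm g = (\<integral>\<^sup>+x. liminf (\<lambda>n. ennreal ((norm (h (k n) x))\<^sup>2)) \<partial>lborel)"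
      unfolding sq_norm_def
    proof (rule nn_integral_cong)
      fix x
      have "(\<lambda>n. ennreal ((norm (h (k n) x))\<^sup>2)) \<longlonglongrightarrow> ennreal ((norm (g x))\<^sup>2)"
        by (intro tendsto_ennrealI tendsto_power tendsto_norm lim)
      then show "ennreal ((norm (g x))\<^sup>2) = liminf (\<lambda>n. ennreal ((norm (h (k n) x))\<^sup>2))"
        by (rule lim_imp_Liminf[OF sequentially_bot, symmetric])
    qed
    also have "\<dots> \<le> liminf (\<lambda>n. sq_norm (h (k n)))" unfolding sq_norm_def by (rule nn_integral_liminf) measurable
    also have "\<dots> \<le> sq_norm f" by (rule Liminf_le) (use gA(4)[OF h(1)] in auto)
    finally show ?thesis .
  qed
  have gdq: "dq_energy s g \<le> dq_energy s f" if "0 < s" for s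
  proof -
    have "dq_energy s g \<le> liminf (\<lambda>n. dq_energy s (h (k n)))"
      by (rule dq_energy_Fatou) (use lim in auto)
    also have "\<dots> \<le> dq_energy s f" by (rule Liminf_le) (use gA(5)[OF h(1) that] in auto)
    finally show ?thesis .
  qed
  have griesz: "riesz \<alpha> p f \<le> riesz \<alpha> p g"
  proof -
    \<comment> \<open>The power of the radius compensates the decay of \<open>envelope\<close>
      across the ball; the maximum with 1 meets the condition on the radius in
      \<open>bounded_le_envelope\<close>.\<close>
    define C where "C = B * (max 1 R) powr (real DIM('a) / 2)"
    have C: "0 < C" using B by (simp add: C_def)
    have "(\<lambda>n. riesz \<alpha> p (h (k n))) \<longlonglongrightarrow> riesz \<alpha> p g"
    proof (rule riesz_dominated[where G="\<lambda>x. C * envelope x"])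
      show "riesz \<alpha> p (\<lambda>x::'a. C * envelope x) < \<infinity>" by (rule riesz_envelope_finite[OF dim \<alpha> p C])
      show "AE x in lborel. (\<lambda>n. h (k n) x) \<longlonglongrightarrow> g x" using lim by simp
      fix n and x :: 'a assume x: "x \<noteq> 0"
      show "\<bar>h (k n) x\<bar> \<le> C * envelope x"
      proof (cases "norm x \<le> R")
        case True
        then have "1 \<le> (max 1 R) powr (real DIM('a) / 2) * envelope x"
          by (intro bounded_le_envelope dim x) auto
        then have "B * 1 \<le> B * ((max 1 R) powr (real DIM('a) / 2) * envelope x)" using B by (intro mult_left_mono) auto
        then show ?thesis using gB[OF h(1), of "k n" x] gA(2)[OF h(1), of "k n" x] True by (simp add: C_def mult.assoc)
      next
        case False
        then show ?thesis using gA(3)[OF h(1), of x "k n"] C by simp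
      qed
    qed (use p0 in auto)
    then show ?thesis by (rule LIMSEQ_le_const) (use gA(6)[OF h(1)] in auto)
  qed
  have gin: "g \<in> \<A>" using gLip gnn gsupp gsq gdq griesz by (auto simp: \<A>_def sym_class_def)
  have "J g = S"
  proof (rule LIMSEQ_unique)
    show "(\<lambda>n. J (h (k n))) \<longlonglongrightarrow> J g"
      unfolding J_def
    proof (rule integral_dominated_convergence[OF _ _ ind])
      show "AE x in lborel. (\<lambda>n. h (k n) x * w x) \<longlonglongrightarrow> g x * w x" by (intro AE_I2 tendsto_mult lim tendsto_const)
      show "AE x in lborel. norm (h (k n) x * w x) \<le> B * indicator (cball 0 R) x" for n using gw[OF h(1)] by simp
    qed measurable
    have "(\<lambda>n. S - inverse (real (Suc n))) \<longlonglongrightarrow> S - 0" by (intro tendsto_intros LIMSEQ_inverse_real_of_nat)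
    then have lS: "(\<lambda>n. S - inverse (real (Suc n))) \<longlonglongrightarrow> S" by simp
    have "(\<lambda>n. J (h n)) \<longlonglongrightarrow> S"
    proof (rule tendsto_sandwich[OF always_eventually always_eventually lS tendsto_const]; rule allI)
      show "S - inverse (real (Suc n)) \<le> J (h n)" for n by (rule less_imp_le[OF h(2)])
      show "J (h n) \<le> S" for n by (rule JS[OF h(1)])
    qed
    then show "(\<lambda>n. J (h (k n))) \<longlonglongrightarrow> S" using LIMSEQ_subseq_LIMSEQ[OF _ k] by (simp add: o_def)
  qed
  then have Jmax: "J h \<le> J g" if "h \<in> \<A>" for h using JS[OF that] by simp
  have "g (hrefl e t x0) \<le> g x0" if e: "norm e = 1" and t: "t < 0" and x0: "t < x0 \<bullet> e" for e t x0
  proof (rule ccontr)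
    assume neg: "\<not> g (hrefl e t x0) \<le> g x0"
    let ?s = "hrefl e t"
    define P where "P = polar e t g"
    have PA: "P \<in> \<A>" unfolding P_def \<A>_def using gin p0 unfolding \<A>_def by (intro polar_sym_class e t L \<alpha>) auto
    have [measurable]: "P \<in> borel_measurable borel" by (rule gm[OF PA])
    define D where "D x = (P x - g x) * w x" for x
    have Di: "integrable lborel D" unfolding D_def left_diff_distrib by (intro Bochner_Integration.integrable_diff Ji PA gin)
    have [measurable]: "D \<in> borel_measurable borel" unfolding D_def by measurable
    have Dle: "(LINT x|lborel. D x) \<le> 0"
      using Jmax[OF PA] Bochner_Integration.integral_diff[OF Ji[OF PA] Ji[OF gin]]
      unfolding D_def left_diff_distrib J_def by simp
    \<comment> \<open>Pairing mirror points makes the gain visible: the sum of the two values is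
      preserved, so \<open>T x\<close> is the change at \<open>x\<close> times the difference of the
      weights, and these two factors have the same sign on either side.\<close>
    define T where "T x = D x + D (?s x)" for x
    have [measurable]: "T \<in> borel_measurable borel" unfolding T_def by measurable
    have Ti: "integrable lborel T" unfolding T_def by (intro Bochner_Integration.integrable_add Di integrable_hrefl e)
    have "(LINT x|lborel. T x) = (LINT x|lborel. D x) + (LINT x|lborel. D (?s x))"
      unfolding T_def by (intro Bochner_Integration.integral_add Di integrable_hrefl e)
    then have Tle: "(LINT x|lborel. T x) \<le> 0"
      using Dle integral_hrefl[OF e, of D t] by simp
    have ps: "P x + P (?s x) = g x + g (?s x)" for x
      unfolding P_def using polar_pair[OF e, where t=t and f=g and x=x] by (cases "t \<le> x \<bullet> e") (auto simp: max_def min_def)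
    have Teq: "T x = (P x - g x) * (w x - w (?s x))" for x
    proof -
      have "P (?s x) - g (?s x) = - (P x - g x)" using ps[of x] by simp
      note q = this
      show ?thesis unfolding T_def D_def q by (simp add: algebra_simps)
    qed
    have wlt: "w (?s x) < w x" if "t < x \<bullet> e" for x
    proof -
      have "norm x < norm (?s x)"
      proof (rule power2_less_imp_less)
        have "0 < (0 \<bullet> e - t) * (x \<bullet> e - t)" using t that by (intro mult_pos_pos) auto
        then show "(norm x)\<^sup>2 < (norm (?s x))\<^sup>2"
          using norm_hrefl_diff_sq[OF e, of 0 t x] by (simp add: mult.assoc)
      qed simp
      then show ?thesis unfolding w_def by (intro divide_strict_left_mono) (auto simp: add_pos_nonneg)
    qed
    have T0: "0 \<le> T x" for x
    proof -
      consider "t < x \<bullet> e" | "x \<bullet> e = t" | "x \<bullet> e < t" by linarith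
      then show ?thesis
      proof cases
        case 1
        then show ?thesis unfolding Teq P_def using wlt[OF 1] polar_pair(1)[OF e, where t=t and f=g and x=x]
          by (intro mult_nonneg_nonneg) auto
      next
        case 2
        then have "?s x = x" by (simp add: hrefl_def)
        then show ?thesis unfolding Teq by simp
      next
        case 3
        have "t < ?s x \<bullet> e" using 3 by (simp add: hrefl_inner[OF e])
        from wlt[OF this] have "w x < w (?s x)" by (simp add: hrefl_hrefl[OF e])
        then show ?thesis unfolding Teq P_def using polar_pair(2)[OF e 3, where f=g]
          by (intro mult_nonpos_nonpos) auto
      qed
    qed
    have "ennreal (LINT x|lborel. T x) = (\<integral>\<^sup>+x. ennreal (T x) \<partial>lborel)"
      using T0 by (intro nn_integral_eq_integral[symmetric] Ti) auto
    moreover have "0 < (\<integral>\<^sup>+x. ennreal (T x) \<partial>lborel)"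
    \<comment> \<open>On this open set the two values are strictly out of order and the polarization
      gains strictly.\<close>
    proof (rule nn_integral_pos_open[of _ "{x. t < x \<bullet> e} \<inter> {x. g x < g (?s x)}"])
      show "open ({x. t < x \<bullet> e} \<inter> {x. g x < g (?s x)})"
        by (intro open_Int open_Collect_less continuous_intros cont continuous_on_compose2[OF cont continuous_on_hrefl]) auto
      show "{x. t < x \<bullet> e} \<inter> {x. g x < g (?s x)} \<noteq> {}" using x0 neg by auto
      fix x assume x: "x \<in> {x. t < x \<bullet> e} \<inter> {x. g x < g (?s x)}"
      then have "0 < T x" unfolding Teq P_def using wlt[of x] polar_pair(1)[OF e, where t=t and f=g and x=x]
        by (intro mult_pos_pos) auto
      then show "0 < ennreal (T x)" by simp
    qed measurable
    ultimately show False using Tle by (simp add: ennreal_neg)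
  qed
  then have "radial_decr g" by (intro radial_decr_if_polarized cont)
  moreover have "dirichlet g \<le> dirichlet f"
    unfolding dirichlet_def using gdq by (intro SUP_mono) auto
  ultimately show ?thesis using gnn cont gsq griesz by (intro exI[of _ g]) simp
qed

section \<open>Maximisers of the Riesz energy\<close>

lemma ennreal_liminf_add:
  fixes a b :: "nat \<Rightarrow> ennreal"
  shows "liminf a + liminf b \<le> liminf (\<lambda>n. a n + b n)"
proof -
  have mono: "incseq (\<lambda>n. INF m\<in>{n..}. a m)" for a :: "nat \<Rightarrow> ennreal"
    by (auto simp: incseq_def intro!: INF_superset_mono)
  have "liminf a + liminf b = (SUP n. (INF m\<in>{n..}. a m) + (INF m\<in>{n..}. b m))"
    unfolding liminf_SUP_INF by (rule ennreal_SUP_add[OF mono mono, symmetric])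
  also have "\<dots> \<le> liminf (\<lambda>n. a n + b n)"
    unfolding liminf_SUP_INF
    by (intro SUP_mono) (auto intro!: INF_greatest add_mono INF_lower)
  finally show ?thesis .
qed

text \<open>The squared \<open>H\<^sup>1\<close> norm, expressed without the gradient.\<close>
definition h1_energy :: "('a::euclidean_space \<Rightarrow> real) \<Rightarrow> ennreal" where
  "h1_energy f = sq_norm f + ennreal (1 / kappa TYPE('a)) * dirichlet f"

text \<open>Reduces a bound for the supremum to one at each scale, where Fatou's lemma applies to
  the sum of both terms. The squared norm is subtracted before the supremum is taken.\<close>

lemma h1_energy_leI:
  fixes f :: "'a::euclidean_space \<Rightarrow> real"
  assumes "\<And>s. 0 < s \<Longrightarrow> sq_norm f + ennreal (1 / kappa TYPE('a)) * dq_energy s f \<le> ennreal B" and B: "0 \<le> B"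
  shows "h1_energy f \<le> ennreal B"
proof -
  let ?k = "kappa TYPE('a)"
  have k: "0 < ?k" by (rule kappa_pos)
  have "sq_norm f \<le> ennreal B" using assms(1)[of 1] by (meson le_iff_add order_trans zero_less_one)
  then obtain a where a: "sq_norm f = ennreal a" "0 \<le> a" "a \<le> B" using B by (cases "sq_norm f") (auto simp: top_unique)
  have "dirichlet f \<le> ennreal (?k * (B - a))"
    unfolding dirichlet_def
  proof (rule SUP_least)
    fix s :: real assume "s \<in> {0<..}"
    then have le: "ennreal a + ennreal (1 / ?k) * dq_energy s f \<le> ennreal B" using assms(1)[of s] a by simp
    then have "ennreal (1 / ?k) * dq_energy s f \<noteq> top" by (auto simp: top_unique)
    then have "dq_energy s f \<noteq> top" using k by (auto simp: ennreal_mult_eq_top_iff)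
    then obtain d where d: "dq_energy s f = ennreal d" "0 \<le> d" by (cases "dq_energy s f") auto
    have "ennreal (a + 1 / ?k * d) \<le> ennreal B"
      using le a d k by (subst ennreal_plus) (auto simp: ennreal_mult[symmetric])
    then have "a + 1 / ?k * d \<le> B" using B by simp
    then have "d \<le> ?k * (B - a)" using k by (simp add: field_simps)
    then show "dq_energy s f \<le> ennreal (?k * (B - a))" using d by (simp add: ennreal_leI)
  qed
  then have "h1_energy f \<le> ennreal a + ennreal (1 / ?k) * ennreal (?k * (B - a))"
    unfolding h1_energy_def a(1) by (intro add_left_mono mult_left_mono) auto
  also have "\<dots> = ennreal (a + 1 / ?k * (?k * (B - a)))"
    using a k by (subst ennreal_mult[symmetric]) (auto simp flip: ennreal_plus)
  also have "a + 1 / ?k * (?k * (B - a)) = B" using k by simp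
  finally show ?thesis .
qed

lemma h1_energy_Fatou:
  fixes f :: "'a::euclidean_space \<Rightarrow> real"
  assumes [measurable]: "f \<in> borel_measurable borel" "\<And>n. F n \<in> borel_measurable borel"
    and lim: "AE x in lborel. (\<lambda>n. F n x) \<longlonglongrightarrow> f x" and le: "\<And>n. h1_energy (F n) \<le> ennreal B" and B: "0 \<le> B"
  shows "h1_energy f \<le> ennreal B"
proof (rule h1_energy_leI[OF _ B])
  fix s :: real assume s: "0 < s"
  let ?c = "ennreal (1 / kappa TYPE('a))"
  have "sq_norm f = (\<integral>\<^sup>+x. liminf (\<lambda>n. ennreal ((norm (F n x))\<^sup>2)) \<partial>lborel)"
    unfolding sq_norm_def
  proof (rule nn_integral_cong_AE, use lim in eventually_elim)
    case (elim x)
    have "(\<lambda>n. ennreal ((norm (F n x))\<^sup>2)) \<longlonglongrightarrow> ennreal ((norm (f x))\<^sup>2)"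
      by (intro tendsto_ennrealI tendsto_power tendsto_norm elim)
    then show ?case by (rule lim_imp_Liminf[OF sequentially_bot, symmetric])
  qed
  also have "\<dots> \<le> liminf (\<lambda>n. sq_norm (F n))" unfolding sq_norm_def by (rule nn_integral_liminf) measurable
  finally have 1: "sq_norm f \<le> liminf (\<lambda>n. sq_norm (F n))" .
  have 2: "?c * dq_energy s f \<le> liminf (\<lambda>n. ?c * dq_energy s (F n))"
  proof -
    have "?c * dq_energy s f \<le> ?c * liminf (\<lambda>n. dq_energy s (F n))"
      by (intro mult_left_mono dq_energy_Fatou lim) auto
    also have "\<dots> \<le> liminf (\<lambda>n. ?c * dq_energy s (F n))"
      unfolding liminf_SUP_INF SUP_mult_left_ennreal
      by (intro SUP_mono) (auto intro!: INF_greatest mult_left_mono INF_lower)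
    finally show ?thesis .
  qed
  have "sq_norm f + ?c * dq_energy s f \<le> liminf (\<lambda>n. sq_norm (F n) + ?c * dq_energy s (F n))"
    by (rule order_trans[OF add_mono[OF 1 2] ennreal_liminf_add])
  also have "\<dots> \<le> ennreal B"
  proof (rule Liminf_le)
    have "sq_norm (F n) + ?c * dq_energy s (F n) \<le> h1_energy (F n)" for n
      unfolding h1_energy_def by (intro add_left_mono mult_left_mono dq_le_dirichlet s) simp
    then show "\<forall>\<^sub>F n in sequentially. sq_norm (F n) + ?c * dq_energy s (F n) \<le> ennreal B"
      by (intro always_eventually allI order_trans[OF _ le])
  qed simp
  finally show "sq_norm f + ?c * dq_energy s f \<le> ennreal B" .
qed

lemma dq_energy_cmult:
  fixes f :: "'a::euclidean_space \<Rightarrow> real"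
  assumes [measurable]: "f \<in> borel_measurable borel"
  shows "dq_energy s (\<lambda>x. c * f x) = ennreal (c\<^sup>2) * dq_energy s f"
proof -
  have "dq_energy s (\<lambda>x. c * f x) = (\<integral>\<^sup>+h. \<integral>\<^sup>+x. ennreal (c\<^sup>2) * ennreal (ker 1 h * ((f (x + s *\<^sub>R h) - f x) / s)\<^sup>2) \<partial>lborel \<partial>lborel)"
    unfolding dq_energy_def
  proof (rule nn_integral_cong, rule nn_integral_cong)
    fix h x :: 'a
    have eq: "ker 1 h * ((c * f (x + s *\<^sub>R h) - c * f x) / s)\<^sup>2 = c\<^sup>2 * (ker 1 h * ((f (x + s *\<^sub>R h) - f x) / s)\<^sup>2)"
      by (simp add: right_diff_distrib[symmetric] power_mult_distrib power_divide)
    show "ennreal (ker 1 h * ((c * f (x + s *\<^sub>R h) - c * f x) / s)\<^sup>2) = ennreal (c\<^sup>2) * ennreal (ker 1 h * ((f (x + s *\<^sub>R h) - f x) / s)\<^sup>2)"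
      unfolding eq by (rule ennreal_mult) auto
  qed
  also have "\<dots> = ennreal (c\<^sup>2) * dq_energy s f"
    unfolding dq_energy_def by (simp add: nn_integral_cmult)
  finally show ?thesis .
qed

lemma h1_energy_cmult:
  fixes f :: "'a::euclidean_space \<Rightarrow> real"
  assumes [measurable]: "f \<in> borel_measurable borel"
  shows "h1_energy (\<lambda>x. c * f x) = ennreal (c\<^sup>2) * h1_energy f"
proof -
  have "dirichlet (\<lambda>x. c * f x) = ennreal (c\<^sup>2) * dirichlet f"
    unfolding dirichlet_def by (simp add: dq_energy_cmult SUP_mult_left_ennreal)
  moreover have "sq_norm (\<lambda>x. c * f x) = ennreal (c\<^sup>2) * sq_norm f"
    using sq_norm_cmult[of f c] by simp
  ultimately show ?thesis by (simp add: h1_energy_def distrib_left mult_ac)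
qed

lemma h1_energy_bounds:
  fixes f :: "'a::euclidean_space \<Rightarrow> real"
  assumes "h1_energy f \<le> ennreal B" "0 \<le> B"
  shows "sq_norm f \<le> ennreal B" "dirichlet f \<le> ennreal (kappa TYPE('a) * B)"
proof -
  let ?k = "kappa TYPE('a)"
  show "sq_norm f \<le> ennreal B" using assms unfolding h1_energy_def by (meson le_iff_add order_trans)
  have "ennreal (1 / ?k) * dirichlet f \<le> ennreal B"
    using assms unfolding h1_energy_def by (metis add.commute le_iff_add order_trans)
  then have "ennreal ?k * (ennreal (1 / ?k) * dirichlet f) \<le> ennreal ?k * ennreal B" by (rule mult_left_mono) simp
  moreover have "ennreal ?k * (ennreal (1 / ?k) * dirichlet f) = dirichlet f"
    using kappa_pos[where 'a='a] by (simp add: mult.assoc[symmetric] ennreal_mult[symmetric])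
  moreover have "ennreal ?k * ennreal B = ennreal (?k * B)"
    using kappa_pos[where 'a='a] assms by (simp add: ennreal_mult)
  ultimately show "dirichlet f \<le> ennreal (?k * B)" by simp
qed

text \<open>Helly's theorem asks for uniformly bounded increasing functions on the real line. The
  radial profile is therefore taken in the logarithm of the norm and compressed by an order
  reversing map into a bounded interval; the bound \<open>G\<close> keeps the limit away from the
  end point that corresponds to infinity.\<close>

lemma radial_decr_selection:
  fixes g :: "nat \<Rightarrow> 'a::euclidean_space \<Rightarrow> real"
  assumes rd: "\<And>n. radial_decr (g n)" and g0: "\<And>n x. 0 \<le> g n x" and cont: "\<And>n. continuous_on UNIV (g n)"
    and bd: "\<And>n x. x \<noteq> 0 \<Longrightarrow> g n x \<le> G x"
  shows "\<exists>k v. strict_mono (k::nat \<Rightarrow> nat) \<and> v \<in> borel_measurable borel \<and> (\<forall>x. 0 \<le> v x) \<and> (AE x in lborel. (\<lambda>n. g (k n) x) \<longlonglongrightarrow> v x)"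
proof -
  obtain b :: 'a where b: "b \<in> Basis" using nonempty_Basis by blast
  define \<gamma> where "\<gamma> n s = g n (exp s *\<^sub>R b)" for n s
  \<comment> \<open>The map \<open>y \<mapsto> - y / (1 + y)\<close> is its own inverse, hence the
    same formula in the definition of \<open>v\<close>; the maximum with 0 there only matters on the
    exceptional set.\<close>
  define \<Phi> where "\<Phi> n s = - (\<gamma> n s / (1 + \<gamma> n s))" for n s
  have \<gamma>0: "0 \<le> \<gamma> n s" for n s by (simp add: \<gamma>_def g0)
  have c\<gamma>: "continuous_on UNIV (\<gamma> n)" for n
    unfolding \<gamma>_def by (rule continuous_on_compose2[OF cont]) (auto intro!: continuous_intros)
  have mono_frac: "x / (1 + x) \<le> y / (1 + y)" if "0 \<le> x" "x \<le> y" for x y :: real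
    using that by (simp add: field_simps)
  have "\<exists>k. strict_mono (k::nat \<Rightarrow> nat) \<and> (\<exists>F. (\<forall>x. continuous (at_right x) F) \<and> mono F \<and> (\<forall>x. \<bar>F x\<bar> \<le> 1) \<and>
    (\<forall>x. continuous (at x) F \<longrightarrow> (\<lambda>n. \<Phi> (k n) x) \<longlonglongrightarrow> F x))"
  proof (rule Helly_selection)
    fix n
    show "continuous (at_right x) (\<Phi> n)" for x
    proof -
      have "1 + \<gamma> n s \<noteq> 0" for s using \<gamma>0[of n s] by linarith
      then have "continuous_on UNIV (\<Phi> n)" unfolding \<Phi>_def by (intro continuous_intros c\<gamma>) auto
      then show ?thesis by (simp add: continuous_on_eq_continuous_at continuous_at_imp_continuous_at_within)
    qed
    show "mono (\<Phi> n)"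
    proof (rule monoI)
      fix x y :: real assume "x \<le> y"
      then have "\<gamma> n y \<le> \<gamma> n x" unfolding \<gamma>_def using b by (intro radial_decrD[OF rd]) simp
      then show "\<Phi> n x \<le> \<Phi> n y" unfolding \<Phi>_def using mono_frac[OF \<gamma>0] by simp
    qed
    show "\<bar>\<Phi> n x\<bar> \<le> 1" for x
      unfolding \<Phi>_def using \<gamma>0[of n x] by (simp add: divide_le_eq)
  qed
  then obtain k F where k: "strict_mono (k::nat \<Rightarrow> nat)" and F: "mono F" "\<And>x. continuous (at x) F \<Longrightarrow> (\<lambda>n. \<Phi> (k n) x) \<longlonglongrightarrow> F x"
    by blast
  define v where "v x = max 0 (- F (ln (norm x)) / (1 + F (ln (norm x))))" for x :: 'a
  have [measurable]: "F \<in> borel_measurable borel" using F(1) by (rule borel_measurable_mono)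
  have "v \<in> borel_measurable borel" unfolding v_def by measurable
  moreover have "0 \<le> v x" for x by (simp add: v_def)
  moreover have "AE x in lborel. (\<lambda>n. g (k n) x) \<longlonglongrightarrow> v x"
  proof -
    \<comment> \<open>Convergence can fail only at the countably many jumps of \<open>F\<close>,
      that is, on countably many spheres, which together form a null set.\<close>
    define S where "S = {s. \<not> isCont F s}"
    have "countable S" unfolding S_def by (rule mono_ctble_discont[OF F(1)])
    have "(\<Union>s\<in>S. sphere (0::'a) (exp s)) \<in> null_sets lborel"
    proof (rule null_sets_UN'[OF \<open>countable S\<close>])
      fix s
      have "sphere (0::'a) (exp s) \<in> null_sets lebesgue"
        using negligible_sphere negligible_iff_null_sets by blast
      moreover have "sphere (0::'a) (exp s) \<in> sets borel" by (intro borel_closed) auto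
      ultimately show "sphere (0::'a) (exp s) \<in> null_sets lborel"
        by (auto simp: null_sets_def)
    qed
    then have "AE x in lborel. x \<notin> (\<Union>s\<in>S. sphere (0::'a) (exp s))"
      by (rule AE_not_in)
    moreover have "AE x in lborel. x \<noteq> (0::'a)" by (rule AE_lborel_singleton)
    ultimately show ?thesis
    proof eventually_elim
      case (elim x)
      define s where "s = ln (norm x)"
      have es: "exp s = norm x" using elim by (simp add: s_def)
      have "s \<notin> S" using elim(1) es by auto
      then have "isCont F s" by (simp add: S_def)
      then have lim: "(\<lambda>n. \<Phi> (k n) s) \<longlonglongrightarrow> F s" by (rule F(2))
      have gx: "g n x = \<gamma> n s" for n
        unfolding \<gamma>_def es using b by (intro antisym radial_decrD[OF rd]) auto
      \<comment> \<open>The bound on the profile keeps the compressed values above a number larger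
        than -1, where the inverse map is continuous.\<close>
      define c where "c = max 0 (G x)"
      have "\<gamma> n s \<le> c" for n using bd[of x n] elim gx[of n] by (simp add: c_def)
      then have "- (c / (1 + c)) \<le> \<Phi> n s" for n unfolding \<Phi>_def using mono_frac[OF \<gamma>0, of n s c] by simp
      then have "- (c / (1 + c)) \<le> F s" by (intro LIMSEQ_le_const[OF lim]) auto
      moreover have "c / (1 + c) < 1" by (simp add: c_def divide_less_eq)
      ultimately have pos: "1 + F s \<noteq> 0" by linarith
      have inv: "- \<Phi> n s / (1 + \<Phi> n s) = \<gamma> n s" for n
      proof -
        have "1 + \<Phi> n s = 1 / (1 + \<gamma> n s)" unfolding \<Phi>_def using \<gamma>0[of n s] by (simp add: field_simps)
        then show ?thesis unfolding \<Phi>_def using \<gamma>0[of n s] by (simp add: field_simps)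
      qed
      have "(\<lambda>n. - \<Phi> (k n) s / (1 + \<Phi> (k n) s)) \<longlonglongrightarrow> - F s / (1 + F s)"
        by (intro tendsto_intros lim pos)
      then have "(\<lambda>n. \<gamma> (k n) s) \<longlonglongrightarrow> - F s / (1 + F s)" unfolding inv .
      moreover from this have "0 \<le> - F s / (1 + F s)" by (rule LIMSEQ_le_const) (use \<gamma>0 in auto)
      then have "v x = - F s / (1 + F s)" unfolding v_def s_def by simp
      ultimately show ?case unfolding gx by simp
    qed
  qed
  ultimately show ?thesis using k by blast
qed

lemma riesz_ker_pos:
  fixes \<alpha> p :: real
  shows "0 < riesz \<alpha> p (ker 1 :: 'a::euclidean_space \<Rightarrow> real)"
  unfolding riesz_def
proof (rule nn_integral_pos_open[of _ "ball 0 1"])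
  fix x :: 'a assume x: "x \<in> ball 0 1"
  show "0 < (\<integral>\<^sup>+y. ennreal (\<bar>ker 1 x\<bar> powr p * \<bar>ker 1 y\<bar> powr p / norm (x - y) powr (real DIM('a) - \<alpha>)) \<partial>lborel)"
  proof (rule nn_integral_pos_open[of _ "ball 0 1 - {x}"])
    show "open (ball 0 1 - {x})" by auto
    obtain b :: 'a where b: "b \<in> Basis" using nonempty_Basis by blast
    have "0 \<in> ball (0::'a) 1" "(1/2) *\<^sub>R b \<in> ball 0 1" "(1/2) *\<^sub>R b \<noteq> 0" using b by auto
    then show "ball 0 1 - {x} \<noteq> {}" by (metis Diff_eq_empty_iff singletonD subsetD)
    fix y assume "y \<in> ball 0 1 - {x}"
    then have "0 < ker 1 y" "0 < ker 1 x" "0 < norm (x - y)" using x by (auto simp: ker_pos_iff)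
    then show "0 < ennreal (\<bar>ker 1 x\<bar> powr p * \<bar>ker 1 y\<bar> powr p / norm (x - y) powr (real DIM('a) - \<alpha>))"
      by simp
  qed measurable
qed auto

lemma riesz_abs [simp]: "riesz \<alpha> p (\<lambda>x. \<bar>f x\<bar>) = riesz \<alpha> p f"
  by (simp add: riesz_def)

text \<open>The supremum is taken over radially decreasing functions only, where the envelope gives
  finiteness and compactness. Lipschitz approximation and \<open>symmetrization\<close> carry the
  inequality over to all functions, and homogeneity turns it into the form with
  \<open>q powr p\<close>.\<close>

lemma riesz_maximiser:
  fixes \<alpha> p :: real
  assumes dim: "DIM('a::euclidean_space) \<ge> 3" and \<alpha>: "0 < \<alpha>" "\<alpha> < real DIM('a)"
    and p: "(real DIM('a) + \<alpha>) / real DIM('a) < p" "p < (real DIM('a) + \<alpha>) / (real DIM('a) - 2)"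
  shows "\<exists>M>0. \<exists>v :: 'a \<Rightarrow> real. v \<in> borel_measurable borel \<and> (\<forall>x. 0 \<le> v x) \<and> h1_energy v \<le> ennreal 1 \<and> riesz \<alpha> p v = ennreal M \<and>
    (\<forall>(f :: 'a \<Rightarrow> real) q. f \<in> borel_measurable borel \<longrightarrow> 0 < q \<longrightarrow> h1_energy f \<le> ennreal q \<longrightarrow> riesz \<alpha> p f \<le> ennreal (M * q powr p))"
proof -
  let ?k = "kappa TYPE('a)"
  have k: "0 < ?k" by (rule kappa_pos)
  have p0: "0 < p" using p(1) \<alpha> by (smt (verit) divide_nonneg_nonneg of_nat_0_le_iff)
  \<comment> \<open>Continuity is required of the competitors but may be lost in the limit, so the
    maximiser itself need not lie in \<open>RR\<close>.\<close>
  define RR where "RR = {g :: 'a \<Rightarrow> real. radial_decr g \<and> (\<forall>x. 0 \<le> g x) \<and> continuous_on UNIV g \<and> h1_energy g \<le> ennreal 1}"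
  have RRD: "radial_decr g" "\<And>x. 0 \<le> g x" "continuous_on UNIV g" "h1_energy g \<le> ennreal 1" if "g \<in> RR" for g
    using that by (auto simp: RR_def)
  have RRm: "g \<in> borel_measurable borel" if "g \<in> RR" for g
    using RRD(3)[OF that] by (rule borel_measurable_continuous_onI)
  obtain C where C: "0 < C" and Cb: "\<And>(g::'a \<Rightarrow> real) x. radial_decr g \<Longrightarrow> (\<And>x. 0 \<le> g x) \<Longrightarrow> g \<in> borel_measurable borel \<Longrightarrow> sq_norm g \<le> ennreal 1 \<Longrightarrow> dirichlet g \<le> ennreal (?k * 1)
     \<Longrightarrow> x \<noteq> 0 \<Longrightarrow> g x \<le> C * norm x powr (- (real DIM('a) / 2)) \<and> g x \<le> C * norm x powr (1 - real DIM('a) / 2)"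
    using radial_bound[OF dim, of 1 "?k * 1"] k by auto
  have envb: "g x \<le> C * envelope x" if "g \<in> RR" "x \<noteq> 0" for g x
    using Cb[OF RRD(1,2)[OF that(1)] RRm[OF that(1)] h1_energy_bounds[OF RRD(4)[OF that(1)]] that(2)] C
    by (auto simp: envelope_def min_def)
  have Gfin: "riesz \<alpha> p (\<lambda>x::'a. C * envelope x) < \<infinity>" by (rule riesz_envelope_finite[OF dim \<alpha> p C])
  have scale: "(\<lambda>x. c * g x) \<in> RR" if "radial_decr g" "\<And>x. 0 \<le> g x" "continuous_on UNIV g" "ennreal (c\<^sup>2) * h1_energy g \<le> ennreal 1" "0 \<le> c" for g c
    unfolding RR_def using that
    by (auto simp: radial_decr_def mult_left_mono h1_energy_cmult[OF borel_measurable_continuous_onI[OF that(3)]] intro!: continuous_intros)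
  obtain c where c: "0 < c" "(\<lambda>x. c * ker 1 x) \<in> RR"
  proof -
    have w: "has_wgrad (ker 1 :: 'a \<Rightarrow> real) (grad (ker 1))" using has_wgrad_test_fun[OF test_fun_ker[of 1 1, where 'a='a]] by simp
    have "h1_energy (ker 1 :: 'a \<Rightarrow> real) \<le> sq_norm (ker 1 :: 'a \<Rightarrow> real) + ennreal (1 / ?k) * (ennreal ?k * sq_norm (grad (ker 1 :: 'a \<Rightarrow> real)))"
      unfolding h1_energy_def by (intro add_left_mono mult_left_mono dirichlet_le_sq_norm[OF w]) simp
    also have "\<dots> < \<infinity>" using w by (simp add: has_wgrad_def L2_def ennreal_mult_less_top)
    finally obtain q where q: "h1_energy (ker 1 :: 'a \<Rightarrow> real) = ennreal q" "0 \<le> q" by (cases "h1_energy (ker 1 :: 'a \<Rightarrow> real)") auto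
    define c where "c = 1 / sqrt (q + 1)"
    have "continuous_on UNIV (ker 1 :: 'a \<Rightarrow> real)"
      using test_fun_differentiable[OF test_fun_ker[of 1 1, where 'a='a]]
      by (intro continuous_at_imp_continuous_on ballI differentiable_imp_continuous_within) simp
    moreover have "radial_decr (ker 1 :: 'a \<Rightarrow> real)" unfolding radial_decr_def by (auto intro: ker_antimono)
    moreover have "ennreal (c\<^sup>2) * h1_energy (ker 1 :: 'a \<Rightarrow> real) \<le> ennreal 1"
    proof -
      have "c\<^sup>2 * q \<le> 1" using q by (simp add: c_def power_divide)
      then show ?thesis unfolding q(1) using q(2) by (subst ennreal_mult[symmetric]) (auto intro: ennreal_leI)
    qed
    ultimately have "(\<lambda>x. c * ker 1 x) \<in> RR" using q by (intro scale) (auto simp: c_def)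
    then show thesis using that[of c] q by (simp add: c_def)
  qed
  define M where "M = enn2real (SUP g\<in>RR. riesz \<alpha> p g)"
  have "(SUP g\<in>RR. riesz \<alpha> p g) \<le> riesz \<alpha> p (\<lambda>x::'a. C * envelope x)"
  proof (rule SUP_least)
    fix g assume g: "g \<in> RR"
    show "riesz \<alpha> p g \<le> riesz \<alpha> p (\<lambda>x::'a. C * envelope x)"
      using envb[OF g] RRD(2)[OF g] C p0 by (intro riesz_mono_off_origin) auto
  qed
  then have SM: "(SUP g\<in>RR. riesz \<alpha> p g) = ennreal M" using Gfin by (simp add: M_def le_less_trans)
  have le_M: "riesz \<alpha> p g \<le> ennreal M" if "g \<in> RR" for g
    unfolding SM[symmetric] using that by (rule SUP_upper)
  have M: "0 < M"
  proof -
    have "0 < ennreal (c powr (2 * p)) * riesz \<alpha> p (ker 1 :: 'a \<Rightarrow> real)"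
      using c riesz_ker_pos[of \<alpha> p, where 'a='a] by (simp add: ennreal_zero_less_mult_iff)
    also have "\<dots> = riesz \<alpha> p (\<lambda>x::'a. c * ker 1 x)" by (rule riesz_cmult[symmetric]) (use c in auto)
    also have "\<dots> \<le> ennreal M" by (rule le_M[OF c(2)])
    finally show ?thesis by simp
  qed
  have "\<exists>f :: nat \<Rightarrow> ennreal. incseq f \<and> range f \<subseteq> riesz \<alpha> p ` RR \<and> Sup (riesz \<alpha> p ` RR) = (SUP i. f i)"
    by (rule ennreal_Sup_countable_SUP) (use c in auto)
  then obtain F where F: "incseq F" "range F \<subseteq> riesz \<alpha> p ` RR" "(SUP i. F i) = ennreal M"
    unfolding SM[symmetric] by metis
  have "\<forall>n. \<exists>g\<in>RR. F n = riesz \<alpha> p g" using F(2) by blast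
  then obtain g where g: "\<And>n. g n \<in> RR" "\<And>n. F n = riesz \<alpha> p (g n)" by metis
  have Flim: "(\<lambda>n. riesz \<alpha> p (g n)) \<longlonglongrightarrow> ennreal M"
    using LIMSEQ_SUP[OF F(1)] unfolding F(3) g(2)[symmetric] .
  have [measurable]: "g n \<in> borel_measurable borel" for n by (rule RRm[OF g(1)])
  obtain k v where k: "strict_mono (k::nat \<Rightarrow> nat)" and [measurable]: "v \<in> borel_measurable borel" and v0: "\<And>x. 0 \<le> v x"
    and lim: "AE x in lborel. (\<lambda>n. g (k n) x) \<longlonglongrightarrow> v x"
    using radial_decr_selection[of g "\<lambda>x. C * envelope x"] RRD[OF g(1)] envb[OF g(1)] by blast
  have Qv: "h1_energy v \<le> ennreal 1"
    by (rule h1_energy_Fatou[OF _ _ lim]) (use RRD(4)[OF g(1)] in auto)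
  have "(\<lambda>n. riesz \<alpha> p (g (k n))) \<longlonglongrightarrow> riesz \<alpha> p v"
  proof (rule riesz_dominated[OF _ _ _ lim p0 _ Gfin])
    show "\<bar>g (k n) x\<bar> \<le> C * envelope x" if "x \<noteq> 0" for n x using envb[OF g(1) that] RRD(2)[OF g(1)] by simp
  qed measurable
  moreover have "(\<lambda>n. riesz \<alpha> p (g (k n))) \<longlonglongrightarrow> ennreal M"
    using LIMSEQ_subseq_LIMSEQ[OF Flim k] by (simp add: o_def)
  ultimately have rv: "riesz \<alpha> p v = ennreal M" by (rule LIMSEQ_unique)
  \<comment> \<open>The strict inequality leaves room for the factors slightly above 1 that the
    approximation introduces; it is removed afterwards by letting \<open>q\<close> decrease to the
    given value.\<close>
  have strict: "riesz \<alpha> p f \<le> ennreal (M * q powr p)"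
    if [measurable]: "f \<in> borel_measurable borel" and q: "0 < q" "h1_energy f < ennreal q" for f :: "'a \<Rightarrow> real" and q
  proof -
    have Qfin: "h1_energy f \<le> ennreal q" using q by simp
    have Lf: "L2 f" using h1_energy_bounds(1)[OF Qfin] q by (auto simp: L2_def le_less_trans)
    have df: "dirichlet f < \<infinity>" using h1_energy_bounds(2)[OF Qfin] q by (auto simp: le_less_trans)
    obtain F where F: "\<And>n. \<exists>L\<ge>0. \<forall>x y. \<bar>F n x - F n y\<bar> \<le> L * norm (x - y)" "\<And>n. \<exists>R>0. \<forall>x. R < norm x \<longrightarrow> F n x = 0" "\<And>n x. 0 \<le> F n x"
      "\<And>n. sq_norm (F n) \<le> sq_norm f" "\<And>n. dirichlet (F n) \<le> ennreal (1 + 1 / real (Suc n)) * dirichlet f + ennreal (2 / real (Suc n)) * sq_norm f"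
      and Flim: "AE x in lborel. (\<lambda>n. F n x) \<longlonglongrightarrow> \<bar>f x\<bar>"
      using lipschitz_approximation[OF Lf df] by blast
    have Fm[measurable]: "F n \<in> borel_measurable borel" for n
    proof -
      obtain L where "\<And>x y. \<bar>F n x - F n y\<bar> \<le> L * norm (x - y)" using F(1) by blast
      then show ?thesis by (intro borel_measurable_continuous_onI continuous_on_lipschitz)
    qed
    obtain a where a: "sq_norm f = ennreal a" "0 \<le> a" using Lf by (cases "sq_norm f") (auto simp: L2_def)
    obtain d where d: "dirichlet f = ennreal d" "0 \<le> d" using df by (cases "dirichlet f") auto
    have kp: "0 < ?k" by (rule kappa_pos)
    have Qeq: "h1_energy f = ennreal (a + 1 / ?k * d)"
      unfolding h1_energy_def a(1) d(1) using a d kp by (subst ennreal_mult[symmetric]) (auto simp flip: ennreal_plus)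
    define r where "r n = a + 1 / ?k * ((1 + 1 / real (Suc n)) * d + 2 / real (Suc n) * a)" for n
    have QF: "h1_energy (F n) \<le> ennreal (r n)" for n
    proof -
      have "h1_energy (F n) \<le> ennreal a + ennreal (1 / ?k) * (ennreal (1 + 1 / real (Suc n)) * ennreal d + ennreal (2 / real (Suc n)) * ennreal a)"
        unfolding h1_energy_def using F(4,5)[of n] unfolding a d by (intro add_mono mult_left_mono) auto
      also have "ennreal (1 + 1 / real (Suc n)) * ennreal d + ennreal (2 / real (Suc n)) * ennreal a = ennreal ((1 + 1 / real (Suc n)) * d + 2 / real (Suc n) * a)"
        by (rule ennreal_combine2) (use a d in auto)
      also have "ennreal a + ennreal (1 / ?k) * ennreal ((1 + 1 / real (Suc n)) * d + 2 / real (Suc n) * a) = ennreal (r n)"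
        unfolding r_def using a d kp by (subst ennreal_mult[symmetric]) (auto simp flip: ennreal_plus)
      finally show ?thesis .
    qed
    have "r \<longlonglongrightarrow> a + 1 / ?k * ((1 + 0) * d + 0 * a)"
    proof -
      have "(\<lambda>n. 2 * inverse (real (Suc n))) \<longlonglongrightarrow> 2 * 0" by (intro tendsto_intros LIMSEQ_inverse_real_of_nat)
      then have "(\<lambda>n. 2 / real (Suc n)) \<longlonglongrightarrow> 0" by (simp add: divide_inverse)
      moreover have "(\<lambda>n. 1 / real (Suc n)) \<longlonglongrightarrow> 0" using LIMSEQ_inverse_real_of_nat by (simp add: divide_inverse)
      ultimately show ?thesis unfolding r_def by (intro tendsto_intros)
    qed
    moreover have "a + 1 / ?k * ((1 + 0) * d + 0 * a) < q" using q(2) q(1) unfolding Qeq by (subst (asm) ennreal_less_iff) (use a d kp in auto)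
    ultimately have ev: "\<forall>\<^sub>F n in sequentially. r n < q" by (rule order_tendstoD)
    have Fle: "riesz \<alpha> p (F n) \<le> ennreal (M * q powr p)" if n: "r n < q" for n
    proof -
      obtain L where L: "0 \<le> L" "\<And>x y. \<bar>F n x - F n y\<bar> \<le> L * norm (x - y)" using F(1) by blast
      obtain R where R: "0 < R" "\<And>x. R < norm x \<Longrightarrow> F n x = 0" using F(2) by blast
      obtain g :: "'a \<Rightarrow> real" where g: "radial_decr g" "\<And>x. 0 \<le> g x" "continuous_on UNIV g" "sq_norm g \<le> sq_norm (F n)" "dirichlet g \<le> dirichlet (F n)" "riesz \<alpha> p (F n) \<le> riesz \<alpha> p g"
      proof -
        have "\<exists>g::'a \<Rightarrow> real. radial_decr g \<and> (\<forall>x. 0 \<le> g x) \<and> continuous_on UNIV g \<and> sq_norm g \<le> sq_norm (F n) \<and> dirichlet g \<le> dirichlet (F n) \<and> riesz \<alpha> p (F n) \<le> riesz \<alpha> p g"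
          by (rule symmetrization[OF dim \<alpha> p L(2) L(1) F(3) _ R(1)]) (rule R(2))
        then show thesis using that by blast
      qed
      have [measurable]: "g \<in> borel_measurable borel" using g(3) by (rule borel_measurable_continuous_onI)
      have "h1_energy g \<le> h1_energy (F n)" unfolding h1_energy_def by (intro add_mono mult_left_mono g) auto
      also have "\<dots> \<le> ennreal q" using QF[of n] n by (meson ennreal_leI less_imp_le order_trans)
      finally have Qg: "h1_energy g \<le> ennreal q" .
      \<comment> \<open>Normalises the symmetrized function to the unit ball; by homogeneity the
        Riesz energy changes by \<open>q powr p\<close>.\<close>
      define c where "c = 1 / sqrt q"
      have c: "0 < c" "c\<^sup>2 = 1 / q" using q by (auto simp: c_def power_divide)
      have "ennreal (c\<^sup>2) * h1_energy g \<le> ennreal (c\<^sup>2) * ennreal q" by (intro mult_left_mono Qg) simp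
      also have "\<dots> = ennreal 1" using c q by (simp flip: ennreal_mult)
      finally have "(\<lambda>x. c * g x) \<in> RR" using c by (intro scale g) auto
      then have "riesz \<alpha> p (\<lambda>x. c * g x) \<le> ennreal M" by (rule le_M)
      then have "ennreal (c powr (2 * p)) * riesz \<alpha> p g \<le> ennreal M" by (subst (asm) riesz_cmult) (use c in auto)
      then have "ennreal (q powr p) * (ennreal (c powr (2 * p)) * riesz \<alpha> p g) \<le> ennreal (q powr p) * ennreal M" by (rule mult_left_mono) simp
      moreover have "q powr p * c powr (2 * p) = 1"
      proof -
        have "c powr (2 * p) = (c powr 2) powr p" by (simp add: powr_powr)
        also have "c powr 2 = 1 / q" using c by (simp add: powr_numeral)
        finally show ?thesis using q by (simp add: powr_divide)
      qed
      then have "ennreal (q powr p) * (ennreal (c powr (2 * p)) * riesz \<alpha> p g) = riesz \<alpha> p g"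
        by (simp add: mult.assoc[symmetric] ennreal_mult[symmetric])
      moreover have "ennreal (q powr p) * ennreal M = ennreal (M * q powr p)" using M by (simp add: mult.commute flip: ennreal_mult)
      ultimately show ?thesis using g(6) by (metis order_trans)
    qed
    have "riesz \<alpha> p f = riesz \<alpha> p (\<lambda>x. \<bar>f x\<bar>)" by simp
    also have "\<dots> \<le> liminf (\<lambda>n. riesz \<alpha> p (F n))" by (rule riesz_Fatou[OF _ _ Flim p0]) measurable
    also have "\<dots> \<le> ennreal (M * q powr p)"
      by (rule Liminf_le) (use ev Fle in \<open>auto elim: eventually_mono\<close>)
    finally show ?thesis .
  qed
  have final: "riesz \<alpha> p f \<le> ennreal (M * q powr p)"
    if f: "f \<in> borel_measurable borel" and q: "0 < q" "h1_energy f \<le> ennreal q" for f :: "'a \<Rightarrow> real" and q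
  proof -
    define r where "r n = q + inverse (real (Suc n))" for n
    have "riesz \<alpha> p f \<le> ennreal (M * r n powr p)" for n
    proof (rule strict[OF f])
      have i: "0 < inverse (real (Suc n))" by simp
      then show "0 < r n" using q by (simp add: r_def add_pos_pos)
      show "h1_energy f < ennreal (r n)" using q i by (intro le_less_trans[OF q(2)] ennreal_lessI) (auto simp: r_def add_pos_pos)
    qed
    moreover have "(\<lambda>n. ennreal (M * r n powr p)) \<longlonglongrightarrow> ennreal (M * (q + 0) powr p)"
      unfolding r_def using q by (intro tendsto_ennrealI tendsto_intros LIMSEQ_inverse_real_of_nat) auto
    ultimately show ?thesis by (intro LIMSEQ_le_const) auto
  qed
  show ?thesis
    using M v0 Qv rv final by (intro exI[of _ M] conjI exI[of _ v]) auto
qed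

section \<open>The Euler--Lagrange equation\<close>

lemma abs_powr_has_derivative:
  fixes p t :: real
  assumes p: "1 < p"
  shows "((\<lambda>t. \<bar>t\<bar> powr p) has_real_derivative p * (\<bar>t\<bar> powr (p - 1) * sgn t)) (at t)"
proof -
  consider "t < 0" | "t = 0" | "0 < t" by linarith
  then show ?thesis
  proof cases
    case 1
    have "((\<lambda>t. (- t) powr p) has_real_derivative p * (- t) powr (p - 1) * (- 1)) (at t)"
      using 1 by (intro has_real_derivative_powr[THEN DERIV_chain2]) (auto intro!: derivative_eq_intros)
    then have "((\<lambda>t. (- t) powr p) has_real_derivative p * (\<bar>t\<bar> powr (p - 1) * sgn t)) (at t)"
      using 1 by simp
    moreover have "eventually (\<lambda>s. s < 0) (nhds t)"
      using 1 by (intro eventually_nhds_in_open[of "{..<0}", simplified]) auto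
    then have "eventually (\<lambda>s. \<bar>s\<bar> powr p = (- s) powr p) (nhds t)" by eventually_elim simp
    ultimately show ?thesis by (subst DERIV_cong_ev[OF refl _ refl]) auto
  next
    case 2
    have "((\<lambda>h. (\<bar>0 + h\<bar> powr p - \<bar>0\<bar> powr p) / h) \<longlongrightarrow> 0) (at 0)"
    proof (rule Lim_null_comparison[where g="\<lambda>h. \<bar>h\<bar> powr (p - 1)"])
      have "norm ((\<bar>0 + h\<bar> powr p - \<bar>0\<bar> powr p) / h) \<le> \<bar>h\<bar> powr (p - 1)" if "h \<noteq> 0" for h :: real
        using that by (simp add: powr_diff)
      then show "\<forall>\<^sub>F h in at 0. norm ((\<bar>0 + h\<bar> powr p - \<bar>0\<bar> powr p) / h) \<le> \<bar>h\<bar> powr (p - 1)"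
        by (auto simp: eventually_at_filter)
      have "((\<lambda>h::real. \<bar>h\<bar> powr (p - 1)) \<longlongrightarrow> \<bar>0\<bar> powr (p - 1)) (at 0)"
        using p by (intro tendsto_powr' tendsto_intros) auto
      then show "((\<lambda>h::real. \<bar>h\<bar> powr (p - 1)) \<longlongrightarrow> 0) (at 0)" by simp
    qed
    then show ?thesis using 2 by (simp add: DERIV_def)
  next
    case 3
    have "((\<lambda>t. t powr p) has_real_derivative p * t powr (p - 1)) (at t)"
      using 3 by (intro has_real_derivative_powr)
    then have "((\<lambda>t. t powr p) has_real_derivative p * (\<bar>t\<bar> powr (p - 1) * sgn t)) (at t)"
      using 3 by simp
    moreover have "eventually (\<lambda>s. 0 < s) (nhds t)"
      using 3 by (intro eventually_nhds_in_open[of "{0<..}", simplified]) auto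
    then have "eventually (\<lambda>s. \<bar>s\<bar> powr p = s powr p) (nhds t)" by eventually_elim simp
    ultimately show ?thesis by (subst DERIV_cong_ev[OF refl _ refl]) auto
  qed
qed

text \<open>This is \<open>|t|^(p - 2) t\<close>, the derivative of the p-th power of the absolute
  value up to the factor \<open>p\<close>, written without the exponent \<open>p - 2\<close>, which
  may be negative.\<close>

definition signed_pow :: "real \<Rightarrow> real \<Rightarrow> real" where
  "signed_pow p t = \<bar>t\<bar> powr (p - 1) * sgn t"

lemma signed_pow_measurable [measurable]: "signed_pow p \<in> borel_measurable borel"
  unfolding signed_pow_def by measurable

lemma pair_power_derivative:
  fixes A B C D p s :: real
  assumes p: "1 < p"
  shows "((\<lambda>s. \<bar>A + s * B\<bar> powr p * \<bar>C + s * D\<bar> powr p) has_real_derivative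
    p * (signed_pow p (A + s * B) * B * \<bar>C + s * D\<bar> powr p + \<bar>A + s * B\<bar> powr p * (signed_pow p (C + s * D) * D))) (at s)"
proof -
  have "((\<lambda>s. \<bar>A + s * B\<bar> powr p) has_real_derivative p * signed_pow p (A + s * B) * B) (at s)" for A B
    unfolding signed_pow_def
    by (rule DERIV_chain2[OF abs_powr_has_derivative[OF p]]) (auto intro!: derivative_eq_intros)
  from DERIV_mult[OF this[of A B] this[of C D]] show ?thesis
    by (simp add: algebra_simps)
qed

text \<open>The mean value theorem for the product, with \<open>s \<le> 1\<close> used to bound all
  intermediate values by the sums of absolute values. This gives a majorant independent of
  \<open>s\<close> for differentiating the Riesz energy under the integral.\<close>

lemma pair_power_quotient_bound:
  fixes A B C D p s :: real
  assumes p: "1 < p" and s: "0 < s" "s \<le> 1"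
  shows "\<bar>(\<bar>A + s * B\<bar> powr p * \<bar>C + s * D\<bar> powr p - \<bar>A\<bar> powr p * \<bar>C\<bar> powr p) / s\<bar>
    \<le> 2 * p * ((\<bar>A\<bar> + \<bar>B\<bar>) powr p * (\<bar>C\<bar> + \<bar>D\<bar>) powr p)"
proof -
  let ?F = "\<lambda>s. \<bar>A + s * B\<bar> powr p * \<bar>C + s * D\<bar> powr p"
  let ?F' = "\<lambda>s. p * (signed_pow p (A + s * B) * B * \<bar>C + s * D\<bar> powr p + \<bar>A + s * B\<bar> powr p * (signed_pow p (C + s * D) * D))"
  obtain z where z: "0 < z" "z < s" "?F s - ?F 0 = (s - 0) * ?F' z"
    using MVT2[of 0 s ?F ?F'] s pair_power_derivative[OF p] by blast
  have le: "\<bar>E + z * G\<bar> \<le> \<bar>E\<bar> + \<bar>G\<bar>" for E G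
  proof -
    have "\<bar>z * G\<bar> \<le> \<bar>G\<bar>" using z s by (simp add: abs_mult mult_left_le_one_le)
    then show ?thesis by linarith
  qed
  have 1: "\<bar>E + z * G\<bar> powr p \<le> (\<bar>E\<bar> + \<bar>G\<bar>) powr p" for E G
    using p by (intro powr_mono2 le) auto
  have 2: "\<bar>signed_pow p (E + z * G) * G\<bar> \<le> (\<bar>E\<bar> + \<bar>G\<bar>) powr p" for E G
  proof -
    have "\<bar>signed_pow p (E + z * G) * G\<bar> \<le> \<bar>E + z * G\<bar> powr (p - 1) * \<bar>G\<bar>"
      by (simp add: signed_pow_def abs_mult sgn_if)
    also have "\<dots> \<le> (\<bar>E\<bar> + \<bar>G\<bar>) powr (p - 1) * (\<bar>E\<bar> + \<bar>G\<bar>)"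
      using p by (intro mult_mono powr_mono2 le) auto
    also have "\<dots> = (\<bar>E\<bar> + \<bar>G\<bar>) powr p"
      using powr_mult_base[of "\<bar>E\<bar> + \<bar>G\<bar>" "p - 1"] by (simp add: mult.commute)
    finally show ?thesis .
  qed
  have "\<bar>?F' z\<bar> = p * \<bar>(signed_pow p (A + z * B) * B) * \<bar>C + z * D\<bar> powr p + \<bar>A + z * B\<bar> powr p * (signed_pow p (C + z * D) * D)\<bar>"
    using p by (simp add: abs_mult)
  also have "\<dots> \<le> p * (\<bar>signed_pow p (A + z * B) * B\<bar> * \<bar>C + z * D\<bar> powr p + \<bar>A + z * B\<bar> powr p * \<bar>signed_pow p (C + z * D) * D\<bar>)"
    using p by (intro mult_left_mono order_trans[OF abs_triangle_ineq]) (auto simp: abs_mult)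
  also have "\<dots> \<le> p * ((\<bar>A\<bar> + \<bar>B\<bar>) powr p * (\<bar>C\<bar> + \<bar>D\<bar>) powr p + (\<bar>A\<bar> + \<bar>B\<bar>) powr p * (\<bar>C\<bar> + \<bar>D\<bar>) powr p)"
    using p by (intro mult_left_mono add_mono mult_mono 1 2) auto
  finally have "\<bar>?F' z\<bar> \<le> 2 * p * ((\<bar>A\<bar> + \<bar>B\<bar>) powr p * (\<bar>C\<bar> + \<bar>D\<bar>) powr p)" by simp
  moreover have "(?F s - ?F 0) / s = ?F' z" using z(3) s by simp
  ultimately show ?thesis by simp
qed

section \<open>Directional derivatives of the Riesz energy and of the H^1 norm\<close>

definition riesz_kernel :: "real \<Rightarrow> 'a::euclidean_space \<times> 'a \<Rightarrow> real" where
  "riesz_kernel \<alpha> = (\<lambda>(x, y). 1 / norm (x - y) powr (real DIM('a) - \<alpha>))"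

lemma riesz_kernel_measurable [measurable]: "riesz_kernel \<alpha> \<in> borel_measurable (borel \<Otimes>\<^sub>M borel)"
  unfolding riesz_kernel_def by measurable

text \<open>The real counterpart of \<open>riesz\<close> as a Bochner integral over the product
  space, where dominated convergence and the exchange of the two variables are available in one
  step.\<close>

definition riesz_real :: "real \<Rightarrow> real \<Rightarrow> ('a::euclidean_space \<Rightarrow> real) \<Rightarrow> real" where
  "riesz_real \<alpha> p f = (LINT z|(lborel \<Otimes>\<^sub>M lborel). riesz_kernel \<alpha> z * (\<bar>f (fst z)\<bar> powr p * \<bar>f (snd z)\<bar> powr p))"

lemma riesz_pair:
  fixes f :: "'a::euclidean_space \<Rightarrow> real"
  assumes [measurable]: "f \<in> borel_measurable borel" and fin: "riesz \<alpha> p f < \<infinity>"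
  shows "integrable (lborel \<Otimes>\<^sub>M lborel) (\<lambda>z. riesz_kernel \<alpha> z * (\<bar>f (fst z)\<bar> powr p * \<bar>f (snd z)\<bar> powr p))"
    and "riesz \<alpha> p f = ennreal (riesz_real \<alpha> p f)" and "0 \<le> riesz_real \<alpha> p f"
proof -
  let ?F = "\<lambda>z::'a\<times>'a. riesz_kernel \<alpha> z * (\<bar>f (fst z)\<bar> powr p * \<bar>f (snd z)\<bar> powr p)"
  have eq: "riesz \<alpha> p f = (\<integral>\<^sup>+z. ennreal (?F z) \<partial>(lborel \<Otimes>\<^sub>M lborel))"
    unfolding riesz_def by (subst lborel.nn_integral_fst[symmetric]) (auto simp: riesz_kernel_def)
  have nn: "0 \<le> ?F z" for z by (auto simp: riesz_kernel_def split: prod.splits)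
  show i: "integrable (lborel \<Otimes>\<^sub>M lborel) ?F"
    using fin unfolding eq by (intro integrableI_nonneg) (use nn in auto)
  show "riesz \<alpha> p f = ennreal (riesz_real \<alpha> p f)"
    unfolding eq riesz_real_def by (intro nn_integral_eq_integral i) (use nn in auto)
  show "0 \<le> riesz_real \<alpha> p f" unfolding riesz_real_def by (intro Bochner_Integration.integral_nonneg nn)
qed

definition choquard_form :: "real \<Rightarrow> real \<Rightarrow> ('a::euclidean_space \<Rightarrow> real) \<Rightarrow> ('a \<Rightarrow> real) \<Rightarrow> real" where
  "choquard_form \<alpha> p u \<phi> = (LINT x|lborel. LINT y|lborel. \<bar>u y\<bar> powr p * (\<bar>u x\<bar> powr (p - 1) * sgn (u x)) * \<phi> x
             / norm (x - y) powr (real DIM('a) - \<alpha>))"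

lemma choquard_form_uminus: "choquard_form \<alpha> p u (\<lambda>x. - \<phi> x) = - choquard_form \<alpha> p u \<phi>"
  by (simp add: choquard_form_def)

text \<open>Differentiation under the integral. The product rule gives two terms that are exchanged
  by swapping the variables, and the kernel is symmetric; hence the factor 2.\<close>

lemma riesz_difference_quotient:
  fixes w \<phi> :: "'a::euclidean_space \<Rightarrow> real"
  assumes p: "1 < p" and [measurable]: "w \<in> borel_measurable borel" "\<phi> \<in> borel_measurable borel"
    and fin: "riesz \<alpha> p (\<lambda>x. \<bar>w x\<bar> + \<bar>\<phi> x\<bar>) < \<infinity>"
  shows "(\<lambda>n. real (Suc n) * (riesz_real \<alpha> p (\<lambda>x. w x + inverse (real (Suc n)) * \<phi> x) - riesz_real \<alpha> p w)) \<longlonglongrightarrow> 2 * p * choquard_form \<alpha> p w \<phi>"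
proof -
  let ?P = "lborel \<Otimes>\<^sub>M lborel :: ('a \<times> 'a) measure"
  define s where "s n = inverse (real (Suc n))" for n
  have s: "0 < s n" "s n \<le> 1" for n by (auto simp: s_def field_simps)
  define Z where "Z x = \<bar>w x\<bar> + \<bar>\<phi> x\<bar>" for x
  have [measurable]: "Z \<in> borel_measurable borel" unfolding Z_def by measurable
  have Zi: "integrable ?P (\<lambda>z. riesz_kernel \<alpha> z * (\<bar>Z (fst z)\<bar> powr p * \<bar>Z (snd z)\<bar> powr p))"
    by (rule riesz_pair) (use fin in \<open>auto simp: Z_def[abs_def]\<close>)
  have Zabs: "\<bar>Z x\<bar> = Z x" for x by (simp add: Z_def)
  have rk0: "0 \<le> riesz_kernel \<alpha> z" for z :: "'a \<times> 'a" by (auto simp: riesz_kernel_def split: prod.splits)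
  let ?F = "\<lambda>s z. \<bar>w (fst z) + s * \<phi> (fst z)\<bar> powr p * \<bar>w (snd z) + s * \<phi> (snd z)\<bar> powr p"
  let ?L = "\<lambda>z. p * (signed_pow p (w (fst z)) * \<phi> (fst z) * \<bar>w (snd z)\<bar> powr p + \<bar>w (fst z)\<bar> powr p * (signed_pow p (w (snd z)) * \<phi> (snd z)))"
  have fins: "riesz \<alpha> p (\<lambda>x. w x + s n * \<phi> x) < \<infinity>" for n
  proof -
    have "\<bar>w x + s n * \<phi> x\<bar> \<le> \<bar>Z x\<bar>" for x
    proof -
      have "\<bar>s n * \<phi> x\<bar> \<le> \<bar>\<phi> x\<bar>" using s[of n] by (simp add: abs_mult mult_left_le_one_le)
      then show ?thesis unfolding Z_def by linarith
    qed
    then have "riesz \<alpha> p (\<lambda>x. w x + s n * \<phi> x) \<le> riesz \<alpha> p Z" using p by (intro riesz_mono) auto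
    then show ?thesis using fin by (auto simp: Z_def[abs_def])
  qed
  have finw: "riesz \<alpha> p w < \<infinity>"
  proof -
    have "riesz \<alpha> p w \<le> riesz \<alpha> p Z" using p by (intro riesz_mono) (auto simp: Z_def)
    then show ?thesis using fin by (auto simp: Z_def[abs_def])
  qed
  have pt: "real (Suc n) * (k * F - k * G) = k * ((F - G) / s n)" for k F G :: real and n
    by (simp add: s_def divide_inverse right_diff_distrib left_diff_distrib mult_ac del: of_nat_Suc)
  have quot: "real (Suc n) * (riesz_real \<alpha> p (\<lambda>x. w x + s n * \<phi> x) - riesz_real \<alpha> p w) = (LINT z|?P. riesz_kernel \<alpha> z * ((?F (s n) z - ?F 0 z) / s n))" for n
  proof -
    define F G where "F = ?F (s n)" and "G = ?F 0"
    have i: "integrable ?P (\<lambda>z. riesz_kernel \<alpha> z * F z)" "integrable ?P (\<lambda>z. riesz_kernel \<alpha> z * G z)"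
      unfolding F_def G_def using riesz_pair(1)[OF _ fins[of n]] riesz_pair(1)[OF _ finw] by simp_all
    have r: "riesz_real \<alpha> p (\<lambda>x. w x + s n * \<phi> x) = (LINT z|?P. riesz_kernel \<alpha> z * F z)" "riesz_real \<alpha> p w = (LINT z|?P. riesz_kernel \<alpha> z * G z)"
      unfolding riesz_real_def F_def G_def by simp_all
    have "real (Suc n) * (riesz_real \<alpha> p (\<lambda>x. w x + s n * \<phi> x) - riesz_real \<alpha> p w) = real (Suc n) * (LINT z|?P. riesz_kernel \<alpha> z * F z - riesz_kernel \<alpha> z * G z)"
      unfolding r by (subst Bochner_Integration.integral_diff[OF i]) (rule refl)
    also have "\<dots> = (LINT z|?P. real (Suc n) * (riesz_kernel \<alpha> z * F z - riesz_kernel \<alpha> z * G z))"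
      by (rule integral_mult_right_zero[symmetric])
    also have "\<dots> = (LINT z|?P. riesz_kernel \<alpha> z * ((F z - G z) / s n))"
      unfolding pt ..
    finally show ?thesis unfolding F_def G_def .
  qed
  have lim: "(\<lambda>n. LINT z|?P. riesz_kernel \<alpha> z * ((?F (s n) z - ?F 0 z) / s n)) \<longlonglongrightarrow> (LINT z|?P. riesz_kernel \<alpha> z * ?L z)"
  proof (rule integral_dominated_convergence[where w="\<lambda>z. 2 * p * (riesz_kernel \<alpha> z * (\<bar>Z (fst z)\<bar> powr p * \<bar>Z (snd z)\<bar> powr p))"])
    show "integrable ?P (\<lambda>z. 2 * p * (riesz_kernel \<alpha> z * (\<bar>Z (fst z)\<bar> powr p * \<bar>Z (snd z)\<bar> powr p)))"
      by (intro integrable_mult_right Zi)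
    show "AE z in ?P. (\<lambda>n. riesz_kernel \<alpha> z * ((?F (s n) z - ?F 0 z) / s n)) \<longlonglongrightarrow> riesz_kernel \<alpha> z * ?L z"
    proof (intro AE_I2 tendsto_mult tendsto_const)
      fix z :: "'a \<times> 'a"
      have "((\<lambda>s. ?F s z) has_real_derivative ?L z) (at 0)"
        using pair_power_derivative[OF p, of "w (fst z)" "\<phi> (fst z)" "w (snd z)" "\<phi> (snd z)" 0] by simp
      then have "((\<lambda>h. (?F h z - ?F 0 z) / h) \<longlongrightarrow> ?L z) (at 0)" by (simp add: DERIV_def)
      moreover have "filterlim s (at 0) sequentially"
        unfolding s_def[abs_def] by (rule filterlim_atI[OF LIMSEQ_inverse_real_of_nat]) auto
      ultimately show "(\<lambda>n. (?F (s n) z - ?F 0 z) / s n) \<longlonglongrightarrow> ?L z" by (rule filterlim_compose)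
    qed
    have "norm (riesz_kernel \<alpha> z * ((?F (s n) z - ?F 0 z) / s n)) \<le> 2 * p * (riesz_kernel \<alpha> z * (\<bar>Z (fst z)\<bar> powr p * \<bar>Z (snd z)\<bar> powr p))" for n z
    proof -
      have "\<bar>(?F (s n) z - ?F 0 z) / s n\<bar> \<le> 2 * p * (Z (fst z) powr p * Z (snd z) powr p)"
        using pair_power_quotient_bound[OF p s, of "w (fst z)" n "\<phi> (fst z)" "w (snd z)" "\<phi> (snd z)"] by (simp add: Z_def)
      then have "riesz_kernel \<alpha> z * \<bar>(?F (s n) z - ?F 0 z) / s n\<bar> \<le> riesz_kernel \<alpha> z * (2 * p * (Z (fst z) powr p * Z (snd z) powr p))"
        by (intro mult_left_mono rk0)
      then show ?thesis using rk0[of z] unfolding Zabs real_norm_def abs_mult[of "riesz_kernel \<alpha> z"] by (simp only: abs_of_nonneg mult_ac)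
    qed
    then show "AE z in ?P. norm (riesz_kernel \<alpha> z * ((?F (s n) z - ?F 0 z) / s n)) \<le> 2 * p * (riesz_kernel \<alpha> z * (\<bar>Z (fst z)\<bar> powr p * \<bar>Z (snd z)\<bar> powr p))" for n
      by (intro AE_I2)
  qed measurable
  let ?L1 = "\<lambda>z. riesz_kernel \<alpha> z * (signed_pow p (w (fst z)) * \<phi> (fst z) * \<bar>w (snd z)\<bar> powr p)"
  let ?L2 = "\<lambda>z. riesz_kernel \<alpha> z * (\<bar>w (fst z)\<bar> powr p * (signed_pow p (w (snd z)) * \<phi> (snd z)))"
  have dple: "\<bar>signed_pow p (w x) * \<phi> x\<bar> \<le> \<bar>Z x\<bar> powr p" for x
  proof -
    have "\<bar>signed_pow p (w x) * \<phi> x\<bar> \<le> \<bar>w x\<bar> powr (p - 1) * \<bar>\<phi> x\<bar>" by (simp add: signed_pow_def abs_mult sgn_if)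
    also have "\<dots> \<le> Z x powr (p - 1) * Z x" using p by (intro mult_mono powr_mono2) (auto simp: Z_def)
    also have "\<dots> = Z x powr p" using powr_mult_base[of "Z x" "p - 1"] by (simp add: mult.commute Z_def)
    finally show ?thesis by (simp add: Zabs)
  qed
  have wle: "\<bar>w x\<bar> powr p \<le> \<bar>Z x\<bar> powr p" for x using p by (intro powr_mono2) (auto simp: Z_def)
  have i1: "integrable ?P ?L1"
  proof (rule Bochner_Integration.integrable_bound[OF Zi])
    show "AE z in ?P. norm (?L1 z) \<le> norm (riesz_kernel \<alpha> z * (\<bar>Z (fst z)\<bar> powr p * \<bar>Z (snd z)\<bar> powr p))"
    proof (rule AE_I2)
      fix z
      have "\<bar>signed_pow p (w (fst z)) * \<phi> (fst z)\<bar> * \<bar>w (snd z)\<bar> powr p \<le> \<bar>Z (fst z)\<bar> powr p * \<bar>Z (snd z)\<bar> powr p"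
        by (intro mult_mono dple wle) auto
      then have "riesz_kernel \<alpha> z * (\<bar>signed_pow p (w (fst z)) * \<phi> (fst z)\<bar> * \<bar>w (snd z)\<bar> powr p) \<le> riesz_kernel \<alpha> z * (\<bar>Z (fst z)\<bar> powr p * \<bar>Z (snd z)\<bar> powr p)"
        by (intro mult_left_mono rk0)
      then show "norm (?L1 z) \<le> norm (riesz_kernel \<alpha> z * (\<bar>Z (fst z)\<bar> powr p * \<bar>Z (snd z)\<bar> powr p))"
        using rk0[of z] by (simp add: abs_mult)
    qed
  qed measurable
  \<comment> \<open>The symmetry of the kernel identifies the second term of the product rule with
    the first.\<close>
  have sw: "?L2 z = ?L1 (snd z, fst z)" for z by (auto simp: riesz_kernel_def norm_minus_commute mult_ac split: prod.splits)
  have i2: "integrable ?P ?L2"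
    using lborel_pair.integrable_product_swap[OF i1] unfolding sw by (simp add: case_prod_beta')
  have e2: "(LINT z|?P. ?L2 z) = (LINT z|?P. ?L1 z)"
    unfolding sw using lborel_pair.integral_product_swap[of ?L1] i1 by (simp add: case_prod_beta')
  have "(LINT z|?P. riesz_kernel \<alpha> z * ?L z) = (LINT z|?P. p * (?L1 z + ?L2 z))"
    by (intro Bochner_Integration.integral_cong) (auto simp: algebra_simps)
  also have "\<dots> = 2 * p * (LINT z|?P. ?L1 z)"
    using i1 i2 e2 by simp
  also have "(LINT z|?P. ?L1 z) = (LINT x|lborel. LINT y|lborel. ?L1 (x, y))"
    by (rule lborel_pair.integral_fst'[symmetric, OF i1])
  also have "\<dots> = choquard_form \<alpha> p w \<phi>"
    unfolding choquard_form_def by (intro Bochner_Integration.integral_cong) (auto simp: riesz_kernel_def signed_pow_def)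
  finally have "(LINT z|?P. riesz_kernel \<alpha> z * ?L z) = 2 * p * choquard_form \<alpha> p w \<phi>" .
  then show ?thesis using lim unfolding quot[symmetric] by (simp add: s_def)
qed

text \<open>The gradients are explicit arguments because \<open>has_wgrad\<close> is a relation that
  determines them only almost everywhere.\<close>

definition h1_inner :: "('a::euclidean_space \<Rightarrow> real) \<Rightarrow> ('a \<Rightarrow> 'a) \<Rightarrow> ('a \<Rightarrow> real) \<Rightarrow> ('a \<Rightarrow> 'a) \<Rightarrow> real" where
  "h1_inner u G v H = (LINT x|lborel. G x \<bullet> H x + u x * v x)"

lemma h1_inner_integrable:
  fixes u v :: "'a::euclidean_space \<Rightarrow> real"
  assumes "L2 u" "L2 G" "L2 v" "L2 H"
  shows "integrable lborel (\<lambda>x. G x \<bullet> H x + u x * v x)" "integrable lborel (\<lambda>x. G x \<bullet> H x)"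
proof -
  have i: "integrable lborel (\<lambda>x. (G x \<bullet> i) * (H x \<bullet> i))" for i
    by (intro L2_integrable_mult L2_inner assms)
  have "(\<lambda>x. G x \<bullet> H x) = (\<lambda>x. \<Sum>i\<in>Basis. (G x \<bullet> i) * (H x \<bullet> i))"
    by (simp add: fun_eq_iff euclidean_inner[symmetric])
  then show "integrable lborel (\<lambda>x. G x \<bullet> H x)" using i by simp
  then show "integrable lborel (\<lambda>x. G x \<bullet> H x + u x * v x)"
    by (intro Bochner_Integration.integrable_add L2_integrable_mult assms)
qed

lemma h1_inner_expand:
  fixes u v :: "'a::euclidean_space \<Rightarrow> real"
  assumes L: "L2 u" "L2 G" "L2 v" "L2 H"
  shows "h1_inner (\<lambda>x. u x + s * v x) (\<lambda>x. G x + s *\<^sub>R H x) (\<lambda>x. u x + s * v x) (\<lambda>x. G x + s *\<^sub>R H x)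
    = h1_inner u G u G + 2 * s * h1_inner u G v H + s\<^sup>2 * h1_inner v H v H"
proof -
  have "h1_inner (\<lambda>x. u x + s * v x) (\<lambda>x. G x + s *\<^sub>R H x) (\<lambda>x. u x + s * v x) (\<lambda>x. G x + s *\<^sub>R H x)
    = (LINT x|lborel. (G x \<bullet> G x + u x * u x) + (2 * s) * (G x \<bullet> H x + u x * v x) + s\<^sup>2 * (H x \<bullet> H x + v x * v x))"
    unfolding h1_inner_def
    by (intro Bochner_Integration.integral_cong) (auto simp: inner_add_left inner_add_right inner_commute power2_eq_square algebra_simps)
  also have "\<dots> = h1_inner u G u G + 2 * s * h1_inner u G v H + s\<^sup>2 * h1_inner v H v H"
    unfolding h1_inner_def using h1_inner_integrable(1)[OF L] h1_inner_integrable(1)[OF L(1,2) L(1,2)] h1_inner_integrable(1)[OF L(3,4) L(3,4)] by simp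
  finally show ?thesis .
qed

text \<open>One inequality between the two Dirichlet integrals holds for every weak gradient. The
  other one is a premise here, since \<open>dirichlet_gradient\<close> delivers it together with the
  gradient.\<close>

lemma h1_energy_le_h1_inner:
  fixes u :: "'a::euclidean_space \<Rightarrow> real"
  assumes w: "has_wgrad u G"
  shows "h1_energy u \<le> ennreal (h1_inner u G u G)" "0 \<le> h1_inner u G u G"
    and "ennreal (kappa TYPE('a)) * sq_norm G \<le> dirichlet u \<Longrightarrow> h1_energy u = ennreal (h1_inner u G u G)"
proof -
  have L: "L2 u" "L2 G" using w by (auto simp: has_wgrad_def)
  have k: "0 < kappa TYPE('a)" by (rule kappa_pos)
  have i: "integrable lborel (\<lambda>x. (norm (u x))\<^sup>2)" "integrable lborel (\<lambda>x. (norm (G x))\<^sup>2)"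
    by (rule L2_integrable_sq[OF L(1)], rule L2_integrable_sq[OF L(2)])
  have h: "h1_inner u G u G = (LINT x|lborel. (norm (u x))\<^sup>2) + (LINT x|lborel. (norm (G x))\<^sup>2)"
    unfolding h1_inner_def Bochner_Integration.integral_add[OF i, symmetric]
    by (intro Bochner_Integration.integral_cong) (auto simp: power2_norm_eq_inner power2_eq_square dot_square_norm)
  then show "0 \<le> h1_inner u G u G" by simp
  have s: "sq_norm u + sq_norm G = ennreal (h1_inner u G u G)"
    unfolding h sq_norm_eq[OF L(1)] sq_norm_eq[OF L(2)] by simp
  have one: "ennreal (1 / kappa TYPE('a)) * (ennreal (kappa TYPE('a)) * X) = X" for X
    using k by (simp add: mult.assoc[symmetric] ennreal_mult[symmetric])
  have "h1_energy u \<le> sq_norm u + ennreal (1 / kappa TYPE('a)) * (ennreal (kappa TYPE('a)) * sq_norm G)"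
    unfolding h1_energy_def by (intro add_left_mono mult_left_mono dirichlet_le_sq_norm[OF w]) simp
  then show le: "h1_energy u \<le> ennreal (h1_inner u G u G)" unfolding one s .
  assume ge: "ennreal (kappa TYPE('a)) * sq_norm G \<le> dirichlet u"
  have "sq_norm u + ennreal (1 / kappa TYPE('a)) * (ennreal (kappa TYPE('a)) * sq_norm G) \<le> h1_energy u"
    unfolding h1_energy_def by (intro add_left_mono mult_left_mono ge) simp
  then show "h1_energy u = ennreal (h1_inner u G u G)" using le unfolding one s by (rule antisym[rotated])
qed

text \<open>The increments of the two absolute values are bounded by those of the functions, so the
  sum again has finite energy and the optimal inequality applies to it. This is the integrable
  majorant for differentiating along \<open>\<phi>\<close>.\<close>

lemma riesz_abs_sum_finite:
  fixes w \<phi> :: "'a::euclidean_space \<Rightarrow> real"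
  assumes bound: "\<And>(f::'a \<Rightarrow> real) q. f \<in> borel_measurable borel \<Longrightarrow> 0 < q \<Longrightarrow> h1_energy f \<le> ennreal q \<Longrightarrow> riesz \<alpha> p f \<le> ennreal (M * q powr p)"
    and w: "has_wgrad w G" and \<phi>: "has_wgrad \<phi> H"
  shows "riesz \<alpha> p (\<lambda>x. \<bar>w x\<bar> + \<bar>\<phi> x\<bar>) < \<infinity>"
proof -
  have L: "L2 w" "L2 G" "L2 \<phi>" "L2 H" using w \<phi> by (auto simp: has_wgrad_def)
  have [measurable]: "w \<in> borel_measurable borel" "\<phi> \<in> borel_measurable borel" using L by (auto simp: L2_def)
  have La: "L2 (\<lambda>x. \<bar>w x\<bar>)" "L2 (\<lambda>x. \<bar>\<phi> x\<bar>)" using L by (auto intro: L2_bound)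
  have sq: "sq_norm (\<lambda>x. \<bar>w x\<bar> + \<bar>\<phi> x\<bar>) < \<infinity>" using L2_add[OF La] by (simp add: L2_def)
  have fin: "dirichlet w < \<infinity>" "dirichlet \<phi> < \<infinity>"
    using dirichlet_le_sq_norm[OF w] dirichlet_le_sq_norm[OF \<phi>] L by (auto simp: L2_def ennreal_mult_less_top le_less_trans)
  have "dirichlet (\<lambda>x. \<bar>w x\<bar> + \<bar>\<phi> x\<bar>) \<le> ennreal 2 * dirichlet w + ennreal 2 * dirichlet \<phi>"
    unfolding dirichlet_def[of "\<lambda>x. \<bar>w x\<bar> + \<bar>\<phi> x\<bar>"]
  proof (rule SUP_least)
    fix s :: real assume "s \<in> {0<..}"
    then have s: "0 < s" by simp
    have "dq_energy s (\<lambda>x. \<bar>w x\<bar> + \<bar>\<phi> x\<bar>) \<le> ennreal (1 + 1) * dq_energy s w + ennreal (1 + 1 / 1) * (\<integral>\<^sup>+h. \<integral>\<^sup>+x. ennreal (ker 1 h * ((\<phi> (x + s *\<^sub>R h) - \<phi> x) / s)\<^sup>2) \<partial>lborel \<partial>lborel)"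
    proof (rule dq_energy_split[OF _ _ _ s, where d="\<lambda>x y. \<phi> x - \<phi> y"])
      fix x y
      show "\<bar>\<bar>w x\<bar> + \<bar>\<phi> x\<bar> - (\<bar>w y\<bar> + \<bar>\<phi> y\<bar>)\<bar> \<le> \<bar>w x - w y\<bar> + \<bar>\<phi> x - \<phi> y\<bar>"
      proof -
        have "\<bar>w x\<bar> + \<bar>\<phi> x\<bar> - (\<bar>w y\<bar> + \<bar>\<phi> y\<bar>) = (\<bar>w x\<bar> - \<bar>w y\<bar>) + (\<bar>\<phi> x\<bar> - \<bar>\<phi> y\<bar>)" by simp
        also have "\<bar>\<dots>\<bar> \<le> \<bar>\<bar>w x\<bar> - \<bar>w y\<bar>\<bar> + \<bar>\<bar>\<phi> x\<bar> - \<bar>\<phi> y\<bar>\<bar>" by (rule abs_triangle_ineq)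
        also have "\<dots> \<le> \<bar>w x - w y\<bar> + \<bar>\<phi> x - \<phi> y\<bar>" by (intro add_mono abs_triangle_ineq3)
        finally show ?thesis .
      qed
      show "0 < (1::real)" by simp
    qed measurable
    also have "\<dots> \<le> ennreal 2 * dirichlet w + ennreal 2 * dirichlet \<phi>"
      unfolding dq_energy_def[of s \<phi>, symmetric] by (intro add_mono mult_mono dq_le_dirichlet s) auto
    finally show "dq_energy s (\<lambda>x. \<bar>w x\<bar> + \<bar>\<phi> x\<bar>) \<le> ennreal 2 * dirichlet w + ennreal 2 * dirichlet \<phi>" .
  qed
  also have "\<dots> < \<infinity>" using fin by (simp add: ennreal_mult_less_top)
  finally have "h1_energy (\<lambda>x. \<bar>w x\<bar> + \<bar>\<phi> x\<bar>) < \<infinity>" using sq by (simp add: h1_energy_def ennreal_mult_less_top)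
  then obtain q where q: "h1_energy (\<lambda>x. \<bar>w x\<bar> + \<bar>\<phi> x\<bar>) = ennreal q" "0 \<le> q" by (cases "h1_energy (\<lambda>x. \<bar>w x\<bar> + \<bar>\<phi> x\<bar>)") auto
  have "riesz \<alpha> p (\<lambda>x. \<bar>w x\<bar> + \<bar>\<phi> x\<bar>) \<le> ennreal (M * (q + 1) powr p)"
    by (rule bound) (use q in \<open>auto intro: ennreal_leI\<close>)
  then show ?thesis by (rule le_less_trans) simp
qed

text \<open>Along \<open>w + t \<phi>\<close> the Riesz energy stays below \<open>M\<close> times
  the p-th power of the squared norm, with equality at \<open>t = 0\<close>. Comparing right
  derivatives gives one inequality, and replacing \<open>\<phi>\<close> by its negative gives the
  other.\<close>

lemma euler_lagrange:
  fixes w \<phi> :: "'a::euclidean_space \<Rightarrow> real"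
  assumes p: "1 < p" and M: "0 < M"
    and bound: "\<And>(f::'a \<Rightarrow> real) q. f \<in> borel_measurable borel \<Longrightarrow> 0 < q \<Longrightarrow> h1_energy f \<le> ennreal q \<Longrightarrow> riesz \<alpha> p f \<le> ennreal (M * q powr p)"
    and w: "has_wgrad w G" and a: "a = h1_inner w G w G" "0 < a" "M * a powr p = a" and rw: "riesz \<alpha> p w = ennreal a"
    and \<phi>: "has_wgrad \<phi> H"
  shows "h1_inner w G \<phi> H = choquard_form \<alpha> p w \<phi>"
proof -
  have le: "choquard_form \<alpha> p w \<phi> \<le> h1_inner w G \<phi> H" if \<phi>: "has_wgrad \<phi> H" for \<phi> H
  proof -
    have L: "L2 w" "L2 G" "L2 \<phi>" "L2 H" using w \<phi> by (auto simp: has_wgrad_def)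
    have [measurable]: "w \<in> borel_measurable borel" "\<phi> \<in> borel_measurable borel" using L by (auto simp: L2_def)
    have Zfin: "riesz \<alpha> p (\<lambda>x. \<bar>w x\<bar> + \<bar>\<phi> x\<bar>) < \<infinity>" by (rule riesz_abs_sum_finite[OF bound w \<phi>])
    define s where "s n = inverse (real (Suc n))" for n
    define b where "b = h1_inner w G \<phi> H"
    define c where "c = h1_inner \<phi> H \<phi> H"
    \<comment> \<open>The squared H^1 norm of \<open>w + t \<phi>\<close> as a quadratic polynomial
      in \<open>t\<close>.\<close>
    define A where "A t = a + 2 * t * b + t\<^sup>2 * c" for t
    have A0: "A 0 = a" by (simp add: A_def)
    have dA: "(A has_real_derivative 2 * b) (at 0)"
      unfolding A_def by (auto intro!: derivative_eq_intros)
    have "((\<lambda>t. M * A t powr p) has_real_derivative M * (p * A 0 powr (p - 1) * (2 * b))) (at 0)"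
      by (rule DERIV_cmult, rule DERIV_chain2[OF has_real_derivative_powr dA]) (simp only: A0 a(2))
    moreover have "M * (p * A 0 powr (p - 1) * (2 * b)) = 2 * p * b"
    proof -
      \<comment> \<open>This is where the multiple of the maximiser matters: with any other value of
        \<open>a\<close> a Lagrange multiplier would remain in the equation.\<close>
      have "M * a powr (p - 1) = 1" using a(2,3) by (simp add: powr_diff field_simps)
      then have "M * A 0 powr (p - 1) = 1" by (simp add: A_def)
      then have "(M * A 0 powr (p - 1)) * (2 * p * b) = 2 * p * b" by simp
      then show ?thesis by (simp add: mult_ac)
    qed
    ultimately have "((\<lambda>t. M * A t powr p) has_real_derivative 2 * p * b) (at 0)" by simp
    then have "((\<lambda>t. (M * A t powr p - M * A 0 powr p) / t) \<longlongrightarrow> 2 * p * b) (at 0)" by (simp add: DERIV_def)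
    moreover have sf: "filterlim s (at 0) sequentially"
      unfolding s_def[abs_def] by (rule filterlim_atI[OF LIMSEQ_inverse_real_of_nat]) auto
    ultimately have R: "(\<lambda>n. (M * A (s n) powr p - M * A 0 powr p) / s n) \<longlonglongrightarrow> 2 * p * b" by (rule filterlim_compose)
    have Ls: "(\<lambda>n. real (Suc n) * (riesz_real \<alpha> p (\<lambda>x. w x + s n * \<phi> x) - riesz_real \<alpha> p w)) \<longlonglongrightarrow> 2 * p * choquard_form \<alpha> p w \<phi>"
      unfolding s_def by (rule riesz_difference_quotient[OF p _ _ Zfin]) measurable
    have "(\<lambda>n. A (s n)) \<longlonglongrightarrow> A 0"
    proof -
      have "s \<longlonglongrightarrow> 0" unfolding s_def[abs_def] by (rule LIMSEQ_inverse_real_of_nat)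
      then have "(\<lambda>n. A (s n)) \<longlonglongrightarrow> a + 2 * 0 * b + 0\<^sup>2 * c" unfolding A_def by (intro tendsto_intros)
      then show ?thesis by (simp add: A_def)
    qed
    then have "\<forall>\<^sub>F n in sequentially. 0 < A (s n)" by (rule order_tendstoD) (use a in \<open>simp add: A_def\<close>)
    then have "\<forall>\<^sub>F n in sequentially. real (Suc n) * (riesz_real \<alpha> p (\<lambda>x. w x + s n * \<phi> x) - riesz_real \<alpha> p w) \<le> (M * A (s n) powr p - M * A 0 powr p) / s n"
    proof eventually_elim
      case (elim n)
      have ws: "has_wgrad (\<lambda>x. w x + s n * \<phi> x) (\<lambda>x. G x + s n *\<^sub>R H x)" using has_wgrad_lincomb[OF w \<phi>, of 1 "s n"] by simp
      have "h1_inner (\<lambda>x. w x + s n * \<phi> x) (\<lambda>x. G x + s n *\<^sub>R H x) (\<lambda>x. w x + s n * \<phi> x) (\<lambda>x. G x + s n *\<^sub>R H x) = A (s n)"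
        unfolding h1_inner_expand[OF L] A_def a(1) b_def c_def ..
      then have "h1_energy (\<lambda>x. w x + s n * \<phi> x) \<le> ennreal (A (s n))" using h1_energy_le_h1_inner(1)[OF ws] by simp
      then have rb: "riesz \<alpha> p (\<lambda>x. w x + s n * \<phi> x) \<le> ennreal (M * A (s n) powr p)" by (intro bound elim) measurable
      then have "riesz \<alpha> p (\<lambda>x. w x + s n * \<phi> x) < \<infinity>" by (auto simp: le_less_trans)
      from riesz_pair(2)[OF _ this] rb have "riesz_real \<alpha> p (\<lambda>x. w x + s n * \<phi> x) \<le> M * A (s n) powr p"
        using M by simp
      moreover have "riesz_real \<alpha> p w = M * A 0 powr p"
      proof -
        have "ennreal (riesz_real \<alpha> p w) = ennreal a" using riesz_pair(2)[of w \<alpha> p] rw by simp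
        then have "riesz_real \<alpha> p w = a" using riesz_pair(3)[of w \<alpha> p] rw a by simp
        then show ?thesis using a(3) by (simp add: A_def)
      qed
      ultimately have "riesz_real \<alpha> p (\<lambda>x. w x + s n * \<phi> x) - riesz_real \<alpha> p w \<le> M * A (s n) powr p - M * A 0 powr p" by simp
      then have "real (Suc n) * (riesz_real \<alpha> p (\<lambda>x. w x + s n * \<phi> x) - riesz_real \<alpha> p w) \<le> real (Suc n) * (M * A (s n) powr p - M * A 0 powr p)"
        by (rule mult_left_mono) simp
      then show ?case by (simp add: s_def divide_inverse mult.commute)
    qed
    then have "2 * p * choquard_form \<alpha> p w \<phi> \<le> 2 * p * b"
      by (rule tendsto_le[OF _ R Ls, rotated]) simp
    then show ?thesis using p by (simp add: b_def)
  qed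
  have "has_wgrad (\<lambda>x. - \<phi> x) (\<lambda>x. - H x)" using has_wgrad_lincomb[OF \<phi> \<phi>, of "-1" 0] by simp
  from le[OF this] have "- choquard_form \<alpha> p w \<phi> \<le> h1_inner w G (\<lambda>x. - \<phi> x) (\<lambda>x. - H x)" by (simp add: choquard_form_uminus)
  also have "h1_inner w G (\<lambda>x. - \<phi> x) (\<lambda>x. - H x) = - h1_inner w G \<phi> H"
  proof -
    have "h1_inner w G (\<lambda>x. - \<phi> x) (\<lambda>x. - H x) = (LINT x|lborel. - (G x \<bullet> H x + w x * \<phi> x))"
      unfolding h1_inner_def by (intro Bochner_Integration.integral_cong) auto
    also have "\<dots> = - (LINT x|lborel. G x \<bullet> H x + w x * \<phi> x)"
      by (rule Bochner_Integration.integral_minus)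
    finally show ?thesis by (simp only: h1_inner_def)
  qed
  finally show ?thesis using le[OF \<phi>] by simp
qed

section \<open>Functions comparable with all their reflections\<close>

text \<open>The mass of the square outside large balls tends to 0, while a lower bound on any ball
  of radius \<open>\<rho>\<close> would contribute a fixed amount. This is the form in which decay
  at infinity is used.\<close>

lemma L2_small_in_distant_balls:
  fixes u :: "'a::euclidean_space \<Rightarrow> real"
  assumes u: "L2 u" and \<delta>: "0 < \<delta>" and \<rho>: "0 < \<rho>"
  shows "\<exists>R\<ge>0. \<forall>c. R < norm c \<longrightarrow> (\<exists>x\<in>ball c \<rho>. u x < \<delta>)"
proof -
  have [measurable]: "u \<in> borel_measurable borel" using u by (simp add: L2_def)
  have i: "integrable lborel (\<lambda>x. (u x)\<^sup>2)" using L2_integrable_sq[OF u] by simp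
  define f :: "nat \<Rightarrow> 'a \<Rightarrow> real" where "f n x = (if real n \<le> norm x then (u x)\<^sup>2 else 0)" for n x
  have [measurable]: "f n \<in> borel_measurable borel" for n unfolding f_def by measurable
  have "(\<lambda>n. LINT x|lborel. f n x) \<longlonglongrightarrow> (LINT x|(lborel::'a measure). (0::real))"
  proof (rule integral_dominated_convergence[where w = "\<lambda>x. (u x)\<^sup>2"])
    show "AE x in lborel. (\<lambda>n. f n x) \<longlonglongrightarrow> 0"
    proof (rule AE_I2)
      fix x :: 'a
      have "\<forall>\<^sub>F n in sequentially. norm x < real n"
        using eventually_gt_at_top[of "nat \<lceil>norm x\<rceil>"] by eventually_elim linarith
      then have "\<forall>\<^sub>F n in sequentially. f n x = 0" by eventually_elim (simp add: f_def)
      then show "(\<lambda>n. f n x) \<longlonglongrightarrow> 0" by (rule tendsto_eventually)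
    qed
    show "AE x in lborel. norm (f n x) \<le> (u x)\<^sup>2" for n by (simp add: f_def)
  qed (use i in measurable)
  then have lim: "(\<lambda>n. LINT x|lborel. f n x) \<longlonglongrightarrow> 0" by simp
  have fi: "integrable lborel (f n)" for n
    by (rule Bochner_Integration.integrable_bound[OF i]) (auto simp: f_def)
  define V where "V = measure lborel (ball (0::'a) \<rho>)"
  have V: "measure lborel (ball c \<rho>) = V" "0 < V" for c :: 'a
    using \<rho> by (auto simp: V_def content_ball)
  have "\<forall>\<^sub>F n in sequentially. (LINT x|lborel. f n x) < \<delta>\<^sup>2 * V"
    using lim by (rule order_tendstoD) (use \<delta> V in simp)
  then obtain n where n: "(LINT x|lborel. f n x) < \<delta>\<^sup>2 * V" by (auto simp: eventually_sequentially)
  have "\<exists>x\<in>ball c \<rho>. u x < \<delta>" if c: "real n + \<rho> < norm c" for c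
  proof (rule ccontr)
    assume "\<not> ?thesis"
    then have ge: "\<delta> \<le> u x" if "x \<in> ball c \<rho>" for x using that by force
    have ib: "integrable lborel (\<lambda>x. \<delta>\<^sup>2 * indicator (ball c \<rho>) x)"
      using emeasure_bounded_finite[of "ball c \<rho>"] by (intro integrable_mult_right integrable_real_indicator) auto
    have "\<delta>\<^sup>2 * V = (LINT x|lborel. \<delta>\<^sup>2 * indicator (ball c \<rho>) x)" by (simp add: V)
    also have "\<dots> \<le> (LINT x|lborel. f n x)"
    proof (rule integral_mono[OF ib fi])
      fix x
      show "\<delta>\<^sup>2 * indicator (ball c \<rho>) x \<le> f n x"
      proof (cases "x \<in> ball c \<rho>")
        case True
        then have "norm (c - x) < \<rho>" by (simp add: dist_norm)
        then have "real n \<le> norm x" using c norm_triangle_sub[of c x] by linarith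
        moreover have "\<delta>\<^sup>2 \<le> (u x)\<^sup>2" using ge[OF True] \<delta> by (intro power_mono) auto
        ultimately show ?thesis using True by (simp add: f_def)
      qed (simp add: f_def)
    qed
    finally show False using n by simp
  qed
  then show ?thesis using \<rho> by (intro exI[of _ "real n + \<rho>"]) auto
qed

lemma hrefl_tendsto:
  assumes "t \<longlonglongrightarrow> a" shows "(\<lambda>n. hrefl e (t n) x) \<longlonglongrightarrow> hrefl e a x"
  unfolding hrefl_def by (intro tendsto_intros assms)

text \<open>For each half space one of the two inequalities holds globally, but which of them may
  depend on \<open>e\<close> and \<open>t\<close>. The locale is instantiated twice, for the ground
  state and for its translate to the centre of symmetry.\<close>

locale reflection_dichotomy =
  fixes u :: "'a::euclidean_space \<Rightarrow> real"
  assumes L2u: "L2 u" and cont: "continuous_on UNIV u" and pos: "\<And>x. 0 < u x"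
    and dich: "\<And>e t. norm e = 1 \<Longrightarrow> (\<forall>x. t < x \<bullet> e \<longrightarrow> u (hrefl e t x) \<le> u x) \<or> (\<forall>x. t < x \<bullet> e \<longrightarrow> u x \<le> u (hrefl e t x))"
begin

lemma lower_bound: "\<exists>\<delta>>0. \<forall>x\<in>cball 0 1. \<delta> \<le> u x"
proof -
  have c: "continuous_on (cball 0 1) u" by (rule continuous_on_subset[OF cont subset_UNIV])
  have "cball (0::'a) 1 \<noteq> {}" by simp
  from continuous_attains_inf[OF compact_cball this c]
  obtain z where z: "\<forall>x\<in>cball 0 1. u z \<le> u x" by (elim bexE)
  show ?thesis by (rule exI[of _ "u z"]) (simp add: z pos)
qed

text \<open>The unit balls centred along the ray leave every bounded set, so one of them contains a
  point where \<open>u\<close> is small.\<close>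

lemma not_large_on_ray:
  assumes e: "norm e = 1" and \<delta>: "0 < \<delta>" and large: "\<And>r x. 0 < r \<Longrightarrow> x \<in> cball 0 1 \<Longrightarrow> \<delta> \<le> u (x + r *\<^sub>R e)"
  shows False
proof -
  obtain R where R: "0 \<le> R" "\<And>c. R < norm c \<Longrightarrow> \<exists>x\<in>ball c 1. u x < \<delta>"
    using L2_small_in_distant_balls[OF L2u \<delta>, of 1] by auto
  have "R < norm ((R + 1) *\<^sub>R e)" using e R(1) by simp
  from R(2)[OF this] obtain y where y: "y \<in> ball ((R + 1) *\<^sub>R e) 1" "u y < \<delta>" by blast
  have "y - (R + 1) *\<^sub>R e \<in> cball 0 1" using y(1) by (simp add: dist_norm norm_minus_commute)
  from large[OF _ this, of "R + 1"] R(1) y(2) show False by simp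
qed

text \<open>\<open>P\<close> and \<open>N\<close> are closed, cover the line and are both nonempty,
  so they meet, and a common \<open>t\<close> gives equality. If one of them were empty,
  \<open>u\<close> would be monotone in a fixed direction along every line, which contradicts square
  integrability.\<close>

lemma symmetry_plane:
  assumes e: "norm e = 1"
  shows "\<exists>t. \<forall>x. u (hrefl e t x) = u x"
proof -
  have ee: "e \<bullet> e = 1" using e by (simp add: norm_eq_1)
  define P where "P = {t. \<forall>x. t < x \<bullet> e \<longrightarrow> u (hrefl e t x) \<le> u x}"
  define N where "N = {t. \<forall>x. t < x \<bullet> e \<longrightarrow> u x \<le> u (hrefl e t x)}"
  have lim: "(\<lambda>n. u (hrefl e (t n) x)) \<longlonglongrightarrow> u (hrefl e a x)" if "t \<longlonglongrightarrow> a" for t a x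
  proof -
    have "isCont u (hrefl e a x)" using cont by (simp add: continuous_on_eq_continuous_at)
    then show ?thesis by (rule isCont_tendsto_compose) (rule hrefl_tendsto[OF that])
  qed
  have "closed P"
    unfolding closed_sequential_limits
  proof (intro allI impI, elim conjE)
    fix t a assume t: "\<forall>n. t n \<in> P" "t \<longlonglongrightarrow> a"
    show "a \<in> P"
      unfolding P_def
    proof (intro CollectI allI impI)
      fix x assume "a < x \<bullet> e"
      then have "\<forall>\<^sub>F n in sequentially. t n < x \<bullet> e" by (rule order_tendstoD(2)[OF t(2)])
      then have "\<forall>\<^sub>F n in sequentially. u (hrefl e (t n) x) \<le> u x"
        by eventually_elim (use t(1) in \<open>auto simp: P_def\<close>)
      then show "u (hrefl e a x) \<le> u x" by (intro tendsto_upperbound[OF lim[OF t(2)]]) auto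
    qed
  qed
  moreover have "closed N"
    unfolding closed_sequential_limits
  proof (intro allI impI, elim conjE)
    fix t a assume t: "\<forall>n. t n \<in> N" "t \<longlonglongrightarrow> a"
    show "a \<in> N"
      unfolding N_def
    proof (intro CollectI allI impI)
      fix x assume "a < x \<bullet> e"
      then have "\<forall>\<^sub>F n in sequentially. t n < x \<bullet> e" by (rule order_tendstoD(2)[OF t(2)])
      then have "\<forall>\<^sub>F n in sequentially. u x \<le> u (hrefl e (t n) x)"
        by eventually_elim (use t(1) in \<open>auto simp: N_def\<close>)
      then show "u x \<le> u (hrefl e a x)" by (intro tendsto_lowerbound[OF lim[OF t(2)]]) auto
    qed
  qed
  moreover have "P \<union> N = UNIV" using dich[OF e] by (auto simp: P_def N_def)
  moreover obtain \<delta> where \<delta>: "0 < \<delta>" "\<And>x. x \<in> cball 0 1 \<Longrightarrow> \<delta> \<le> u x" using lower_bound by blast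
  have "N \<noteq> {}"
  proof
    assume "N = {}"
    then have P: "t < y \<bullet> e \<Longrightarrow> u (hrefl e t y) \<le> u y" for t y using \<open>P \<union> N = UNIV\<close> by (auto simp: P_def)
    show False
    proof (rule not_large_on_ray[OF e \<delta>(1)])
      fix r :: real and x :: 'a assume r: "0 < r" and x: "x \<in> cball 0 1"
      \<comment> \<open>The hyperplane halfway between \<open>x\<close> and
        \<open>x + r *\<^sub>R e\<close> exchanges these two points.\<close>
      have "hrefl e (x \<bullet> e + r / 2) (x + r *\<^sub>R e) = x"
        by (simp add: hrefl_def inner_add_left ee)
      moreover have "x \<bullet> e + r / 2 < (x + r *\<^sub>R e) \<bullet> e" using r by (simp add: inner_add_left ee)
      ultimately have "u x \<le> u (x + r *\<^sub>R e)" using P[of "x \<bullet> e + r / 2" "x + r *\<^sub>R e"] by simp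
      then show "\<delta> \<le> u (x + r *\<^sub>R e)" using \<delta>(2)[OF x] by simp
    qed
  qed
  moreover have "P \<noteq> {}"
  proof
    assume "P = {}"
    then have N: "t < y \<bullet> e \<Longrightarrow> u y \<le> u (hrefl e t y)" for t y using \<open>P \<union> N = UNIV\<close> by (auto simp: N_def)
    show False
    proof (rule not_large_on_ray[of "- e", OF _ \<delta>(1)])
      fix r :: real and x :: 'a assume r: "0 < r" and x: "x \<in> cball 0 1"
      have "hrefl e (x \<bullet> e - r / 2) x = x + r *\<^sub>R (- e)" by (simp add: hrefl_def)
      moreover have "x \<bullet> e - r / 2 < x \<bullet> e" using r by simp
      ultimately have "u x \<le> u (x + r *\<^sub>R (- e))" using N[of "x \<bullet> e - r / 2" x] by simp
      then show "\<delta> \<le> u (x + r *\<^sub>R (- e))" using \<delta>(2)[OF x] by simp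
    qed (use e in simp)
  qed
  ultimately have "P \<inter> N \<noteq> {}"
    using connected_closedD[OF connected_UNIV, of P N] by auto
  then obtain t where t: "t \<in> P" "t \<in> N" by blast
  have "u (hrefl e t x) = u x" for x
  proof -
    consider "t < x \<bullet> e" | "x \<bullet> e = t" | "x \<bullet> e < t" by linarith
    then show ?thesis
    proof cases
      case 1
      then show ?thesis using t unfolding P_def N_def by (auto intro: antisym)
    next
      case 2
      then show ?thesis by (simp add: hrefl_def)
    next
      case 3
      then have "t < hrefl e t x \<bullet> e" by (simp add: hrefl_inner[OF e])
      then have "u (hrefl e t (hrefl e t x)) = u (hrefl e t x)" using t unfolding P_def N_def by (auto intro: antisym)
      then show ?thesis by (simp add: hrefl_hrefl[OF e])
    qed
  qed
  then show ?thesis by blast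
qed

text \<open>The reflections in the coordinate hyperplanes act on different coordinates, so their
  composition is the reflection in the common point \<open>c\<close>.\<close>

lemma centre_of_symmetry: "\<exists>c. \<forall>x. u (2 *\<^sub>R c - x) = u x"
proof -
  have "\<forall>i\<in>Basis. \<exists>t. \<forall>x. u (hrefl i t x) = u x" using symmetry_plane by simp
  then obtain t where t: "\<And>i x. i \<in> Basis \<Longrightarrow> u (hrefl i (t i) x) = u x" by metis
  define c where "c = (\<Sum>i\<in>Basis. t i *\<^sub>R i)"
  have part: "u (x - (\<Sum>i\<in>S. (2 * (x \<bullet> i - t i)) *\<^sub>R i)) = u x" if "finite S" "S \<subseteq> Basis" for S x
    using that
  proof (induction S rule: finite_induct)
    case (insert j S)
    define y where "y = x - (\<Sum>i\<in>S. (2 * (x \<bullet> i - t i)) *\<^sub>R i)"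
    have "y \<bullet> j = x \<bullet> j"
    proof -
      have "i \<bullet> j = 0" if "i \<in> S" for i using that insert by (intro inner_not_same_Basis) auto
      then have "(\<Sum>i\<in>S. (2 * (x \<bullet> i - t i)) *\<^sub>R i) \<bullet> j = 0" by (simp add: inner_sum_left)
      then show ?thesis by (simp add: y_def inner_diff_left)
    qed
    then have "x - (\<Sum>i\<in>insert j S. (2 * (x \<bullet> i - t i)) *\<^sub>R i) = hrefl j (t j) y"
      using insert by (simp add: hrefl_def y_def)
    then show ?case using t[of j y] insert by (simp add: y_def)
  qed simp
  have "u (2 *\<^sub>R c - x) = u x" for x
  proof -
    have "(\<Sum>i\<in>Basis. (2 * (x \<bullet> i - t i)) *\<^sub>R i) = 2 *\<^sub>R (\<Sum>i\<in>Basis. (x \<bullet> i) *\<^sub>R i) - 2 *\<^sub>R c"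
      unfolding c_def scaleR_sum_right sum_subtractf[symmetric] by (intro sum.cong) (auto simp: algebra_simps)
    also have "\<dots> = 2 *\<^sub>R x - 2 *\<^sub>R c" by (simp add: euclidean_representation)
    finally have "x - (\<Sum>i\<in>Basis. (2 * (x \<bullet> i - t i)) *\<^sub>R i) = 2 *\<^sub>R c - x" by (simp add: scaleR_2)
    then show ?thesis using part[of Basis x] by simp
  qed
  then show ?thesis by blast
qed

end

text \<open>The inequality cannot point away from the origin: iterating it would keep \<open>u\<close> bounded below along a ray.\<close>
lemma (in reflection_dichotomy) even_imp_radial_decr:
  assumes even: "\<And>x. u (- x) = u x"
  shows "radial_decr u"
proof -
  have plane: "u (hrefl e 0 x) = u x" if e: "norm e = 1" for e x
  proof -
    have *: "u (hrefl e 0 x) = u x" if x: "0 < x \<bullet> e" for x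
    proof -
      \<comment> \<open>The point \<open>- hrefl e 0 x\<close> lies on the same side as
        \<open>x\<close> and is mirrored to \<open>- x\<close>. By evenness the inequality at this
        point is the reverse of the one at \<open>x\<close>, so every hyperplane through the origin
        is a plane of symmetry.\<close>
      have h: "hrefl e 0 (- hrefl e 0 x) = - x"
      proof -
        have "hrefl e 0 (- y) = - hrefl e 0 y" for y by (simp add: hrefl_def)
        then show ?thesis by (simp add: hrefl_hrefl[OF e])
      qed
      have x': "0 < (- hrefl e 0 x) \<bullet> e" using x by (simp add: hrefl_inner[OF e])
      show ?thesis
        using dich[OF e, of 0]
      proof
        assume P: "\<forall>x. 0 < x \<bullet> e \<longrightarrow> u (hrefl e 0 x) \<le> u x"
        have "u (hrefl e 0 (- hrefl e 0 x)) \<le> u (- hrefl e 0 x)" using P x' by blast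
        then have "u x \<le> u (hrefl e 0 x)" unfolding h by (simp add: even)
        then show ?thesis using P x by (intro antisym) auto
      next
        assume N: "\<forall>x. 0 < x \<bullet> e \<longrightarrow> u x \<le> u (hrefl e 0 x)"
        have "u (- hrefl e 0 x) \<le> u (hrefl e 0 (- hrefl e 0 x))" using N x' by blast
        then have "u (hrefl e 0 x) \<le> u x" unfolding h by (simp add: even)
        then show ?thesis using N x by (intro antisym) auto
      qed
    qed
    consider "0 < x \<bullet> e" | "x \<bullet> e = 0" | "x \<bullet> e < 0" by linarith
    then show ?thesis
    proof cases
      case 2
      then show ?thesis by (simp add: hrefl_def)
    next
      case 3
      then have "0 < hrefl e 0 x \<bullet> e" by (simp add: hrefl_inner[OF e])
      from *[OF this] show ?thesis by (simp add: hrefl_hrefl[OF e])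
    qed (rule *)
  qed
  have radial: "u x = u y" if n: "norm x = norm y" for x y
  proof (cases "x = y")
    case False
    \<comment> \<open>Points of equal norm are exchanged by a reflection whose hyperplane passes
      through the origin.\<close>
    define e where "e = (x - y) /\<^sub>R norm (x - y)"
    have e: "norm e = 1" using False by (simp add: e_def)
    have n2: "(norm (x - y))\<^sup>2 = 2 * (x \<bullet> (x - y))"
    proof -
      have "x \<bullet> x = y \<bullet> y" using n by (simp add: dot_square_norm)
      then show ?thesis by (simp add: power2_norm_eq_inner inner_diff_left inner_diff_right inner_commute)
    qed
    have "2 * (x \<bullet> e) = norm (x - y)"
    proof -
      have "2 * (x \<bullet> e) = (norm (x - y))\<^sup>2 / norm (x - y)" unfolding n2 by (simp add: e_def divide_inverse)
      then show ?thesis using False by (simp add: power2_eq_square)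
    qed
    then have "hrefl e 0 x = x - norm (x - y) *\<^sub>R e" by (simp add: hrefl_def)
    then have "hrefl e 0 x = y" using False by (simp add: e_def)
    then show ?thesis using plane[OF e, of x] by simp
  qed simp
  show ?thesis
  proof (rule radial_decr_if_polarized[OF cont])
    fix e :: 'a and t x assume e: "norm e = 1" and t: "t < 0" and x: "t < x \<bullet> e"
    have ee: "e \<bullet> e = 1" using e by (simp add: norm_eq_1)
    have "\<not> (\<forall>x. t < x \<bullet> e \<longrightarrow> u x \<le> u (hrefl e t x))"
    proof
      assume N: "\<forall>x. t < x \<bullet> e \<longrightarrow> u x \<le> u (hrefl e t x)"
      \<comment> \<open>Reflecting \<open>r *\<^sub>R e\<close> at the hyperplane gives
        \<open>- ((r + T) *\<^sub>R e)\<close>; evenness turns this into a move outward along the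
        same ray by the fixed length \<open>T\<close>.\<close>
      define T where "T = - 2 * t"
      have T: "0 < T" using t by (simp add: T_def)
      have step: "u (r *\<^sub>R e) \<le> u ((r + T) *\<^sub>R e)" if "0 \<le> r" for r
      proof -
        have "u (r *\<^sub>R e) \<le> u (hrefl e t (r *\<^sub>R e))" using N that t by (simp add: ee)
        also have "hrefl e t (r *\<^sub>R e) = - ((r + T) *\<^sub>R e)"
          by (simp only: hrefl_def inner_scaleR_left ee T_def flip: scaleR_minus_left scaleR_diff_left) (simp add: algebra_simps)
        also have "u (- ((r + T) *\<^sub>R e)) = u ((r + T) *\<^sub>R e)" by (rule even)
        finally show ?thesis .
      qed
      have steps: "u (r *\<^sub>R e) \<le> u ((r + real n * T) *\<^sub>R e)" if "0 \<le> r" for r n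
      proof (induction n)
        case (Suc n)
        have "u ((r + real n * T) *\<^sub>R e) \<le> u ((r + real n * T + T) *\<^sub>R e)"
          using that T by (intro step) auto
        then show ?case using Suc by (simp add: algebra_simps)
      qed simp
      obtain \<delta> where \<delta>: "0 < \<delta>" "\<And>x. x \<in> cball 0 1 \<Longrightarrow> \<delta> \<le> u x" using lower_bound by blast
      obtain R where R: "0 \<le> R" "\<And>c. R < norm c \<Longrightarrow> \<exists>x\<in>ball c (1/2). u x < \<delta>"
        using L2_small_in_distant_balls[OF L2u \<delta>(1), of "1/2"] by auto
      obtain n :: nat where n: "R < real n * T" using reals_Archimedean3[OF T] by blast
      \<comment> \<open>Centre and radius 1/2 are chosen so that every point of the ball has norm
        between \<open>n * T\<close> and \<open>n * T + 1\<close>; its norm is then reached by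
        \<open>n\<close> moves from a point of the unit ball.\<close>
      have "norm ((real n * T + 1/2) *\<^sub>R e) = real n * T + 1/2" using e T by simp
      then have "R < norm ((real n * T + 1/2) *\<^sub>R e)" using n by linarith
      from R(2)[OF this] obtain y where y: "y \<in> ball ((real n * T + 1/2) *\<^sub>R e) (1/2)" "u y < \<delta>" by blast
      have "\<bar>norm y - (real n * T + 1/2)\<bar> \<le> norm (y - (real n * T + 1/2) *\<^sub>R e)"
        using norm_triangle_ineq3[of y "(real n * T + 1/2) *\<^sub>R e"] e T by simp
      also have "\<dots> < 1/2" using y(1) by (simp add: dist_norm norm_minus_commute)
      finally have ny: "real n * T \<le> norm y" "norm y \<le> real n * T + 1" by linarith+
      define r where "r = norm y - real n * T"
      have r: "0 \<le> r" "r \<le> 1" using ny by (auto simp: r_def)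
      have "\<delta> \<le> u (r *\<^sub>R e)" using r e by (intro \<delta>) simp
      also have "\<dots> \<le> u ((r + real n * T) *\<^sub>R e)" by (rule steps[OF r(1)])
      also have "\<dots> = u y" by (rule radial) (simp add: r_def e)
      finally show False using y(2) by simp
    qed
    then show "u (hrefl e t x) \<le> u x" using dich[OF e, of t] x by blast
  qed
qed

lemma (in reflection_dichotomy) radial_about_centre:
  "\<exists>c. \<exists>v::real \<Rightarrow> real. (\<forall>r\<ge>0. v r \<ge> 0) \<and> (\<forall>r s. 0 \<le> r \<longrightarrow> r \<le> s \<longrightarrow> v s \<le> v r) \<and>
     (\<forall>x. u x = v (norm (x - c))) \<and> (v \<longlongrightarrow> 0) at_top"
proof -
  obtain c where c: "\<And>x. u (2 *\<^sub>R c - x) = u x" using centre_of_symmetry by blast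
  define U where "U z = u (z + c)" for z
  \<comment> \<open>Translation by \<open>c\<close> shifts the hyperplane at \<open>t\<close> to the
    one at \<open>t + c \<bullet> e\<close>, so the dichotomy is inherited.\<close>
  interpret U: reflection_dichotomy U
  proof
    show "L2 U" unfolding U_def by (rule L2_shift[OF L2u])
    show "continuous_on UNIV U" unfolding U_def by (intro continuous_on_compose2[OF cont] continuous_intros) auto
    show "0 < U x" for x by (simp add: U_def pos)
    fix e :: 'a and t assume e: "norm e = 1"
    have h: "hrefl e t z + c = hrefl e (t + c \<bullet> e) (z + c)" for z
      by (simp add: hrefl_def inner_add_left)
    show "(\<forall>x. t < x \<bullet> e \<longrightarrow> U (hrefl e t x) \<le> U x) \<or> (\<forall>x. t < x \<bullet> e \<longrightarrow> U x \<le> U (hrefl e t x))"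
      unfolding U_def h using dich[OF e, of "t + c \<bullet> e"] by (auto simp: inner_add_left)
  qed
  have "radial_decr U"
  proof (rule U.even_imp_radial_decr)
    show "U (- x) = U x" for x
    proof -
      have "- x + c = 2 *\<^sub>R c - (x + c)" by (simp add: scaleR_2)
      then show ?thesis unfolding U_def by (simp only: c)
    qed
  qed
  obtain b :: 'a where b: "b \<in> Basis" using nonempty_Basis by blast
  define v where "v r = U (r *\<^sub>R b)" for r
  have Uv: "U z = v (norm z)" for z
    unfolding v_def using b by (intro antisym radial_decrD[OF \<open>radial_decr U\<close>]) auto
  have mono: "v s \<le> v r" if "0 \<le> r" "r \<le> s" for r s
    unfolding v_def using b that by (intro radial_decrD[OF \<open>radial_decr U\<close>]) simp
  have nonneg: "0 \<le> v r" for r unfolding v_def by (simp add: less_imp_le U.pos)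
  have "(v \<longlongrightarrow> 0) at_top"
  proof (rule order_tendstoI)
    fix a :: real assume "0 < a"
    from L2_small_in_distant_balls[OF U.L2u this, of 1] obtain R where R: "0 \<le> R" "\<And>c. R < norm c \<Longrightarrow> \<exists>x\<in>ball c 1. U x < a" by auto
    \<comment> \<open>Since the profile is decreasing, a single small value at some point far out
      bounds it from there on.\<close>
    have "R < norm ((R + 1) *\<^sub>R b)" using b R(1) by simp
    from R(2)[OF this] obtain x where x: "x \<in> ball ((R + 1) *\<^sub>R b) 1" "U x < a" by blast
    have "norm x \<le> R + 2"
      using x(1) norm_triangle_sub[of x "(R + 1) *\<^sub>R b"] R(1) b by (simp add: dist_norm norm_minus_commute)
    then have "v r < a" if "R + 2 \<le> r" for r
      using mono[of "norm x" r] that x(2) by (simp add: Uv)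
    then show "\<forall>\<^sub>F r in at_top. v r < a" by (rule eventually_at_top_linorderI)
  next
    fix a :: real assume "a < 0"
    then show "\<forall>\<^sub>F r in at_top. a < v r" by (intro always_eventually allI less_le_trans[OF _ nonneg])
  qed
  moreover have "u x = v (norm (x - c))" for x using Uv[of "x - c"] by (simp add: U_def)
  ultimately show ?thesis using mono nonneg by blast
qed

section \<open>Ground states\<close>

lemma has_wgrad_unique:
  fixes u u' :: "'a::euclidean_space \<Rightarrow> real"
  assumes u: "has_wgrad u G" and u': "has_wgrad u' G'" and eq: "AE x in lborel. u x = u' x"
  shows "AE x in lborel. G x = G' x"
proof -
  have L: "L2 u" "L2 u'" "L2 G" "L2 G'" using u u' by (auto simp: has_wgrad_def)
  note [measurable] = L[THEN L2_measurable]
  have comp: "AE x in lborel. (G x - G' x) \<bullet> i = 0" if i: "i \<in> Basis" for i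
  proof (rule AE_eq_0_test_fun)
    have L': "L2 (\<lambda>x. (G x - G' x) \<bullet> i)" by (intro L2_inner L2_diff L)
    then show "(\<lambda>x. (G x - G' x) \<bullet> i) \<in> borel_measurable borel" by (rule L2_measurable)
    show "integrable lborel (\<lambda>x. ((G x - G' x) \<bullet> i)\<^sup>2)" using L2_integrable_sq[OF L'] by simp
    fix \<phi> :: "'a \<Rightarrow> real" assume \<phi>: "test_fun \<phi>"
    note L\<phi> = test_fun_L2[OF \<phi>]
    note [measurable] = test_fun_measurable[OF \<phi>]
    have "(LINT x|lborel. (G x - G' x) \<bullet> i * \<phi> x) = (LINT x|lborel. (G x \<bullet> i) * \<phi> x) - (LINT x|lborel. (G' x \<bullet> i) * \<phi> x)"
      unfolding inner_diff_left left_diff_distrib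
      by (intro Bochner_Integration.integral_diff L2_integrable_mult L2_inner L L\<phi>)
    also have "(LINT x|lborel. (G x \<bullet> i) * \<phi> x) = - (LINT x|lborel. u x * (grad \<phi> x \<bullet> i))"
      using u \<phi> by (simp add: has_wgrad_def)
    also have "(LINT x|lborel. (G' x \<bullet> i) * \<phi> x) = - (LINT x|lborel. u' x * (grad \<phi> x \<bullet> i))"
      using u' \<phi> by (simp add: has_wgrad_def)
    also have "(LINT x|lborel. u x * (grad \<phi> x \<bullet> i)) = (LINT x|lborel. u' x * (grad \<phi> x \<bullet> i))"
      by (intro integral_cong_AE) (use eq in \<open>auto elim: AE_mp\<close>)
    finally show "(LINT x|lborel. (G x - G' x) \<bullet> i * \<phi> x) = 0" by simp
  qed
  have "AE x in lborel. \<forall>i\<in>Basis. (G x - G' x) \<bullet> i = 0" using comp by (intro AE_finite_allI) auto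
  then show ?thesis
  proof (rule AE_mp, intro AE_I2 impI)
    fix x assume "\<forall>i\<in>Basis. (G x - G' x) \<bullet> i = 0"
    then show "G x = G' x" by (intro euclidean_eqI[of "G x"]) (simp add: inner_diff_left)
  qed
qed

lemma wgrad_weak_gradient:
  assumes "H1 u"
  shows "weak_gradient u (wgrad u)" "square_integrable (\<lambda>x. norm (wgrad u x))"
proof -
  have "\<exists>G. weak_gradient u G \<and> square_integrable (\<lambda>x. norm (G x))" using assms by (simp add: H1_def)
  from someI_ex[OF this] show "weak_gradient u (wgrad u)" "square_integrable (\<lambda>x. norm (wgrad u x))"
    unfolding wgrad_def by blast+
qed

lemma L2I_AE_square_integrable:
  fixes f' :: "'a::euclidean_space \<Rightarrow> 'b::euclidean_space"
  assumes f: "square_integrable (\<lambda>x. norm (f x))" and [measurable]: "f' \<in> borel_measurable borel"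
    and eq: "AE x in lebesgue. f x = f' x"
  shows "L2 f'"
proof (rule L2I_integrable)
  have [measurable]: "(\<lambda>x. norm (f x)) \<in> borel_measurable lebesgue" using f by (simp add: square_integrable_def)
  have b: "(\<lambda>x. (norm (f' x))\<^sup>2) \<in> borel_measurable lborel" by measurable
  have i: "integrable lebesgue (\<lambda>x. (norm (f x))\<^sup>2)" using f by (simp add: square_integrable_def)
  have "integrable lebesgue (\<lambda>x. (norm (f' x))\<^sup>2)"
  proof (rule integrable_cong_AE_imp[OF i])
    show "AE x in lebesgue. (norm (f x))\<^sup>2 = (norm (f' x))\<^sup>2" using eq by eventually_elim simp
    show "(\<lambda>x. (norm (f' x))\<^sup>2) \<in> borel_measurable lebesgue" using b by (rule measurable_completion)
  qed
  then show "integrable lborel (\<lambda>x. (norm (f' x))\<^sup>2)" using integrable_completion[OF b] by simp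
qed fact

text \<open>Functions measurable for the completed measure agree almost everywhere with Borel
  functions; for the gradient this is done coordinate by coordinate. The weak gradient relation is
  given for basis directions and extends linearly to all directions.\<close>

lemma H1_borel_representative:
  fixes u :: "'a::euclidean_space \<Rightarrow> real"
  assumes H: "H1 u"
  shows "\<exists>u' G'. has_wgrad u' G' \<and> (AE x in lebesgue. u x = u' x) \<and> (AE x in lebesgue. wgrad u x = G' x)"
proof -
  note W = wgrad_weak_gradient[OF H]
  have su: "square_integrable u" using H by (simp add: H1_def)
  have mu: "u \<in> borel_measurable lebesgue" using su by (simp add: square_integrable_def)
  have mG: "wgrad u \<in> borel_measurable lebesgue" using W(1) by (simp add: weak_gradient_def)
  note [measurable] = mu mG
  from completion_ex_borel_measurable_real[OF mu] obtain u' where u': "u' \<in> borel_measurable lborel" "AE x in lborel. u x = u' x" by blast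
  have "\<exists>g'\<in>borel_measurable lborel. (AE x in lborel. wgrad u x \<bullet> i = g' x)" for i
    by (rule completion_ex_borel_measurable_real) measurable
  then obtain g where g: "\<And>i. g i \<in> borel_measurable lborel" "\<And>i. AE x in lborel. wgrad u x \<bullet> i = g i x" by metis
  define G' where "G' x = (\<Sum>i\<in>Basis. g i x *\<^sub>R i)" for x
  have [measurable]: "u' \<in> borel_measurable borel" using u'(1) by simp
  have [measurable]: "g i \<in> borel_measurable borel" for i using g(1) by simp
  have [measurable]: "G' \<in> borel_measurable borel" unfolding G'_def by measurable
  have eu: "AE x in lebesgue. u x = u' x" by (rule AE_completion[OF u'(2)])
  have "AE x in lborel. \<forall>i\<in>Basis. wgrad u x \<bullet> i = g i x" using g(2) by (intro AE_finite_allI) auto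
  then have "AE x in lborel. wgrad u x = G' x"
  proof (rule AE_mp, intro AE_I2 impI)
    fix x assume *: "\<forall>i\<in>Basis. wgrad u x \<bullet> i = g i x"
    have "wgrad u x = (\<Sum>i\<in>Basis. (wgrad u x \<bullet> i) *\<^sub>R i)" by (rule euclidean_representation[symmetric])
    also have "\<dots> = G' x" unfolding G'_def using * by (intro sum.cong) auto
    finally show "wgrad u x = G' x" .
  qed
  then have eG: "AE x in lebesgue. wgrad u x = G' x" by (rule AE_completion)
  have Lu: "L2 u'"
  proof (rule L2I_AE_square_integrable[OF _ _ eu])
    show "square_integrable (\<lambda>x. norm (u x))" using su by (auto simp: square_integrable_def)
  qed measurable
  have LG: "L2 G'" by (rule L2I_AE_square_integrable[OF W(2) _ eG]) measurable
  have basis: "(LINT x|lborel. u' x * (grad \<phi> x \<bullet> i)) = - (LINT x|lborel. (G' x \<bullet> i) * \<phi> x)" if \<phi>: "test_fun \<phi>" and i: "i \<in> Basis" for \<phi> i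
  proof -
    note [measurable] = test_fun_measurable[OF \<phi>]
    have m1: "(\<lambda>x. u' x * (grad \<phi> x \<bullet> i)) \<in> borel_measurable lborel" by measurable
    have m2: "(\<lambda>x. (G' x \<bullet> i) * \<phi> x) \<in> borel_measurable lborel" by measurable
    have m3: "(\<lambda>x. grad \<phi> x \<bullet> i) \<in> borel_measurable lebesgue" by (intro measurable_completion) measurable
    have m4: "\<phi> \<in> borel_measurable lebesgue" by (intro measurable_completion) measurable
    note [measurable] = m3 m4
    have "(LINT x|lborel. u' x * (grad \<phi> x \<bullet> i)) = (LINT x|lebesgue. u' x * (grad \<phi> x \<bullet> i))"
      by (rule integral_completion[OF m1, symmetric])
    also have "\<dots> = (LINT x|lebesgue. u x * (grad \<phi> x \<bullet> i))"
    proof (rule integral_cong_AE)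
      show "AE x in lebesgue. u' x * (grad \<phi> x \<bullet> i) = u x * (grad \<phi> x \<bullet> i)" using eu by eventually_elim simp
    qed (use measurable_completion[OF m1] in simp, measurable)
    also have "\<dots> = - (LINT x|lebesgue. (wgrad u x \<bullet> i) * \<phi> x)"
      using W(1) \<phi> i by (simp add: weak_gradient_def grad_inner_Basis)
    also have "(LINT x|lebesgue. (wgrad u x \<bullet> i) * \<phi> x) = (LINT x|lebesgue. (G' x \<bullet> i) * \<phi> x)"
    proof (rule integral_cong_AE)
      show "AE x in lebesgue. (wgrad u x \<bullet> i) * \<phi> x = (G' x \<bullet> i) * \<phi> x" using eG by eventually_elim simp
      show "(\<lambda>x. (G' x \<bullet> i) * \<phi> x) \<in> borel_measurable lebesgue" by (rule measurable_completion[OF m2])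
    qed measurable
    also have "\<dots> = (LINT x|lborel. (G' x \<bullet> i) * \<phi> x)" by (rule integral_completion[OF m2])
    finally show ?thesis .
  qed
  have "has_wgrad u' G'"
    unfolding has_wgrad_def
  proof (intro conjI allI impI Lu LG)
    fix \<phi> :: "'a \<Rightarrow> real" and v :: 'a assume \<phi>: "test_fun \<phi>"
    note L\<phi> = test_fun_L2[OF \<phi>]
    have ex: "w \<bullet> v = (\<Sum>i\<in>Basis. (v \<bullet> i) * (w \<bullet> i))" for w
      unfolding euclidean_inner[of w v] by (intro sum.cong) (auto simp: mult.commute)
    have "(LINT x|lborel. u' x * (grad \<phi> x \<bullet> v)) = (LINT x|lborel. (\<Sum>i\<in>Basis. (v \<bullet> i) * (u' x * (grad \<phi> x \<bullet> i))))"
      by (intro Bochner_Integration.integral_cong refl) (simp add: ex sum_distrib_left mult.left_commute)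
    also have "\<dots> = (\<Sum>i\<in>Basis. (v \<bullet> i) * (LINT x|lborel. u' x * (grad \<phi> x \<bullet> i)))"
      by (subst Bochner_Integration.integral_sum) (auto intro!: L2_integrable_mult L2_inner Lu L\<phi>)
    also have "\<dots> = (\<Sum>i\<in>Basis. - ((v \<bullet> i) * (LINT x|lborel. (G' x \<bullet> i) * \<phi> x)))"
      by (intro sum.cong refl) (simp add: basis[OF \<phi>])
    also have "\<dots> = - (\<Sum>i\<in>Basis. (v \<bullet> i) * (LINT x|lborel. (G' x \<bullet> i) * \<phi> x))" by (rule sum_negf)
    also have "(\<Sum>i\<in>Basis. (v \<bullet> i) * (LINT x|lborel. (G' x \<bullet> i) * \<phi> x)) = (LINT x|lborel. (\<Sum>i\<in>Basis. (v \<bullet> i) * ((G' x \<bullet> i) * \<phi> x)))"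
      by (subst Bochner_Integration.integral_sum) (auto intro!: L2_integrable_mult L2_inner LG L\<phi>)
    also have "\<dots> = (LINT x|lborel. (G' x \<bullet> v) * \<phi> x)"
      by (intro Bochner_Integration.integral_cong refl) (simp add: ex sum_distrib_right mult.assoc)
    finally show "(LINT x|lborel. u' x * (grad \<phi> x \<bullet> v)) = - (LINT x|lborel. (G' x \<bullet> v) * \<phi> x)" .
  qed
  then show ?thesis using eu eG by blast
qed

text \<open>\<open>wgrad\<close> is an arbitrary choice among the weak gradients, so it can be
  identified with \<open>G\<close> only almost everywhere, through uniqueness.\<close>

lemma has_wgrad_imp_H1:
  fixes u :: "'a::euclidean_space \<Rightarrow> real"
  assumes u: "has_wgrad u G"
  shows "H1 u" and "AE x in lebesgue. wgrad u x = G x"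
proof -
  have L: "L2 u" "L2 G" using u by (auto simp: has_wgrad_def)
  note [measurable] = L[THEN L2_measurable]
  have sq: "square_integrable (\<lambda>x. norm (f x))" if f: "L2 f" for f :: "'a \<Rightarrow> 'b::euclidean_space"
  proof -
    have [measurable]: "f \<in> borel_measurable borel" using f by (rule L2_measurable)
    have b: "(\<lambda>x. norm (f x)) \<in> borel_measurable lborel" "(\<lambda>x. (norm (f x))\<^sup>2) \<in> borel_measurable lborel" by measurable
    show ?thesis
      unfolding square_integrable_def using measurable_completion[OF b(1)] integrable_completion[OF b(2)] L2_integrable_sq[OF f] by simp
  qed
  have "weak_gradient u G"
    unfolding weak_gradient_def
  proof (intro conjI allI impI ballI)
    have "G \<in> borel_measurable lborel" by measurable
    then show "G \<in> borel_measurable lebesgue" by (rule measurable_completion)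
    fix \<phi> :: "'a \<Rightarrow> real" and i :: 'a assume \<phi>: "test_fun \<phi>" and i: "i \<in> Basis"
    note [measurable] = test_fun_measurable[OF \<phi>]
    have m1: "(\<lambda>x. u x * (grad \<phi> x \<bullet> i)) \<in> borel_measurable lborel" by measurable
    have m2: "(\<lambda>x. (G x \<bullet> i) * \<phi> x) \<in> borel_measurable lborel" by measurable
    have "(LINT x|lborel. u x * (grad \<phi> x \<bullet> i)) = - (LINT x|lborel. (G x \<bullet> i) * \<phi> x)" using u \<phi> by (simp add: has_wgrad_def)
    then show "(LINT x|lebesgue. u x * frechet_derivative \<phi> (at x) i) = - (LINT x|lebesgue. (G x \<bullet> i) * \<phi> x)"
      unfolding grad_inner_Basis[OF i, symmetric] integral_completion[OF m1] integral_completion[OF m2] .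
  qed
  moreover have "square_integrable u" using sq[OF L(1)] L(1)[THEN L2_measurable] by (simp add: square_integrable_def measurable_completion)
  ultimately show H: "H1 u" unfolding H1_def using sq[OF L(2)] by blast
  obtain u' G' where r: "has_wgrad u' G'" "AE x in lebesgue. u x = u' x" "AE x in lebesgue. wgrad u x = G' x"
    using H1_borel_representative[OF H] by (elim exE conjE)
  have "AE x in lborel. u x = u' x" using r(2) by (simp add: AE_completion_iff)
  from AE_completion[OF has_wgrad_unique[OF u r(1) this]] r(3) show "AE x in lebesgue. wgrad u x = G x"
    by eventually_elim simp
qed

lemma lebesgue_h1_inner:
  fixes u v :: "'a::euclidean_space \<Rightarrow> real"
  assumes u: "has_wgrad u G" and v: "H1 v" "has_wgrad v' H" "AE x in lebesgue. v x = v' x" "AE x in lebesgue. wgrad v x = H x"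
  shows "(LINT x|lebesgue. wgrad u x \<bullet> wgrad v x + u x * v x) = h1_inner u G v' H"
proof -
  have L: "L2 u" "L2 G" "L2 v'" "L2 H" using u v(2) by (auto simp: has_wgrad_def)
  note [measurable] = L[THEN L2_measurable]
  have m: "(\<lambda>x. G x \<bullet> H x + u x * v' x) \<in> borel_measurable lborel" by measurable
  note W = has_wgrad_imp_H1[OF u]
  have [measurable]: "wgrad u \<in> borel_measurable lebesgue" "wgrad v \<in> borel_measurable lebesgue"
    using wgrad_weak_gradient(1)[OF W(1)] wgrad_weak_gradient(1)[OF v(1)] by (auto simp: weak_gradient_def)
  have [measurable]: "u \<in> borel_measurable lebesgue" "v \<in> borel_measurable lebesgue"
    using W(1) v(1) by (auto simp: H1_def square_integrable_def)
  have "(LINT x|lebesgue. wgrad u x \<bullet> wgrad v x + u x * v x) = (LINT x|lebesgue. G x \<bullet> H x + u x * v' x)"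
  proof (rule integral_cong_AE)
    show "(\<lambda>x. G x \<bullet> H x + u x * v' x) \<in> borel_measurable lebesgue" by (rule measurable_completion[OF m])
    show "AE x in lebesgue. wgrad u x \<bullet> wgrad v x + u x * v x = G x \<bullet> H x + u x * v' x"
      using W(2) v(3,4) by eventually_elim simp
  qed measurable
  also have "\<dots> = h1_inner u G v' H" unfolding h1_inner_def by (rule integral_completion[OF m])
  finally show ?thesis .
qed

lemma lebesgue_choquard_form:
  fixes u \<phi> \<phi>' :: "'a::euclidean_space \<Rightarrow> real"
  assumes [measurable]: "u \<in> borel_measurable borel" "\<phi>' \<in> borel_measurable borel" "\<phi> \<in> borel_measurable lebesgue"
    and eq: "AE x in lebesgue. \<phi> x = \<phi>' x"
  shows "(LINT x|lebesgue. LINT y|lebesgue. \<bar>u y\<bar> powr p * (\<bar>u x\<bar> powr (p - 1) * sgn (u x)) * \<phi> x / norm (x - y) powr (real DIM('a) - \<alpha>))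
    = choquard_form \<alpha> p u \<phi>'"
proof -
  \<comment> \<open>The test function depends on the outer variable alone. Once it is factored out
    of the inner integral, it can be exchanged for its Borel version on a null set of that
    variable.\<close>
  define F where "F x = (LINT y|lborel. \<bar>u y\<bar> powr p * (\<bar>u x\<bar> powr (p - 1) * sgn (u x)) / norm (x - y) powr (real DIM('a) - \<alpha>))" for x
  have mF: "F \<in> borel_measurable lborel" unfolding F_def by measurable
  have mF\<phi>: "(\<lambda>x. F x * \<phi>' x) \<in> borel_measurable lborel" using mF by measurable
  have [measurable]: "F \<in> borel_measurable lebesgue" by (rule measurable_completion[OF mF])
  have inner: "(LINT y|lebesgue. \<bar>u y\<bar> powr p * (\<bar>u x\<bar> powr (p - 1) * sgn (u x)) * c / norm (x - y) powr (real DIM('a) - \<alpha>)) = F x * c"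
    "(LINT y|lborel. \<bar>u y\<bar> powr p * (\<bar>u x\<bar> powr (p - 1) * sgn (u x)) * c / norm (x - y) powr (real DIM('a) - \<alpha>)) = F x * c" for x c
  proof -
    have m: "(\<lambda>y. \<bar>u y\<bar> powr p * (\<bar>u x\<bar> powr (p - 1) * sgn (u x)) * c / norm (x - y) powr (real DIM('a) - \<alpha>)) \<in> borel_measurable lborel"
      by measurable
    show 2: "(LINT y|lborel. \<bar>u y\<bar> powr p * (\<bar>u x\<bar> powr (p - 1) * sgn (u x)) * c / norm (x - y) powr (real DIM('a) - \<alpha>)) = F x * c"
      unfolding F_def integral_mult_left_zero[symmetric] by (intro Bochner_Integration.integral_cong refl) simp
    show "(LINT y|lebesgue. \<bar>u y\<bar> powr p * (\<bar>u x\<bar> powr (p - 1) * sgn (u x)) * c / norm (x - y) powr (real DIM('a) - \<alpha>)) = F x * c"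
      unfolding integral_completion[OF m] 2 ..
  qed
  have "(LINT x|lebesgue. F x * \<phi> x) = (LINT x|lebesgue. F x * \<phi>' x)"
  proof (rule integral_cong_AE)
    show "(\<lambda>x. F x * \<phi>' x) \<in> borel_measurable lebesgue" by (rule measurable_completion[OF mF\<phi>])
    show "AE x in lebesgue. F x * \<phi> x = F x * \<phi>' x" using eq by eventually_elim simp
  qed measurable
  also have "\<dots> = (LINT x|lborel. F x * \<phi>' x)" by (rule integral_completion[OF mF\<phi>])
  finally show ?thesis unfolding choquard_form_def inner .
qed

lemma iterated_riesz_real:
  fixes u :: "'a::euclidean_space \<Rightarrow> real"
  assumes [measurable]: "u \<in> borel_measurable borel" and fin: "riesz \<alpha> p u < \<infinity>"
  shows "(LINT x|lborel. LINT y|lborel. \<bar>u x\<bar> powr p * \<bar>u y\<bar> powr p / norm (x - y) powr (real DIM('a) - \<alpha>)) = riesz_real \<alpha> p u"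
  using lborel_pair.integral_fst'[OF riesz_pair(1)[OF assms]] by (simp add: riesz_real_def riesz_kernel_def)

lemma choquard_energy_eq:
  fixes u :: "'a::euclidean_space \<Rightarrow> real"
  assumes u: "has_wgrad u G" and fin: "riesz \<alpha> p u < \<infinity>"
  shows "choquard_energy \<alpha> p u = (1/2) * h1_inner u G u G - (1/(2*p)) * riesz_real \<alpha> p u"
proof -
  have L: "L2 u" "L2 G" using u by (auto simp: has_wgrad_def)
  note [measurable] = L[THEN L2_measurable]
  have "(LINT x|lebesgue. (norm (wgrad u x))\<^sup>2 + (u x)\<^sup>2) = (LINT x|lebesgue. wgrad u x \<bullet> wgrad u x + u x * u x)"
    unfolding power2_norm_eq_inner power2_eq_square[of "u _"] ..
  also have "\<dots> = h1_inner u G u G" by (rule lebesgue_h1_inner[OF u has_wgrad_imp_H1(1)[OF u] u _ has_wgrad_imp_H1(2)[OF u]]) simp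
  finally have 1: "(LINT x|lebesgue. (norm (wgrad u x))\<^sup>2 + (u x)\<^sup>2) = h1_inner u G u G" .
  have m: "(\<lambda>y. \<bar>u x\<bar> powr p * \<bar>u y\<bar> powr p / norm (x - y) powr (real DIM('a) - \<alpha>)) \<in> borel_measurable lborel" for x by measurable
  have m': "(\<lambda>x. LINT y|lborel. \<bar>u x\<bar> powr p * \<bar>u y\<bar> powr p / norm (x - y) powr (real DIM('a) - \<alpha>)) \<in> borel_measurable lborel" by measurable
  have 2: "(LINT x|lebesgue. LINT y|lebesgue. \<bar>u x\<bar> powr p * \<bar>u y\<bar> powr p / norm (x - y) powr (real DIM('a) - \<alpha>)) = riesz_real \<alpha> p u"
    unfolding integral_completion[OF m] integral_completion[OF m'] by (rule iterated_riesz_real[OF _ fin]) measurable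
  show ?thesis unfolding choquard_energy_def 1 2 ..
qed

lemma choquard_weak_solutionI:
  fixes w :: "'a::euclidean_space \<Rightarrow> real"
  assumes w: "has_wgrad w G" and crit: "\<And>\<phi> H. has_wgrad \<phi> H \<Longrightarrow> h1_inner w G \<phi> H = choquard_form \<alpha> p w \<phi>"
  shows "choquard_weak_solution \<alpha> p w"
  unfolding choquard_weak_solution_def
proof (intro conjI allI impI has_wgrad_imp_H1(1)[OF w])
  fix \<phi> :: "'a \<Rightarrow> real" assume \<phi>: "H1 \<phi>"
  obtain \<phi>' H where r: "has_wgrad \<phi>' H" "AE x in lebesgue. \<phi> x = \<phi>' x" "AE x in lebesgue. wgrad \<phi> x = H x"
    using H1_borel_representative[OF \<phi>] by (elim exE conjE)
  have m: "w \<in> borel_measurable borel" "\<phi>' \<in> borel_measurable borel" "\<phi> \<in> borel_measurable lebesgue"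
    using w r(1) \<phi> by (auto simp: has_wgrad_def L2_def H1_def square_integrable_def)
  show "(LINT x|lebesgue. wgrad w x \<bullet> wgrad \<phi> x + w x * \<phi> x) =
        (LINT x|lebesgue. LINT y|lebesgue. \<bar>w y\<bar> powr p * (\<bar>w x\<bar> powr (p - 1) * sgn (w x)) * \<phi> x
             / norm (x - y) powr (real DIM('a) - \<alpha>))"
    unfolding lebesgue_h1_inner[OF w \<phi> r] lebesgue_choquard_form[OF m r(2)] by (rule crit[OF r(1)])
qed

text \<open>Needed to give the continuous function \<open>u\<close> itself the gradient of its Borel
  representative, since positivity and continuity hold for \<open>u\<close> and not for the
  representative.\<close>

lemma has_wgrad_cong_AE:
  fixes u u' :: "'a::euclidean_space \<Rightarrow> real"
  assumes u': "has_wgrad u' G" and m: "u \<in> borel_measurable borel" and eq: "AE x in lborel. u x = u' x"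
  shows "has_wgrad u G"
  unfolding has_wgrad_def
proof (intro conjI allI impI)
  have L: "L2 u'" "L2 G" using u' by (auto simp: has_wgrad_def)
  note [measurable] = L[THEN L2_measurable] m
  have "sq_norm u = sq_norm u'" unfolding sq_norm_def by (intro nn_integral_cong_AE) (use eq in \<open>auto elim: AE_mp\<close>)
  then show "L2 u" using L(1) m by (simp add: L2_def)
  show "L2 G" by fact
  fix \<phi> :: "'a \<Rightarrow> real" and v :: 'a assume \<phi>: "test_fun \<phi>"
  note [measurable] = test_fun_measurable[OF \<phi>]
  have "(LINT x|lborel. u x * (grad \<phi> x \<bullet> v)) = (LINT x|lborel. u' x * (grad \<phi> x \<bullet> v))"
    by (intro integral_cong_AE) (use eq in \<open>auto elim: AE_mp\<close>)
  also have "\<dots> = - (LINT x|lborel. (G x \<bullet> v) * \<phi> x)" using u' \<phi> by (simp add: has_wgrad_def)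
  finally show "(LINT x|lborel. u x * (grad \<phi> x \<bullet> v)) = - (LINT x|lborel. (G x \<bullet> v) * \<phi> x)" .
qed

lemma riesz_eq_0:
  fixes w :: "'a::euclidean_space \<Rightarrow> real"
  assumes "AE x in lborel. w x = 0"
  shows "riesz \<alpha> p w = 0"
proof -
  have "riesz \<alpha> p w = (\<integral>\<^sup>+x. 0 \<partial>(lborel::'a measure))"
    unfolding riesz_def by (rule nn_integral_cong_AE) (use assms in eventually_elim, simp)
  then show ?thesis by simp
qed

text \<open>The maximiser has squared norm 1 and Riesz energy \<open>M\<close>. Multiplying by
  \<open>sqrt a\<close> makes them \<open>a\<close> and \<open>M * a powr p\<close>; a weak solution
  tested with itself needs both to be equal.\<close>

lemma choquard_scaled_maximiser:
  fixes \<alpha> p :: real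
  assumes dim: "DIM('a::euclidean_space) \<ge> 3" and \<alpha>: "0 < \<alpha>" "\<alpha> < real DIM('a)"
    and p: "(real DIM('a) + \<alpha>) / real DIM('a) < p" "p < (real DIM('a) + \<alpha>) / (real DIM('a) - 2)" and p1: "1 < p"
  shows "\<exists>M>0. \<exists>a>0. \<exists>w :: 'a \<Rightarrow> real. M * a powr p = a
    \<and> (\<forall>(f :: 'a \<Rightarrow> real) q. f \<in> borel_measurable borel \<longrightarrow> 0 < q \<longrightarrow> h1_energy f \<le> ennreal q \<longrightarrow> riesz \<alpha> p f \<le> ennreal (M * q powr p))
    \<and> choquard_weak_solution \<alpha> p w \<and> nonzero_H1 w \<and> choquard_energy \<alpha> p w = (1/2 - 1/(2*p)) * a"
proof -
  obtain M and v :: "'a \<Rightarrow> real" where M: "0 < M" and mv: "v \<in> borel_measurable borel"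
    and v: "h1_energy v \<le> ennreal 1" "riesz \<alpha> p v = ennreal M"
    and bound: "\<And>(f :: 'a \<Rightarrow> real) q. f \<in> borel_measurable borel \<Longrightarrow> 0 < q \<Longrightarrow> h1_energy f \<le> ennreal q \<Longrightarrow> riesz \<alpha> p f \<le> ennreal (M * q powr p)"
    using riesz_maximiser[OF dim \<alpha> p] by (elim exE conjE) blast
  note [measurable] = mv
  \<comment> \<open>A maximiser inside the open unit ball would violate the optimal inequality with
    \<open>q < 1\<close>, because \<open>q powr p\<close> is then below 1.\<close>
  have Qv: "h1_energy v = 1"
  proof (rule ccontr)
    assume "h1_energy v \<noteq> 1"
    then have "h1_energy v < 1" using v(1) by simp
    from dense[OF this] obtain r where r: "h1_energy v < r" "r < 1" by blast
    have "r < \<infinity>" using less_trans[OF r(2) ennreal_one_less_top] by simp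
    then obtain q where q: "r = ennreal q" "0 \<le> q" by (cases r) auto
    have "0 < q" using r(1) q by (cases "q = 0") auto
    moreover have "q < 1" using r(2) q by simp
    ultimately have "q powr p < 1 powr p" using p1 by (intro powr_less_mono2) auto
    then have "M * q powr p < M" using M by simp
    moreover have "ennreal M \<le> ennreal (M * q powr p)"
      using bound[OF mv \<open>0 < q\<close>] r(1) v(2) q(1) by simp
    ultimately show False using M by (simp add: ennreal_le_iff)
  qed
  \<comment> \<open>The solution of \<open>M * a powr (p - 1) = 1\<close>.\<close>
  define a where "a = M powr (- 1 / (p - 1))"
  have a: "0 < a" using M by (simp add: a_def)
  have ap: "M * a powr (p - 1) = 1"
  proof -
    have "a powr (p - 1) = M powr (- 1)" using p1 unfolding a_def powr_powr by simp
    then show ?thesis using M by (simp add: powr_minus)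
  qed
  have aM: "M * a powr p = a"
  proof -
    have "a powr p = a powr (p - 1) * a powr 1" unfolding powr_add[symmetric] by simp
    then have "M * a powr p = (M * a powr (p - 1)) * a" using a by simp
    then show ?thesis unfolding ap by simp
  qed
  define w where "w x = sqrt a * v x" for x
  have mw [measurable]: "w \<in> borel_measurable borel" unfolding w_def by measurable
  have Qw: "h1_energy w = ennreal a" unfolding w_def h1_energy_cmult[OF mv] Qv using a by simp
  have "sqrt a powr (2 * p) = a powr p"
    using a by (simp add: powr_half_sqrt[symmetric] powr_powr)
  then have "riesz \<alpha> p w = ennreal (a powr p) * ennreal M" unfolding w_def using a by (simp add: riesz_cmult[OF mv] v(2))
  also have "\<dots> = ennreal (M * a powr p)" using M by (simp add: ennreal_mult' mult.commute)
  finally have rw: "riesz \<alpha> p w = ennreal a" unfolding aM .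
  have B: "sq_norm w \<le> ennreal a" "dirichlet w \<le> ennreal (kappa TYPE('a) * a)" using h1_energy_bounds[of w a] Qw a by auto
  have "L2 w" unfolding L2_def using mw B(1) by (auto intro: le_less_trans)
  moreover have "dirichlet w < \<infinity>" using B(2) by (auto intro: le_less_trans)
  ultimately obtain G where G: "has_wgrad w G" "ennreal (kappa TYPE('a)) * sq_norm G \<le> dirichlet w"
    using dirichlet_gradient by blast
  have "ennreal (h1_inner w G w G) = ennreal a" using h1_energy_le_h1_inner(3)[OF G] Qw by simp
  then have h1_inner: "a = h1_inner w G w G" using a h1_energy_le_h1_inner(2)[OF G(1)] by simp
  have rzw: "riesz_real \<alpha> p w = a"
    using riesz_pair(2,3)[of w \<alpha> p] rw a by simp
  show ?thesis
  proof (rule exI[of _ M], rule conjI[OF M], rule exI[of _ a], rule conjI[OF a], rule exI[of _ w], intro conjI aM)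
    show "\<forall>(f :: 'a \<Rightarrow> real) q. f \<in> borel_measurable borel \<longrightarrow> 0 < q \<longrightarrow> h1_energy f \<le> ennreal q \<longrightarrow> riesz \<alpha> p f \<le> ennreal (M * q powr p)"
      using bound by blast
    show "choquard_weak_solution \<alpha> p w"
      by (rule choquard_weak_solutionI[OF G(1)]) (rule euler_lagrange[OF p1 M bound G(1) h1_inner a aM rw])
    show "nonzero_H1 w"
      unfolding nonzero_H1_def AE_completion_iff using riesz_eq_0[of w \<alpha> p] rw a by auto
    show "choquard_energy \<alpha> p w = (1/2 - 1/(2*p)) * a"
      using choquard_energy_eq[OF G(1), of \<alpha> p] rw rzw by (simp add: h1_inner[symmetric] left_diff_distrib)
  qed
qed

theorem theorem4p2:
  fixes u :: "'a::euclidean_space \<Rightarrow> real" and \<alpha> p :: real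
  assumes "DIM('a) \<ge> 3"
    and "0 < \<alpha>" and "\<alpha> < real DIM('a)"
    and "(real DIM('a) + \<alpha>) / real DIM('a) < p" and "p < (real DIM('a) + \<alpha>) / (real DIM('a) - 2)"
    and "choquard_ground_state \<alpha> p u"
    and "continuous_on UNIV u"
    and "\<forall>x. u x > 0"
  shows "\<exists>xs::'a. \<exists>v::real \<Rightarrow> real.
           (\<forall>r\<ge>0. v r \<ge> 0) \<and>
           (\<forall>r s. 0 \<le> r \<longrightarrow> r \<le> s \<longrightarrow> v s \<le> v r) \<and>
           (\<forall>x. u x = v (norm (x - xs))) \<and>
           (v \<longlongrightarrow> 0) at_top"
proof -
  have "1 < (real DIM('a) + \<alpha>) / real DIM('a)" using assms(2) by simp
  then have p1: "1 < p" using assms(4) by linarith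
  obtain M a :: real and w :: "'a \<Rightarrow> real" where M: "0 < M" and a: "0 < a" "M * a powr p = a"
    and bound: "\<And>(f :: 'a \<Rightarrow> real) q. f \<in> borel_measurable borel \<Longrightarrow> 0 < q \<Longrightarrow> h1_energy f \<le> ennreal q \<Longrightarrow> riesz \<alpha> p f \<le> ennreal (M * q powr p)"
    and w: "choquard_weak_solution \<alpha> p w" "nonzero_H1 w" "choquard_energy \<alpha> p w = (1/2 - 1/(2*p)) * a"
    using choquard_scaled_maximiser[OF assms(1-5) p1] by (elim exE conjE) blast
  have sol: "choquard_weak_solution \<alpha> p u" and nz: "nonzero_H1 u"
    and least: "choquard_energy \<alpha> p u \<le> choquard_energy \<alpha> p w"
    using assms(6) w(1,2) by (auto simp: choquard_ground_state_def)
  have H: "H1 u" using sol by (simp add: choquard_weak_solution_def)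
  have pos: "0 < u x" for x using assms(8) by simp
  have mu [measurable]: "u \<in> borel_measurable borel" by (rule borel_measurable_continuous_onI[OF assms(7)])
  obtain u' G where r: "has_wgrad u' G" "AE x in lebesgue. u x = u' x" "AE x in lebesgue. wgrad u x = G x"
    using H1_borel_representative[OF H] by (elim exE conjE)
  have u: "has_wgrad u G" using has_wgrad_cong_AE[OF r(1) mu] r(2) by (simp add: AE_completion_iff)
  define A where "A = h1_inner u G u G"
  have QA: "h1_energy u \<le> ennreal A" "0 \<le> A" using h1_energy_le_h1_inner(1,2)[OF u] by (auto simp: A_def)
  have A: "0 < A"
  proof (rule ccontr)
    assume "\<not> 0 < A"
    then have "A = 0" using QA(2) by simp
    then have "sq_norm u = 0" using h1_energy_bounds(1)[OF QA] by simp
    then have "AE x in lborel. ennreal ((norm (u x))\<^sup>2) = 0" unfolding sq_norm_def by (subst (asm) nn_integral_0_iff_AE) auto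
    then have "AE x in lborel. u x = 0" by eventually_elim simp
    then show False using nz by (simp add: nonzero_H1_def AE_completion_iff)
  qed
  have "riesz \<alpha> p u \<le> ennreal (M * A powr p)" by (rule bound[OF mu A QA(1)])
  then have fin: "riesz \<alpha> p u < \<infinity>" by (auto intro: le_less_trans)
  \<comment> \<open>The weak equation is tested with \<open>u\<close> itself. Positivity of
    \<open>u\<close> turns the power with exponent \<open>p - 1\<close> times \<open>u\<close> into
    the p-th power.\<close>
  have rzA: "riesz_real \<alpha> p u = A"
  proof -
    have mul: "u \<in> borel_measurable lebesgue" using H by (simp add: H1_def square_integrable_def)
    have "A = (LINT x|lebesgue. wgrad u x \<bullet> wgrad u x + u x * u x)"
      unfolding A_def by (rule lebesgue_h1_inner[OF u H u _ r(3), symmetric]) simp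
    also have "\<dots> = (LINT x|lebesgue. LINT y|lebesgue. \<bar>u y\<bar> powr p * (\<bar>u x\<bar> powr (p - 1) * sgn (u x)) * u x
             / norm (x - y) powr (real DIM('a) - \<alpha>))"
      using sol H unfolding choquard_weak_solution_def by blast
    also have "\<dots> = choquard_form \<alpha> p u u" by (rule lebesgue_choquard_form[OF mu mu mul]) simp
    also have "\<dots> = (LINT x|lborel. LINT y|lborel. \<bar>u x\<bar> powr p * \<bar>u y\<bar> powr p / norm (x - y) powr (real DIM('a) - \<alpha>))"
    proof -
      have "\<bar>u y\<bar> powr p * (\<bar>u x\<bar> powr (p - 1) * sgn (u x)) * u x = \<bar>u x\<bar> powr p * \<bar>u y\<bar> powr p" for x y
        using pos[of x] by (simp add: powr_diff)
      then show ?thesis unfolding choquard_form_def by (simp only:)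
    qed
    also have "\<dots> = riesz_real \<alpha> p u" by (rule iterated_riesz_real[OF mu fin])
    finally show ?thesis ..
  qed
  have rA: "riesz \<alpha> p u = ennreal A" using riesz_pair(2)[OF mu fin] rzA by simp
  have "choquard_energy \<alpha> p u = (1/2 - 1/(2*p)) * A"
    using choquard_energy_eq[OF u fin] by (simp add: rzA A_def[symmetric] left_diff_distrib)
  then have "(1/2 - 1/(2*p)) * A \<le> (1/2 - 1/(2*p)) * a" using least w(3) by simp
  moreover have "0 < 1/2 - 1/(2*p)" using p1 by (simp add: field_simps)
  ultimately have Aa: "A \<le> a" by (simp only: mult_le_cancel_left_pos)
  \<comment> \<open>The function \<open>z \<mapsto> M * z powr (p - 1)\<close> is increasing and
    takes the value 1 at \<open>a\<close>, so it is at most 1 at \<open>A\<close>. Together with the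
    general inequality this makes \<open>u\<close> extremal, since its Riesz energy is
    \<open>A\<close>.\<close>
  have MA: "M * A powr p \<le> A"
  proof -
    have s: "M * z powr p = (M * z powr (p - 1)) * z" if "0 < z" for z using that by (simp add: powr_diff)
    have "M * a powr (p - 1) = 1" using a s[OF a(1)] by simp
    moreover have "A powr (p - 1) \<le> a powr (p - 1)" using A Aa p1 by (intro powr_mono2) auto
    ultimately have "M * A powr (p - 1) \<le> 1" using mult_left_mono[of "A powr (p - 1)" "a powr (p - 1)" M] M by simp
    then show ?thesis unfolding s[OF A] using mult_right_mono[of "M * A powr (p - 1)" 1 A] A by simp
  qed
  interpret reflection_dichotomy u
  proof
    show "L2 u" using u by (simp add: has_wgrad_def)
    show "continuous_on UNIV u" by fact
    show "0 < u x" for x by (rule pos)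
    fix e :: 'a and t assume e: "norm e = 1"
    have "h1_energy (polar e t u) \<le> h1_energy u"
      unfolding h1_energy_def sq_norm_polar[OF e mu] by (intro add_left_mono mult_left_mono dirichlet_polar[OF mu e]) auto
    then have "h1_energy (polar e t u) \<le> ennreal A" using QA(1) by (rule order_trans)
    then have "riesz \<alpha> p (polar e t u) \<le> ennreal (M * A powr p)" by (intro bound A) measurable
    also have "\<dots> \<le> riesz \<alpha> p u" unfolding rA using MA by (rule ennreal_leI)
    finally have le: "riesz \<alpha> p (polar e t u) \<le> riesz \<alpha> p u" .
    \<comment> \<open>Two points of the half space with opposite strict inequalities are excluded,
      so one of the two weak inequalities holds on all of it.\<close>
    have "\<not> (u (hrefl e t x) < u x \<and> u y < u (hrefl e t y))" if "t < x \<bullet> e" "t < y \<bullet> e" for x y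
      using p1 by (intro riesz_polar_rigid[OF e assms(3) less_imp_le[OF pos] _ assms(7) le fin that]) simp
    then show "(\<forall>x. t < x \<bullet> e \<longrightarrow> u (hrefl e t x) \<le> u x) \<or> (\<forall>x. t < x \<bullet> e \<longrightarrow> u x \<le> u (hrefl e t x))"
      by (meson not_le)
  qed
  show ?thesis by (rule radial_about_centre)
qed

end
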